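(* Let $r>3$ be a fixed constant. There exists $\delta>0$ such that for any $(c,a)\in\mathcal{P}_{\lambda}$ with $|a|<\delta$ we can find a coordinate transformation $\phi_{a}$ from the tubular neighborhood $B=\mathbb{D}_{\rho'}(q_{0})\times\mathbb{D}_{r}$ of the local stable manifold of the semi-parabolic fixed point $\mathbf{q}_{a}$, $$\phi_{a}:B\to\mathbb{D}_{\rho}\times\mathbb{D}_{r+O(|a|)},$$ in which the Hénon map has the form $\widetilde{H}_{a}(x,y)=(x_{1},y_{1})$ with $$\begin{cases} x_{1}=\lambda\left(x+x^{q+1}+Cx^{2q+1}+a_{2q+2}(y)x^{2q+2}+\dots\right)\\ y_{1}=\mu y+xh(x,y)\end{cases}$$ where $C$ is a constant (depending on $a$), and $xh(x,y)=O(a)$. Moreover, the maps $\phi_{a}$ are holomorphic in $a$ and $$\lim_{a\to 0}\phi_{a}=\phi_{0},\qquad \phi_{0}(x,y)=(\phi(x),y),$$ where $\phi:\mathbb{D}_{\rho'}(q_0)\to\mathbb{D}_{\rho}$ is the change of coordinates for the polynomial $P(x)=x^{2}+c_{0}$ with a parabolic fixed point at $q_{0}$, $$\phi\circ P\circ\phi^{-1}(x)=\lambda x\left(1+x^{q}+C'x^{2q}+O(x^{2q+1})\right)$$ for some constant $C'$.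
   Context: Let $p/q$ be a rational number in lowest terms ($q\ge1$), $\lambda=e^{2\pi i p/q}$, $c_{0}=\frac{\lambda}{2}-\frac{\lambda^{2}}{4}$, $P(x)=x^{2}+c_{0}$, with parabolic fixed point $q_{0}=\lambda/2$ of multiplier $\lambda$. The curve $\mathcal{P}_{\lambda}$ is the set of $(c,a)\in\mathbb{C}^2$ with $c=c(a)=(1-a^{2})\left(\frac{\lambda}{2}-\frac{a^{2}}{2\lambda}\right)-\left(\frac{\lambda}{2}-\frac{a^{2}}{2\lambda}\right)^{2}$; for such parameters write $H_{a}(x,y)=(x^{2}+c(a)+ay,\ ax)$ (Hénon map when $a\ne0$; $H_0(x,y)=(P(x),0)$). $H_{a}$ has the fixed point $\mathbf{q}_{a}=\left(\frac{\lambda}{2}-\frac{a^{2}}{2\lambda},\ a\left(\frac{\lambda}{2}-\frac{a^{2}}{2\lambda}\right)\right)$, at which $DH_{a}$ has eigenvalues $\lambda$ and $\mu=-a^{2}/\lambda$; for $|a|<1$ it is called semi-parabolic. Its stable manifold $W^{s}(\mathbf{q}_{a})$ is the set of points whose forward iterates converge to $\mathbf{q}_{a}$ at exponential rate $|\mu|^m$ (for $a=0$ it is the vertical line through $\mathbf{q}_0$). The local stable manifold is the connected component of $W^{s}(\mathbf{q}_{a})\cap\{(x,y)\in\mathbb{C}^2:|y|<r\}$ that contains $\mathbf{q}_{a}$. $\mathbb{D}_s(x_0)$ is the disk of radius $s$ centered at $x_0$, $\mathbb{D}_s=\mathbb{D}_s(0)$. The radii are fixed as follows, depending only on $P$: there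 are a neighborhood $V_{0}$ of $q_{0}$, a small $\rho>0$ and a conformal isomorphism $\phi:V_{0}\to\mathbb{D}_{\rho}$ with $\phi(q_0)=0$ putting $P$ in the normal form $\phi\circ P\circ\phi^{-1}(x)=\lambda x(1+x^{q}+C'x^{2q}+O(x^{2q+1}))$ near $0$; $\rho'>0$ is chosen so that $\mathbb{D}_{2\rho'}(q_{0})\subset V_{0}$. "Coordinate transformation" means an injective holomorphic map; "has the form $\widetilde H_a$" means $\widetilde H_a=\phi_a\circ H_a\circ\phi_a^{-1}$ (where defined), with $\phi_a(\mathbf{q}_a)=0$. The $a_j(y)$, $j\ge 2q+2$, and $h(x,y)$ are holomorphic functions. *)

theory Defs
  imports "HOL-Analysis.Analysis" "HOL-Library.Landau_Symbols"
begin

definition multiplier :: "int \<Rightarrow> nat \<Rightarrow> complex" where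
  "multiplier p q = exp (2 * of_real pi * \<i> * (of_int p / of_nat q))"

definition parabolic_poly :: "complex \<Rightarrow> complex \<Rightarrow> complex" where
  "parabolic_poly l x = x^2 + (l / 2 - l^2 / 4)"

text \<open>The normal form near the parabolic fixed point \<open>l / 2\<close> is written after multiplying out,
  so the error term \<open>l x O(x^(2q+1))\<close> becomes \<open>O(x^(2q+2))\<close>.\<close>

definition parabolic_coordinate ::
    "complex \<Rightarrow> nat \<Rightarrow> complex set \<Rightarrow> real \<Rightarrow> (complex \<Rightarrow> complex) \<Rightarrow> bool" where
  "parabolic_coordinate l q V \<rho> \<phi> \<longleftrightarrow>
     open V \<and> l / 2 \<in> V \<and> \<rho> > 0 \<and>
     \<phi> holomorphic_on V \<and> bij_betw \<phi> V (ball 0 \<rho>) \<and> \<phi> (l / 2) = 0 \<and>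
     (\<exists>C'. (\<lambda>x. \<phi> (parabolic_poly l (inv_into V \<phi> x)) - l * x * (1 + x^q + C' * x^(2*q)))
             \<in> O[at 0](\<lambda>x. x^(2*q+2)))"

definition henon :: "complex \<Rightarrow> complex \<Rightarrow> complex \<times> complex \<Rightarrow> complex \<times> complex" where
  "henon c a = (\<lambda>(x, y). (x^2 + c + a * y, a * x))"

definition fixed_x :: "complex \<Rightarrow> complex \<Rightarrow> complex" where
  "fixed_x l a = l / 2 - a^2 / (2 * l)"

definition semi_parabolic_curve :: "complex \<Rightarrow> (complex \<times> complex) set" where
  "semi_parabolic_curve l = {(c, a). c = (1 - a^2) * fixed_x l a - (fixed_x l a)^2}"

definition fixed_pt :: "complex \<Rightarrow> complex \<Rightarrow> complex \<times> complex" where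
  "fixed_pt l a = (fixed_x l a, a * fixed_x l a)"

definition small_eigenvalue :: "complex \<Rightarrow> complex \<Rightarrow> complex" where
  "small_eigenvalue l a = - (a^2) / l"

text \<open>For \<open>a = 0\<close> the rate condition would also admit the line \<open>x = - l / 2\<close>, because \<open>henon c 0\<close>
  is not injective; the stable manifold is then by convention only the vertical line through
  the fixed point.\<close>

definition stable_manifold :: "complex \<Rightarrow> complex \<Rightarrow> complex \<Rightarrow> (complex \<times> complex) set" where
  "stable_manifold l c a =
     (if a = 0 then {fixed_x l 0} \<times> UNIV
      else {z. (\<lambda>m. (henon c a ^^ m) z) \<longlonglongrightarrow> fixed_pt l a \<and>
               (\<lambda>m. dist ((henon c a ^^ m) z) (fixed_pt l a))
                 \<in> O(\<lambda>m. norm (small_eigenvalue l a) ^ m)})"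

definition local_stable_manifold ::
    "complex \<Rightarrow> real \<Rightarrow> complex \<Rightarrow> complex \<Rightarrow> (complex \<times> complex) set" where
  "local_stable_manifold l r c a =
     connected_component_set (stable_manifold l c a \<inter> {(x, y). norm y < r}) (fixed_pt l a)"

text \<open>Holomorphy in two variables: Frechet differentiability with a complex-linear derivative.\<close>

definition holomorphic2_on ::
    "(complex \<times> complex \<Rightarrow> complex) \<Rightarrow> (complex \<times> complex) set \<Rightarrow> bool" where
  "holomorphic2_on f S \<longleftrightarrow>
     (\<forall>z\<in>S. \<exists>A B. (f has_derivative (\<lambda>(u, v). A * u + B * v)) (at z within S))"

definition coordinate_transformation ::
    "(complex \<times> complex \<Rightarrow> complex \<times> complex) \<Rightarrow> (complex \<times> complex) set \<Rightarrow> bool" where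
  "coordinate_transformation \<Phi> B \<longleftrightarrow>
     inj_on \<Phi> B \<and> holomorphic2_on (fst \<circ> \<Phi>) B \<and> holomorphic2_on (snd \<circ> \<Phi>) B"

text \<open>The map \<open>\<Phi> \<circ> H \<circ> \<Phi>\<inverse>\<close> for a coordinate change \<open>\<Phi>\<close> on \<open>B\<close>, and the set on which it is
  defined.\<close>

definition conj_map ::
    "('a \<Rightarrow> 'b) \<Rightarrow> 'a set \<Rightarrow> ('a \<Rightarrow> 'a) \<Rightarrow> 'b \<Rightarrow> 'b" where
  "conj_map \<Phi> B H = \<Phi> \<circ> H \<circ> inv_into B \<Phi>"

definition conj_dom ::
    "('a \<Rightarrow> 'b) \<Rightarrow> 'a set \<Rightarrow> ('a \<Rightarrow> 'a) \<Rightarrow> 'b set" where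
  "conj_dom \<Phi> B H = \<Phi> ` (B \<inter> H -` B)"

text \<open>The power series in \<open>x\<close> represents the first component on a uniform neighbourhood
  \<open>norm x < \<epsilon>\<close> of the line \<open>x = 0\<close>; its disc of convergence need not cover the whole domain of the
  conjugated map. The coefficients are holomorphic in all values that the second coordinate
  takes.\<close>

definition semi_parabolic_expansion ::
    "complex \<Rightarrow> nat \<Rightarrow> (complex \<times> complex \<Rightarrow> complex \<times> complex) \<Rightarrow> (complex \<times> complex) set \<Rightarrow>
     (complex \<times> complex \<Rightarrow> complex \<times> complex) \<Rightarrow> bool" where
  "semi_parabolic_expansion l q \<Phi> B H \<longleftrightarrow>
     (\<exists>C (\<alpha> :: nat \<Rightarrow> complex \<Rightarrow> complex) \<epsilon>. \<epsilon> > 0 \<and>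
        (\<forall>j\<ge>2*q+2. \<alpha> j holomorphic_on snd ` \<Phi> ` B) \<and>
        (\<forall>(x, y) \<in> conj_dom \<Phi> B H. norm x < \<epsilon> \<longrightarrow>
           summable (\<lambda>n. \<alpha> (2*q+2+n) y * x^(2*q+2+n)) \<and>
           fst (conj_map \<Phi> B H (x, y)) =
             l * (x + x^(q+1) + C * x^(2*q+1) + (\<Sum>n. \<alpha> (2*q+2+n) y * x^(2*q+2+n)))))"

end

theory Submission
  imports Defs "HOL-Complex_Analysis.Complex_Analysis"
begin

text \<open>The stable manifold near the fixed point is a curve \<open>t \<mapsto> (X t, Y t)\<close>, given by a power series that
  conjugates \<open>H\<^sub>a\<close> to \<open>t \<mapsto> \<mu> t\<close>. Because \<open>\<mu> = O(a\<^sup>2)\<close>, this series converges on large disks, depends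
  holomorphically on \<open>a\<close>, and for \<open>a = 0\<close> it is the vertical line. Straightening it and applying \<open>\<phi>\<close> brings
  \<open>H\<^sub>a\<close> into the form \<open>(x A(x, t), \<mu> t + O(x))\<close>. The coefficients of the powers of \<open>x\<close> are then made constant
  one after the other: each step solves a cohomological equation over the contraction \<open>t \<mapsto> \<mu> t\<close>,
  written for the logarithm in the case of the linear coefficient. Powers other than \<open>x\<^bsup>q+1\<^esup>\<close>
  and \<open>x\<^bsup>2q+1\<^esup>\<close> are removed as in one variable. For \<open>a = 0\<close> nothing has to be corrected, so all
  corrections tend to the identity.

  That the local stable manifold is the straightened curve is a global question, since the component
  of the intersection with \<open>norm y < r\<close> might leave the tube. By Fatou's theorem the critical value of
  the parabolic polynomial enters the open basin, so for small \<open>a\<close> a neighbourhood of the critical value avoids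
  the stable manifold. The iterated preimages of the curve are then graphs over the whole disk
  \<open>norm y < r\<close>, any two of which coincide or are disjoint, and a connected set meets only one of them.\<close>

section \<open>Holomorphic families in three variables\<close>

text \<open>The radii \<open>r\<close>, \<open>\<rho>\<close> and \<open>\<rho>'\<close> are
  prescribed, so the tube may not be shrunk and all smallness has to come from \<open>a\<close>.
  Hence every object is jointly holomorphic in the parameter and both coordinates and explicit at
  \<open>a = 0\<close>, and the estimates are open conditions at \<open>a = 0\<close> on compact
  sets that persist for small \<open>a\<close>. The degeneration at \<open>a = 0\<close>, where the
  plane is collapsed to a line and \<open>\<mu> = 0\<close>, is an advantage: the cohomological
  equations are solved by series contracting with \<open>\<mu>\<close>, without small divisors, and
  the stable curve converges on discs of radius of order \<open>1 / |a|\<close>. Resonances remain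
  only in the x-direction, where \<open>l\<close> is a root of unity. The doubled disc around
  \<open>l / 2\<close> absorbs the displacement caused by straightening, and the O(a) bounds rest on
  the Schwarz lemma in the variable \<open>a\<close>. For the stable manifold, the rate
  \<open>|\<mu>|^m\<close> separates points of the curve from points attracted through the parabolic
  petals, since a nonzero normal coordinate decays at most like \<open>2^-m\<close>.\<close>

lemma schwarz_scaled:
  assumes hol: "f holomorphic_on ball 0 r" and f0: "f 0 = 0" and r: "r > 0"
    and bd: "\<And>z. norm z < r \<Longrightarrow> norm (f z) \<le> M" and z: "norm z < r"
  shows "norm (f z) \<le> M * norm z / r"
proof -
  have M: "M \<ge> 0" using bd[of 0] f0 r by simp
  \<comment> \<open>The Schwarz lemma needs values of modulus strictly below 1, while the hypothesis
    is a weak bound; so it is inflated to \<open>N > M\<close>, and \<open>N\<close> tends to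
    \<open>M\<close> at the end.\<close>
  have aux: "norm (f z) \<le> N * norm z / r" if N: "N > M" for N
  proof -
    have N0: "N > 0" using N M by simp
    let ?g = "\<lambda>w. f (of_real r * w) / of_real N"
    have sub: "(\<lambda>w. of_real r * w) ` ball (0::complex) 1 \<subseteq> ball 0 r"
      using r by (auto simp: norm_mult dist_norm)
    have "?g holomorphic_on ball 0 1"
      using hol sub N0
      by (intro holomorphic_intros holomorphic_on_compose_gen[OF _ hol, unfolded o_def]) auto
    moreover have "norm (?g w) < 1" if "norm w < 1" for w
    proof -
      have "norm (f (of_real r * w)) \<le> M"
        using that r by (intro bd) (simp add: norm_mult)
      then show ?thesis using N N0 by (simp add: norm_divide divide_less_eq)
    qed
    moreover have "norm (z / of_real r) < 1" using z r by (simp add: norm_divide)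
    ultimately have "norm (?g (z / of_real r)) \<le> norm (z / of_real r)"
      using Schwarz_Lemma(1)[of ?g "z / of_real r"] f0 by auto
    then show ?thesis using r N0
      by (simp add: norm_divide field_simps)
  qed
  show ?thesis
  proof (rule field_le_epsilon)
    fix e :: real assume e: "e > 0"
    have "norm (f z) \<le> (M + e) * norm z / r" using aux[of "M+e"] e by simp
    also have "\<dots> = M * norm z / r + e * (norm z / r)" by (simp add: add_divide_distrib distrib_right)
    also have "\<dots> \<le> M * norm z / r + e"
      using z r e by (simp add: mult_left_le divide_le_eq)
    finally show "norm (f z) \<le> M * norm z / r + e" .
  qed
qed

text \<open>A single arity serves the whole development: the parameter \<open>a\<close> and two
  coordinates, a function of fewer variables being constant in the rest, often with a factor
  \<open>UNIV\<close>. The derivative is taken at the point and not within \<open>S\<close>, so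
  restriction to subsets is immediate.\<close>

definition hol3 :: "(complex \<Rightarrow> complex \<Rightarrow> complex \<Rightarrow> complex) \<Rightarrow> (complex \<times> complex \<times> complex) set \<Rightarrow> bool"
  where "hol3 f S \<longleftrightarrow> (\<forall>z\<in>S. \<exists>A B C.
     ((\<lambda>(a, x, t). f a x t) has_derivative (\<lambda>(u, v, w). A * u + B * v + C * w)) (at z))"

lemma hol3_subset: "hol3 f S \<Longrightarrow> S' \<subseteq> S \<Longrightarrow> hol3 f S'"
  by (auto simp: hol3_def)

lemma hol3_continuous_on: "hol3 f S \<Longrightarrow> continuous_on S (\<lambda>(a, x, t). f a x t)"
  unfolding hol3_def
  by (meson continuous_at_imp_continuous_on has_derivative_continuous)

lemma hol3_cong_open:
  assumes "hol3 f S" "open S" "\<And>a x t. (a, x, t) \<in> S \<Longrightarrow> f a x t = g a x t"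
  shows "hol3 g S"
  unfolding hol3_def
proof safe
  fix a x t assume z: "(a, x, t) \<in> S"
  then obtain A B C where D: "((\<lambda>(a, x, t). f a x t) has_derivative (\<lambda>(u, v, w). A * u + B * v + C * w)) (at (a,x,t))"
    using assms(1) unfolding hol3_def by blast
  have "((\<lambda>(a, x, t). g a x t) has_derivative (\<lambda>(u, v, w). A * u + B * v + C * w)) (at (a,x,t))"
    by (rule has_derivative_transform_within_open[OF D assms(2) z]) (use assms(3) in auto)
  then show "\<exists>A B C. ((\<lambda>(a, x, t). g a x t) has_derivative (\<lambda>(u, v, w). A * u + B * v + C * w)) (at (a,x,t))"
    by blast
qed

lemma hol3_local:
  assumes "\<And>z. z \<in> S \<Longrightarrow> \<exists>U. open U \<and> z \<in> U \<and> hol3 f U"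
  shows "hol3 f S"
  using assms unfolding hol3_def by blast

lemma hol3_const [intro]: "hol3 (\<lambda>a x t. c) S"
  unfolding hol3_def
  by (rule ballI, rule exI[of _ 0], rule exI[of _ 0], rule exI[of _ 0])
     (auto simp: case_prod_unfold intro!: derivative_eq_intros)

lemma hol3_a [intro]: "hol3 (\<lambda>a x t. a) S"
  unfolding hol3_def
  by (rule ballI, rule exI[of _ 1], rule exI[of _ 0], rule exI[of _ 0])
     (auto simp: case_prod_unfold intro!: derivative_eq_intros)

lemma hol3_x [intro]: "hol3 (\<lambda>a x t. x) S"
  unfolding hol3_def
  by (rule ballI, rule exI[of _ 0], rule exI[of _ 1], rule exI[of _ 0])
     (auto simp: case_prod_unfold intro!: derivative_eq_intros)

lemma hol3_t [intro]: "hol3 (\<lambda>a x t. t) S"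
  unfolding hol3_def
  by (rule ballI, rule exI[of _ 0], rule exI[of _ 0], rule exI[of _ 1])
     (auto simp: case_prod_unfold intro!: derivative_eq_intros)

lemma hol3_comp:
  assumes f: "hol3 f S" and u: "hol3 u S'" and v: "hol3 v S'" and w: "hol3 w S'"
    and sub: "\<And>a x t. (a, x, t) \<in> S' \<Longrightarrow> (u a x t, v a x t, w a x t) \<in> S"
  shows "hol3 (\<lambda>a x t. f (u a x t) (v a x t) (w a x t)) S'"
  unfolding hol3_def
proof
  fix z assume z: "z \<in> S'"
  obtain A1 B1 C1 where 1: "((\<lambda>(a, x, t). u a x t) has_derivative (\<lambda>(p, q, r). A1 * p + B1 * q + C1 * r)) (at z)"
    using u z unfolding hol3_def by blast
  obtain A2 B2 C2 where 2: "((\<lambda>(a, x, t). v a x t) has_derivative (\<lambda>(p, q, r). A2 * p + B2 * q + C2 * r)) (at z)"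
    using v z unfolding hol3_def by blast
  obtain A3 B3 C3 where 3: "((\<lambda>(a, x, t). w a x t) has_derivative (\<lambda>(p, q, r). A3 * p + B3 * q + C3 * r)) (at z)"
    using w z unfolding hol3_def by blast
  let ?g = "\<lambda>z. ((\<lambda>(a, x, t). u a x t) z, (\<lambda>(a, x, t). v a x t) z, (\<lambda>(a, x, t). w a x t) z)"
  have "?g z \<in> S" using sub z by (cases z) auto
  then obtain A B C where 0: "((\<lambda>(a, x, t). f a x t) has_derivative (\<lambda>(p, q, r). A * p + B * q + C * r)) (at (?g z))"
    using f unfolding hol3_def by blast
  have g: "(?g has_derivative (\<lambda>h. ((\<lambda>(p, q, r). A1 * p + B1 * q + C1 * r) h,
      (\<lambda>(p, q, r). A2 * p + B2 * q + C2 * r) h, (\<lambda>(p, q, r). A3 * p + B3 * q + C3 * r) h))) (at z)"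
    by (intro has_derivative_Pair 1 2 3)
  have "((\<lambda>(a, x, t). f (u a x t) (v a x t) (w a x t)) has_derivative
     (\<lambda>(p, q, r). (A * A1 + B * A2 + C * A3) * p + (A * B1 + B * B2 + C * B3) * q + (A * C1 + B * C2 + C * C3) * r)) (at z)"
    using has_derivative_compose[OF g 0]
    by (simp add: case_prod_unfold algebra_simps)
  then show "\<exists>A B C. ((\<lambda>(a, x, t). f (u a x t) (v a x t) (w a x t)) has_derivative
     (\<lambda>(p, q, r). A * p + B * q + C * r)) (at z)" by blast
qed

lemma hol3_add: "hol3 f S \<Longrightarrow> hol3 g S \<Longrightarrow> hol3 (\<lambda>a x t. f a x t + g a x t) S"
proof (rule hol3_comp[where f = "\<lambda>a x t. x + t" and u = "\<lambda>a x t. 0" and v = f and w = g and S = UNIV])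
  have "((\<lambda>(a, x, t). x + t) has_derivative (\<lambda>(u, v, w). 0 * u + 1 * v + 1 * w)) (at z)"
    for z :: "complex \<times> complex \<times> complex"
    unfolding case_prod_unfold by (auto intro!: derivative_eq_intros)
  then show "hol3 (\<lambda>a x t. x + t) UNIV" unfolding hol3_def by blast
qed auto

lemma hol3_mult: "hol3 f S \<Longrightarrow> hol3 g S \<Longrightarrow> hol3 (\<lambda>a x t. f a x t * g a x t) S"
proof (rule hol3_comp[where f = "\<lambda>a x t. x * t" and u = "\<lambda>a x t. 0" and v = f and w = g and S = UNIV])
  show "hol3 (\<lambda>a x t. x * t) UNIV"
    unfolding hol3_def
  proof
    fix z :: "complex \<times> complex \<times> complex"
    obtain a x t where z: "z = (a, x, t)" by (cases z)
    have "((\<lambda>(a, x, t). x * t) has_derivative (\<lambda>(u, v, w). 0 * u + t * v + x * w)) (at z)"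
      unfolding case_prod_unfold z by (auto intro!: derivative_eq_intros)
    then show "\<exists>A B C. ((\<lambda>(a, x, t). x * t) has_derivative (\<lambda>(u, v, w). A * u + B * v + C * w)) (at z)"
      by blast
  qed
qed auto

lemma hol3_holomorphic:
  assumes "g holomorphic_on A" "open A" "hol3 f S" "\<And>a x t. (a, x, t) \<in> S \<Longrightarrow> f a x t \<in> A"
  shows "hol3 (\<lambda>a x t. g (f a x t)) S"
proof (rule hol3_comp[where f = "\<lambda>a x t. g x" and u = "\<lambda>a x t. 0" and v = f and w = "\<lambda>a x t. 0" and S = "UNIV \<times> A \<times> UNIV"])
  show "hol3 (\<lambda>a x t. g x) (UNIV \<times> A \<times> UNIV)"
    unfolding hol3_def
  proof
    fix z :: "complex \<times> complex \<times> complex" assume zA: "z \<in> UNIV \<times> A \<times> UNIV"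
    then obtain a x t where z: "z = (a, x, t)" "x \<in> A" by auto
    have "(g has_field_derivative deriv g x) (at x)"
      using assms(1,2) z by (simp add: holomorphic_derivI)
    then have g: "(g has_derivative (\<lambda>h. deriv g x * h)) (at x)"
      by (simp add: has_field_derivative_def)
    have p: "((\<lambda>z::complex \<times> complex \<times> complex. fst (snd z)) has_derivative (\<lambda>h. fst (snd h))) (at z)"
      by (auto intro!: derivative_eq_intros)
    have "((\<lambda>z. g (fst (snd z))) has_derivative (\<lambda>h. deriv g x * fst (snd h))) (at z)"
      using has_derivative_compose[OF p, of g "\<lambda>h. deriv g x * h"] g z by simp
    then have "((\<lambda>(a, x, t). g x) has_derivative (\<lambda>(u, v, w). 0 * u + deriv g x * v + 0 * w)) (at z)"
      by (simp add: case_prod_unfold)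
    then show "\<exists>A B C. ((\<lambda>(a, x, t). g x) has_derivative (\<lambda>(u, v, w). A * u + B * v + C * w)) (at z)"
      by blast
  qed
qed (use assms in auto)

lemma hol3_uminus: "hol3 f S \<Longrightarrow> hol3 (\<lambda>a x t. - f a x t) S"
  by (rule hol3_holomorphic[where g = uminus and A = UNIV]) (auto intro!: holomorphic_intros)

lemma hol3_diff: "hol3 f S \<Longrightarrow> hol3 g S \<Longrightarrow> hol3 (\<lambda>a x t. f a x t - g a x t) S"
  using hol3_add[OF _ hol3_uminus] by simp

lemma hol3_power: "hol3 f S \<Longrightarrow> hol3 (\<lambda>a x t. f a x t ^ n) S"
  by (rule hol3_holomorphic[where g = "\<lambda>z. z ^ n" and A = UNIV]) (auto intro!: holomorphic_intros)

lemma hol3_divide: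
  assumes "hol3 f S" "hol3 g S" "\<And>a x t. (a, x, t) \<in> S \<Longrightarrow> g a x t \<noteq> 0"
  shows "hol3 (\<lambda>a x t. f a x t / g a x t) S"
proof -
  have "hol3 (\<lambda>a x t. inverse (g a x t)) S"
    by (rule hol3_holomorphic[where g = inverse and A = "- {0}"])
       (use assms in \<open>auto intro!: holomorphic_intros\<close>)
  from hol3_mult[OF assms(1) this] show ?thesis by (simp add: divide_inverse)
qed

lemma hol3_sum: "(\<And>i. i \<in> I \<Longrightarrow> hol3 (f i) S) \<Longrightarrow> hol3 (\<lambda>a x t. \<Sum>i\<in>I. f i a x t) S"
  by (induction I rule: infinite_finite_induct) (auto intro: hol3_add)

lemmas hol3_intros = hol3_const hol3_a hol3_x hol3_t hol3_add hol3_mult hol3_uminus hol3_diff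
  hol3_power hol3_sum

text \<open>Restriction to a holomorphic curve leads back to one variable, where Cauchy estimates,
  the Schwarz lemma and power series are available.\<close>

lemma hol3_slice:
  assumes f: "hol3 f S" and U: "open U"
    and u: "u holomorphic_on U" and v: "v holomorphic_on U" and w: "w holomorphic_on U"
    and sub: "\<And>z. z \<in> U \<Longrightarrow> (u z, v z, w z) \<in> S"
  shows "(\<lambda>z. f (u z) (v z) (w z)) holomorphic_on U"
proof -
  have "hol3 (\<lambda>a x t. f (u x) (v x) (w x)) (UNIV \<times> U \<times> UNIV)"
    by (intro hol3_comp[OF f] hol3_holomorphic[OF u U] hol3_holomorphic[OF v U] hol3_holomorphic[OF w U])
       (use sub in \<open>auto intro: hol3_intros\<close>)
  then have *: "\<exists>A B C. ((\<lambda>(a, x, t). f (u x) (v x) (w x)) has_derivative (\<lambda>(u, v, w). A * u + B * v + C * w)) (at (0, z, 0))" if "z \<in> U" for z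
    using that unfolding hol3_def by blast
  have "\<exists>D. ((\<lambda>z. f (u z) (v z) (w z)) has_field_derivative D) (at z)" if z: "z \<in> U" for z
  proof -
    obtain A B C where D: "((\<lambda>(a, x, t). f (u x) (v x) (w x)) has_derivative (\<lambda>(u, v, w). A * u + B * v + C * w)) (at (0::complex, z, 0::complex))"
      using *[OF z] by auto
    have "((\<lambda>z. (0, z, 0)) has_derivative (\<lambda>h. (0, h, 0))) (at z)"
      by (auto intro!: derivative_eq_intros)
    from has_derivative_compose[OF this D]
    have "((\<lambda>z. f (u z) (v z) (w z)) has_derivative (\<lambda>h. B * h)) (at z)" by simp
    then show ?thesis by (auto simp: has_field_derivative_def)
  qed
  then show ?thesis using U by (simp add: holomorphic_on_open)
qed

text \<open>Comparing the slice at \<open>z\<close> with the slice at \<open>z0\<close> by the Schwarz lemma makes the first-order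
  expansion uniform in \<open>z\<close>.\<close>

lemma slice_derivative_uniform:
  fixes f :: "'a::euclidean_space \<Rightarrow> complex" and e :: "complex \<Rightarrow> 'a"
  assumes cont: "continuous_on S f" and S: "open S" and z0: "z0 \<in> S"
    and e: "linear e" "\<And>h. norm (e h) = norm h"
    and sl: "\<And>z. z \<in> S \<Longrightarrow> (\<lambda>h. f (z + e h)) field_differentiable at 0"
    and \<epsilon>: "\<epsilon> > 0"
  shows "\<exists>d>0. \<forall>z\<in>ball z0 d. \<forall>h. norm h < d \<longrightarrow>
    norm (f (z + e h) - f z - deriv (\<lambda>h. f (z0 + e h)) 0 * h) \<le> \<epsilon> * norm h"
proof -
  obtain r where r: "r > 0" "cball z0 (3 * r) \<subseteq> S"
  proof -
    obtain s where "s > 0" "cball z0 s \<subseteq> S" using S z0 open_contains_cball by blast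
    then show ?thesis using that[of "s/3"] by simp
  qed
  have uc: "uniformly_continuous_on (cball z0 (3 * r)) f"
    by (rule compact_uniformly_continuous) (use cont r continuous_on_subset in auto)
  \<comment> \<open>This makes the Schwarz bound \<open>2 * \<eta> / r\<close> below equal to
    \<open>\<epsilon> / 2\<close>.\<close>
  define \<eta> where "\<eta> = \<epsilon> * r / 4"
  have \<eta>: "\<eta> > 0" using \<epsilon> r by (simp add: \<eta>_def)
  obtain d1 where d1: "d1 > 0" "\<And>x y. x \<in> cball z0 (3*r) \<Longrightarrow> y \<in> cball z0 (3*r) \<Longrightarrow> dist y x < d1 \<Longrightarrow> dist (f y) (f x) < \<eta>"
    using uc \<eta> unfolding uniformly_continuous_on_def by metis
  let ?D = "deriv (\<lambda>h. f (z0 + e h)) 0"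
  have "((\<lambda>h. f (z0 + e h)) has_field_derivative ?D) (at 0)"
    using sl[OF z0] by (simp add: DERIV_deriv_iff_field_differentiable)
  then have "((\<lambda>h. f (z0 + e h)) has_derivative (\<lambda>h. ?D * h)) (at 0)"
    by (simp add: has_field_derivative_def)
  then obtain d2 where d2: "d2 > 0" "\<And>h. norm h < d2 \<Longrightarrow> norm (f (z0 + e h) - f z0 - ?D * h) \<le> (\<epsilon>/2) * norm h"
    unfolding has_derivative_at_alt using \<epsilon> linear_0[OF e(1)] by (auto dest!: spec[of _ "\<epsilon>/2"])
  define d where "d = min (min d1 d2) r"
  have d: "d > 0" "d \<le> d1" "d \<le> d2" "d \<le> r" using d1 d2 r by (auto simp: d_def)
  have slice: "(\<lambda>h. f (z + e h)) holomorphic_on ball 0 r" if z: "z \<in> cball z0 (2 * r)" for z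
    unfolding holomorphic_on_def
  proof
    fix h0 :: complex assume h0: "h0 \<in> ball 0 r"
    have "dist z0 (z + e h0) \<le> dist z0 z + norm (e h0)"
      by (metis add_diff_cancel_left' dist_commute dist_norm dist_triangle2)
    then have "z + e h0 \<in> S" using z h0 r e by (force simp: dist_norm)
    from sl[OF this] have "(\<lambda>h. f ((z + e h0) + e h)) field_differentiable at 0" .
    then obtain D where "((\<lambda>h. f ((z + e h0) + e h)) has_field_derivative D) (at 0)"
      by (auto simp: field_differentiable_def)
    moreover have "((\<lambda>h. h - h0) has_field_derivative 1) (at h0)"
      by (auto intro!: derivative_eq_intros)
    ultimately have "((\<lambda>h. f ((z + e h0) + e (h - h0))) has_field_derivative D) (at h0)"
      using DERIV_chain2[of "\<lambda>h. f ((z + e h0) + e h)" D "\<lambda>h. h - h0" h0 1] by simp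
    then show "(\<lambda>h. f (z + e h)) field_differentiable at h0 within ball 0 r"
      by (auto simp: linear_diff[OF e(1)] field_differentiable_def intro: has_field_derivative_at_within)
  qed
  show ?thesis
  proof (intro exI[of _ d] conjI ballI allI impI)
    fix z and h :: complex assume z: "z \<in> ball z0 d" and h: "norm h < d"
    let ?k = "\<lambda>h. f (z + e h) - f z - (f (z0 + e h) - f z0)"
    have "norm (?k h) \<le> (2 * \<eta>) * norm h / r"
    proof (rule schwarz_scaled)
      show "?k holomorphic_on ball 0 r"
        by (intro holomorphic_intros slice) (use z d r in auto)
      show "norm h < r" using h d by simp
      show "norm (?k h) \<le> 2 * \<eta>" if "norm h < r" for h
      proof -
        have a: "dist (f (z + e h)) (f (z0 + e h)) < \<eta>"
        proof (rule d1(2))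
          have "dist z0 (z + e h) \<le> dist z0 z + norm (e h)"
            by (metis add_diff_cancel_left' dist_commute dist_norm dist_triangle2)
          then show "z + e h \<in> cball z0 (3*r)" using z d r that e by simp
          show "z0 + e h \<in> cball z0 (3*r)" using that e r by (simp add: dist_norm)
          show "dist (z + e h) (z0 + e h) < d1" using z d by (simp add: dist_norm norm_minus_commute)
        qed
        have b: "dist (f z) (f z0) < \<eta>"
          by (rule d1(2)) (use z d r in \<open>auto simp: dist_commute\<close>)
        have "norm (?k h) = norm ((f (z + e h) - f (z0 + e h)) - (f z - f z0))" by (simp add: algebra_simps)
        also have "\<dots> \<le> norm (f (z + e h) - f (z0 + e h)) + norm (f z - f z0)" by (rule norm_triangle_ineq4)
        finally show ?thesis using a b by (simp add: dist_norm)
      qed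
    qed (use r linear_0[OF e(1)] in auto)
    also have "\<dots> = (\<epsilon>/2) * norm h" using r by (simp add: \<eta>_def)
    finally have 1: "norm (?k h) \<le> (\<epsilon>/2) * norm h" .
    have 2: "norm (f (z0 + e h) - f z0 - ?D * h) \<le> (\<epsilon>/2) * norm h" using d2(2)[of h] h d by simp
    have "f (z + e h) - f z - ?D * h = ?k h + (f (z0 + e h) - f z0 - ?D * h)" by simp
    then have "norm (f (z + e h) - f z - ?D * h) \<le> norm (?k h) + norm (f (z0 + e h) - f z0 - ?D * h)"
      by (metis norm_triangle_ineq)
    then show "norm (f (z + e h) - f z - ?D * h) \<le> \<epsilon> * norm h" using 1 2 by linarith
  qed (use d in auto)
qed

text \<open>Osgood's lemma. An increment is split into three coordinate increments; the second and
  third start from displaced points, and the uniform first-order expansion permits the partial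
  derivatives at the original point to be used there.\<close>

lemma hol3_osgood:
  assumes cont: "continuous_on S (\<lambda>(a, x, t). f a x t)" and S: "open S"
    and sa: "\<And>a x t. (a, x, t) \<in> S \<Longrightarrow> (\<lambda>z. f z x t) field_differentiable at a"
    and sx: "\<And>a x t. (a, x, t) \<in> S \<Longrightarrow> (\<lambda>z. f a z t) field_differentiable at x"
    and st: "\<And>a x t. (a, x, t) \<in> S \<Longrightarrow> (\<lambda>z. f a x z) field_differentiable at t"
  shows "hol3 f S"
  unfolding hol3_def
proof safe
  fix a x t assume z0: "(a, x, t) \<in> S"
  let ?f = "\<lambda>(a, x, t). f a x t"
  define e1 :: "complex \<Rightarrow> complex \<times> complex \<times> complex" where "e1 = (\<lambda>h. (h, 0, 0))"
  define e2 :: "complex \<Rightarrow> complex \<times> complex \<times> complex" where "e2 = (\<lambda>h. (0, h, 0))"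
  define e3 :: "complex \<Rightarrow> complex \<times> complex \<times> complex" where "e3 = (\<lambda>h. (0, 0, h))"
  have shift: "(\<lambda>h. g (y + h)) field_differentiable at 0" if gd: "g field_differentiable at y" for g :: "complex \<Rightarrow> complex" and y :: complex
  proof -
    obtain D where "(g has_field_derivative D) (at y)" using gd by (auto simp: field_differentiable_def)
    moreover have "((\<lambda>h. y + h) has_field_derivative 1) (at 0)" by (auto intro!: derivative_eq_intros)
    ultimately have "((\<lambda>h. g (y + h)) has_field_derivative D) (at 0)"
      using DERIV_chain2[of g D "\<lambda>h. y + h" 0 1] by simp
    then show ?thesis by (auto simp: field_differentiable_def)
  qed
  have lin: "linear e1" "linear e2" "linear e3"
    by (auto simp: e1_def e2_def e3_def intro!: linearI)
  have nrm: "norm (e1 h) = norm h" "norm (e2 h) = norm h" "norm (e3 h) = norm h" for h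
    by (auto simp: e1_def e2_def e3_def norm_prod_def)
  define D1 where "D1 = deriv (\<lambda>h. ?f ((a, x, t) + e1 h)) 0"
  define D2 where "D2 = deriv (\<lambda>h. ?f ((a, x, t) + e2 h)) 0"
  define D3 where "D3 = deriv (\<lambda>h. ?f ((a, x, t) + e3 h)) 0"
  have D1: "\<exists>d>0. \<forall>z\<in>ball (a, x, t) d. \<forall>h. norm h < d \<longrightarrow> norm (?f (z + e1 h) - ?f z - D1 * h) \<le> \<epsilon> * norm h"
    if "\<epsilon> > 0" for \<epsilon>
    unfolding D1_def
    by (rule slice_derivative_uniform[OF cont S z0 lin(1) nrm(1) _ that])
       (auto simp: e1_def intro!: shift sa)
  have D2: "\<exists>d>0. \<forall>z\<in>ball (a, x, t) d. \<forall>h. norm h < d \<longrightarrow> norm (?f (z + e2 h) - ?f z - D2 * h) \<le> \<epsilon> * norm h"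
    if "\<epsilon> > 0" for \<epsilon>
    unfolding D2_def
    by (rule slice_derivative_uniform[OF cont S z0 lin(2) nrm(2) _ that])
       (auto simp: e2_def intro!: shift sx)
  have D3: "\<exists>d>0. \<forall>z\<in>ball (a, x, t) d. \<forall>h. norm h < d \<longrightarrow> norm (?f (z + e3 h) - ?f z - D3 * h) \<le> \<epsilon> * norm h"
    if "\<epsilon> > 0" for \<epsilon>
    unfolding D3_def
    by (rule slice_derivative_uniform[OF cont S z0 lin(3) nrm(3) _ that])
       (auto simp: e3_def intro!: shift st)
  have "(?f has_derivative (\<lambda>(u, v, w). D1 * u + D2 * v + D3 * w)) (at (a, x, t))"
    unfolding has_derivative_at_alt
  proof (intro conjI allI impI)
    have "linear (\<lambda>(u, v, w). D1 * u + D2 * v + D3 * w)"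
      by (rule linearI) (auto simp: algebra_simps)
    then show "bounded_linear (\<lambda>(u, v, w). D1 * u + D2 * v + D3 * w)"
      by (rule linear_conv_bounded_linear[THEN iffD1])
    fix \<epsilon> :: real assume \<epsilon>: "0 < \<epsilon>"
    then have "\<epsilon>/3 > 0" by simp
    obtain d1 where d1: "d1 > 0" "\<And>z h. z \<in> ball (a, x, t) d1 \<Longrightarrow> norm h < d1 \<Longrightarrow> norm (?f (z + e1 h) - ?f z - D1 * h) \<le> \<epsilon>/3 * norm h"
      using D1[OF \<open>\<epsilon>/3 > 0\<close>] by blast
    obtain d2 where d2: "d2 > 0" "\<And>z h. z \<in> ball (a, x, t) d2 \<Longrightarrow> norm h < d2 \<Longrightarrow> norm (?f (z + e2 h) - ?f z - D2 * h) \<le> \<epsilon>/3 * norm h"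
      using D2[OF \<open>\<epsilon>/3 > 0\<close>] by blast
    obtain d3 where d3: "d3 > 0" "\<And>z h. z \<in> ball (a, x, t) d3 \<Longrightarrow> norm h < d3 \<Longrightarrow> norm (?f (z + e3 h) - ?f z - D3 * h) \<le> \<epsilon>/3 * norm h"
      using D3[OF \<open>\<epsilon>/3 > 0\<close>] by blast
    define d where "d = min d1 (min d2 d3)"
    show "\<exists>d>0. \<forall>y. norm (y - (a, x, t)) < d \<longrightarrow>
        norm (?f y - ?f (a, x, t) - (\<lambda>(u, v, w). D1 * u + D2 * v + D3 * w) (y - (a, x, t))) \<le> \<epsilon> * norm (y - (a, x, t))"
    proof (intro exI[of _ d] conjI allI impI)
      show "d > 0" using d1 d2 d3 by (simp add: d_def)
      fix y assume y: "norm (y - (a, x, t)) < d"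
      obtain u v w where uvw: "y - (a, x, t) = (u, v, w)" by (cases "y - (a, x, t)")
      then have y_eq: "y = (a + u, x + v, t + w)" by (metis add_Pair diff_add_cancel add.commute)
      have n: "norm u \<le> norm (u, v, w)" "norm v \<le> norm (u, v, w)" "norm w \<le> norm (u, v, w)"
        "norm (u, v, 0::complex) \<le> norm (u, v, w)"
        by (auto simp: norm_prod_def intro!: real_le_rsqrt)
      have y': "norm (u, v, w) < d" using y uvw by simp
      have 1: "norm (f (a + u) x t - f a x t - D1 * u) \<le> \<epsilon>/3 * norm u"
        using d1(2)[of "(a, x, t)" u] d1(1) n y' by (simp add: e1_def d_def)
      have "dist (a, x, t) (a + u, x, t) < d2"
        using n y' by (simp add: dist_norm norm_prod_def d_def)
      then have 2: "norm (f (a + u) (x + v) t - f (a + u) x t - D2 * v) \<le> \<epsilon>/3 * norm v"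
        using d2(2)[of "(a + u, x, t)" v] n y' by (simp add: e2_def d_def)
      have "dist (a, x, t) (a + u, x + v, t) = norm (u, v, 0::complex)"
        by (simp add: dist_norm norm_prod_def)
      then have "dist (a, x, t) (a + u, x + v, t) < d3"
        using n y' by (simp add: d_def)
      then have 3: "norm (f (a + u) (x + v) (t + w) - f (a + u) (x + v) t - D3 * w) \<le> \<epsilon>/3 * norm w"
        using d3(2)[of "(a + u, x + v, t)" w] n y' by (simp add: e3_def d_def)
      have "f (a + u) (x + v) (t + w) - f a x t - (D1 * u + D2 * v + D3 * w) =
         (f (a + u) x t - f a x t - D1 * u) + (f (a + u) (x + v) t - f (a + u) x t - D2 * v)
         + (f (a + u) (x + v) (t + w) - f (a + u) (x + v) t - D3 * w)" by (simp add: algebra_simps)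
      also have "norm \<dots> \<le> \<epsilon>/3 * norm u + \<epsilon>/3 * norm v + \<epsilon>/3 * norm w"
        by (intro norm_triangle_le add_mono 1 2 3)
      also have "\<dots> \<le> \<epsilon>/3 * norm (u,v,w) + \<epsilon>/3 * norm (u,v,w) + \<epsilon>/3 * norm (u,v,w)"
        using n \<epsilon> by (intro add_mono mult_left_mono) auto
      finally show "norm (?f y - ?f (a, x, t) - (\<lambda>(u, v, w). D1 * u + D2 * v + D3 * w) (y - (a, x, t))) \<le> \<epsilon> * norm (y - (a, x, t))"
        by (simp add: uvw y_eq)
    qed
  qed
  then show "\<exists>A B C. (?f has_derivative (\<lambda>(u, v, w). A * u + B * v + C * w)) (at (a, x, t))" by blast
qed

lemma hol3_slices:
  assumes f: "hol3 f S" and z: "(a, x, t) \<in> S"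
  shows "(\<lambda>z. f z x t) field_differentiable at a" "(\<lambda>z. f a z t) field_differentiable at x"
    "(\<lambda>z. f a x z) field_differentiable at t"
proof -
  obtain A B C where D: "((\<lambda>(a, x, t). f a x t) has_derivative (\<lambda>(u, v, w). A * u + B * v + C * w)) (at (a, x, t))"
    using f z unfolding hol3_def by blast
  have 1: "((\<lambda>z. (z, x, t)) has_derivative (\<lambda>h. (h, 0::complex \<times> complex))) (at a)"
    and 2: "((\<lambda>z. (a, z, t)) has_derivative (\<lambda>h. (0, h, 0))) (at x)"
    and 3: "((\<lambda>z. (a, x, z)) has_derivative (\<lambda>h. (0, 0, h))) (at t)"
    by (auto intro!: derivative_eq_intros simp: zero_prod_def)
  have "((\<lambda>z. f z x t) has_field_derivative A) (at a)" "((\<lambda>z. f a z t) has_field_derivative B) (at x)"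
    "((\<lambda>z. f a x z) has_field_derivative C) (at t)"
    using has_derivative_compose[OF 1 D] has_derivative_compose[OF 2 D] has_derivative_compose[OF 3 D]
    by (auto simp: has_field_derivative_def zero_prod_def)
  then show "(\<lambda>z. f z x t) field_differentiable at a" "(\<lambda>z. f a z t) field_differentiable at x"
    "(\<lambda>z. f a x z) field_differentiable at t"
    by (auto simp: field_differentiable_def)
qed

text \<open>The limit is continuous and its slices are holomorphic by the one-variable Weierstrass
  theorem, so Osgood's lemma applies. The auxiliary fact \<open>one\<close> treats the three
  coordinate lines at once, as \<open>p + k \<zeta>\<close>.\<close>

lemma hol3_uniform_limit:
  assumes S: "open S" and f: "\<And>n. hol3 (f n) S"
    and lim: "\<And>z. z \<in> S \<Longrightarrow> \<exists>e>0. ball z e \<subseteq> S \<and>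
      uniform_limit (ball z e) (\<lambda>n (a, x, t). f n a x t) (\<lambda>(a, x, t). g a x t) sequentially"
  shows "hol3 g S"
proof (rule hol3_local)
  fix z assume z: "z \<in> S"
  obtain e where e: "e > 0" "ball z e \<subseteq> S"
    and ul: "uniform_limit (ball z e) (\<lambda>n (a, x, t). f n a x t) (\<lambda>(a, x, t). g a x t) sequentially"
    using lim[OF z] by blast
  have fe: "hol3 (f n) (ball z e)" for n using f e hol3_subset by blast
  have one: "(\<lambda>\<zeta>. G (p + k \<zeta>)) field_differentiable at \<zeta>0"
    if pk: "p + k \<zeta>0 \<in> ball z e" "continuous_on UNIV k" "\<And>n \<zeta>. p + k \<zeta> \<in> ball z e \<Longrightarrow> (\<lambda>\<zeta>. F n (p + k \<zeta>)) field_differentiable at \<zeta>"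
      and u: "uniform_limit (ball z e) F G sequentially"
    for p :: "complex \<times> complex \<times> complex" and k :: "complex \<Rightarrow> complex \<times> complex \<times> complex" and \<zeta>0 F G
  proof -
    let ?U = "(\<lambda>\<zeta>. p + k \<zeta>) -` ball z e"
    have U: "open ?U" by (intro open_vimage continuous_intros pk) auto
    have "(\<lambda>\<zeta>. G (p + k \<zeta>)) holomorphic_on ?U"
    proof (rule holomorphic_uniform_sequence[OF U])
      show "(\<lambda>\<zeta>. F n (p + k \<zeta>)) holomorphic_on ?U" for n
        using pk(3) by (auto simp: holomorphic_on_def intro: field_differentiable_at_within)
      show "\<exists>d>0. cball x d \<subseteq> ?U \<and> uniform_limit (cball x d) (\<lambda>n \<zeta>. F n (p + k \<zeta>)) (\<lambda>\<zeta>. G (p + k \<zeta>)) sequentially"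
        if x: "x \<in> ?U" for x
      proof -
        obtain d where d: "d > 0" "cball x d \<subseteq> ?U" using U x open_contains_cball by blast
        have "uniform_limit (cball x d) (\<lambda>n \<zeta>. F n (p + k \<zeta>)) (\<lambda>\<zeta>. G (p + k \<zeta>)) sequentially"
          using u d(2) unfolding uniform_limit_iff
          by (elim all_forward imp_forward eventually_mono) auto
        with d show ?thesis by blast
      qed
    qed
    then show ?thesis using U pk(1) by (simp add: holomorphic_on_open field_differentiable_def)
  qed
  have "hol3 g (ball z e)"
  proof (rule hol3_osgood)
    show "continuous_on (ball z e) (\<lambda>(a, x, t). g a x t)"
      by (rule uniform_limit_theorem[OF _ ul]) (auto intro!: always_eventually hol3_continuous_on[OF fe])
    fix a x t assume m: "(a, x, t) \<in> ball z e"
    show "(\<lambda>z. g z x t) field_differentiable at a"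
    proof -
      have "(\<lambda>\<zeta>. (\<lambda>(a, x, t). g a x t) ((0, x, t) + ((\<zeta>, 0, 0)))) field_differentiable at a"
        by (rule one[OF _ _ _ ul]) (use m in \<open>auto intro!: continuous_intros hol3_slices[OF fe]\<close>)
      then show ?thesis by simp
    qed
    show "(\<lambda>z. g a z t) field_differentiable at x"
    proof -
      have "(\<lambda>\<zeta>. (\<lambda>(a, x, t). g a x t) ((a, 0, t) + ((0, \<zeta>, 0)))) field_differentiable at x"
        by (rule one[OF _ _ _ ul]) (use m in \<open>auto intro!: continuous_intros hol3_slices[OF fe]\<close>)
      then show ?thesis by simp
    qed
    show "(\<lambda>z. g a x z) field_differentiable at t"
    proof -
      have "(\<lambda>\<zeta>. (\<lambda>(a, x, t). g a x t) ((a, x, 0) + ((0, 0, \<zeta>)))) field_differentiable at t"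
        by (rule one[OF _ _ _ ul]) (use m in \<open>auto intro!: continuous_intros hol3_slices[OF fe]\<close>)
      then show ?thesis by simp
    qed
  qed auto
  then show "\<exists>U. open U \<and> z \<in> U \<and> hol3 g U" using e by (intro exI[of _ "ball z e"]) auto
qed

lemma field_differentiable_shift:
  fixes g :: "complex \<Rightarrow> complex"
  assumes "g field_differentiable at (y + z)"
  shows "(\<lambda>z. g (y + z)) field_differentiable at z"
proof -
  have "(g \<circ> (\<lambda>z. y + z)) field_differentiable at z"
    by (rule field_differentiable_compose) (use assms in \<open>auto intro!: derivative_intros\<close>)
  then show ?thesis by (simp add: o_def)
qed

section \<open>Division by a coordinate with holomorphic parameters\<close>

text \<open>Removable singularity with parameters. On \<open>x = 0\<close> the slice in
  \<open>x\<close> extends by the one-variable theorem, joint continuity follows from the uniform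
  first-order expansion, and the slices in \<open>a\<close> and \<open>t\<close> are uniform limits
  of quotients at small nonzero \<open>x\<close>. All later orders in \<open>x\<close> are split off
  by this division.\<close>

lemma hol3_divide_x:
  assumes f: "hol3 f S" and S: "open S" and f0: "\<And>a t. (a, 0, t) \<in> S \<Longrightarrow> f a 0 t = 0"
  shows "\<exists>g. hol3 g S \<and> (\<forall>a x t. (a, x, t) \<in> S \<longrightarrow> f a x t = x * g a x t)"
proof -
  define g where "g = (\<lambda>a x t. if x = 0 then deriv (\<lambda>x. f a x t) 0 else f a x t / x)"
  have gx: "f a x t = x * g a x t" if "(a, x, t) \<in> S" for a x t
    using that f0 by (auto simp: g_def)
  let ?f = "\<lambda>(a, x, t). f a x t" and ?g = "\<lambda>(a, x, t). g a x t"
  have off: "\<exists>U. open U \<and> z \<in> U \<and> hol3 g U" if z: "z \<in> S" "fst (snd z) \<noteq> 0" for z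
  proof -
    let ?U = "S \<inter> (UNIV \<times> (- {0}) \<times> UNIV)"
    have U: "open ?U" using S by (intro open_Int open_Times) auto
    have "hol3 (\<lambda>a x t. f a x t / x) ?U"
      by (rule hol3_divide) (auto intro: hol3_subset[OF f] hol3_x)
    then have "hol3 g ?U" by (rule hol3_cong_open[OF _ U]) (auto simp: g_def)
    then show ?thesis using U z by (intro exI[of _ ?U]) (auto simp: mem_Times_iff)
  qed
  have slx: "(\<lambda>x. g a x t) field_differentiable at x" if z: "(a, x, t) \<in> S" for a x t
  proof -
    let ?U = "(\<lambda>x. (a, x, t)) -` S"
    have U: "open ?U" by (intro open_vimage S continuous_intros)
    have hf: "(\<lambda>x. f a x t) holomorphic_on ?U"
      using hol3_slices(2)[OF f] by (auto simp: holomorphic_on_def intro: field_differentiable_at_within)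
    have "(\<lambda>z. if z = 0 then deriv (\<lambda>x. f a x t) 0 else (f a z t - f a 0 t) / (z - 0)) holomorphic_on ?U"
      by (rule pole_lemma_open[OF hf U])
    moreover have "(\<lambda>x. g a x t) = (\<lambda>z. if z = 0 then deriv (\<lambda>x. f a x t) 0 else (f a z t - f a 0 t) / (z - 0))"
      if "(a, 0, t) \<in> S" using f0[OF that] by (auto simp: g_def)
    ultimately have "(\<lambda>x. g a x t) holomorphic_on ?U \<or> (a, 0, t) \<notin> S" by (cases "(a, 0, t) \<in> S") simp_all
    moreover have "(\<lambda>x. g a x t) field_differentiable at x" if "(a, 0, t) \<notin> S"
    proof -
      have "x \<noteq> 0" using that z by auto
      then obtain U where "open U" "(a, x, t) \<in> U" "hol3 g U" using off[of "(a, x, t)"] z by auto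
      then show ?thesis using hol3_slices(2) by blast
    qed
    ultimately show ?thesis using z U
      by (auto simp: holomorphic_on_open field_differentiable_def)
  qed
  have cont0: "isCont ?g z" if z: "z \<in> S" for z
  proof (cases "fst (snd z) = 0")
    case False
    then obtain U where "open U" "z \<in> U" "hol3 g U" using off z by blast
    then show ?thesis using hol3_continuous_on by (metis continuous_on_eq_continuous_at)
  next
    case True
    then obtain a0 t0 where z0: "z = (a0, 0, t0)" by (cases z) auto
    show ?thesis unfolding continuous_at_eps_delta
    proof (intro allI impI)
      fix e :: real assume e: "e > 0"
      define e2 :: "complex \<Rightarrow> complex \<times> complex \<times> complex" where "e2 = (\<lambda>h. (0, h, 0))"
      have "\<exists>d>0. \<forall>z\<in>ball z d. \<forall>h. norm h < d \<longrightarrow>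
          norm (?f (z + e2 h) - ?f z - deriv (\<lambda>h. ?f ((a0, 0, t0) + e2 h)) 0 * h) \<le> e/2 * norm h"
        unfolding z0
      proof (rule slice_derivative_uniform[OF hol3_continuous_on[OF f] S])
        show "linear e2" by (auto simp: e2_def intro!: linearI)
        fix w assume w: "w \<in> S"
        obtain a x t where w': "w = (a, x, t)" by (cases w)
        have "(\<lambda>z. f a z t) field_differentiable at (x + 0)" using hol3_slices(2)[OF f] w w' by auto
        then have "((\<lambda>z. f a z t) \<circ> (\<lambda>h. x + h)) field_differentiable at 0"
          by (intro field_differentiable_compose) (auto intro!: derivative_intros)
        then show "(\<lambda>h. ?f (w + e2 h)) field_differentiable at 0"
          by (simp add: w' e2_def o_def)
      qed (use z0 z e in \<open>auto simp: e2_def norm_prod_def\<close>)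
      moreover have "deriv (\<lambda>h. ?f ((a0, 0, t0) + e2 h)) 0 = g a0 0 t0" by (simp add: g_def e2_def)
      ultimately obtain d where d: "d > 0" and dd: "\<And>w h. w \<in> ball z d \<Longrightarrow> norm h < d \<Longrightarrow>
          norm (?f (w + e2 h) - ?f w - g a0 0 t0 * h) \<le> e/2 * norm h"
        by metis
      obtain d' where d': "d' > 0" "ball z d' \<subseteq> S" using S z open_contains_ball by blast
      define d0 where "d0 = min d d'"
      have bd: "norm (g a x t - g a0 0 t0) \<le> e/2" if w: "(a, 0, t) \<in> ball z d0" "norm x < d" "x \<noteq> 0" for a x t
      proof -
        have "(a, 0, t) \<in> S" using w d' by (auto simp: d0_def)
        then have "norm (f a x t - g a0 0 t0 * x) \<le> e/2 * norm x"
          using dd[of "(a, 0, t)" x] w f0 by (auto simp: e2_def d0_def)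
        moreover have "f a x t - g a0 0 t0 * x = (g a x t - g a0 0 t0) * x"
          using w(3) by (simp add: g_def algebra_simps)
        ultimately show ?thesis using w(3) by (simp add: norm_mult)
      qed
      have bd0: "norm (g a 0 t - g a0 0 t0) \<le> e/2" if w: "(a, 0, t) \<in> ball z d0" for a t
      proof (rule tendsto_upperbound)
        have "(a, 0, t) \<in> S" using w d' by (auto simp: d0_def)
        then have "isCont (\<lambda>x. g a x t) 0" using slx field_differentiable_imp_continuous_at by blast
        then show "((\<lambda>x. norm (g a x t - g a0 0 t0)) \<longlongrightarrow> norm (g a 0 t - g a0 0 t0)) (at 0)"
          unfolding isCont_def by (intro tendsto_intros)
        have "eventually (\<lambda>x. x \<in> ball 0 d - {0}) (at (0::complex))"
          using d eventually_at_ball' by (auto simp: eventually_at dist_norm intro!: exI[of _ d])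
        then show "\<forall>\<^sub>F x in at 0. norm (g a x t - g a0 0 t0) \<le> e/2"
          by eventually_elim (use bd w in auto)
      qed auto
      have "norm (?g w - ?g z) < e" if "dist w z < d0" for w
      proof -
        obtain a x t where w: "w = (a, x, t)" by (cases w)
        have "dist z (a, 0, t) \<le> dist z w" unfolding z0 w
          by (auto simp: dist_norm norm_prod_def)
        then have 1: "(a, 0, t) \<in> ball z d0" using that by (simp add: dist_commute)
        have "norm x \<le> dist z w" unfolding z0 w
          by (auto simp: dist_norm norm_prod_def intro!: real_le_rsqrt)
        then have "norm x < d" using that by (simp add: d0_def dist_commute)
        then have "norm (?g w - ?g z) \<le> e/2" using bd[OF 1] bd0[OF 1] by (cases "x = 0") (auto simp: w z0)
        then show ?thesis using e by simp
      qed
      then show "\<exists>d>0. \<forall>x'. dist x' z < d \<longrightarrow> dist (?g x') (?g z) < e"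
        using d d' by (intro exI[of _ d0]) (auto simp: d0_def dist_norm)
    qed
  qed
  then have cont: "continuous_on S ?g" by (simp add: continuous_at_imp_continuous_on)
  have lim: "(\<lambda>\<zeta>. ?g (p + k \<zeta>)) field_differentiable at \<zeta>0"
    if pk: "p + k \<zeta>0 \<in> S" "fst (snd (p + k \<zeta>0)) = 0" "continuous_on UNIV k" "\<And>\<zeta>. fst (snd (k \<zeta>)) = 0"
     and sl: "\<And>p \<zeta>. p + k \<zeta> \<in> S \<Longrightarrow> (\<lambda>\<zeta>. ?f (p + k \<zeta>)) field_differentiable at \<zeta>"
    for p :: "complex \<times> complex \<times> complex" and k :: "complex \<Rightarrow> complex \<times> complex \<times> complex" and \<zeta>0
  proof -
    have p0: "fst (snd p) = 0" using pk(2) pk(4)[of \<zeta>0] by simp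
    define G where "G = (\<lambda>z :: complex \<times> complex. (p + k (fst z)) + (0, snd z, 0))"
    have cG: "continuous_on A G" for A
      unfolding G_def by (intro continuous_intros continuous_on_compose2[OF pk(3)]) auto
    have "open (G -` S)" by (rule open_vimage[OF S cG])
    moreover have "(\<zeta>0, 0) \<in> G -` S" using pk(1) by (simp add: G_def zero_prod_def[symmetric])
    ultimately obtain A B where AB0: "open A" "open B" "(\<zeta>0, 0) \<in> A \<times> B" "A \<times> B \<subseteq> G -` S"
      by (rule open_prod_elim)
    then have AB: "open A" "open B" "\<zeta>0 \<in> A" "0 \<in> B" "A \<times> B \<subseteq> G -` S" by auto
    obtain d1 where d1: "d1 > 0" "cball \<zeta>0 d1 \<subseteq> A" using AB open_contains_cball by blast
    obtain d2 where d2: "d2 > 0" "cball 0 d2 \<subseteq> B" using AB open_contains_cball by blast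
    define s where "s = (\<lambda>n. complex_of_real (d2 * inverse (real (Suc n))))"
    have s: "s n \<noteq> 0" "s n \<in> cball 0 d2" for n
    proof -
      show "s n \<noteq> 0" using d2 unfolding s_def by (simp del: of_nat_Suc)
      have "norm (s n) = d2 * inverse (real (Suc n))" unfolding s_def norm_of_real using d2 by simp
      also have "\<dots> \<le> d2 * 1" using d2 by (intro mult_left_mono) (auto simp: inverse_le_1_iff)
      finally show "s n \<in> cball 0 d2" by simp
    qed
    have s0: "s \<longlonglongrightarrow> 0" 
      using tendsto_of_real[OF tendsto_mult_right_zero[OF LIMSEQ_inverse_real_of_nat], where 'a = complex]
      unfolding s_def by (simp only: of_real_0)
    have mem: "G (\<zeta>, x) \<in> S" if "\<zeta> \<in> cball \<zeta>0 d1" "x \<in> cball 0 d2" for \<zeta> x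
      using that AB d1 d2 by blast
    have "uniformly_continuous_on (cball \<zeta>0 d1 \<times> cball 0 d2) (\<lambda>z. ?g (G z))"
      by (intro compact_uniformly_continuous compact_Times compact_cball continuous_on_compose2[OF cont cG])
         (use mem in auto)
    note uc = this[unfolded uniformly_continuous_on_def]
    have "(\<lambda>\<zeta>. ?g (p + k \<zeta>)) holomorphic_on ball \<zeta>0 d1"
    proof (rule holomorphic_uniform_limit[where F = sequentially and f = "\<lambda>n \<zeta>. ?g (G (\<zeta>, s n))"])
      have "(\<lambda>\<zeta>. ?g (G (\<zeta>, s n))) field_differentiable at \<zeta>" if "\<zeta> \<in> cball \<zeta>0 d1" for \<zeta> n
      proof -
        have eq: "?g (G (\<zeta>, s n)) = ?f ((p + (0, s n, 0)) + k \<zeta>) / s n" for \<zeta>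
          using pk(4)[of \<zeta>] p0 s(1)[of n] by (cases p; cases "k \<zeta>") (auto simp: G_def g_def)
        have "(p + (0, s n, 0)) + k \<zeta> \<in> S" using mem[OF that s(2)] by (simp add: G_def algebra_simps)
        then show ?thesis unfolding eq
          by (intro field_differentiable_divide sl field_differentiable_const s)
      qed
      note fd = this
      show "\<forall>\<^sub>F n in sequentially. continuous_on (cball \<zeta>0 d1) (\<lambda>\<zeta>. ?g (G (\<zeta>, s n)))
          \<and> (\<lambda>\<zeta>. ?g (G (\<zeta>, s n))) holomorphic_on ball \<zeta>0 d1"
        using fd by (intro always_eventually allI conjI continuous_at_imp_continuous_on ballI field_differentiable_imp_continuous_at)
          (auto simp: holomorphic_on_def intro!: field_differentiable_at_within[OF fd])
      show "uniform_limit (cball \<zeta>0 d1) (\<lambda>n \<zeta>. ?g (G (\<zeta>, s n))) (\<lambda>\<zeta>. ?g (p + k \<zeta>)) sequentially"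
        unfolding uniform_limit_iff
      proof (intro allI impI)
        fix e :: real assume "e > 0"
        then obtain d where d: "d > 0" "\<And>x x'. x \<in> cball \<zeta>0 d1 \<times> cball 0 d2 \<Longrightarrow> x' \<in> cball \<zeta>0 d1 \<times> cball 0 d2 \<Longrightarrow> dist x' x < d \<Longrightarrow> dist (?g (G x')) (?g (G x)) < e"
          using uc by metis
        have "\<forall>\<^sub>F n in sequentially. dist (s n) 0 < d" using s0 d(1) by (rule tendstoD)
        then show "\<forall>\<^sub>F n in sequentially. \<forall>\<zeta>\<in>cball \<zeta>0 d1. dist (?g (G (\<zeta>, s n))) (?g (p + k \<zeta>)) < e"
        proof eventually_elim
          case (elim n)
          have "dist (?g (G (\<zeta>, s n))) (?g (G (\<zeta>, 0))) < e" if "\<zeta> \<in> cball \<zeta>0 d1" for \<zeta>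
            by (rule d(2)) (use that s(2) d2 elim in \<open>auto simp: dist_Pair_Pair\<close>)
          then show ?case by (simp add: G_def zero_prod_def[symmetric])
        qed
      qed
    qed auto
    then show ?thesis using d1 by (simp add: holomorphic_on_open field_differentiable_def)
  qed
  have "hol3 g S"
  proof (rule hol3_osgood[OF cont S])
    fix a x t assume z: "(a, x, t) \<in> S"
    show "(\<lambda>x. g a x t) field_differentiable at x" using slx z by blast
    show "(\<lambda>z. g z x t) field_differentiable at a"
    proof (cases "x = 0")
      case False
      then show ?thesis using off[of "(a, x, t)"] z hol3_slices(1) by force
    next
      case True
      have "(\<lambda>\<zeta>. ?g ((0, 0, t) + (\<zeta>, 0, 0))) field_differentiable at a"
        by (rule lim) (use z True in \<open>auto intro!: continuous_intros hol3_slices[OF f] field_differentiable_shift\<close>)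
      then show ?thesis using True by simp
    qed
    show "(\<lambda>z. g a x z) field_differentiable at t"
    proof (cases "x = 0")
      case False
      then show ?thesis using off[of "(a, x, t)"] z hol3_slices(3) by force
    next
      case True
      have "(\<lambda>\<zeta>. ?g ((a, 0, 0) + (0, 0, \<zeta>))) field_differentiable at t"
        by (rule lim) (use z True in \<open>auto intro!: continuous_intros hol3_slices[OF f] field_differentiable_shift\<close>)
      then show ?thesis using True by simp
    qed
  qed
  with gx show ?thesis by blast
qed

section \<open>Inversion and persistence with parameters\<close>

text \<open>The closed disc of radius \<open>d / 2\<close> around a point of the smaller ball stays
  in the larger one; the Cauchy estimate on it gives the constant \<open>2 * m / d\<close>.\<close>

lemma holomorphic_lipschitz:
  assumes f: "f holomorphic_on ball c R" and bd: "\<And>x. x \<in> ball c R \<Longrightarrow> norm (f x) \<le> m" and d: "d > 0"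
    and x: "x \<in> ball c (R - d)" and y: "y \<in> ball c (R - d)"
  shows "norm (f x - f y) \<le> 2 * m / d * norm (x - y)"
proof (rule field_differentiable_bound[OF convex_ball[of c "R - d"] _ _ x y])
  fix z assume z: "z \<in> ball c (R - d)"
  have sub: "cball z (d/2) \<subseteq> ball c R"
  proof
    fix w assume "w \<in> cball z (d/2)"
    then show "w \<in> ball c R" using z d dist_triangle[of c w z] by simp
  qed
  show "(f has_field_derivative deriv f z) (at z within ball c (R - d))"
    by (rule has_field_derivative_at_within, rule holomorphic_derivI[OF f]) (use z d in auto)
  have "norm ((deriv ^^ 1) f z) \<le> fact 1 * m / (d/2) ^ 1"
  proof (rule Cauchy_inequality)
    show "f holomorphic_on ball z (d/2)" using sub f holomorphic_on_subset ball_subset_cball by (metis order_trans)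
    show "continuous_on (cball z (d/2)) f"
      using sub f holomorphic_on_subset holomorphic_on_imp_continuous_on by blast
    show "norm (f x) \<le> m" if "norm (z - x) = d/2" for x
      using that sub by (intro bd) (auto simp: dist_norm)
  qed (use d in auto)
  then show "norm (deriv f z) \<le> 2 * m / d" by (simp add: mult.commute)
qed

text \<open>Inversion of the perturbed identity \<open>x + E a x t\<close> by Picard iteration
  started at \<open>w\<close>. The bound \<open>m\<close> on \<open>E\<close> is exactly the radius
  lost; the Lipschitz constant \<open>1/2\<close> makes the increments geometric and the solution
  unique in the larger ball.\<close>

lemma hol3_fixpoint:
  assumes E: "hol3 E (D \<times> ball 0 M \<times> T)" and D: "open D" and T: "open T"
    and bd: "\<And>a x t. a \<in> D \<Longrightarrow> x \<in> ball 0 M \<Longrightarrow> t \<in> T \<Longrightarrow> norm (E a x t) \<le> m"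
    and lip: "\<And>a x x' t. a \<in> D \<Longrightarrow> x \<in> ball 0 M \<Longrightarrow> x' \<in> ball 0 M \<Longrightarrow> t \<in> T \<Longrightarrow>
       norm (E a x t - E a x' t) \<le> 1/2 * norm (x - x')"
    and m: "m \<ge> 0"
  obtains s where "hol3 s (D \<times> ball 0 (M - m) \<times> T)"
    "\<And>a w t. a \<in> D \<Longrightarrow> w \<in> ball 0 (M - m) \<Longrightarrow> t \<in> T \<Longrightarrow>
        norm (s a w t) < M \<and> norm (s a w t - w) \<le> m \<and> s a w t + E a (s a w t) t = w"
    "\<And>a x w t. a \<in> D \<Longrightarrow> x \<in> ball 0 M \<Longrightarrow> t \<in> T \<Longrightarrow> w \<in> ball 0 (M - m) \<Longrightarrow> x + E a x t = w \<Longrightarrow> x = s a w t"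
proof -
  define S :: "(complex \<times> complex \<times> complex) set" where "S = D \<times> ball 0 (M - m) \<times> T"
  have S: "open S" unfolding S_def by (intro open_Times D T) auto
  define it :: "nat \<Rightarrow> complex \<Rightarrow> complex \<Rightarrow> complex \<Rightarrow> complex" where "it = rec_nat (\<lambda>a w t. w) (\<lambda>_ f a w t. w - E a (f a w t) t)"
  have it0: "it 0 a w t = w" and itS: "it (Suc n) a w t = w - E a (it n a w t) t" for n a w t
    by (simp_all add: it_def)
  have nit: "norm (it n a w t) < M \<and> norm (it n a w t - w) \<le> m" if "(a, w, t) \<in> S" for n and a w t :: complex
  proof (induction n)
    case 0 then show ?case using that m by (auto simp: it0 S_def)
  next
    case (Suc n)
    have 1: "norm (E a (it n a w t) t) \<le> m" using that Suc by (intro bd) (auto simp: S_def)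
    have "norm (it (Suc n) a w t) \<le> norm w + norm (E a (it n a w t) t)"
      unfolding itS by (rule norm_triangle_ineq4)
    then show ?case using 1 that by (auto simp: itS S_def)
  qed
  have hit: "hol3 (it n) S" for n
  proof (induction n)
    case 0
    have "it 0 = (\<lambda>a w t. w)" by (simp add: it0 fun_eq_iff)
    then show ?case by (auto intro: hol3_intros)
  next
    case (Suc n)
    have eq: "it (Suc n) = (\<lambda>a w t. w - E a (it n a w t) t)" by (simp add: itS fun_eq_iff)
    show ?case unfolding eq
      by (intro hol3_intros hol3_comp[OF E _ Suc]) (use nit in \<open>auto simp: S_def\<close>)
  qed
  define u where "u = (\<lambda>n z. (\<lambda>(a, w, t). it (Suc n) a w t - it n a w t) z)"
  have nu: "norm (u n z) \<le> m * (1/2) ^ n" if "z \<in> S" for n z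
  proof -
    obtain a w t where z: "z = (a, w, t)" by (cases z)
    show ?thesis unfolding z u_def
    proof (induction n)
      case 0
      have "norm (E a w t) \<le> m" using that z m by (intro bd) (auto simp: S_def)
      then show ?case by (simp add: itS it0)
    next
      case (Suc n)
      have "norm (it (Suc (Suc n)) a w t - it (Suc n) a w t) = norm (E a (it n a w t) t - E a (it (Suc n) a w t) t)"
        by (simp add: itS[of "Suc n"] itS[of n a w t])
      also have "\<dots> \<le> 1/2 * norm (it n a w t - it (Suc n) a w t)"
        using that nit[of a w t] z by (intro lip) (auto simp: S_def)
      finally show ?case using Suc by (simp add: norm_minus_commute)
    qed
  qed
  have sumu: "(\<Sum>i<n. u i (a, w, t)) = it n a w t - w" for n a w t
    unfolding u_def by (induction n) (simp_all add: it0)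
  define s where "s = (\<lambda>a w t. w + (\<Sum>i. u i (a, w, t)))"
  have ul: "uniform_limit S (\<lambda>n z. \<Sum>i<n. u i z) (\<lambda>z. \<Sum>i. u i z) sequentially"
    by (rule Weierstrass_m_test[OF nu]) (auto intro!: summable_mult summable_geometric)
  have ul': "uniform_limit S (\<lambda>n (a, w, t). it n a w t) (\<lambda>(a, w, t). s a w t) sequentially"
  proof -
    have "uniform_limit S (\<lambda>n z. fst (snd z) + (\<Sum>i<n. u i z)) (\<lambda>z. fst (snd z) + (\<Sum>i. u i z)) sequentially"
      by (intro uniform_limit_intros ul)
    moreover have "(\<lambda>(a, w, t). it n a w t) = (\<lambda>z. fst (snd z) + (\<Sum>i<n. u i z))" for n
      using sumu by (auto simp: fun_eq_iff)
    moreover have "(\<lambda>(a, w, t). s a w t) = (\<lambda>z. fst (snd z) + (\<Sum>i. u i z))"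
      by (auto simp: fun_eq_iff s_def)
    ultimately show ?thesis by simp
  qed
  have hs: "hol3 s S"
  proof (rule hol3_uniform_limit[OF S hit])
    fix z assume "z \<in> S"
    then obtain e where "e > 0" "ball z e \<subseteq> S" using S open_contains_ball by blast
    then show "\<exists>e>0. ball z e \<subseteq> S \<and> uniform_limit (ball z e) (\<lambda>n (a, x, t). it n a x t) (\<lambda>(a, x, t). s a x t) sequentially"
      using ul' uniform_limit_on_subset by blast
  qed
  have props: "norm (s a w t) < M \<and> norm (s a w t - w) \<le> m \<and> s a w t + E a (s a w t) t = w"
    if z: "(a, w, t) \<in> S" for a w t :: complex
  proof -
    have l: "(\<lambda>n. it n a w t) \<longlonglongrightarrow> s a w t"
      using tendsto_uniform_limitI[OF ul' z] by simp
    have 1: "norm (s a w t - w) \<le> m"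
      by (rule tendsto_upperbound[OF tendsto_norm[OF tendsto_diff[OF l tendsto_const]]])
         (use nit[OF z] in auto)
    have "norm (s a w t) \<le> norm w + norm (s a w t - w)" by (metis add_diff_cancel_left' diff_add_cancel norm_triangle_ineq)
    then have 2: "norm (s a w t) < M" using 1 z by (auto simp: S_def)
    have "continuous_on (ball 0 M) (\<lambda>x. E a x t)"
      by (intro holomorphic_on_imp_continuous_on hol3_slice[OF E]) (use z in \<open>auto simp: S_def intro!: holomorphic_intros\<close>)
    then have "isCont (\<lambda>x. E a x t) (s a w t)" using 2 by (simp add: continuous_on_eq_continuous_at)
    then have "(\<lambda>n. E a (it n a w t) t) \<longlonglongrightarrow> E a (s a w t) t" using l isCont_tendsto_compose by blast
    then have "(\<lambda>n. it (Suc n) a w t) \<longlonglongrightarrow> w - E a (s a w t) t" unfolding itS by (intro tendsto_intros)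
    moreover have "(\<lambda>n. it (Suc n) a w t) \<longlonglongrightarrow> s a w t" using l by (rule LIMSEQ_Suc)
    ultimately have "s a w t = w - E a (s a w t) t" using LIMSEQ_unique by blast
    then have "s a w t + E a (s a w t) t = w" by (rule eq_diff_eq[THEN iffD1])
    then show ?thesis using 1 2 by blast
  qed
  show thesis
  proof (rule that[of s])
    show "hol3 s (D \<times> ball 0 (M - m) \<times> T)" using hs by (simp add: S_def)
    show "norm (s a w t) < M \<and> norm (s a w t - w) \<le> m \<and> s a w t + E a (s a w t) t = w"
      if "a \<in> D" "w \<in> ball 0 (M - m)" "t \<in> T" for a w t using props that by (auto simp: S_def)
    fix a x w t assume A: "a \<in> D" "x \<in> ball 0 M" "t \<in> T" "w \<in> ball 0 (M - m)" "x + E a x t = w"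
    have p: "norm (s a w t) < M" "s a w t + E a (s a w t) t = w" using props A by (auto simp: S_def)
    have "x - s a w t = E a (s a w t) t - E a x t" 
    proof -
      have "x - s a w t - (E a (s a w t) t - E a x t) = (x + E a x t) - (s a w t + E a (s a w t) t)" by simp
      then show ?thesis using p(2) A(5) by simp
    qed
    then have "norm (x - s a w t) \<le> 1/2 * norm (s a w t - x)" using lip[of a "s a w t" x t] p A by auto
    then show "x = s a w t" by (simp add: norm_minus_commute)
  qed
qed

text \<open>By the tube lemma an open condition that holds at \<open>a = 0\<close> on a compact
  product holds for all small \<open>a\<close>. Most reductions of the parameter radius come from
  here.\<close>

lemma hol3_small_parameter:
  assumes f: "hol3 f (ball 0 \<delta> \<times> U \<times> W)" and U: "open U" "open W" and K: "compact K" "K \<subseteq> U" "compact L" "L \<subseteq> W"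
    and V: "open V" and f0: "\<And>x t. x \<in> K \<Longrightarrow> t \<in> L \<Longrightarrow> f 0 x t \<in> V" and \<delta>: "\<delta> > 0"
  obtains \<delta>' where "\<delta>' > 0" "\<delta>' \<le> \<delta>" "\<And>a x t. norm a < \<delta>' \<Longrightarrow> x \<in> K \<Longrightarrow> t \<in> L \<Longrightarrow> f a x t \<in> V"
proof -
  let ?S = "ball 0 \<delta> \<times> U \<times> W"
  let ?W = "{z \<in> ?S. (\<lambda>(a, x, t). f a x t) z \<in> V}"
  have "open ?S" using U by (intro open_Times) auto
  then have "open ((\<lambda>(a, x, t). f a x t) -` V \<inter> ?S)"
    using continuous_on_open_vimage[of ?S "\<lambda>(a, x, t). f a x t"] hol3_continuous_on[OF f] V by blast
  moreover have "(\<lambda>(a, x, t). f a x t) -` V \<inter> ?S = ?W" by auto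
  ultimately have W: "open ?W" by metis
  have "{0} \<times> (K \<times> L) \<subseteq> ?W" using f0 K \<delta> by auto
  from Elementary_Topology.tube_lemma[OF compact_Times[OF K(1,3)] W this]
  obtain X0 where X0: "0 \<in> X0" "open X0" "X0 \<times> (K \<times> L) \<subseteq> ?W" by blast
  then obtain e where e: "e > 0" "ball 0 e \<subseteq> X0" using open_contains_ball by blast
  have "f a x t \<in> V" if "norm a < min e \<delta>" "x \<in> K" "t \<in> L" for a x t
  proof -
    have "a \<in> X0" using that e by auto
    then have "(a, x, t) \<in> ?W" using X0(3) that by blast
    then show ?thesis by auto
  qed
  then show thesis using e \<delta> by (intro that[of "min e \<delta>"]) auto
qed

lemma hol3_imp_holomorphic2_on:
  assumes f: "hol3 f S" and B: "\<And>x t. (x, t) \<in> B \<Longrightarrow> (a, x, t) \<in> S"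
  shows "holomorphic2_on (\<lambda>(x, t). f a x t) B"
  unfolding holomorphic2_on_def
proof safe
  fix x t assume "(x, t) \<in> B"
  then obtain A B' C where D: "((\<lambda>(a, x, t). f a x t) has_derivative (\<lambda>(u, v, w). A * u + B' * v + C * w)) (at (a, x, t))"
    using f B unfolding hol3_def by blast
  have "((\<lambda>z::complex \<times> complex. (a, z)) has_derivative (\<lambda>h. (0, h))) (at (x, t))"
    by (auto intro!: derivative_eq_intros)
  from has_derivative_compose[OF this D]
  have "((\<lambda>(x, t). f a x t) has_derivative (\<lambda>(v, w). B' * v + C * w)) (at (x, t))"
    by (simp add: case_prod_unfold)
  then show "\<exists>A B'. ((\<lambda>(x, t). f a x t) has_derivative (\<lambda>(u, v). A * u + B' * v)) (at (x, t) within B)"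
    using has_derivative_at_withinI by blast
qed

section \<open>Normal forms along an invariant curve\<close>

text \<open>Division by a coordinate is stated for the middle variable; the exchange makes it
  available for \<open>t\<close>.\<close>

lemma hol3_swap:
  assumes "hol3 f (A \<times> B \<times> C)"
  shows "hol3 (\<lambda>a x t. f a t x) (A \<times> C \<times> B)"
  by (rule hol3_comp[OF assms]) (auto intro: hol3_intros)

lemma hol3_compact_bound:
  assumes "hol3 f S" "compact K" "K \<subseteq> S"
  obtains M where "M > 0" "\<And>a x t. (a, x, t) \<in> K \<Longrightarrow> norm (f a x t) \<le> M"
proof -
  have "compact ((\<lambda>(a, x, t). f a x t) ` K)"
    using assms by (intro compact_continuous_image) (blast intro: continuous_on_subset hol3_continuous_on)
  then obtain M where "M > 0" "\<forall>z \<in> (\<lambda>(a, x, t). f a x t) ` K. norm z \<le> M"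
    by (meson bounded_pos compact_imp_bounded)
  then show thesis by (intro that[of M]) force+
qed

text \<open>The solution is the series of \<open>w ^ m * r a (\<mu> a ^ m * t)\<close>. Since
  \<open>r\<close> vanishes at \<open>t = 0\<close>, its terms are \<open>O(2^-m)\<close> even for
  \<open>|w| = 1\<close>, so no small divisors occur. The last conclusion records that a right-hand
  side vanishing at \<open>a = 0\<close> produces no correction there.\<close>

lemma cohomological_equation:
  fixes r :: "complex \<Rightarrow> complex \<Rightarrow> complex"
  assumes r: "hol3 (\<lambda>a x t. r a t) (ball 0 \<delta> \<times> UNIV \<times> ball 0 R)"
    and r0: "\<And>a. norm a < \<delta> \<Longrightarrow> r a 0 = 0"
    and w: "norm w \<le> 1" and \<mu>: "\<mu> holomorphic_on ball 0 \<delta>" "\<And>a. norm a < \<delta> \<Longrightarrow> norm (\<mu> a) \<le> 1/2"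
    and "\<delta> > 0"
  shows "\<exists>b. hol3 (\<lambda>a x t. b a t) (ball 0 \<delta> \<times> UNIV \<times> ball 0 R) \<and>
    (\<forall>a. norm a < \<delta> \<longrightarrow> b a 0 = 0) \<and>
    (\<forall>a t. norm a < \<delta> \<longrightarrow> norm t < R \<longrightarrow> b a t - w * b a (\<mu> a * t) = r a t) \<and>
    ((\<forall>t. norm t < R \<longrightarrow> r 0 t = 0) \<longrightarrow> (\<forall>t. norm t < R \<longrightarrow> b 0 t = 0))"
proof -
  let ?S = "ball 0 \<delta> \<times> UNIV \<times> ball 0 R :: (complex \<times> complex \<times> complex) set"
  have "hol3 (\<lambda>a x t. r a x) (ball 0 \<delta> \<times> ball 0 R \<times> UNIV)" using hol3_swap[OF r] .
  then have "\<exists>Q. hol3 Q (ball 0 \<delta> \<times> ball 0 R \<times> UNIV) \<and>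
      (\<forall>a x t. (a, x, t) \<in> ball 0 \<delta> \<times> ball 0 R \<times> UNIV \<longrightarrow> r a x = x * Q a x t)"
    by (rule hol3_divide_x) (auto intro!: open_Times r0)
  then obtain Q where Q: "hol3 Q (ball 0 \<delta> \<times> ball 0 R \<times> UNIV)"
    and rQ: "\<And>a x t. (a, x, t) \<in> ball 0 \<delta> \<times> ball 0 R \<times> UNIV \<Longrightarrow> r a x = x * Q a x t"
    by blast
  have S: "open ?S" by (intro open_Times) auto
  have m: "norm (\<mu> a ^ m * t) \<le> (1/2) ^ m * norm t" if "norm a < \<delta>" for a t m
    using \<mu>(2)[OF that] by (simp add: norm_mult norm_power mult_right_mono power_mono)
  have m': "norm (\<mu> a ^ m * t) \<le> norm t" if "norm a < \<delta>" for a t m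
    using m[OF that, of m t] mult_right_mono[of "(1/2)^m" 1 "norm t"] by (simp add: power_le_one)
  define T where "T = (\<lambda>m a t. w ^ m * r a (\<mu> a ^ m * t))"
  define b where "b = (\<lambda>a t. \<Sum>m. T m a t)"
  have bound: "\<exists>M. \<forall>m a t. norm a \<le> \<delta>' \<longrightarrow> norm t \<le> R' \<longrightarrow> norm (T m a t) \<le> M * (1/2) ^ m"
    if d: "\<delta>' < \<delta>" "R' < R" for \<delta>' R'
  proof -
    obtain M where M: "M > 0" "\<And>a x t. (a, x, t) \<in> cball 0 \<delta>' \<times> cball 0 R' \<times> {0} \<Longrightarrow> norm (Q a x t) \<le> M"
      by (rule hol3_compact_bound[OF Q, of "cball 0 \<delta>' \<times> cball 0 R' \<times> {0}"]) (use d in \<open>auto intro!: compact_Times\<close>)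
    have "norm (T m a t) \<le> (R' * M) * (1/2) ^ m" if a: "norm a \<le> \<delta>'" and t: "norm t \<le> R'" for m a t
    proof -
      have a': "norm a < \<delta>" using a d by simp
      have R': "norm (\<mu> a ^ m * t) \<le> R'" using m'[OF a', of m t] t by simp
      have "norm (T m a t) \<le> 1 * norm (r a (\<mu> a ^ m * t))"
        unfolding T_def norm_mult norm_power by (intro mult_right_mono power_le_one w) auto
      also have "r a (\<mu> a ^ m * t) = (\<mu> a ^ m * t) * Q a (\<mu> a ^ m * t) 0"
        using R' d a' by (intro rQ) auto
      also have "1 * norm \<dots> \<le> ((1/2) ^ m * norm t) * M"
        unfolding mult_1 norm_mult[of "\<mu> a ^ m * t"] using a R' by (intro mult_mono m[OF a'] M) auto
      also have "\<dots> \<le> ((1/2) ^ m * R') * M" using t M by (intro mult_right_mono mult_left_mono) auto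
      finally show ?thesis by (simp add: mult_ac)
    qed
    then show ?thesis by blast
  qed
  have Tsum: "summable (\<lambda>m. T m a t)" if at: "norm a < \<delta>" "norm t < R" for a t
  proof -
    obtain M where "\<forall>m. norm (T m a t) \<le> M * (1/2) ^ m"
      using bound[OF at] by auto
    then have M: "norm (T m a t) \<le> M * (1/2) ^ m" for m by blast
    show ?thesis
    proof (rule summable_comparison_test'[where N = 0])
      show "summable (\<lambda>m. M * (1/2) ^ m)" by (intro summable_mult summable_geometric) auto
    qed (use M in auto)
  qed
  show ?thesis
  proof (intro exI[of _ b] conjI impI allI)
    have hT: "hol3 (\<lambda>a x t. T m a t) ?S" for m
    proof -
      have "hol3 (\<lambda>a x t. \<mu> a) ?S" by (rule hol3_holomorphic[OF \<mu>(1)]) (auto intro: hol3_intros)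
      then show ?thesis unfolding T_def
        by (intro hol3_intros hol3_comp[OF r]) (auto intro: le_less_trans[OF m'])
    qed
    show "hol3 (\<lambda>a x t. b a t) ?S"
    proof (rule hol3_uniform_limit[OF S, of "\<lambda>n a x t. \<Sum>m<n. T m a t"])
      show "hol3 (\<lambda>a x t. \<Sum>m<n. T m a t) ?S" for n by (intro hol3_sum hT)
      fix z assume z: "z \<in> ?S"
      obtain a0 x0 t0 where z0: "z = (a0, x0, t0)" by (cases z)
      define e where "e = min (\<delta> - norm a0) (R - norm t0) / 2"
      have e: "e > 0" "norm a0 + e < \<delta>" "norm t0 + e < R" using z z0 by (auto simp: e_def min_def field_simps)
      obtain M where M: "\<And>m a t. norm a \<le> norm a0 + e \<Longrightarrow> norm t \<le> norm t0 + e \<Longrightarrow> norm (T m a t) \<le> M * (1/2) ^ m"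
        using bound[OF e(2,3)] by blast
      have nb: "norm a \<le> norm a0 + e \<and> norm t \<le> norm t0 + e" if "(a, x, t) \<in> ball z e" for a x t
      proof -
        have d: "dist (a0, x0, t0) (a, x, t) < e" using that z0 by simp
        have "dist a0 a \<le> dist (a0, x0, t0) (a, x, t)" "dist t0 t \<le> dist (a0, x0, t0) (a, x, t)"
          by (auto simp: dist_prod_def intro!: real_le_rsqrt)
        then have "dist a0 a < e" "dist t0 t < e" using d by linarith+
        then show ?thesis using norm_triangle_ineq2[of a a0] norm_triangle_ineq2[of t t0]
          by (auto simp: dist_norm norm_minus_commute)
      qed
      have "uniform_limit (ball z e) (\<lambda>n z. \<Sum>m<n. (\<lambda>(a, x, t). T m a t) z) (\<lambda>z. \<Sum>m. (\<lambda>(a, x, t). T m a t) z) sequentially"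
        by (rule Weierstrass_m_test[where M = "\<lambda>m. M * (1/2) ^ m"])
           (use nb M in \<open>auto intro!: summable_mult summable_geometric\<close>)
      moreover have "ball z e \<subseteq> ?S" using nb e by force
      ultimately show "\<exists>e>0. ball z e \<subseteq> ?S \<and> uniform_limit (ball z e) (\<lambda>n (a, x, t). \<Sum>m<n. T m a t) (\<lambda>(a, x, t). b a t) sequentially"
        using e by (intro exI[of _ e]) (auto simp: b_def case_prod_unfold)
    qed
    show "b a 0 = 0" if "norm a < \<delta>" for a using r0[OF that] by (simp add: b_def T_def)
    show "b a t - w * b a (\<mu> a * t) = r a t" if at: "norm a < \<delta>" "norm t < R" for a t
    proof -
      have \<mu>t: "norm (\<mu> a * t) < R" using m'[OF at(1), of 1 t] at by simp
      have "b a t = T 0 a t + (\<Sum>m. T (Suc m) a t)"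
        unfolding b_def using suminf_split_head[OF Tsum[OF at]] by simp
      also have "(\<lambda>m. T (Suc m) a t) = (\<lambda>m. w * T m a (\<mu> a * t))" by (simp add: T_def fun_eq_iff mult_ac)
      also have "(\<Sum>m. w * T m a (\<mu> a * t)) = w * b a (\<mu> a * t)"
        unfolding b_def by (rule suminf_mult[OF Tsum[OF at(1) \<mu>t]])
      finally show ?thesis by (simp add: T_def)
    qed
    show "b 0 t = 0" if z: "\<forall>t. norm t < R \<longrightarrow> r 0 t = 0" and t: "norm t < R" for t
    proof -
      have "norm (\<mu> 0 ^ m * t) < R" for m using m'[of 0 m t] t \<open>0 < \<delta>\<close> by simp
      then show ?thesis using z by (simp add: b_def T_def)
    qed
  qed
qed

text \<open>Replacing a coordinate \<open>x * y\<close> by the corrected one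
  \<open>x * y * (1 + x ^ j * z)\<close> changes its \<open>i\<close>-th power only from order
  \<open>i + j\<close> on; the difference is given with that power of \<open>x\<close> explicit, so
  that it can be cancelled.\<close>

lemma powers_distribute:
  fixes x :: complex
  shows "x ^ i * y ^ i - (x * y * (1 + x ^ j * z)) ^ i = - (x ^ (i + j) * z * y ^ i * (\<Sum>k<i. (1 + x ^ j * z) ^ k))"
proof -
  have "(1 + x ^ j * z) ^ i - 1 = (x ^ j * z) * (\<Sum>k<i. (1 + x ^ j * z) ^ k)"
    using power_diff_1_eq[of "1 + x ^ j * z" i] by simp
  then have *: "(1 + x ^ j * z) ^ i = 1 + (x ^ j * z) * (\<Sum>k<i. (1 + x ^ j * z) ^ k)"
    by (simp add: algebra_simps)
  show ?thesis unfolding power_mult_distrib *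
    by (simp add: algebra_simps power_add)
qed

section \<open>Order-by-order normalization of the first component\<close>

text \<open>A family of maps preserving the line \<open>x = 0\<close>, on which it acts as
  \<open>t \<mapsto> \<mu> a * t\<close>. Positivity of \<open>Re (A a 0 t / l)\<close> makes the
  principal logarithm usable, \<open>A a 0 0 = l\<close> makes that logarithm vanish at
  \<open>t = 0\<close>, and \<open>n\<close> is the jet at \<open>a = 0\<close>, which is already
  normalized.\<close>

locale semi_parabolic_jet =
  fixes F G A :: "complex \<Rightarrow> complex \<Rightarrow> complex \<Rightarrow> complex" and \<mu> k :: "complex \<Rightarrow> complex"
    and l :: complex and \<delta> \<epsilon> R :: real and q :: nat and n :: "nat \<Rightarrow> complex"
  assumes pos: "\<delta> > 0" "\<epsilon> > 0" "R > 0" and q: "q \<ge> 1"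
    and l: "norm l = 1" and l_root: "\<And>i. l ^ i = 1 \<longleftrightarrow> q dvd i"
    and A: "hol3 A (ball 0 \<delta> \<times> ball 0 \<epsilon> \<times> ball 0 R)"
    and G: "hol3 G (ball 0 \<delta> \<times> ball 0 \<epsilon> \<times> ball 0 R)"
    and F_A: "\<And>a x t. norm a < \<delta> \<Longrightarrow> norm x < \<epsilon> \<Longrightarrow> norm t < R \<Longrightarrow> F a x t = x * A a x t"
    and A0: "\<And>a t. norm a < \<delta> \<Longrightarrow> norm t < R \<Longrightarrow> 0 < Re (A a 0 t / l)"
    and A00: "\<And>a. norm a < \<delta> \<Longrightarrow> A a 0 0 = l"
    and G_bound: "\<And>a x t. norm a < \<delta> \<Longrightarrow> norm x < \<epsilon> \<Longrightarrow> norm t < R \<Longrightarrow> norm (G a x t) < R"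
    and G0: "\<And>a t. norm a < \<delta> \<Longrightarrow> norm t < R \<Longrightarrow> G a 0 t = \<mu> a * t"
    and \<mu>: "\<mu> holomorphic_on ball 0 \<delta>" "\<And>a. norm a < \<delta> \<Longrightarrow> norm (\<mu> a) \<le> 1/2"
    and F0: "\<And>x t. norm x < \<epsilon> \<Longrightarrow> norm t < R \<Longrightarrow>
          F 0 x t = (\<Sum>i<2*q+2. n i * x ^ i) + x ^ (2*q+2) * k x"
    and k: "isCont k 0"
    and n: "n 1 = l" "n (q+1) = l" "\<And>i. i \<notin> {1, q+1, 2*q+1} \<Longrightarrow> n i = 0"
begin

text \<open>At stage \<open>j\<close> the coordinate is \<open>T = x * B\<close> and the
  coefficients below order \<open>j\<close> do not depend on \<open>t\<close>. The corrections
  constructed below are polynomial in \<open>x\<close>, whence the factor \<open>UNIV\<close> for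
  \<open>B\<close>: \<open>T\<close> can be evaluated at \<open>F a x t\<close> without a bound on
  it. The remainder is measured in powers of the original \<open>x\<close>, which avoids inverting
  \<open>T\<close> at every step.\<close>

definition stage :: "nat \<Rightarrow> (complex \<Rightarrow> complex \<Rightarrow> complex \<Rightarrow> complex) \<Rightarrow> (complex \<Rightarrow> complex \<Rightarrow> complex \<Rightarrow> complex) \<Rightarrow>
    (nat \<Rightarrow> complex \<Rightarrow> complex) \<Rightarrow> (complex \<Rightarrow> complex \<Rightarrow> complex \<Rightarrow> complex) \<Rightarrow> bool" where
  "stage j T B c rem \<longleftrightarrow>
     hol3 B (ball 0 \<delta> \<times> UNIV \<times> ball 0 R) \<and> hol3 rem (ball 0 \<delta> \<times> ball 0 \<epsilon> \<times> ball 0 R) \<and>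
     (\<forall>a x t. T a x t = x * B a x t) \<and>
     (\<forall>a t. norm a < \<delta> \<longrightarrow> norm t < R \<longrightarrow> B a 0 t \<noteq> 0) \<and>
     (\<forall>x t. norm t < R \<longrightarrow> B 0 x t = 1) \<and>
     (\<forall>i. c i holomorphic_on ball 0 \<delta>) \<and> (\<forall>i a. i \<notin> {1, q+1, 2*q+1} \<longrightarrow> c i a = 0) \<and>
     (\<forall>a. c 1 a = l) \<and> (\<forall>i<j. c i 0 = n i) \<and>
     (\<forall>a x t. norm a < \<delta> \<longrightarrow> norm x < \<epsilon> \<longrightarrow> norm t < R \<longrightarrow>
        T a (F a x t) (G a x t) = (\<Sum>i<j. c i a * T a x t ^ i) + x ^ j * rem a x t)"

lemma l_nz: "l \<noteq> 0" using l by auto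

text \<open>With \<open>T = x * exp (\<beta> a t)\<close> the linear coefficient becomes
  \<open>l\<close> as soon as
  \<open>\<beta> a t - \<beta> a (\<mu> a * t) = Ln (A a 0 t / l)\<close>, which is the
  cohomological equation with \<open>w = 1\<close>.\<close>

lemma stage_2: "\<exists>T B c rem. stage 2 T B c rem"
proof -
  let ?S = "ball 0 \<delta> \<times> UNIV \<times> ball 0 R :: (complex \<times> complex \<times> complex) set"
  let ?V = "ball 0 \<delta> \<times> ball 0 \<epsilon> \<times> ball 0 R :: (complex \<times> complex \<times> complex) set"
  have S0: "open ?V" by (intro open_Times) auto
  define r where "r = (\<lambda>a t. Ln (A a 0 t / l))"
  have "hol3 (\<lambda>a x t. A a 0 t) ?S"
    by (rule hol3_comp[OF A]) (use pos in \<open>auto intro: hol3_intros\<close>)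
  then have r: "hol3 (\<lambda>a x t. r a t) ?S" unfolding r_def
    by (intro hol3_holomorphic[where g = Ln and A = "{z. 0 < Re z}"] hol3_divide)
       (use A0 l_nz in \<open>auto intro!: holomorphic_intros hol3_intros open_halfspace_Re_gt simp: complex_nonpos_Reals_iff\<close>)
  have r0: "r a 0 = 0" if "norm a < \<delta>" for a using A00[OF that] l_nz by (simp add: r_def)
  have F0': "x * A 0 x t = (\<Sum>i<2*q+2. n i * x ^ i) + x ^ (2*q+2) * k x" if "norm x < \<epsilon>" "norm t < R" for x t
    using F0[OF that] F_A[of 0 x t] that pos by simp
  \<comment> \<open>At \<open>a = 0\<close> the linear coefficient is that of the one-variable map
    for every \<open>t\<close>, so the right-hand side of the equation vanishes there.\<close>
  have A0t: "A 0 0 t = l" if t: "norm t < R" for t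
  proof -
    define h where "h = (\<lambda>x. (\<Sum>i\<in>{1..<2*q+2}. n i * x ^ (i - 1)) + x ^ (2*q+1) * k x)"
    have "x * A 0 x t = x * h x" if "norm x < \<epsilon>" for x
    proof -
      have "{..<2*q+2} = insert 0 {1..<2*q+2}" by auto
      then have "(\<Sum>i<2*q+2. n i * x ^ i) = (\<Sum>i\<in>{1..<2*q+2}. n i * x ^ i)" using n(3)[of 0] by simp
      also have "\<dots> = x * (\<Sum>i\<in>{1..<2*q+2}. n i * x ^ (i - 1))"
        unfolding sum_distrib_left by (rule sum.cong) (auto simp: power_eq_if)
      finally show ?thesis unfolding F0'[OF that t] h_def by (simp add: algebra_simps)
    qed
    then have eq: "A 0 x t = h x" if "norm x < \<epsilon>" "x \<noteq> 0" for x using that by auto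
    have "continuous_on (ball 0 \<epsilon>) (\<lambda>x. A 0 x t)"
      by (intro holomorphic_on_imp_continuous_on hol3_slice[OF A]) (use t pos in \<open>auto intro!: holomorphic_intros\<close>)
    then have "isCont (\<lambda>x. A 0 x t) 0" using pos by (simp add: continuous_on_eq_continuous_at)
    then have 1: "((\<lambda>x. A 0 x t) \<longlongrightarrow> A 0 0 t) (at 0)" by (simp add: isCont_def)
    have "isCont h 0" unfolding h_def by (intro continuous_intros k)
    then have 2: "(h \<longlongrightarrow> h 0) (at 0)" by (simp add: isCont_def)
    have "eventually (\<lambda>x. h x = A 0 x t) (at 0)"
      unfolding eventually_at using eq pos by (intro exI[of _ \<epsilon>]) (auto simp: dist_norm)
    from Lim_transform_eventually[OF 2 this] have "A 0 0 t = h 0" using 1 LIM_unique by blast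
    also have "h 0 = n 1"
    proof -
      have "{1..<2*q+2} = insert 1 {2..<2*q+2}" using q by auto
      then have "(\<Sum>i\<in>{1..<2*q+2}. n i * 0 ^ (i - 1)) = n 1 + (\<Sum>i\<in>{2..<2*q+2}. n i * 0 ^ (i - 1))" by simp
      also have "(\<Sum>i\<in>{2..<2*q+2}. n i * 0 ^ (i - 1)) = 0" by (rule sum.neutral) auto
      finally show ?thesis by (simp add: h_def)
    qed
    finally show ?thesis using n by simp
  qed
  obtain \<beta> where \<beta>: "hol3 (\<lambda>a x t. \<beta> a t) ?S"
    and \<beta>_eq: "\<And>a t. norm a < \<delta> \<Longrightarrow> norm t < R \<Longrightarrow> \<beta> a t - 1 * \<beta> a (\<mu> a * t) = r a t"
    and \<beta>0: "(\<forall>t. norm t < R \<longrightarrow> r 0 t = 0) \<longrightarrow> (\<forall>t. norm t < R \<longrightarrow> \<beta> 0 t = 0)"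
    using cohomological_equation[OF r r0 _ \<mu> pos(1), of 1] by auto
  have \<beta>00: "\<beta> 0 t = 0" if "norm t < R" for t
    using \<beta>0 A0t l_nz that by (simp add: r_def)
  define B where "B = (\<lambda>a (x::complex) t. exp (\<beta> a t))"
  have B: "hol3 B ?S" unfolding B_def
    by (rule hol3_holomorphic[where g = exp and A = UNIV]) (auto intro!: holomorphic_intros \<beta>)
  have BG: "hol3 (\<lambda>a x t. B a x (G a x t)) ?V"
    by (rule hol3_comp[OF B _ _ G]) (use G_bound in \<open>auto intro: hol3_intros\<close>)
  have "hol3 (\<lambda>a x t. A a x t * B a x (G a x t) - l * B a x t) ?V"
    by (intro hol3_intros A BG hol3_subset[OF B]) auto
  then have "\<exists>rem. hol3 rem ?V \<and> (\<forall>a x t. (a, x, t) \<in> ?V \<longrightarrow> A a x t * B a x (G a x t) - l * B a x t = x * rem a x t)"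
  proof (rule hol3_divide_x[OF _ S0])
    fix a t assume "(a, 0, t) \<in> ?V"
    then have at: "norm a < \<delta>" "norm t < R" by auto
    have "exp (\<beta> a t) = exp (\<beta> a (\<mu> a * t) + r a t)" using \<beta>_eq[OF at] by (simp add: algebra_simps)
    also have "\<dots> = exp (\<beta> a (\<mu> a * t)) * (A a 0 t / l)"
      unfolding exp_add r_def using A0[OF at] by (subst exp_Ln) auto
    finally show "A a 0 t * B a 0 (G a 0 t) - l * B a 0 t = 0" using l_nz G0[OF at] by (simp add: B_def)
  qed
  then obtain rem where rem: "hol3 rem ?V" "\<And>a x t. (a, x, t) \<in> ?V \<Longrightarrow> A a x t * B a x (G a x t) - l * B a x t = x * rem a x t"
    by blast
  define c :: "nat \<Rightarrow> complex \<Rightarrow> complex" where "c = (\<lambda>i a. if i = 1 then l else 0)"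
  have "stage 2 (\<lambda>a x t. x * B a x t) B c rem"
    unfolding stage_def
  proof (intro conjI B rem(1) allI impI)
    show "B 0 x t = 1" if "norm t < R" for x t using \<beta>00[OF that] by (simp add: B_def)
    show "c i 0 = n i" if "i < 2" for i using that n(1) n(3)[of 0] by (auto simp: c_def less_2_cases_iff)
    show "F a x t * B a (F a x t) (G a x t) = (\<Sum>i<2. c i a * (x * B a x t) ^ i) + x\<^sup>2 * rem a x t"
      if axt: "norm a < \<delta>" "norm x < \<epsilon>" "norm t < R" for a x t
    proof -
      have "F a x t * B a (F a x t) (G a x t) = x * (A a x t * B a x (G a x t))"
        using F_A[OF axt] by (simp add: B_def)
      also have "A a x t * B a x (G a x t) = l * B a x t + x * rem a x t"
        using rem(2)[of a x t] axt by (simp add: algebra_simps)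
      finally show ?thesis by (simp add: c_def algebra_simps power2_eq_square numeral_2_eq_2)
    qed
  qed (auto simp: c_def B_def)
  then show ?thesis by blast
qed

text \<open>At \<open>a = 0\<close> the coordinate is still \<open>x\<close>, so the remainder at
  \<open>x = 0\<close> is the next coefficient of the one-variable jet, the same for all
  \<open>t\<close>. Hence the next step corrects nothing at \<open>a = 0\<close>.\<close>

lemma stage_remainder_0:
  assumes st: "stage j T B c rem" and j: "1 \<le> j" "j \<le> 2*q+1" and t: "norm t < R"
  shows "rem 0 0 t = n j"
proof -
  let ?V = "ball 0 \<delta> \<times> ball 0 \<epsilon> \<times> ball 0 R :: (complex \<times> complex \<times> complex) set"
  define h where "h = (\<lambda>x. (\<Sum>i\<in>{j..<2*q+2}. n i * x ^ (i - j)) + x ^ (2*q+2 - j) * k x)"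
  have rem: "hol3 rem ?V" using st by (simp add: stage_def)
  have rel: "\<And>a x t. norm a < \<delta> \<Longrightarrow> norm x < \<epsilon> \<Longrightarrow> norm t < R \<Longrightarrow>
        T a (F a x t) (G a x t) = (\<Sum>i<j. c i a * T a x t ^ i) + x ^ j * rem a x t"
    using st unfolding stage_def by blast
  have ci: "c i 0 = n i" if "i < j" for i using st that unfolding stage_def by blast
  have eq: "rem 0 x t = h x" if x: "norm x < \<epsilon>" "x \<noteq> 0" for x
  proof -
    have T0: "T 0 y s = y" if "norm s < R" for y s using st that by (simp add: stage_def)
    have "(\<Sum>i<j. n i * x ^ i) + x ^ j * rem 0 x t = F 0 x t"
    proof -
      have "T 0 (F 0 x t) (G 0 x t) = (\<Sum>i<j. c i 0 * T 0 x t ^ i) + x ^ j * rem 0 x t"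
        using rel[of 0 x t] x t pos by simp
      moreover have "(\<Sum>i<j. c i 0 * T 0 x t ^ i) = (\<Sum>i<j. n i * x ^ i)"
        by (intro sum.cong) (simp_all add: T0[OF t] ci)
      ultimately show ?thesis using T0 G_bound[of 0 x t] x t pos by simp
    qed
    also have "\<dots> = (\<Sum>i<2*q+2. n i * x ^ i) + x ^ (2*q+2) * k x" by (rule F0[OF x(1) t])
    also have "(\<Sum>i<2*q+2. n i * x ^ i) = (\<Sum>i<j. n i * x ^ i) + (\<Sum>i\<in>{j..<2*q+2}. n i * x ^ i)"
      using j sum.atLeastLessThan_concat[of 0 j "2*q+2" "\<lambda>i. n i * x ^ i"] by (simp add: atLeast0LessThan)
    also have "(\<Sum>i\<in>{j..<2*q+2}. n i * x ^ i) = x ^ j * (\<Sum>i\<in>{j..<2*q+2}. n i * x ^ (i - j))"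
      unfolding sum_distrib_left by (rule sum.cong) (auto simp flip: power_add)
    also have "x ^ (2*q+2) = x ^ j * x ^ (2*q+2 - j)" using j by (simp flip: power_add)
    finally have "x ^ j * rem 0 x t = x ^ j * h x" by (simp add: h_def algebra_simps)
    then show ?thesis using x by simp
  qed
  have "continuous_on (ball 0 \<epsilon>) (\<lambda>x. rem 0 x t)"
    by (intro holomorphic_on_imp_continuous_on hol3_slice[OF rem]) (use t pos in \<open>auto intro!: holomorphic_intros\<close>)
  then have "isCont (\<lambda>x. rem 0 x t) 0" using pos by (simp add: continuous_on_eq_continuous_at)
  then have 1: "((\<lambda>x. rem 0 x t) \<longlongrightarrow> rem 0 0 t) (at 0)" by (simp add: isCont_def)
  have "isCont h 0" unfolding h_def by (intro continuous_intros k)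
  then have 2: "(h \<longlongrightarrow> h 0) (at 0)" by (simp add: isCont_def)
  have "eventually (\<lambda>x. h x = rem 0 x t) (at 0)"
    unfolding eventually_at using eq pos by (intro exI[of _ \<epsilon>]) (auto simp: dist_norm)
  from Lim_transform_eventually[OF 2 this] have "rem 0 0 t = h 0" using 1 LIM_unique by blast
  also have "h 0 = n j"
  proof -
    have "{j..<2*q+2} = insert j {Suc j..<2*q+2}" using j by auto
    then have "(\<Sum>i\<in>{j..<2*q+2}. n i * 0 ^ (i - j)) = n j + (\<Sum>i\<in>{Suc j..<2*q+2}. n i * 0 ^ (i - j))" by simp
    also have "(\<Sum>i\<in>{Suc j..<2*q+2}. n i * 0 ^ (i - j)) = 0" by (rule sum.neutral) auto
    finally show ?thesis using j by (simp add: h_def)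
  qed
  finally show ?thesis .
qed

text \<open>For \<open>T' = T + b * T ^ j\<close> the coefficient of order \<open>j\<close> is
  constant when \<open>l * Q a t + l ^ j * b a (\<mu> a * t) - l * b a t = c0 a\<close>. The part of
  \<open>Q\<close> vanishing at \<open>t = 0\<close> is removed by the cohomological equation with
  \<open>w = l ^ (j - 1)\<close>; its value at \<open>t = 0\<close> is divided by
  \<open>1 - l ^ (j - 1)\<close>, or survives as \<open>c0 a = l * Q a 0\<close> when that divisor
  is zero.\<close>

lemma stage_step:
  assumes st: "stage j T B c rem" and j: "2 \<le> j" "j \<le> 2*q+1"
  shows "\<exists>T B c rem. stage (Suc j) T B c rem"
proof -
  let ?U = "ball 0 \<delta> \<times> UNIV \<times> ball 0 R :: (complex \<times> complex \<times> complex) set"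
  let ?V = "ball 0 \<delta> \<times> ball 0 \<epsilon> \<times> ball 0 R :: (complex \<times> complex \<times> complex) set"
  have V: "open ?V" by (intro open_Times) auto
  have B: "hol3 B ?U" and rem: "hol3 rem ?V" and T: "\<And>a x t. T a x t = x * B a x t"
    and Bnz: "\<And>a t. norm a < \<delta> \<Longrightarrow> norm t < R \<Longrightarrow> B a 0 t \<noteq> 0"
    and B0: "\<And>x t. norm t < R \<Longrightarrow> B 0 x t = 1"
    and c: "\<And>i. c i holomorphic_on ball 0 \<delta>" "\<And>i a. i \<notin> {1, q+1, 2*q+1} \<Longrightarrow> c i a = 0"
      "\<And>a. c 1 a = l" "\<And>i. i < j \<Longrightarrow> c i 0 = n i"
    and rel: "\<And>a x t. norm a < \<delta> \<Longrightarrow> norm x < \<epsilon> \<Longrightarrow> norm t < R \<Longrightarrow>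
        T a (F a x t) (G a x t) = (\<Sum>i<j. c i a * T a x t ^ i) + x ^ j * rem a x t"
    using st by (auto simp: stage_def)
  have BV: "hol3 B ?V" by (rule hol3_subset[OF B]) auto
  \<comment> \<open>Dividing by \<open>B a 0 t ^ j\<close> expresses the coefficient in powers of
    \<open>T\<close> instead of \<open>x\<close>; the factor \<open>l\<close> normalizes the
    equation for \<open>b\<close>.\<close>
  define Q where "Q = (\<lambda>a t. rem a 0 t / (l * B a 0 t ^ j))"
  have B_at_0: "hol3 (\<lambda>a x t. B a 0 t) ?U"
    by (rule hol3_comp[OF B]) (auto intro: hol3_intros)
  have "hol3 (\<lambda>a x t. rem a 0 t) ?U"
    by (rule hol3_comp[OF rem]) (use pos in \<open>auto intro: hol3_intros\<close>)
  then have Q: "hol3 (\<lambda>a x t. Q a t) ?U"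
    unfolding Q_def by (rule hol3_divide) (use Bnz l_nz in \<open>auto intro!: hol3_intros B_at_0\<close>)
  have Q_at_0: "hol3 (\<lambda>a x t. Q a 0) S" if "S \<subseteq> ball 0 \<delta> \<times> UNIV" for S
    by (rule hol3_comp[OF Q]) (use pos that in \<open>auto intro: hol3_intros\<close>)
  have Qa: "(\<lambda>a. Q a 0) holomorphic_on ball 0 \<delta>"
    by (rule hol3_slice[OF Q]) (use pos in \<open>auto intro!: holomorphic_intros\<close>)
  have Q0: "Q 0 t = n j / l" if "norm t < R" for t
    using stage_remainder_0[OF st _ j(2) that] j B0[OF that] by (simp add: Q_def)
  have "hol3 (\<lambda>a x t. Q a t - Q a 0) ?U" by (intro hol3_intros Q Q_at_0) auto
  from cohomological_equation[OF this _ _ \<mu> pos(1), of "l ^ (j - 1)"]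
  obtain \<beta> where \<beta>: "hol3 (\<lambda>a x t. \<beta> a t) ?U"
    and \<beta>_eq: "\<And>a t. norm a < \<delta> \<Longrightarrow> norm t < R \<Longrightarrow> \<beta> a t - l ^ (j - 1) * \<beta> a (\<mu> a * t) = Q a t - Q a 0"
    and \<beta>0: "(\<forall>t. norm t < R \<longrightarrow> Q 0 t - Q 0 0 = 0) \<longrightarrow> (\<forall>t. norm t < R \<longrightarrow> \<beta> 0 t = 0)"
    using l by (auto simp: norm_power)
  have \<beta>00: "\<beta> 0 t = 0" if "norm t < R" for t using \<beta>0 Q0 that pos by simp
  define c0 where "c0 = (\<lambda>a. if q dvd j - 1 then l * Q a 0 else 0)"
  define b0 where "b0 = (\<lambda>a. if q dvd j - 1 then 0 else Q a 0 / (1 - l ^ (j - 1)))"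
  define b where "b = (\<lambda>a t. b0 a + \<beta> a t)"
  \<comment> \<open>Between \<open>2\<close> and \<open>2*q+1\<close> only \<open>q+1\<close> and
    \<open>2*q+1\<close> satisfy \<open>q dvd j - 1\<close>; this is where the shape of the normal
    form comes from.\<close>
  have j_res: "j \<in> {1, q+1, 2*q+1} \<longleftrightarrow> q dvd j - 1"
  proof
    assume "q dvd j - 1"
    then obtain m where m: "j - 1 = q * m" by (elim dvdE)
    have "q * m \<le> q * 2" using m j(2) by linarith
    then have "m \<le> 2" using q by simp
    moreover have "m \<noteq> 0" using m j by (intro notI) simp
    ultimately have "m = 1 \<or> m = 2" by auto
    then show "j \<in> {1, q+1, 2*q+1}" using m j by auto
  qed (use j in auto)
  have b_eq: "l * Q a t + l ^ j * b a (\<mu> a * t) - l * b a t - c0 a = 0" if at: "norm a < \<delta>" "norm t < R" for a t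
  proof -
    have lj: "l ^ j = l * l ^ (j - 1)" using j by (simp flip: power_Suc)
    have 1: "\<beta> a t = l ^ (j - 1) * \<beta> a (\<mu> a * t) + Q a t - Q a 0" using \<beta>_eq[OF at] by (simp add: algebra_simps)
    show ?thesis
    proof (cases "q dvd j - 1")
      case True
      then show ?thesis by (simp add: b_def b0_def c0_def lj 1 algebra_simps)
    next
      case False
      then have "1 - l ^ (j - 1) \<noteq> 0" using l_root[of "j - 1"] by auto
      then have "Q a 0 = b0 a * (1 - l ^ (j - 1))" using False by (simp add: b0_def)
      then have "b0 a * l ^ (j - 1) = b0 a - Q a 0" by (simp add: algebra_simps)
      then have "l * (b0 a * l ^ (j - 1)) = l * (b0 a - Q a 0)" by simp
      moreover have "l * Q a t + l ^ j * b a (\<mu> a * t) - l * b a t - c0 a = l * (b0 a * l ^ (j - 1)) - l * (b0 a - Q a 0)"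
        using False by (simp add: b_def c0_def lj 1 algebra_simps)
      ultimately show ?thesis by simp
    qed
  qed
  have b0_0: "b 0 t = 0" if "norm t < R" for t
  proof -
    \<comment> \<open>A nonresonant \<open>n j\<close> is zero, so the constant part of the
      correction also vanishes at \<open>a = 0\<close>.\<close>
    have "b0 0 = 0" using Q0[of 0] n(3)[of j] j_res pos by (auto simp: b0_def)
    then show ?thesis using \<beta>00[OF that] by (simp add: b_def)
  qed
  have b: "hol3 (\<lambda>a x t. b a t) ?U"
    unfolding b_def b0_def
    by (cases "q dvd j - 1") (use l_root[of "j - 1"] in \<open>auto intro!: hol3_intros hol3_divide \<beta> Q_at_0\<close>)
  have bV: "hol3 (\<lambda>a x t. b a t) ?V" by (rule hol3_subset[OF b]) auto
  have bG: "hol3 (\<lambda>a x t. b a (G a x t)) ?V"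
    by (rule hol3_comp[OF b _ _ G]) (use G_bound in \<open>auto intro: hol3_intros\<close>)
  define B' where "B' = (\<lambda>a x t. B a x t + b a t * x ^ (j - 1) * B a x t ^ j)"
  define T' where "T' = (\<lambda>a x t. x * B' a x t)"
  define c' where "c' = c(j := c0)"
  have B': "hol3 B' ?U" unfolding B'_def by (intro hol3_intros B b)
  have B'V: "hol3 B' ?V" by (rule hol3_subset[OF B']) auto
  have j1: "1 \<le> j" using j by simp
  have pw: "x ^ i = x * x ^ (i - 1)" if "1 \<le> i" for x :: complex and i
    using that by (cases i) auto
  have T'_T: "T' a x t = T a x t + b a t * T a x t ^ j" for a x t
    using j by (simp add: T'_def B'_def T algebra_simps power_mult_distrib flip: power_Suc)
  have cV: "hol3 (\<lambda>a x t. c i a) ?V" for i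
    by (rule hol3_holomorphic[OF c(1)]) (auto intro: hol3_intros)
  have c0_hol: "c0 holomorphic_on ball 0 \<delta>" unfolding c0_def
    by (cases "q dvd j - 1") (auto intro!: holomorphic_intros Qa)
  have c0V: "hol3 (\<lambda>a x t. c0 a) ?V"
    by (rule hol3_holomorphic[OF c0_hol]) (auto intro: hol3_intros)
  \<comment> \<open>The old image coordinate divided by \<open>x\<close>, so that its
    \<open>j\<close>-th power exhibits the factor \<open>x ^ j\<close>.\<close>
  define U where "U = (\<lambda>a x t. (\<Sum>i\<in>{1..<j}. c i a * x ^ (i - 1) * B a x t ^ i) + x ^ (j - 1) * rem a x t)"
  have U: "hol3 U ?V" unfolding U_def by (intro hol3_intros cV BV rem)
  have split: "{..<j} = insert 0 {1..<j}" using j by auto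
  have split2: "{1..<j} = insert 1 {2..<j}" using j by auto
  have c00: "c 0 a = 0" for a using c(2)[of 0] by simp
  have T1: "T a (F a x t) (G a x t) = x * U a x t" if axt: "norm a < \<delta>" "norm x < \<epsilon>" "norm t < R" for a x t
  proof -
    have "(\<Sum>i<j. c i a * T a x t ^ i) = (\<Sum>i\<in>{1..<j}. c i a * T a x t ^ i)"
      unfolding split by (simp add: c00)
    also have "\<dots> = x * (\<Sum>i\<in>{1..<j}. c i a * x ^ (i - 1) * B a x t ^ i)"
      unfolding sum_distrib_left T
    proof (rule sum.cong)
      fix i assume "i \<in> {1..<j}"
      then show "c i a * (x * B a x t) ^ i = x * (c i a * x ^ (i - 1) * B a x t ^ i)"
        by (simp add: power_mult_distrib pw[of i x])
    qed auto
    finally show ?thesis unfolding rel[OF axt] U_def pw[OF j1, of x] by (simp add: distrib_left mult.assoc)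
  qed
  have U0: "U a 0 t = l * B a 0 t" if "norm a < \<delta>" "norm t < R" for a t
  proof -
    have "(\<Sum>i\<in>{2..<j}. c i a * 0 ^ (i - 1) * B a 0 t ^ i) = 0" by (rule sum.neutral) auto
    then show ?thesis unfolding U_def split2 using j c(3)[of a] by simp
  qed
  define z where "z = (\<lambda>a x t. b a t * B a x t ^ (j - 1))"
  define s where "s = (\<lambda>i a x t. \<Sum>k<i. (1 + x ^ (j - 1) * z a x t) ^ k)"
  have zV: "hol3 z ?V" unfolding z_def by (intro hol3_intros bV BV)
  have sV: "hol3 (s i) ?V" for i unfolding s_def by (intro hol3_intros zV)
  \<comment> \<open>Once the terms of order below \<open>j\<close> have cancelled, the new relation
    has error \<open>x ^ j * g\<close>. Its value at \<open>x = 0\<close> is the left-hand side of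
    \<open>b_eq\<close> times \<open>B a 0 t ^ j\<close>, so one more factor \<open>x\<close> splits
    off.\<close>
  define g where "g = (\<lambda>a x t. rem a x t + b a (G a x t) * U a x t ^ j
     - (\<Sum>i\<in>{1..<j}. c i a * (x ^ (i - 1) * z a x t * B a x t ^ i * s i a x t)) - c0 a * B' a x t ^ j)"
  have g: "hol3 g ?V" unfolding g_def by (intro hol3_intros rem bG U cV zV BV sV c0V B'V)
  have g0: "g a 0 t = 0" if "(a, 0, t) \<in> ?V" for a t
  proof -
    have at: "norm a < \<delta>" "norm t < R" using that by auto
    have "(\<Sum>i\<in>{2..<j}. c i a * (0 ^ (i - 1) * z a 0 t * B a 0 t ^ i * s i a 0 t)) = 0" by (rule sum.neutral) auto
    then have 1: "(\<Sum>i\<in>{1..<j}. c i a * (0 ^ (i - 1) * z a 0 t * B a 0 t ^ i * s i a 0 t)) = l * (b a t * B a 0 t ^ j)"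
      unfolding split2 using j c(3)[of a] pw[OF j1, of "B a 0 t"] by (simp add: z_def s_def mult_ac)
    have 2: "B' a 0 t = B a 0 t" using j by (simp add: B'_def)
    have 3: "rem a 0 t = l * Q a t * B a 0 t ^ j" using Bnz[OF at] l_nz by (simp add: Q_def)
    have "g a 0 t = (l * Q a t + l ^ j * b a (\<mu> a * t) - l * b a t - c0 a) * B a 0 t ^ j"
      unfolding g_def 1 2 3 U0[OF at] G0[OF at] power_mult_distrib by (simp add: algebra_simps)
    then show ?thesis using b_eq[OF at] by simp
  qed
  obtain rem' where rem': "hol3 rem' ?V" "\<And>a x t. (a, x, t) \<in> ?V \<Longrightarrow> g a x t = x * rem' a x t"
    using hol3_divide_x[OF g V g0] by blast
  have rel': "T' a (F a x t) (G a x t) = (\<Sum>i<Suc j. c' i a * T' a x t ^ i) + x ^ Suc j * rem' a x t"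
    if axt: "norm a < \<delta>" "norm x < \<epsilon>" "norm t < R" for a x t
  proof -
    have B'z: "B' a x t = B a x t * (1 + x ^ (j - 1) * z a x t)"
      unfolding B'_def z_def pw[OF j1, of "B a x t"] by (simp add: algebra_simps)
    have diff: "T a x t ^ i = T' a x t ^ i - x ^ j * (x ^ (i - 1) * z a x t * B a x t ^ i * s i a x t)" if "1 \<le> i" for i
    proof -
      have "x ^ (i + (j - 1)) = x ^ j * x ^ (i - 1)" using that j by (simp add: add.commute flip: power_add)
      then show ?thesis
        using powers_distribute[of x i "B a x t" "j - 1" "z a x t"]
        by (simp add: T T'_def B'z power_mult_distrib s_def algebra_simps)
    qed
    have "T' a (F a x t) (G a x t) = T a (F a x t) (G a x t) + b a (G a x t) * (x * U a x t) ^ j"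
      unfolding T'_T T1[OF axt] ..
    also have "T a (F a x t) (G a x t) = (\<Sum>i\<in>{1..<j}. c i a * T a x t ^ i) + x ^ j * rem a x t"
      unfolding rel[OF axt] split by (simp add: c00)
    also have "(\<Sum>i\<in>{1..<j}. c i a * T a x t ^ i) = (\<Sum>i\<in>{1..<j}. c i a * T' a x t ^ i)
       - x ^ j * (\<Sum>i\<in>{1..<j}. c i a * (x ^ (i - 1) * z a x t * B a x t ^ i * s i a x t))"
      unfolding sum_distrib_left sum_subtractf[symmetric]
      by (rule sum.cong) (auto simp: diff algebra_simps)
    also have "(\<Sum>i\<in>{1..<j}. c i a * T' a x t ^ i) = (\<Sum>i<Suc j. c' i a * T' a x t ^ i) - c0 a * T' a x t ^ j"
    proof -
      have "(\<Sum>i<Suc j. c' i a * T' a x t ^ i) = (\<Sum>i<j. c i a * T' a x t ^ i) + c0 a * T' a x t ^ j"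
        unfolding sum.lessThan_Suc by (simp add: c'_def)
      then show ?thesis unfolding split by (simp add: c00)
    qed
    finally have "T' a (F a x t) (G a x t) = (\<Sum>i<Suc j. c' i a * T' a x t ^ i) + x ^ j * g a x t"
      by (simp add: g_def T'_def power_mult_distrib algebra_simps)
    then show ?thesis using rem'(2)[of a x t] axt by (simp add: algebra_simps)
  qed
  have "stage (Suc j) T' B' c' rem'"
    unfolding stage_def
  proof (intro conjI B' rem'(1) allI impI)
    show "B' a 0 t \<noteq> 0" if "norm a < \<delta>" "norm t < R" for a t
    proof -
      have "B' a 0 t = B a 0 t" using j by (simp add: B'_def)
      then show ?thesis using Bnz[OF that] by simp
    qed
    show "B' 0 x t = 1" if "norm t < R" for x t using B0[OF that] b0_0[OF that] by (simp add: B'_def)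
    show "c' i holomorphic_on ball 0 \<delta>" for i using c(1) c0_hol by (simp add: c'_def)
    show "c' i a = 0" if "i \<notin> {1, q+1, 2*q+1}" for i a
      using that j_res c(2) by (cases "i = j") (simp_all add: c'_def c0_def)
    show "c' 1 a = l" for a using j c(3) by (simp add: c'_def)
    show "c' i 0 = n i" if "i < Suc j" for i
    proof (cases "i = j")
      case True
      then show ?thesis using Q0[of 0] l_nz j_res n(3)[of j] pos by (auto simp: c'_def c0_def)
    next
      case False
      then show ?thesis using that c(4) by (simp add: c'_def)
    qed
  qed (use rel' in \<open>auto simp: T'_def\<close>)
  then show ?thesis by blast
qed

lemma stage_all: "2 \<le> j \<Longrightarrow> j \<le> 2*q+2 \<Longrightarrow> \<exists>T B c rem. stage j T B c rem"
proof (induction j rule: dec_induct)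
  case base
  show ?case by (rule stage_2)
next
  case (step j)
  then obtain T B c rem where "stage j T B c rem" by auto
  then show ?case using stage_step step by auto
qed

text \<open>It remains to normalize the coefficient of order \<open>q+1\<close>. Scaling
  \<open>T\<close> by \<open>\<kappa> a\<close> with \<open>\<kappa> a ^ q = c (q+1) a / l\<close>
  makes it equal to \<open>l\<close>; the root is the branch with \<open>\<kappa> 0 = 1\<close>,
  taken while the quotient has positive real part, and this is why \<open>\<delta>\<close>
  shrinks.\<close>

lemma normal_form_exists:
  "\<exists>\<delta>'>0. \<delta>' \<le> \<delta> \<and> (\<exists>T B rem C.
     hol3 B (ball 0 \<delta>' \<times> UNIV \<times> ball 0 R) \<and> hol3 rem (ball 0 \<delta>' \<times> ball 0 \<epsilon> \<times> ball 0 R) \<and>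
     C holomorphic_on ball 0 \<delta>' \<and>
     (\<forall>a x t. T a x t = x * B a x t) \<and>
     (\<forall>a t. norm a < \<delta>' \<longrightarrow> norm t < R \<longrightarrow> B a 0 t \<noteq> 0) \<and>
     (\<forall>x t. norm t < R \<longrightarrow> B 0 x t = 1) \<and>
     (\<forall>a x t. norm a < \<delta>' \<longrightarrow> norm x < \<epsilon> \<longrightarrow> norm t < R \<longrightarrow>
        T a (F a x t) (G a x t) = l * (T a x t + T a x t ^ (q+1) + C a * T a x t ^ (2*q+1)) + x ^ (2*q+2) * rem a x t))"
proof -
  obtain T B c rem where st: "stage (2*q+2) T B c rem" using stage_all[of "2*q+2"] by auto
  have B: "hol3 B (ball 0 \<delta> \<times> UNIV \<times> ball 0 R)" and rem: "hol3 rem (ball 0 \<delta> \<times> ball 0 \<epsilon> \<times> ball 0 R)"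
    and T: "\<And>a x t. T a x t = x * B a x t"
    and Bnz: "\<And>a t. norm a < \<delta> \<Longrightarrow> norm t < R \<Longrightarrow> B a 0 t \<noteq> 0"
    and B0: "\<And>x t. norm t < R \<Longrightarrow> B 0 x t = 1"
    and c: "\<And>i. c i holomorphic_on ball 0 \<delta>" "\<And>i a. i \<notin> {1, q+1, 2*q+1} \<Longrightarrow> c i a = 0"
      "\<And>a. c 1 a = l" "\<And>i. i < 2*q+2 \<Longrightarrow> c i 0 = n i"
    and rel: "\<And>a x t. norm a < \<delta> \<Longrightarrow> norm x < \<epsilon> \<Longrightarrow> norm t < R \<Longrightarrow>
        T a (F a x t) (G a x t) = (\<Sum>i<2*q+2. c i a * T a x t ^ i) + x ^ (2*q+2) * rem a x t"
    using st unfolding stage_def by blast+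
  have sum3: "(\<Sum>i<2*q+2. c i a * y ^ i) = l * y + c (q+1) a * y ^ (q+1) + c (2*q+1) a * y ^ (2*q+1)" for a y
  proof -
    have "(\<Sum>i<2*q+2. c i a * y ^ i) = (\<Sum>i\<in>{1, q+1, 2*q+1}. c i a * y ^ i)"
      by (rule sum.mono_neutral_right) (use c(2) in auto)
    also have "\<dots> = c 1 a * y ^ 1 + (c (q+1) a * y ^ (q+1) + c (2*q+1) a * y ^ (2*q+1))"
      using q by (subst sum.insert; simp)
    finally show ?thesis using c(3) by simp
  qed
  have c1: "c (q+1) 0 = l" using c(4)[of "q+1"] n(2) by simp
  have "continuous_on (ball 0 \<delta>) (c (q+1))" using c(1) holomorphic_on_imp_continuous_on by blast
  then have "isCont (c (q+1)) 0" using pos by (simp add: continuous_on_eq_continuous_at)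
  then have "((\<lambda>a. c (q+1) a / l) \<longlongrightarrow> c (q+1) 0 / l) (at 0)"
    unfolding isCont_def by (rule tendsto_divide) (use l_nz in auto)
  from tendsto_Re[OF this] have "((\<lambda>a. Re (c (q+1) a / l)) \<longlongrightarrow> 1) (at 0)" using c1 l_nz by simp
  then have "eventually (\<lambda>a. 0 < Re (c (q+1) a / l)) (at 0)" by (rule order_tendstoD(1)[OF _ zero_less_one])
  then obtain d where d: "d > 0" "\<And>a. a \<noteq> 0 \<Longrightarrow> norm a < d \<Longrightarrow> 0 < Re (c (q+1) a / l)"
    unfolding eventually_at by (auto simp: dist_norm)
  define \<delta>' where "\<delta>' = min d \<delta>"
  have \<delta>': "\<delta>' > 0" "\<delta>' \<le> \<delta>" using d pos by (auto simp: \<delta>'_def)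
  have Rec: "0 < Re (c (q+1) a / l)" if "norm a < \<delta>'" for a
    using d(2)[of a] that c1 l_nz by (cases "a = 0") (auto simp: \<delta>'_def)
  define \<kappa> where "\<kappa> = (\<lambda>a. exp (Ln (c (q+1) a / l) / of_nat q))"
  have cd: "c i holomorphic_on ball 0 \<delta>'" for i using c(1)[of i] \<delta>' by (auto intro: holomorphic_on_subset)
  have \<kappa>_hol: "\<kappa> holomorphic_on ball 0 \<delta>'" unfolding \<kappa>_def
    using q l_nz Rec by (intro holomorphic_intros cd) (auto simp: complex_nonpos_Reals_iff not_le dest: Rec)
  have \<kappa>_nz: "\<kappa> a \<noteq> 0" for a by (simp add: \<kappa>_def)
  have \<kappa>0: "\<kappa> 0 = 1" using c1 l_nz by (simp add: \<kappa>_def)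
  have \<kappa>q: "\<kappa> a ^ q = c (q+1) a / l" if "norm a < \<delta>'" for a
  proof -
    have "\<kappa> a ^ q = exp (Ln (c (q+1) a / l))"
      using q by (simp add: \<kappa>_def flip: exp_of_nat_mult)
    also have "\<dots> = c (q+1) a / l" using Rec[OF that] by (intro exp_Ln) auto
    finally show ?thesis .
  qed
  define C where "C = (\<lambda>a. c (2*q+1) a / (l * \<kappa> a ^ (2*q)))"
  have C_hol: "C holomorphic_on ball 0 \<delta>'" unfolding C_def
    using l_nz \<kappa>_nz by (intro holomorphic_intros cd \<kappa>_hol) auto
  have \<kappa>3: "hol3 (\<lambda>a x t. \<kappa> a) S" if "S \<subseteq> ball 0 \<delta>' \<times> UNIV" for S
    by (rule hol3_holomorphic[OF \<kappa>_hol]) (use that in \<open>auto intro: hol3_intros\<close>)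
  show ?thesis
  proof (rule exI[of _ \<delta>'], rule conjI[OF \<delta>'(1)], rule conjI[OF \<delta>'(2)],
      rule exI[of _ "\<lambda>a x t. \<kappa> a * T a x t"], rule exI[of _ "\<lambda>a x t. \<kappa> a * B a x t"],
      rule exI[of _ "\<lambda>a x t. \<kappa> a * rem a x t"], rule exI[of _ C], intro conjI C_hol allI impI)
    show "hol3 (\<lambda>a x t. \<kappa> a * B a x t) (ball 0 \<delta>' \<times> UNIV \<times> ball 0 R)"
      by (intro hol3_intros \<kappa>3 hol3_subset[OF B]) (use \<delta>' in auto)
    show "hol3 (\<lambda>a x t. \<kappa> a * rem a x t) (ball 0 \<delta>' \<times> ball 0 \<epsilon> \<times> ball 0 R)"
      by (intro hol3_intros \<kappa>3 hol3_subset[OF rem]) (use \<delta>' in auto)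
    fix a x t :: complex assume axt: "norm a < \<delta>'" "norm x < \<epsilon>" "norm t < R"
    let ?y = "T a x t"
    have a: "norm a < \<delta>" using axt \<delta>' by simp
    have e1: "l * (\<kappa> a * ?y) ^ (q+1) = \<kappa> a * (c (q+1) a * ?y ^ (q+1))"
      using \<kappa>q[OF axt(1)] l_nz by (simp add: power_mult_distrib)
    have e2: "l * (C a * (\<kappa> a * ?y) ^ (2*q+1)) = \<kappa> a * (c (2*q+1) a * ?y ^ (2*q+1))"
      using l_nz \<kappa>_nz by (simp add: C_def power_mult_distrib)
    show "\<kappa> a * T a (F a x t) (G a x t) = l * (\<kappa> a * ?y + (\<kappa> a * ?y) ^ (q+1) + C a * (\<kappa> a * ?y) ^ (2*q+1))
       + x ^ (2*q+2) * (\<kappa> a * rem a x t)"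
      unfolding rel[OF a axt(2,3)] sum3 distrib_left e1 e2 by (simp add: algebra_simps)
  qed (use T \<kappa>_nz \<kappa>0 B0 Bnz \<delta>' in auto)
qed

end

section \<open>The stable curve\<close>

lemma hol3_series:
  assumes S: "open S" and f: "\<And>n. hol3 (f n) S"
    and bd: "\<And>n a x t. (a, x, t) \<in> S \<Longrightarrow> norm (f n a x t) \<le> M n" and M: "summable M"
  shows "hol3 (\<lambda>a x t. \<Sum>n. f n a x t) S"
proof (rule hol3_uniform_limit[OF S, of "\<lambda>n a x t. \<Sum>m<n. f m a x t"])
  show "hol3 (\<lambda>a x t. \<Sum>m<n. f m a x t) S" for n by (intro hol3_sum f)
  fix z assume "z \<in> S"
  then obtain e where e: "e > 0" "ball z e \<subseteq> S" using S open_contains_ball by blast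
  have "uniform_limit S (\<lambda>n z. \<Sum>m<n. (\<lambda>(a, x, t). f m a x t) z) (\<lambda>z. \<Sum>m. (\<lambda>(a, x, t). f m a x t) z) sequentially"
    by (rule Weierstrass_m_test[OF _ M]) (use bd in auto)
  then have "uniform_limit S (\<lambda>n (a, x, t). \<Sum>m<n. f m a x t) (\<lambda>(a, x, t). \<Sum>m. f m a x t) sequentially"
    by (simp add: case_prod_unfold)
  then show "\<exists>e>0. ball z e \<subseteq> S \<and> uniform_limit (ball z e) (\<lambda>n (a, x, t). \<Sum>m<n. f m a x t) (\<lambda>(a, x, t). \<Sum>n. f n a x t) sequentially"
    using e uniform_limit_on_subset by blast
qed

definition curve_c :: "complex \<Rightarrow> complex \<Rightarrow> complex" where
  "curve_c l a = (1 - a^2) * fixed_x l a - (fixed_x l a)^2"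

text \<open>The stable manifold is parametrized by a curve \<open>t \<mapsto> (X t, Y t)\<close> conjugating the Henon map to
  multiplication by the small eigenvalue \<open>\<mu>\<close>, i.e. \<open>X (\<mu> t) = (X t)\<^sup>2 + c + a * Y t\<close> and
  \<open>Y (\<mu> t) = a * X t\<close>. Comparing coefficients gives this recursion for the power series of
  \<open>Y\<close>, in which every division by \<open>a\<close> has been cancelled, so that \<open>a = 0\<close> is allowed.\<close>

fun stable_coeff :: "complex \<Rightarrow> complex \<Rightarrow> nat \<Rightarrow> complex" where
  "stable_coeff l a n = (if n = 0 then 0 else if n = 1 then 1 else
     - ((- 1 / l) ^ n * a ^ (2*n - 3) * (\<Sum>i\<in>{1..<n}. stable_coeff l a i * stable_coeff l a (n - i))) /
       (1 + (2 * fixed_x l a - small_eigenvalue l a ^ n) * (- 1 / l) ^ n * a ^ (2*n - 2)))"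

declare stable_coeff.simps [simp del]

lemma stable_coeff_0 [simp]: "stable_coeff l a 0 = 0"
  and stable_coeff_1 [simp]: "stable_coeff l a (Suc 0) = 1"
  by (simp_all add: stable_coeff.simps)

lemma stable_coeff_rec:
  assumes "n \<ge> 2"
  shows "stable_coeff l a n = - ((- 1 / l) ^ n * a ^ (2*n - 3) * (\<Sum>i\<in>{1..<n}. stable_coeff l a i * stable_coeff l a (n - i))) /
       (1 + (2 * fixed_x l a - small_eigenvalue l a ^ n) * (- 1 / l) ^ n * a ^ (2*n - 2))"
  using assms by (subst stable_coeff.simps) auto

text \<open>The term added to \<open>1\<close> has modulus at most \<open>3/16\<close>: the bracket
  is at most \<open>3\<close> and \<open>|a| ^ (2*n - 2)\<close> at most \<open>1/16\<close>. So the
  recursion never divides by a small number.\<close>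

lemma stable_denominator:
  assumes l: "norm l = 1" and a: "norm a \<le> 1/4" and n: "n \<ge> 2"
  shows "1/2 \<le> norm (1 + (2 * fixed_x l a - small_eigenvalue l a ^ n) * (- 1 / l) ^ n * a ^ (2*n - 2))"
proof -
  have a2: "norm a ^ 2 \<le> 1/16" using power_mono[OF a, of 2] by (simp add: power2_eq_square)
  have "norm (2 * fixed_x l a) \<le> 1 + norm a ^ 2"
  proof -
    have "2 * fixed_x l a = l - a^2 / l" using l by (auto simp: fixed_x_def field_simps)
    also have "norm \<dots> \<le> norm l + norm (a^2 / l)" by (rule norm_triangle_ineq4)
    finally show ?thesis using l by (simp add: norm_divide norm_power)
  qed
  moreover have "norm (small_eigenvalue l a ^ n) \<le> 1"
    using a2 l by (simp add: small_eigenvalue_def norm_power norm_divide power_le_one)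
  ultimately have 1: "norm (2 * fixed_x l a - small_eigenvalue l a ^ n) \<le> 3"
    using a2 norm_triangle_ineq4[of "2 * fixed_x l a" "small_eigenvalue l a ^ n"] by linarith
  have "norm a ^ (2*n - 2) \<le> norm a ^ 2" using n a by (intro power_decreasing) auto
  then have 2: "norm a ^ (2*n - 2) \<le> 1/16" using a2 by linarith
  have "norm ((2 * fixed_x l a - small_eigenvalue l a ^ n) * (- 1 / l) ^ n * a ^ (2*n - 2)) \<le> 3 * 1 * (1/16)"
    unfolding norm_mult using 1 2 l by (intro mult_mono) (auto simp: norm_power norm_divide)
  moreover have "norm (1::complex) - norm ((2 * fixed_x l a - small_eigenvalue l a ^ n) * (- 1 / l) ^ n * a ^ (2*n - 2))
      \<le> norm (1 + (2 * fixed_x l a - small_eigenvalue l a ^ n) * (- 1 / l) ^ n * a ^ (2*n - 2))"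
    by (rule norm_diff_ineq)
  ultimately show ?thesis unfolding norm_one by linarith
qed

text \<open>The convolution has \<open>n - 1\<close> terms of modulus at most
  \<open>(2 * |a|) ^ (n - 2)\<close>, and \<open>|a| ^ (2*n - 3)\<close> absorbs the factor
  \<open>n - 1\<close> with one power of \<open>|a|\<close> to spare. The radius of convergence is
  thus at least of order \<open>1 / |a|\<close>, and any prescribed disc is covered for small
  \<open>a\<close>.\<close>

lemma stable_coeff_bound:
  assumes l: "norm l = 1" and a: "norm a \<le> 1/4" and n: "n \<ge> 1"
  shows "norm (stable_coeff l a n) \<le> (2 * norm a) ^ (n - 1)"
  using n
proof (induction n rule: less_induct)
  case (less n)
  show ?case
  proof (cases "n = 1")
    case False
    then have n: "n \<ge> 2" using less.prems by simp
    define S where "S = (\<Sum>i\<in>{1..<n}. stable_coeff l a i * stable_coeff l a (n - i))"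
    define D where "D = 1 + (2 * fixed_x l a - small_eigenvalue l a ^ n) * (- 1 / l) ^ n * a ^ (2*n - 2)"
    have D: "1/2 \<le> norm D" unfolding D_def by (rule stable_denominator[OF l a n])
    have "norm S \<le> (\<Sum>i\<in>{1..<n}. (2 * norm a) ^ (n - 2))"
      unfolding S_def
    proof (rule sum_norm_le)
      fix i assume i: "i \<in> {1..<n}"
      have "norm (stable_coeff l a i * stable_coeff l a (n - i)) \<le> (2 * norm a) ^ (i - 1) * (2 * norm a) ^ (n - i - 1)"
        unfolding norm_mult using i by (intro mult_mono less.IH) auto
      also have "\<dots> = (2 * norm a) ^ (n - 2)" 
      proof -
        have "(i - 1) + (n - i - 1) = n - 2" using i by auto
        then show ?thesis by (metis power_add)
      qed
      finally show "norm (stable_coeff l a i * stable_coeff l a (n - i)) \<le> (2 * norm a) ^ (n - 2)" .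
    qed
    then have S: "norm S \<le> real (n - 1) * (2 * norm a) ^ (n - 2)" by simp
    have na: "real (n - 1) * norm a ^ (2*n - 4) \<le> 1"
    proof -
      have "real (n - 1) \<le> 2 ^ (n - 2)" 
      proof -
        have "n - 1 \<le> 2 ^ (n - 2)" using n less_exp[of "n - 2"] by linarith
        then show ?thesis by (metis of_nat_le_iff of_nat_numeral of_nat_power)
      qed
      moreover have "norm a ^ (2*n - 4) \<le> (1/2) ^ (n - 2)"
      proof -
        have "norm a ^ (2*n - 4) \<le> norm a ^ (n - 2)" using n a by (intro power_decreasing) auto
        also have "\<dots> \<le> (1/2) ^ (n - 2)" using a by (intro power_mono) auto
        finally show ?thesis .
      qed
      ultimately have "real (n - 1) * norm a ^ (2*n - 4) \<le> 2 ^ (n - 2) * (1/2) ^ (n - 2)"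
        by (intro mult_mono) auto
      also have "\<dots> = (1::real)" by (simp flip: power_mult_distrib)
      finally show ?thesis .
    qed
    have "norm (stable_coeff l a n) = norm a ^ (2*n - 3) * norm S / norm D"
      unfolding stable_coeff_rec[OF n] S_def[symmetric] D_def[symmetric] using l
      by (simp add: norm_divide norm_mult norm_power)
    also have "\<dots> \<le> norm a ^ (2*n - 3) * norm S / (1/2)"
      using D by (intro divide_left_mono) auto
    also have "\<dots> = 2 * norm a ^ (2*n - 3) * norm S" by simp
    also have "\<dots> \<le> 2 * norm a ^ (2*n - 3) * (real (n - 1) * (2 * norm a) ^ (n - 2))"
      by (intro mult_left_mono S) auto
    also have "norm a ^ (2*n - 3) = norm a * norm a ^ (2*n - 4)"

    proof -
      have "2*n - 3 = Suc (2*n - 4)" using n by simp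
      then show ?thesis by simp
    qed
    also have "2 * (norm a * norm a ^ (2*n - 4)) * (real (n - 1) * (2 * norm a) ^ (n - 2))
       = (real (n - 1) * norm a ^ (2*n - 4)) * ((2 * norm a) * (2 * norm a) ^ (n - 2))"
      by (simp add: mult_ac)
    also have "\<dots> \<le> 1 * ((2 * norm a) * (2 * norm a) ^ (n - 2))"
      by (intro mult_right_mono na) auto
    also have "\<dots> = (2 * norm a) ^ (n - 1)"

    proof -
      have "n - 1 = Suc (n - 2)" using n by simp
      then show ?thesis by (simp only: power_Suc mult_1_left)
    qed
    finally show ?thesis .
  qed simp
qed

lemma stable_coeff_holomorphic:
  assumes l: "norm l = 1" shows "(\<lambda>a. stable_coeff l a n) holomorphic_on ball 0 (1/4)"
proof (induction n rule: less_induct)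
  case (less n)
  show ?case
  proof (cases "n \<ge> 2")
    case False
    then have "n = 0 \<or> n = 1" by auto
    then show ?thesis by auto
  next
    case True
    have nz: "1 + (2 * fixed_x l a - small_eigenvalue l a ^ n) * (- 1 / l) ^ n * a ^ (2*n - 2) \<noteq> 0" if "a \<in> ball 0 (1/4)" for a
      using stable_denominator[OF l _ True, of a] that by auto
    have l0: "l \<noteq> 0" using l by auto
    show ?thesis unfolding stable_coeff_rec[OF True]
      using nz l0 unfolding fixed_x_def small_eigenvalue_def by (intro holomorphic_intros less.IH) auto
  qed
qed

lemma sum_atMost_no_ends:
  fixes f :: "nat \<Rightarrow> complex"
  assumes "f 0 = 0" "f n = 0"
  shows "(\<Sum>i\<le>n. f i) = (\<Sum>i\<in>{1..<n}. f i)"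
  by (rule sum.mono_neutral_right) (use assms in \<open>auto simp: not_less le_less Suc_le_eq intro: Nat.gr0I\<close>)

text \<open>The second curve equation determines the series of \<open>X\<close> from that of
  \<open>Y\<close> after cancelling one power of \<open>a\<close>; what remains is the comparison of
  coefficients in the first. The derivatives at \<open>0\<close> form the eigenvector
  \<open>(- a / l, 1)\<close> of the small eigenvalue.\<close>

lemma strong_stable_curve:
  assumes l: "norm l = 1" and R: "R > 0"
  shows "\<exists>\<delta>>0. \<delta> \<le> 1/4 \<and> (\<exists>X Y :: complex \<Rightarrow> complex \<Rightarrow> complex.
     hol3 (\<lambda>a x t. X a t) (ball 0 \<delta> \<times> UNIV \<times> ball 0 R) \<and>
     hol3 (\<lambda>a x t. Y a t) (ball 0 \<delta> \<times> UNIV \<times> ball 0 R) \<and>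
     (\<forall>a t. norm a < \<delta> \<longrightarrow> norm t < R \<longrightarrow>
        X a (small_eigenvalue l a * t) = (X a t)^2 + curve_c l a + a * Y a t \<and>
        Y a (small_eigenvalue l a * t) = a * X a t) \<and>
     (\<forall>a. X a 0 = fixed_x l a \<and> Y a 0 = a * fixed_x l a) \<and>
     (\<forall>t. X 0 t = l / 2 \<and> Y 0 t = t) \<and>
     (\<forall>a. norm a < \<delta> \<longrightarrow> (Y a has_field_derivative 1) (at 0) \<and> (X a has_field_derivative (- a / l)) (at 0)))"
proof -
  \<comment> \<open>The bound \<open>1/4\<close> serves the recursion; \<open>1 / (4 * R)\<close>
    makes \<open>2 * \<delta> * R \<le> 1/2\<close>, the ratio of the dominating geometric
    series.\<close>
  define \<delta> where "\<delta> = min (1/4) (1 / (4 * R))"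
  have \<delta>: "\<delta> > 0" "\<delta> \<le> 1/4" and \<delta>R: "2 * \<delta> * R \<le> 1/2" using R by (auto simp: \<delta>_def min_def field_simps)
  have l0: "l \<noteq> 0" using l by auto
  define \<zeta> where "\<zeta> = stable_coeff l"
  \<comment> \<open>This is \<open>small_eigenvalue l a ^ n * \<zeta> a n / a\<close> with the
    division carried out. At \<open>n = 0\<close> the truncated exponent is harmless because
    \<open>\<zeta> a 0 = 0\<close>.\<close>
  define \<xi> where "\<xi> = (\<lambda>a n. (- 1 / l) ^ n * a ^ (2*n - 1) * \<zeta> a n)"
  define Y where "Y = (\<lambda>a t. a * fixed_x l a + (\<Sum>n. \<zeta> a n * t ^ n))"
  define X where "X = (\<lambda>a t. fixed_x l a + (\<Sum>n. \<xi> a n * t ^ n))"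
  have \<zeta>0: "\<zeta> a 0 = 0" and \<zeta>1: "\<zeta> a (Suc 0) = 1" for a by (simp_all add: \<zeta>_def)
  have \<xi>0: "\<xi> a 0 = 0" for a by (simp add: \<xi>_def \<zeta>0)
  have \<zeta>_bd: "norm (\<zeta> a n * t ^ n) \<le> 2 * R * (1/2) ^ n" if at: "norm a < \<delta>" "norm t < R" for a t n
  proof (cases "n = 0")
    case False
    have "norm (\<zeta> a n * t ^ n) \<le> (2 * norm a) ^ (n - 1) * norm t ^ n"
      unfolding norm_mult norm_power \<zeta>_def using at \<delta> False
      by (intro mult_right_mono stable_coeff_bound l) auto
    also have "\<dots> \<le> (2 * \<delta>) ^ (n - 1) * R ^ n" using at \<delta>(1) by (intro mult_mono power_mono) auto
    also have "\<dots> = R * (2 * \<delta> * R) ^ (n - 1)" using False by (cases n) (auto simp: power_mult_distrib)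
    also have "\<dots> \<le> R * (1/2) ^ (n - 1)" using R \<delta> \<delta>R by (intro mult_left_mono power_mono) auto
    also have "\<dots> = 2 * R * (1/2) ^ n" using False by (cases n) auto
    finally show ?thesis .
  qed (use R in \<open>simp add: \<zeta>0\<close>)
  have \<xi>_bd: "norm (\<xi> a n * t ^ n) \<le> 2 * R * (1/2) ^ n" if at: "norm a < \<delta>" "norm t < R" for a t n
  proof -
    have "norm (\<xi> a n * t ^ n) = norm a ^ (2*n - 1) * norm (\<zeta> a n * t ^ n)"
      using l by (simp add: \<xi>_def norm_mult norm_power norm_divide)
    also have "\<dots> \<le> 1 * norm (\<zeta> a n * t ^ n)" using at \<delta> by (intro mult_right_mono power_le_one) auto
    finally show ?thesis using \<zeta>_bd[OF at, of n] by simp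
  qed
  have sM: "summable (\<lambda>n. 2 * R * (1/2) ^ n)" by (intro summable_mult summable_geometric) auto
  have \<zeta>_sum: "summable (\<lambda>n. norm (\<zeta> a n * t ^ n))" and \<xi>_sum: "summable (\<lambda>n. norm (\<xi> a n * t ^ n))"
    if at: "norm a < \<delta>" "norm t < R" for a t
    by (rule summable_comparison_test'[OF sM, of 0]; use \<zeta>_bd[OF at] \<xi>_bd[OF at] in simp)+
  let ?U = "ball 0 \<delta> \<times> UNIV \<times> ball 0 R :: (complex \<times> complex \<times> complex) set"
  have U: "open ?U" by (intro open_Times) auto
  have \<zeta>_hol: "hol3 (\<lambda>a x t. \<zeta> a n) ?U" for n
    unfolding \<zeta>_def by (rule hol3_holomorphic[OF stable_coeff_holomorphic[OF l]]) (use \<delta> in \<open>auto intro: hol3_intros\<close>)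
  have \<xi>_hol: "hol3 (\<lambda>a x t. \<xi> a n) ?U" for n
    unfolding \<xi>_def by (intro hol3_intros \<zeta>_hol)
  have fx: "hol3 (\<lambda>a x t. fixed_x l a) S" for S
    unfolding fixed_x_def using l0 by (intro hol3_holomorphic[where g = "\<lambda>a. l / 2 - a\<^sup>2 / (2 * l)" and A = UNIV])
     (auto intro!: holomorphic_intros hol3_intros)
  have Y: "hol3 (\<lambda>a x t. Y a t) ?U" unfolding Y_def
    by (intro hol3_intros fx hol3_series[OF U _ _ sM] \<zeta>_hol) (use \<zeta>_bd in auto)
  have X: "hol3 (\<lambda>a x t. X a t) ?U" unfolding X_def
    by (intro hol3_add fx hol3_series[OF U _ _ sM] hol3_intros \<xi>_hol) (use \<xi>_bd in auto)
  have mu: "small_eigenvalue l a ^ n = (- 1 / l) ^ n * a ^ (2*n)" for a n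
    by (simp add: small_eigenvalue_def power_mult flip: power_mult_distrib)
  have coeff: "\<xi> a n * small_eigenvalue l a ^ n = 2 * fixed_x l a * \<xi> a n + (\<Sum>i\<le>n. \<xi> a i * \<xi> a (n - i)) + a * \<zeta> a n"
    if a: "norm a < \<delta>" for a n
  proof -
    consider "n = 0" | "n = 1" | "n \<ge> 2" by linarith
    then show ?thesis
    proof cases
      case 1 then show ?thesis by (simp add: \<xi>0 \<zeta>0)
    next
      \<comment> \<open>The coefficient of order one expresses that \<open>(- a / l, 1)\<close> is
        an eigenvector.\<close>
      case 2
      then show ?thesis using l0
        by (simp add: \<xi>_def \<zeta>1 \<zeta>0 small_eigenvalue_def fixed_x_def field_simps power2_eq_square)
    next
      case 3
      define S where "S = (\<Sum>i\<in>{1..<n}. \<zeta> a i * \<zeta> a (n - i))"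
      define D where "D = 1 + (2 * fixed_x l a - small_eigenvalue l a ^ n) * (- 1 / l) ^ n * a ^ (2*n - 2)"
      have "D \<noteq> 0" using stable_denominator[OF l _ 3, of a] a \<delta> by (auto simp: D_def)
      then have zD: "\<zeta> a n * D = - ((- 1 / l) ^ n * a ^ (2*n - 3) * S)"
        unfolding \<zeta>_def stable_coeff_rec[OF 3] S_def[unfolded \<zeta>_def, symmetric] D_def[symmetric] by simp
      have "(\<Sum>i\<le>n. \<xi> a i * \<xi> a (n - i)) = (\<Sum>i\<in>{1..<n}. \<xi> a i * \<xi> a (n - i))"
        by (rule sum_atMost_no_ends) (auto simp: \<xi>0)
      also have "\<dots> = (- 1 / l) ^ n * a ^ (2*n - 2) * S" unfolding S_def sum_distrib_left
      proof (rule sum.cong)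
        fix i assume i: "i \<in> {1..<n}"
        have e1: "(- 1 / l) ^ n = (- 1 / l) ^ i * (- 1 / l) ^ (n - i)" using power_add[of "- 1 / l" i "n - i"] i by simp
        have "(2*i - 1) + (2*(n - i) - 1) = 2*n - 2" using i by auto
        then have e2: "a ^ (2*n - 2) = a ^ (2*i - 1) * a ^ (2*(n - i) - 1)" by (metis power_add)
        show "\<xi> a i * \<xi> a (n - i) = (- 1 / l) ^ n * a ^ (2 * n - 2) * (\<zeta> a i * \<zeta> a (n - i))"
          unfolding \<xi>_def e1 e2 by (simp only: mult_ac)
      qed auto
      finally have S2: "(\<Sum>i\<le>n. \<xi> a i * \<xi> a (n - i)) = (- 1 / l) ^ n * a ^ (2*n - 2) * S" .
      have "2*n - 2 = Suc (2*n - 3)" "2*n - 1 = Suc (2*n - 2)" using 3 by simp_all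
      then have p1: "a ^ (2*n - 2) = a * a ^ (2*n - 3)" and p2: "a ^ (2*n - 1) = a * a ^ (2*n - 2)"
        by (simp_all only: power_Suc)
      have "a * (\<zeta> a n * D) = - ((- 1 / l) ^ n * a ^ (2*n - 2) * S)" unfolding zD p1 by (simp add: mult_ac)
      moreover have "\<xi> a n = (- 1 / l) ^ n * a ^ (2*n - 1) * \<zeta> a n" by (simp add: \<xi>_def)
      ultimately show ?thesis unfolding S2 D_def p2 by (simp add: algebra_simps)
    qed
  qed
  have nmu: "norm (small_eigenvalue l a * t) < R" if at: "norm a < \<delta>" "norm t < R" for a t
  proof -
    have "norm (small_eigenvalue l a) \<le> 1"
      using at \<delta> l by (simp add: small_eigenvalue_def norm_divide norm_power power_le_one)
    then have "norm (small_eigenvalue l a * t) \<le> 1 * norm t" unfolding norm_mult by (intro mult_right_mono) auto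
    then show ?thesis using at by simp
  qed
  have eqX: "X a (small_eigenvalue l a * t) = (X a t)^2 + curve_c l a + a * Y a t" if at: "norm a < \<delta>" "norm t < R" for a t
  proof -
    let ?u = "\<Sum>n. \<xi> a n * t ^ n" and ?v = "\<Sum>n. \<zeta> a n * t ^ n"
    have s1: "(\<lambda>n. \<xi> a n * t ^ n) sums ?u" and s2: "(\<lambda>n. \<zeta> a n * t ^ n) sums ?v"
      by (rule summable_sums[OF summable_norm_cancel[OF \<xi>_sum[OF at]]], rule summable_sums[OF summable_norm_cancel[OF \<zeta>_sum[OF at]]])
    have s3: "(\<lambda>n. \<Sum>i\<le>n. (\<xi> a i * t ^ i) * (\<xi> a (n - i) * t ^ (n - i))) sums (?u * ?u)"
      by (rule Cauchy_product_sums[OF \<xi>_sum[OF at] \<xi>_sum[OF at]])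
    have e3: "(\<Sum>i\<le>n. (\<xi> a i * t ^ i) * (\<xi> a (n - i) * t ^ (n - i))) = (\<Sum>i\<le>n. \<xi> a i * \<xi> a (n - i)) * t ^ n" for n
      unfolding sum_distrib_right
    proof (rule sum.cong)
      fix i assume "i \<in> {..n}"
      then have "t ^ n = t ^ i * t ^ (n - i)" by (simp flip: power_add)
      then show "\<xi> a i * t ^ i * (\<xi> a (n - i) * t ^ (n - i)) = \<xi> a i * \<xi> a (n - i) * t ^ n" by (simp add: mult_ac)
    qed auto
    have "(\<lambda>n. 2 * fixed_x l a * (\<xi> a n * t ^ n) + (\<Sum>i\<le>n. \<xi> a i * \<xi> a (n - i)) * t ^ n + a * (\<zeta> a n * t ^ n)) sums
        (2 * fixed_x l a * ?u + ?u * ?u + a * ?v)"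
      by (intro sums_add sums_mult s1 s2 s3[unfolded e3])
    moreover have "2 * fixed_x l a * (\<xi> a n * t ^ n) + (\<Sum>i\<le>n. \<xi> a i * \<xi> a (n - i)) * t ^ n + a * (\<zeta> a n * t ^ n)
        = \<xi> a n * (small_eigenvalue l a * t) ^ n" for n
      unfolding power_mult_distrib mult.assoc[symmetric] coeff[OF at(1)] by (simp add: algebra_simps)
    ultimately have "(\<lambda>n. \<xi> a n * (small_eigenvalue l a * t) ^ n) sums (2 * fixed_x l a * ?u + ?u * ?u + a * ?v)" by simp
    then have "X a (small_eigenvalue l a * t) = fixed_x l a + (2 * fixed_x l a * ?u + ?u * ?u + a * ?v)"
      by (simp add: X_def sums_iff)
    then show ?thesis by (simp add: X_def Y_def curve_c_def power2_eq_square algebra_simps)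
  qed
  have eqY: "Y a (small_eigenvalue l a * t) = a * X a t" if at: "norm a < \<delta>" "norm t < R" for a t
  proof -
    have "\<zeta> a n * (small_eigenvalue l a * t) ^ n = a * (\<xi> a n * t ^ n)" for n
    proof (cases n)
      case (Suc m)
      then have "a ^ (2*n) = a * a ^ (2*n - 1)" by simp
      then show ?thesis unfolding power_mult_distrib mu \<xi>_def by (simp add: mult_ac)
    qed (simp add: \<zeta>0 \<xi>0)
    moreover have "summable (\<lambda>n. \<xi> a n * t ^ n)" using \<xi>_sum[OF at] by (rule summable_norm_cancel)
    ultimately have "(\<Sum>n. \<zeta> a n * (small_eigenvalue l a * t) ^ n) = a * (\<Sum>n. \<xi> a n * t ^ n)"
      by (simp only: suminf_mult)
    then show ?thesis by (simp add: Y_def X_def distrib_left)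
  qed
  have z0: "\<zeta> 0 n = (if n = 1 then 1 else 0)" for n
  proof (cases "n \<ge> 2")
    case True
    then show ?thesis unfolding \<zeta>_def by (subst stable_coeff_rec) auto
  next
    case False
    then have "n = 0 \<or> n = 1" by auto
    then show ?thesis by (auto simp: \<zeta>0 \<zeta>1)
  qed
  have "(\<Sum>n. \<zeta> 0 n * t ^ n) = t" for t
  proof -
    have "(\<Sum>n. \<zeta> 0 n * t ^ n) = (\<Sum>n\<in>{1}. \<zeta> 0 n * t ^ n)" by (rule suminf_finite) (auto simp: z0)
    then show ?thesis by (simp add: z0)
  qed
  then have Y0: "Y 0 t = t" for t by (simp add: Y_def)
  have "\<xi> 0 n = 0" for n by (cases n) (auto simp: \<xi>_def \<zeta>0)
  then have X0: "X 0 t = l / 2" for t by (simp add: X_def fixed_x_def)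
  have at0: "X a 0 = fixed_x l a" "Y a 0 = a * fixed_x l a" for a
    by (simp_all add: X_def Y_def powser_zero \<xi>0 \<zeta>0)
  have der: "((\<lambda>t. \<Sum>n. f n * t ^ n) has_field_derivative f (Suc 0)) (at 0)"
    if f: "summable (\<lambda>n. f n * K ^ n)" "norm K > 0" for f :: "nat \<Rightarrow> complex" and K
  proof -
    have "((\<lambda>t. \<Sum>n. f n * t ^ n) has_field_derivative (\<Sum>n. diffs f n * 0 ^ n)) (at 0)"
      by (rule termdiffs_strong[OF f(1)]) (use f in auto)
    then show ?thesis by (simp add: diffs_def)
  qed
  have K: "norm (of_real (R/2) :: complex) < R" "norm (of_real (R/2) :: complex) > 0" using R by auto
  have dY: "(Y a has_field_derivative 1) (at 0)" if "norm a < \<delta>" for a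
    using der[OF summable_norm_cancel[OF \<zeta>_sum[OF that K(1)]] K(2)] unfolding Y_def
    by (auto simp: \<zeta>1 intro!: derivative_eq_intros)
  have dX: "(X a has_field_derivative (- a / l)) (at 0)" if "norm a < \<delta>" for a
    using der[OF summable_norm_cancel[OF \<xi>_sum[OF that K(1)]] K(2)] unfolding X_def
    by (auto simp: \<zeta>1 \<xi>_def intro!: derivative_eq_intros)
  show ?thesis
    by (rule exI[of _ \<delta>], intro conjI \<delta>, rule exI[of _ X], rule exI[of _ Y])
       (use X Y eqX eqY at0 X0 Y0 dX dY in auto)
qed

section \<open>Parabolic polynomials and the critical orbit\<close>

lemma inverse_power_expansion:
  "\<exists>M\<ge>0. \<forall>v::complex. norm v \<le> 1/2 \<longrightarrow> norm (1 / (1 + v) ^ q - 1 + of_nat q * v) \<le> M * norm v ^ 2"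
proof (induction q)
  case 0 then show ?case by (intro exI[of _ 0]) simp
next
  case (Suc q)
  then obtain M where M: "M \<ge> 0" "\<And>v::complex. norm v \<le> 1/2 \<Longrightarrow> norm (1 / (1 + v) ^ q - 1 + of_nat q * v) \<le> M * norm v ^ 2"
    by blast
  show ?case
  proof (intro exI[of _ "2 * (M + real (Suc q))"] conjI allI impI)
    fix v :: complex assume v: "norm v \<le> 1/2"
    have h: "1/2 \<le> norm (1 + v)" using norm_diff_ineq[of 1 v] v by simp
    then have nz: "1 + v \<noteq> 0" by auto
    define e where "e = 1 / (1 + v) ^ q - 1 + of_nat q * v"
    have "1 / (1 + v) ^ Suc q - 1 + of_nat (Suc q) * v = (1 / (1 + v) ^ q - (1 - of_nat (Suc q) * v) * (1 + v)) / (1 + v)"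
      using nz by (simp add: divide_simps) (simp add: algebra_simps)
    also have "1 / (1 + v) ^ q - (1 - of_nat (Suc q) * v) * (1 + v) = e + of_nat (Suc q) * v^2"
      by (simp add: e_def algebra_simps power2_eq_square)
    finally have "norm (1 / (1 + v) ^ Suc q - 1 + of_nat (Suc q) * v) = norm (e + of_nat (Suc q) * v^2) / norm (1 + v)"
      by (simp add: norm_divide)
    also have "\<dots> \<le> norm (e + of_nat (Suc q) * v^2) / (1/2)" using h by (intro divide_left_mono) auto
    also have "norm (e + of_nat (Suc q) * v^2) \<le> M * norm v ^ 2 + real (Suc q) * norm v ^ 2"
      using M(2)[OF v] unfolding e_def[symmetric]
      by (intro norm_triangle_le add_mono) (auto simp: norm_mult norm_power simp del: of_nat_Suc)
    finally show "norm (1 / (1 + v) ^ Suc q - 1 + of_nat (Suc q) * v) \<le> 2 * (M + real (Suc q)) * norm v ^ 2"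
      by (simp add: algebra_simps)
  qed (use M in auto)
qed

text \<open>In \<open>w = - 1 / x ^ q\<close> the map is nearly the translation by \<open>q\<close>:
  as \<open>l ^ q = 1\<close>, the new value is \<open>w / (1 + v) ^ q\<close> with
  \<open>v = x ^ q * (1 + x * s)\<close>, whose linear term contributes
  \<open>q * (1 + x * s)\<close>. The constants depend on \<open>s\<close> only through its bound
  \<open>K\<close>, so \<open>s\<close> may vary with the point and with \<open>a\<close>.\<close>

lemma petal_coordinate_step:
  fixes l :: complex and K :: real
  assumes q: "q \<ge> 1" and l: "l ^ q = 1" "norm l = 1" and K: "K \<ge> 0"
  shows "\<exists>\<epsilon> K'. 0 < \<epsilon> \<and> \<epsilon> \<le> 1 \<and> K' \<ge> 0 \<and> (\<forall>x s. x \<noteq> 0 \<longrightarrow> norm x < \<epsilon> \<longrightarrow> norm s \<le> K \<longrightarrow>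
     norm (l * x * (1 + x ^ q + x ^ (q+1) * s)) \<ge> norm x / 2 \<and>
     norm (- 1 / (l * x * (1 + x ^ q + x ^ (q+1) * s)) ^ q - (- 1 / x ^ q) - of_nat q) \<le> K' * norm x)"
proof -
  obtain M where M: "M \<ge> 0" "\<And>v::complex. norm v \<le> 1/2 \<Longrightarrow> norm (1 / (1 + v) ^ q - 1 + of_nat q * v) \<le> M * norm v ^ 2"
    using inverse_power_expansion by blast
  \<comment> \<open>Then \<open>|v| \<le> |x| * (1 + K) \<le> 1/2\<close>, the range of the
    expansion of the inverse power.\<close>
  define \<epsilon> where "\<epsilon> = 1 / (2 * (1 + K))"
  define K' where "K' = M * (1 + K)^2 + real q * K"
  have \<epsilon>: "\<epsilon> > 0" "\<epsilon> \<le> 1" "(1 + K) * \<epsilon> = 1/2" using K by (auto simp: \<epsilon>_def field_simps)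
  have main: "norm (l * x * (1 + x ^ q + x ^ (q+1) * s)) \<ge> norm x / 2 \<and>
     norm (- 1 / (l * x * (1 + x ^ q + x ^ (q+1) * s)) ^ q - (- 1 / x ^ q) - of_nat q) \<le> K' * norm x"
    if x: "x \<noteq> 0" "norm x < \<epsilon>" and s: "norm s \<le> K" for x s
  proof -
    define v where "v = x ^ q + x ^ (q+1) * s"
    have x1: "norm x < 1" using x \<epsilon> by linarith
    have v_eq: "v = x ^ q * (1 + x * s)" by (simp add: v_def algebra_simps)
    have "norm (x * s) \<le> 1 * K"
      unfolding norm_mult using s x1 by (intro mult_mono) auto
    then have "norm (1 + x * s) \<le> 1 + K" by (intro norm_triangle_le) simp
    then have nv: "norm v \<le> norm x ^ q * (1 + K)" unfolding v_eq norm_mult norm_power by (intro mult_left_mono) auto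
    have xq: "norm x ^ q \<le> norm x" using power_decreasing[of 1 q "norm x"] q x1 by simp
    have "norm x ^ q * (1 + K) \<le> \<epsilon> * (1 + K)" using xq x K by (intro mult_right_mono) auto
    then have v2: "norm v \<le> 1/2" using nv \<epsilon> by (simp add: mult.commute)
    have h: "1/2 \<le> norm (1 + v)" using norm_diff_ineq[of 1 v] v2 by simp
    have e: "l * x * (1 + x ^ q + x ^ (q+1) * s) = l * x * (1 + v)" by (simp add: v_def)
    have xq0: "x ^ q \<noteq> 0" using x by simp
    have "- 1 / (l * x * (1 + v)) ^ q - (- 1 / x ^ q) - of_nat q
        = - ((1 / (1 + v) ^ q - 1 + of_nat q * v) / x ^ q) + of_nat q * (x * s)"
      using xq0 h l(1) by (simp add: power_mult_distrib v_eq divide_simps) (simp add: algebra_simps)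
    also have "norm \<dots> \<le> norm (1 / (1 + v) ^ q - 1 + of_nat q * v) / norm x ^ q + real q * (norm x * norm s)"
      by (rule norm_triangle_le) (simp add: norm_divide norm_mult norm_power)
    also have "norm (1 / (1 + v) ^ q - 1 + of_nat q * v) / norm x ^ q \<le> (M * (norm x ^ q * (1 + K))^2) / norm x ^ q"
      using M(2)[OF v2] nv M(1) by (intro divide_right_mono order_trans[OF M(2)[OF v2]] mult_left_mono power_mono) auto
    also have "(M * (norm x ^ q * (1 + K))^2) / norm x ^ q = M * (1 + K)^2 * norm x ^ q"
      using x by (simp add: power2_eq_square)
    also have "\<dots> \<le> M * (1 + K)^2 * norm x" using xq M by (intro mult_left_mono) auto
    also have "real q * (norm x * norm s) \<le> real q * (norm x * K)" using s by (intro mult_left_mono) auto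
    finally have "norm (- 1 / (l * x * (1 + v)) ^ q - (- 1 / x ^ q) - of_nat q) \<le> K' * norm x"
      by (simp add: K'_def algebra_simps)
    moreover have "norm (l * x * (1 + v)) \<ge> norm x / 2"
      using h l(2) mult_left_mono[OF h, of "norm x"] by (simp add: norm_mult)
    ultimately show ?thesis unfolding e by blast
  qed
  show ?thesis using \<epsilon> main M K by (intro exI[of _ \<epsilon>] exI[of _ K']) (auto simp: K'_def)
qed

text \<open>The point \<open>x = 0\<close> is excluded because division by zero gives
  \<open>0\<close>, which is not above \<open>L > 0\<close>; otherwise \<open>|x| ^ -q\<close>
  exceeds \<open>L\<close>.\<close>

lemma petal_small:
  assumes "Re (- 1 / x ^ q) > L" "L > 0" "\<epsilon> > 0" "1 / \<epsilon> ^ q \<le> L" "q \<ge> 1"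
  shows "x \<noteq> 0" "norm x < \<epsilon>"
proof -
  show x: "x \<noteq> 0" using assms by (auto simp: power_0_left)
  have "L < norm (- 1 / x ^ q)" using assms(1) complex_Re_le_cmod order_less_le_trans by blast
  then have "1 / \<epsilon> ^ q < 1 / norm x ^ q" using assms(4) by (simp add: norm_divide norm_power)
  then have "norm x ^ q < \<epsilon> ^ q" using assms(3) x by (simp add: field_simps)
  then show "norm x < \<epsilon>" using assms(3) power_less_imp_less_base by fastforce
qed

lemma open_petal: "open {x::complex. x \<noteq> 0 \<and> Re (- 1 / x ^ q) > L}"
proof -
  have "{x::complex. x \<noteq> 0 \<and> Re (- 1 / x ^ q) > L} = - {0} \<inter> (\<lambda>x. Re (- 1 / x ^ q)) -` {L<..}" by auto
  moreover have "open \<dots>"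
    by (rule continuous_open_preimage) (auto intro!: continuous_intros)
  ultimately show ?thesis by simp
qed

section \<open>Fatou's theorem for the critical orbit\<close>

text \<open>What the dynamics uses of the coordinate: an inverse \<open>\<psi>\<close> on the full
  disc and, on a smaller disc, the form \<open>l * x * (1 + x ^ q + x ^ (q+1) * s)\<close> with
  \<open>s\<close> merely bounded.\<close>

locale parabolic_germ =
  fixes l :: complex and q :: nat and V :: "complex set" and \<phi> \<psi> :: "complex \<Rightarrow> complex" and \<rho> \<epsilon> K :: real
  assumes q: "q \<ge> 1" and l: "l ^ q = 1" "norm l = 1"
    and V: "open V" and \<phi>: "\<phi> holomorphic_on V" and \<psi>: "\<psi> holomorphic_on ball 0 \<rho>"
    and \<phi>\<psi>: "\<And>x. norm x < \<rho> \<Longrightarrow> \<psi> x \<in> V \<and> \<phi> (\<psi> x) = x"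
    and \<psi>\<phi>: "\<And>x. x \<in> V \<Longrightarrow> norm (\<phi> x) < \<rho> \<and> \<psi> (\<phi> x) = x"
    and \<psi>0: "\<psi> 0 = l / 2" and \<epsilon>: "0 < \<epsilon>" "\<epsilon> \<le> \<rho>" and K: "K \<ge> 0"
    and step: "\<And>x. norm x < \<epsilon> \<Longrightarrow> parabolic_poly l (\<psi> x) \<in> V \<and>
       (\<exists>s. norm s \<le> K \<and> \<phi> (parabolic_poly l (\<psi> x)) = l * x * (1 + x ^ q + x ^ (q+1) * s))"
begin

abbreviation P where "P \<equiv> parabolic_poly l"

lemma P_holomorphic: "(P ^^ n) holomorphic_on S"
proof (induction n)
  case (Suc n)
  have "(\<lambda>z. (P ^^ n) z ^ 2 + (l / 2 - l^2 / 4)) holomorphic_on S"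
    using Suc by (intro holomorphic_intros)
  moreover have "(P ^^ Suc n) = (\<lambda>z. (P ^^ n) z ^ 2 + (l / 2 - l^2 / 4))"
    by (rule ext) (simp add: parabolic_poly_def[of l "(parabolic_poly l ^^ n) _"])
  ultimately show ?case by simp
qed (auto simp: id_def)

lemma const_bound: "norm (l / 2 - l^2 / 4) \<le> 3/4"
  using norm_triangle_ineq4[of "l / 2" "l^2 / 4"] l by (simp add: norm_divide norm_power)

text \<open>The constant term has modulus at most \<open>3/4\<close>, so \<open>|z| \<ge> 2\<close>
  is forward invariant. Read backwards, a preimage of a point of modulus below \<open>2\<close> has
  modulus below \<open>2\<close>, which bounds all inverse branches at once.\<close>

lemma P_escape: "norm z \<ge> 2 \<Longrightarrow> norm ((P ^^ n) z) \<ge> 2"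
proof (induction n)
  case (Suc n)
  let ?y = "(P ^^ n) z"
  have "2^2 \<le> norm ?y ^ 2" using Suc by (intro power_mono) auto
  moreover have "norm (?y ^ 2) - norm (l / 2 - l^2 / 4) \<le> norm (P ?y)"
    unfolding parabolic_poly_def by (rule norm_diff_ineq)
  ultimately show ?case using const_bound by (simp add: norm_power)
qed simp

text \<open>The branch is built from successive square roots on a convex, hence contractible, set.
  The radicand vanishes only where the previous branch takes the critical value, and this is
  excluded by \<open>avoid\<close>.\<close>

lemma lift_inverse_branch:
  assumes D: "convex D" and w0: "w0 \<in> D" and g: "g holomorphic_on D" "g w0 = (P ^^ n) x0"
    and avoid: "\<And>k w. w \<in> D \<Longrightarrow> (P ^^ Suc k) 0 \<noteq> g w"
  shows "k \<le> n \<Longrightarrow> \<exists>h. h holomorphic_on D \<and> (\<forall>w\<in>D. (P ^^ k) (h w) = g w) \<and> h w0 = (P ^^ (n - k)) x0"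
proof (induction k)
  case 0
  then show ?case using g by (intro exI[of _ g]) auto
next
  case (Suc k)
  then obtain h where h: "h holomorphic_on D" "\<And>w. w \<in> D \<Longrightarrow> (P ^^ k) (h w) = g w" "h w0 = (P ^^ (n - k)) x0"
    by auto
  define c0 where "c0 = l / 2 - l^2 / 4"
  have nz: "h w - c0 \<noteq> 0" if "w \<in> D" for w
  proof
    assume "h w - c0 = 0"
    then have "h w = P 0" by (simp add: parabolic_poly_def c0_def)
    then have "(P ^^ Suc k) 0 = g w" using h(2)[OF that] by (simp add: funpow_swap1)
    then show False using avoid[OF that, of k] by simp
  qed
  have hc: "(\<lambda>w. h w - c0) holomorphic_on D" by (intro holomorphic_intros h)
  have "\<exists>s. s holomorphic_on D \<and> (\<forall>w\<in>D. h w - c0 = s w ^ 2)"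
    by (rule contractible_imp_holomorphic_sqrt[OF hc convex_imp_contractible[OF D] nz]) auto
  then obtain s where s: "s holomorphic_on D" "\<And>w. w \<in> D \<Longrightarrow> h w - c0 = s w ^ 2"
    by blast
  define y where "y = (P ^^ (n - Suc k)) x0"
  have "n - k = Suc (n - Suc k)" using Suc.prems by simp
  then have "h w0 = P y" using h(3) by (simp add: y_def)
  then have "s w0 ^ 2 = y ^ 2" using s(2)[OF w0] by (simp add: parabolic_poly_def c0_def)
  then have "s w0 = y \<or> - s w0 = y" using power2_eq_iff by (metis minus_minus)
  \<comment> \<open>The sign of the root is chosen so that at \<open>w0\<close> the branch follows
    the orbit of \<open>x0\<close> backwards.\<close>
  then obtain \<sigma> :: complex where \<sigma>: "\<sigma> * s w0 = y" "\<sigma> ^ 2 = 1"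
    by (metis mult_1 mult_minus1 power2_minus power_one)
  have "(P ^^ Suc k) (\<sigma> * s w) = g w" if "w \<in> D" for w
  proof -
    have "P (\<sigma> * s w) = h w" using s(2)[OF that] \<sigma>(2)
      by (simp add: parabolic_poly_def power_mult_distrib c0_def[symmetric]) (metis diff_add_cancel)
    then show ?thesis using h(2)[OF that] by (simp add: funpow_swap1)
  qed
  then show ?case using s(1) \<sigma>(1) by (intro exI[of _ "\<lambda>w. \<sigma> * s w"]) (auto simp: y_def intro!: holomorphic_intros)
qed

text \<open>Two bounds on the deviation from the translation are kept: \<open>q / 2\<close> makes
  the real part of \<open>w\<close> increase by at least \<open>q / 2\<close> per step, and
  \<open>K' * |x|\<close> makes the deviation tend to zero along an orbit.\<close>

lemma petal_dynamics:
  "\<exists>K' L0. K' \<ge> 0 \<and> L0 > 0 \<and> (\<forall>L\<ge>L0. \<forall>x. x \<noteq> 0 \<longrightarrow> Re (- 1 / x ^ q) > L \<longrightarrow>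
     norm x < \<epsilon> \<and> norm (\<psi> x) < 2 \<and> \<phi> (P (\<psi> x)) \<noteq> 0 \<and>
     norm (- 1 / \<phi> (P (\<psi> x)) ^ q - (- 1 / x ^ q) - of_nat q) \<le> min (K' * norm x) (real q / 2))"
proof -
  obtain e K' where e: "0 < e" "e \<le> 1" "K' \<ge> 0" and
    st: "\<And>x s. x \<noteq> 0 \<Longrightarrow> norm x < e \<Longrightarrow> norm s \<le> K \<Longrightarrow>
     norm (l * x * (1 + x ^ q + x ^ (q+1) * s)) \<ge> norm x / 2 \<and>
     norm (- 1 / (l * x * (1 + x ^ q + x ^ (q+1) * s)) ^ q - (- 1 / x ^ q) - of_nat q) \<le> K' * norm x"
    using petal_coordinate_step[OF q l K] by blast
  have "isCont \<psi> 0"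
    using \<psi> \<epsilon> holomorphic_on_imp_continuous_on continuous_on_eq_continuous_at[of "ball 0 \<rho>" \<psi>] by auto
  moreover have "norm (\<psi> 0) < 2" unfolding \<psi>0 using l by (simp add: norm_divide)
  ultimately have "\<forall>\<^sub>F x in at 0. norm (\<psi> x) < 2"
    using order_tendstoD(2)[OF tendsto_norm] unfolding isCont_def by blast
  then obtain d where d: "d > 0" "\<And>x. x \<noteq> 0 \<Longrightarrow> norm x < d \<Longrightarrow> norm (\<psi> x) < 2"
    unfolding eventually_at by (auto simp: dist_norm)
  define e' where "e' = min (min e \<epsilon>) (min d (1 / (2 * (K' + 1))))"
  have e': "e' > 0" "e' \<le> e" "e' \<le> \<epsilon>" "e' \<le> d" "e' \<le> 1 / (2 * (K' + 1))"
    using e \<epsilon> d by (auto simp: e'_def)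
  show ?thesis
  proof (rule exI[of _ K'], rule exI[of _ "1 / e' ^ q"], intro conjI allI impI e)
    show L0: "0 < 1 / e' ^ q" using e' by simp
    fix L x assume L: "1 / e' ^ q \<le> L" and x: "x \<noteq> 0" "Re (- 1 / x ^ q) > L"
    have nx: "norm x < e'" by (rule petal_small[OF x(2) _ e'(1) L q]) (use L L0 in linarith)
    show "norm x < \<epsilon>" "norm (\<psi> x) < 2" using nx e' d x by auto
    obtain s where s: "norm s \<le> K" "\<phi> (P (\<psi> x)) = l * x * (1 + x ^ q + x ^ (q+1) * s)"
      using step[of x] nx e' by auto
    have 1: "norm (\<phi> (P (\<psi> x))) \<ge> norm x / 2"
      and 2: "norm (- 1 / \<phi> (P (\<psi> x)) ^ q - (- 1 / x ^ q) - of_nat q) \<le> K' * norm x"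
      using st[OF x(1) _ s(1)] nx e' unfolding s(2) by auto
    show "\<phi> (P (\<psi> x)) \<noteq> 0" using 1 x by auto
    have "K' * norm x \<le> (K' + 1) * (1 / (2 * (K' + 1)))" using nx e' e by (intro mult_mono) auto
    also have "\<dots> = 1/2" using e by (simp add: field_simps)
    finally have "K' * norm x \<le> real q / 2" using q by simp
    then show "norm (- 1 / \<phi> (P (\<psi> x)) ^ q - (- 1 / x ^ q) - of_nat q) \<le> min (K' * norm x) (real q / 2)"
      using 2 by simp
  qed
qed

text \<open>Fatou's theorem. If the critical orbit missed the petal, then the inverse branches of
  \<open>P ^^ n\<close> along an orbit in the petal would exist on discs of radius of order \<open>n\<close> in the
  coordinate \<open>w = - 1 / x ^ q\<close> and be uniformly bounded, so the derivative of \<open>P ^^ n\<close> along the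
  orbit would grow at least linearly; but \<open>w\<close> moves by \<open>q + o(1)\<close> in each step, which makes that
  derivative \<open>o(n)\<close>.\<close>

lemma critical_orbit_enters_petal:
  "\<exists>L0>0. \<forall>L\<ge>L0. \<exists>n. (P ^^ Suc n) 0 \<in> V \<and> \<phi> ((P ^^ Suc n) 0) \<noteq> 0 \<and> Re (- 1 / \<phi> ((P ^^ Suc n) 0) ^ q) > L"
proof -
  obtain K' L0 where K': "K' \<ge> 0" and L0: "L0 > 0" and dyn: "\<And>L x. L \<ge> L0 \<Longrightarrow> x \<noteq> 0 \<Longrightarrow> Re (- 1 / x ^ q) > L \<Longrightarrow>
     norm x < \<epsilon> \<and> norm (\<psi> x) < 2 \<and> \<phi> (P (\<psi> x)) \<noteq> 0 \<and>
     norm (- 1 / \<phi> (P (\<psi> x)) ^ q - (- 1 / x ^ q) - of_nat q) \<le> min (K' * norm x) (real q / 2)"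
    using petal_dynamics by blast
  have "\<exists>n. (P ^^ Suc n) 0 \<in> V \<and> \<phi> ((P ^^ Suc n) 0) \<noteq> 0 \<and> Re (- 1 / \<phi> ((P ^^ Suc n) 0) ^ q) > L" if L: "L \<ge> L0" for L
  proof (rule ccontr)
    assume "\<not> ?thesis"
    then have miss: "\<And>n. (P ^^ Suc n) 0 \<in> V \<Longrightarrow> \<phi> ((P ^^ Suc n) 0) \<noteq> 0 \<Longrightarrow> \<not> Re (- 1 / \<phi> ((P ^^ Suc n) 0) ^ q) > L" by blast
    have Lpos: "L > 0" using L L0 by linarith
    define A where "A = {x. x \<noteq> 0 \<and> Re (- 1 / x ^ q) > L}"
    define U where "U = {x \<in> V. \<phi> x \<in> A}"
    define W where "W = (\<lambda>n x. - 1 / \<phi> ((P ^^ n) x) ^ q)"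
    have A\<epsilon>: "norm x < \<epsilon>" "norm x < \<rho>" if "x \<in> A" for x
      using dyn[OF L, of x] that \<epsilon> by (auto simp: A_def)
    have \<psi>A: "\<psi> x \<in> U" if "x \<in> A" for x using A\<epsilon>[OF that] \<phi>\<psi> that by (auto simp: U_def)
    have avoid: "(P ^^ Suc k) 0 \<notin> U" for k using miss[of k] by (auto simp: U_def A_def simp del: funpow.simps)
    have stepU: "P x \<in> U \<and> norm (- 1 / \<phi> (P x) ^ q - (- 1 / \<phi> x ^ q) - of_nat q) \<le> min (K' * norm (\<phi> x)) (real q / 2)
        \<and> norm x < 2" if "x \<in> U" for x
    proof -
      have x: "x \<in> V" "\<phi> x \<noteq> 0" "Re (- 1 / \<phi> x ^ q) > L" "\<psi> (\<phi> x) = x"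
        using that \<psi>\<phi> by (auto simp: U_def A_def)
      note d = dyn[OF L x(2,3), unfolded x(4)]
      have PV: "P x \<in> V" using step[of "\<phi> x"] d x(4) by auto
      have "\<bar>Re (- 1 / \<phi> (P x) ^ q - (- 1 / \<phi> x ^ q) - of_nat q)\<bar> \<le> real q / 2"
        using d abs_Re_le_cmod order_trans by (meson min.boundedE)
      then have "- (real q / 2) \<le> Re (- 1 / \<phi> (P x) ^ q - (- 1 / \<phi> x ^ q) - of_nat q)" by linarith
      then have "Re (- 1 / \<phi> (P x) ^ q) \<ge> Re (- 1 / \<phi> x ^ q) + real q / 2"
        unfolding minus_complex.simps by simp
      then have "Re (- 1 / \<phi> (P x) ^ q) > L" using x by (smt (verit) of_nat_0_le_iff divide_nonneg_nonneg)
      then show ?thesis using d PV by (auto simp: U_def A_def)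
    qed
    have itU: "(P ^^ n) x \<in> U" if "x \<in> U" for n x
      using that by (induction n) (auto simp: stepU)
    have W_step: "norm (W (Suc n) x - W n x - of_nat q) \<le> min (K' * norm (\<phi> ((P ^^ n) x))) (real q / 2)" if "x \<in> U" for n x
      using stepU[OF itU[OF that, of n]] by (simp add: W_def)
    have W_re: "Re (W n x) \<ge> Re (W 0 x) + real n * real q / 2" if x: "x \<in> U" for n x
    proof (induction n)
      case (Suc n)
      have "\<bar>Re (W (Suc n) x - W n x - of_nat q)\<bar> \<le> real q / 2"
        using W_step[OF x, of n] abs_Re_le_cmod order_trans by (meson min.boundedE)
      then have "- (real q / 2) \<le> Re (W (Suc n) x - W n x - of_nat q)" by linarith
      then have "Re (W n x) + real q / 2 \<le> Re (W (Suc n) x)" by simp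
      moreover have "real (Suc n) * real q / 2 = real n * real q / 2 + real q / 2" by (simp add: field_simps)
      ultimately show ?case using Suc by linarith
    qed simp
    have WL: "Re (W n x) > L" if "x \<in> U" for n x using itU[OF that, of n] by (auto simp: W_def U_def A_def)
    have U_open: "open U"
    proof -
      have "open A" unfolding A_def by (rule open_petal)
      then have "open (V \<inter> \<phi> -` A)"
        by (intro continuous_open_preimage V holomorphic_on_imp_continuous_on \<phi>)
      moreover have "U = V \<inter> \<phi> -` A" by (auto simp: U_def)
      ultimately show ?thesis by simp
    qed
    \<comment> \<open>A point with \<open>- 1 / X0 ^ q = 2 * L\<close>, hence in the petal.\<close>
    define X0 where "X0 = exp (Ln (complex_of_real (- 1 / (2 * L))) / of_nat q)"
    have X0q: "X0 ^ q = complex_of_real (- 1 / (2 * L))"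
    proof -
      have "X0 ^ q = exp (Ln (complex_of_real (- 1 / (2 * L))))"
        using q unfolding X0_def by (simp flip: exp_of_nat_mult)
      also have "\<dots> = complex_of_real (- 1 / (2 * L))" by (rule exp_Ln) (use Lpos in simp)
      finally show ?thesis .
    qed
    have wX0: "- 1 / X0 ^ q = complex_of_real (2 * L)" unfolding X0q using Lpos by (simp add: field_simps)
    have "X0 \<in> A" using Lpos unfolding A_def mem_Collect_eq wX0 by (simp add: X0_def)
    define x0 where "x0 = \<psi> X0"
    have x0: "x0 \<in> U" unfolding x0_def by (rule \<psi>A) fact
    obtain d where d: "d > 0" "cball x0 d \<subseteq> U" using U_open x0 open_contains_cball by blast
    have W_hol: "W n holomorphic_on U" for n
      unfolding W_def using itU
      by (intro holomorphic_intros holomorphic_on_compose_gen[OF P_holomorphic \<phi>, unfolded o_def])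
         (auto simp: U_def A_def)
    have lower: "real n * real q / 16 \<le> norm (deriv (W n) x0)" if n: "n \<ge> 1" for n
    proof -
      define wn where "wn = W n x0"
      define r where "r = real n * real q / 2"
      \<comment> \<open>In \<open>n\<close> steps the real part grows from \<open>2 * L\<close> by
        at least \<open>r\<close>, so the disc of radius \<open>r\<close> around \<open>wn\<close>
        stays in the half-plane \<open>Re w > L\<close>.\<close>
      define D where "D = ball wn r"
      have r: "r > 0" using n q by (simp add: r_def)
      have w0: "W 0 x0 = complex_of_real (2 * L)"
        unfolding W_def x0_def using \<phi>\<psi>[OF A\<epsilon>(2)[OF \<open>X0 \<in> A\<close>]] wX0 by simp
      have DRe: "Re w > L" if "w \<in> D" for w
      proof -
        have "\<bar>Re (wn - w)\<bar> < r" using that abs_Re_le_cmod[of "wn - w"] by (simp add: D_def dist_norm)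
        moreover have "Re wn \<ge> 2 * L + r" using W_re[OF x0, of n] w0 by (simp add: wn_def r_def)
        ultimately show ?thesis using Lpos by (auto simp: abs_less_iff)
      qed
      have wnD: "wn \<in> D" using r by (simp add: D_def)
      define Xn where "Xn = \<phi> ((P ^^ n) x0)"
      have Xn: "Xn \<in> A" "\<psi> Xn = (P ^^ n) x0" using itU[OF x0, of n] \<psi>\<phi> by (auto simp: Xn_def U_def)
      have Xn0: "Xn \<noteq> 0" using Xn by (simp add: A_def)
      have wn_eq: "wn = - 1 / Xn ^ q" by (simp add: wn_def W_def Xn_def)
      \<comment> \<open>The branch of \<open>w \<mapsto> x\<close> with
        \<open>- 1 / x ^ q = w\<close> through \<open>Xn\<close>. As \<open>wn\<close> and
        \<open>w\<close> have positive real parts, their quotient avoids the cut of the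
        logarithm.\<close>
      define E where "E = (\<lambda>w. Xn * exp (Ln (wn / w) / of_nat q))"
      have ratio: "wn / w \<notin> \<real>\<^sub>\<le>\<^sub>0" if w: "w \<in> D" for w
      proof
        assume "wn / w \<in> \<real>\<^sub>\<le>\<^sub>0"
        then obtain s where s: "s \<le> 0" "wn / w = complex_of_real s" by (auto elim: nonpos_Reals_cases)
        have w0: "w \<noteq> 0" using DRe[OF w] Lpos by auto
        then have "wn = complex_of_real s * w" using s(2) by (simp add: field_simps)
        then have "Re wn = s * Re w" by simp
        moreover have "s * Re w \<le> 0" using s DRe[OF w] Lpos by (intro mult_nonpos_nonneg) auto
        ultimately show False using DRe[OF wnD] Lpos by linarith
      qed
      have Eq: "- 1 / E w ^ q = w" if w: "w \<in> D" for w
      proof -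
        have w0: "w \<noteq> 0" "wn \<noteq> 0" using DRe[OF w] DRe[OF wnD] Lpos by auto
        have "exp (Ln (wn / w) / of_nat q) ^ q = exp (Ln (wn / w))"
          using q by (simp flip: exp_of_nat_mult)
        also have "\<dots> = wn / w" using w0 by (intro exp_Ln) auto
        finally have "E w ^ q = Xn ^ q * (wn / w)" by (simp add: E_def power_mult_distrib)
        then have m: "w * E w ^ q = - 1" using w0 Xn0 by (simp add: wn_eq field_simps)
        then have "E w ^ q \<noteq> 0" using q by (auto simp: zero_power)
        then show ?thesis using m by (subst divide_eq_eq) simp
      qed
      have EA: "E w \<in> A" if "w \<in> D" for w
        unfolding A_def mem_Collect_eq Eq[OF that] using DRe[OF that] Xn0 by (simp add: E_def)
      have E_wn: "E wn = Xn" using DRe[OF wnD] Lpos by (auto simp: E_def)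
      have E_hol: "E holomorphic_on D" unfolding E_def
        using ratio q DRe Lpos by (intro holomorphic_intros) force+
      have g_hol: "(\<lambda>w. \<psi> (E w)) holomorphic_on D"
        by (rule holomorphic_on_compose_gen[OF E_hol \<psi>, unfolded o_def]) (use EA A\<epsilon> in auto)
      have "\<exists>h. h holomorphic_on D \<and> (\<forall>w\<in>D. (P ^^ n) (h w) = \<psi> (E w)) \<and> h wn = (P ^^ (n - n)) x0"
        by (rule lift_inverse_branch[OF _ wnD g_hol]) (use \<psi>A EA avoid E_wn Xn in \<open>auto simp: D_def\<close>, metis)
      then obtain h where h: "h holomorphic_on D" "\<And>w. w \<in> D \<Longrightarrow> (P ^^ n) (h w) = \<psi> (E w)" "h wn = x0" by auto
      have h_bd: "norm (h w) < 2" if w: "w \<in> D" for w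
      proof (rule ccontr)
        assume "\<not> norm (h w) < 2"
        then have "norm ((P ^^ n) (h w)) \<ge> 2" by (intro P_escape) simp
        moreover have "norm (\<psi> (E w)) < 2" using stepU[OF \<psi>A[OF EA[OF w]]] by simp
        ultimately show False using h(2)[OF w] by simp
      qed
      \<comment> \<open>The branch is bounded by \<open>2\<close> on a disc of radius of order
        \<open>n\<close>, so its derivative is at most \<open>4 / r\<close>; as \<open>W n\<close>
        undoes it, \<open>W n\<close> has derivative at least \<open>r / 4\<close> at
        \<open>x0\<close>.\<close>
      have "norm ((deriv ^^ 1) h wn) \<le> fact 1 * 2 / (r/2) ^ 1"
      proof (rule Cauchy_inequality)
        have sub: "cball wn (r/2) \<subseteq> D" using r by (auto simp: D_def)
        show "h holomorphic_on ball wn (r/2)" using h(1) sub ball_subset_cball holomorphic_on_subset by (metis order_trans)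
        show "continuous_on (cball wn (r/2)) h" using h(1) sub holomorphic_on_subset holomorphic_on_imp_continuous_on by blast
        show "norm (h x) \<le> 2" if "norm (wn - x) = r/2" for x
          using h_bd[of x] that r by (simp add: D_def dist_norm)
      qed (use r in auto)
      then have h': "norm (deriv h wn) \<le> 4 / r" by simp
      have 1: "(h has_field_derivative deriv h wn) (at wn)"
        by (rule holomorphic_derivI[OF h(1) _ wnD]) (simp add: D_def)
      have 2: "(W n has_field_derivative deriv (W n) x0) (at (h wn))"
        unfolding h(3) by (rule holomorphic_derivI[OF W_hol U_open x0])
      have 3: "((\<lambda>w. W n (h w)) has_field_derivative deriv (W n) x0 * deriv h wn) (at wn)"
        using DERIV_chain2[OF 2 1] .
      have "W n (h w) = w" if w: "w \<in> D" for w
        using h(2)[OF w] \<phi>\<psi>[OF A\<epsilon>(2)[OF EA[OF w]]] Eq[OF w] by (simp add: W_def)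
      then have "((\<lambda>w. w) has_field_derivative deriv (W n) x0 * deriv h wn) (at wn)"
        by (intro has_field_derivative_transform_within_open[OF 3, of D]) (use wnD in \<open>auto simp: D_def\<close>)
      then have "deriv (W n) x0 * deriv h wn = 1" using DERIV_ident DERIV_unique by blast
      then have "1 = norm (deriv (W n) x0) * norm (deriv h wn)" by (metis norm_mult norm_one)
      also have "\<dots> \<le> norm (deriv (W n) x0) * (4 / r)" by (intro mult_left_mono h') auto
      finally have "r / 4 \<le> norm (deriv (W n) x0)" using r by (simp add: field_simps)
      moreover have "real n * real q / 16 \<le> r / 4" using n q by (simp add: r_def)
      ultimately show ?thesis by linarith
    qed
    \<comment> \<open>With this \<open>e\<close> the part of the upper bound that grows with
      \<open>n\<close> is \<open>n * q / 32\<close>, half of the lower bound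
      \<open>n * q / 16\<close>.\<close>
    define e where "e = d * real q / 64"
    have e: "e > 0" using d q by (simp add: e_def)
    define \<eta> where "\<eta> = e / (K' + 1)"
    have \<eta>: "\<eta> > 0" "K' * \<eta> \<le> e" using e K' by (auto simp: \<eta>_def field_simps)
    obtain k0 :: nat where k0: "real k0 \<ge> 2 / \<eta> ^ q" using real_arch_simple by blast
    have small: "norm (W (Suc n) x - W n x - of_nat q) \<le> e" if x: "x \<in> U" and n: "n \<ge> k0" for n x
    proof -
      have "real n * real q / 2 \<le> Re (W n x)" using W_re[OF x, of n] WL[OF x, of 0] Lpos by linarith
      moreover have "1 / \<eta> ^ q \<le> real n * real q / 2"
      proof -
        have "2 / \<eta> ^ q \<le> real n * 1" using k0 n by simp
        also have "\<dots> \<le> real n * real q" using q by (intro mult_left_mono) auto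
        finally show ?thesis by simp
      qed
      moreover have "real n * real q / 2 > 0"
        using \<open>1 / \<eta> ^ q \<le> real n * real q / 2\<close> \<eta> by (smt (verit) zero_less_divide_1_iff zero_less_power)
      moreover have "Re (W n x) \<noteq> real n * real q / 2" using W_re[OF x, of n] WL[OF x, of 0] Lpos by linarith
      ultimately have "norm (\<phi> ((P ^^ n) x)) < \<eta>"
        by (intro petal_small(2)[of "real n * real q / 2" _ q]) (use \<eta> q in \<open>auto simp: W_def\<close>)
      then have "K' * norm (\<phi> ((P ^^ n) x)) \<le> K' * \<eta>" using K' by (intro mult_left_mono) auto
      then show ?thesis using W_step[OF x, of n] \<eta> by linarith
    qed
    \<comment> \<open>The first \<open>k0\<close> steps cost at most \<open>q\<close> each, every
      later one at most \<open>e\<close>.\<close>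
    have drift: "norm (W n x - W 0 x - of_nat n * of_nat q) \<le> real k0 * real q + real n * e" if x: "x \<in> U" for n x
    proof -
      have "norm (W n x - W 0 x - of_nat n * of_nat q) \<le> real (min n k0) * real q + real (n - min n k0) * e" for n
      proof (induction n)
        case (Suc n)
        have eq: "W (Suc n) x - W 0 x - of_nat (Suc n) * of_nat q =
            (W n x - W 0 x - of_nat n * of_nat q) + (W (Suc n) x - W n x - of_nat q)" by (simp add: algebra_simps)
        show ?case
        proof (cases "n < k0")
          case True
          have "norm (W (Suc n) x - W n x - of_nat q) \<le> real q" using W_step[OF x, of n] by (simp add: min_def split: if_splits)
          then show ?thesis unfolding eq using Suc True by (intro norm_triangle_le) (simp add: algebra_simps)
        next
          case False
          then have "norm (W (Suc n) x - W n x - of_nat q) \<le> e" by (intro small x) simp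
          then show ?thesis unfolding eq using Suc False
            by (intro norm_triangle_le) (simp add: Suc_diff_le algebra_simps)
        qed
      qed simp
      from this[of n] have "norm (W n x - W 0 x - of_nat n * of_nat q) \<le> real (min n k0) * real q + real (n - min n k0) * e" .
      also have "\<dots> \<le> real k0 * real q + real n * e" using e by (intro add_mono mult_right_mono) auto
      finally show ?thesis .
    qed
    obtain M where M: "\<And>x. x \<in> cball x0 d \<Longrightarrow> norm (W 0 x) \<le> M"
    proof -
      have "compact (W 0 ` cball x0 d)"
        using d W_hol holomorphic_on_imp_continuous_on continuous_on_subset by (intro compact_continuous_image) (blast, simp)
      then show ?thesis using that by (metis bounded_iff compact_imp_bounded imageI)
    qed
    have upper: "norm (deriv (W n) x0) \<le> (2 * (M + real k0 * real q + real n * e)) / d" for n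
    proof -
      define C where "C = M + real k0 * real q + real n * e"
      define f where "f = (\<lambda>x. W n x - of_nat n * of_nat q)"
      have f_hol: "f holomorphic_on U" unfolding f_def by (intro holomorphic_intros W_hol)
      have f_bd: "norm (f x) \<le> C" if "x \<in> cball x0 d" for x
      proof -
        have "f x = W 0 x + (W n x - W 0 x - of_nat n * of_nat q)" by (simp add: f_def)
        also have "norm \<dots> \<le> M + (real k0 * real q + real n * e)"
          using M[OF that] drift[of x n] that d by (intro norm_triangle_le add_mono) auto
        finally show ?thesis by (simp add: C_def)
      qed
      have "norm ((deriv ^^ 1) f x0) \<le> fact 1 * C / d ^ 1"
      proof (rule Cauchy_inequality)
        show "f holomorphic_on ball x0 d" using f_hol d holomorphic_on_subset ball_subset_cball by (metis order_trans)
        show "continuous_on (cball x0 d) f" using f_hol d holomorphic_on_subset holomorphic_on_imp_continuous_on by blast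
        show "norm (f x) \<le> C" if "norm (x0 - x) = d" for x using that by (intro f_bd) (simp add: dist_norm)
      qed (use d in auto)
      moreover have "deriv f x0 = deriv (W n) x0"
      proof -
        have "(W n has_field_derivative deriv (W n) x0) (at x0)" by (rule holomorphic_derivI[OF W_hol U_open x0])
        then have "(f has_field_derivative deriv (W n) x0) (at x0)"
          unfolding f_def by (auto intro!: derivative_eq_intros)
        then show ?thesis by (rule DERIV_imp_deriv)
      qed
      moreover have "0 \<le> C" using f_bd[of x0] d by (meson centre_in_cball less_imp_le norm_ge_zero order_trans)
      ultimately have "norm (deriv (W n) x0) \<le> C / d" by simp
      also have "\<dots> \<le> 2 * C / d" using \<open>0 \<le> C\<close> d by (simp add: divide_right_mono)
      finally show ?thesis by (simp add: C_def)
    qed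
    obtain n :: nat where n: "real n > 64 * \<bar>M + real k0 * real q\<bar> / (d * real q)" using reals_Archimedean2 by blast
    have dq: "d * real q > 0" using d q by simp
    have n1: "n \<ge> 1" using n dq by (cases n) (auto simp: divide_less_0_iff not_less[symmetric])
    have "64 * \<bar>M + real k0 * real q\<bar> < real n * (d * real q)" using n dq by (simp add: divide_less_eq)
    moreover have "real n * real q / 16 * d \<le> 2 * (M + real k0 * real q + real n * e)"
      using order_trans[OF lower[OF n1] upper[of n]] d by (simp add: le_divide_eq)
    ultimately show False unfolding e_def by (simp add: algebra_simps abs_if split: if_splits)
  qed
  then show ?thesis using L0 by blast
qed

end

section \<open>The given parabolic coordinate as an abstract germ\<close>

lemma multiplier_root_of_unity:
  assumes q: "q \<ge> 1" and c: "coprime p (int q)"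
  shows "norm (multiplier p q) = 1" "multiplier p q ^ i = 1 \<longleftrightarrow> q dvd i"
proof -
  show "norm (multiplier p q) = 1"
    by (simp add: multiplier_def norm_exp_eq_Re)
  have "multiplier p q ^ i = exp (of_nat i * (2 * of_real pi * \<i> * (of_int p / of_nat q)))"
    unfolding multiplier_def by (rule exp_of_nat_mult[symmetric])
  also have "of_nat i * (2 * of_real pi * \<i> * (of_int p / of_nat q)) = Complex 0 (2 * pi * (real i * real_of_int p / real q))"
    by (auto simp: complex_eq_iff)
  finally have "multiplier p q ^ i = 1 \<longleftrightarrow> (\<exists>n::int. 2 * pi * (real i * real_of_int p / real q) = of_int (2 * n) * pi)"
    by (simp add: exp_eq_1)
  also have "\<dots> \<longleftrightarrow> (\<exists>n::int. int i * p = n * int q)"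
  proof (rule iff_exI)
    fix n :: int
    have "2 * pi * (real i * real_of_int p / real q) = of_int (2 * n) * pi \<longleftrightarrow> real i * real_of_int p / real q = of_int n"
    proof -
      have "of_int (2 * n) * pi = (2 * pi) * of_int n" by simp
      then show ?thesis by (simp only: mult_cancel_left) simp
    qed
    also have "\<dots> \<longleftrightarrow> real i * real_of_int p = of_int n * real q" using q by (simp add: divide_eq_eq)
    also have "\<dots> \<longleftrightarrow> real_of_int (int i * p) = real_of_int (n * int q)" by simp
    also have "\<dots> \<longleftrightarrow> int i * p = n * int q" by (rule of_int_eq_iff)
    finally show "2 * pi * (real i * real_of_int p / real q) = of_int (2 * n) * pi \<longleftrightarrow> int i * p = n * int q" .
  qed
  also have "\<dots> \<longleftrightarrow> int q dvd int i * p" by (auto simp: dvd_def mult.commute)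
  also have "\<dots> \<longleftrightarrow> int q dvd int i" using c by (simp add: coprime_dvd_mult_left_iff coprime_commute)
  finally show "multiplier p q ^ i = 1 \<longleftrightarrow> q dvd i" by simp
qed

lemma holomorphic_isCont:
  "f holomorphic_on ball c e \<Longrightarrow> e > 0 \<Longrightarrow> isCont f c"
  by (meson centre_in_ball continuous_on_eq_continuous_at holomorphic_on_imp_continuous_on open_ball)

text \<open>The quotient by \<open>x ^ m\<close> is bounded near \<open>0\<close>, so it extends
  holomorphically. The Landau condition ignores the point \<open>0\<close> itself; the identity
  there follows from continuity.\<close>

lemma bigo_power_factor:
  fixes g :: "complex \<Rightarrow> complex"
  assumes g: "g holomorphic_on ball 0 e" and e: "e > 0" and O: "g \<in> O[at 0](\<lambda>x. x ^ m)"
  shows "\<exists>k. k holomorphic_on ball 0 e \<and> (\<forall>x\<in>ball 0 e. g x = x ^ m * k x)"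
proof -
  obtain c where c: "eventually (\<lambda>x. norm (g x) \<le> c * norm (x ^ m)) (at 0)"
    using O by (auto elim: landau_o.bigE)
  have "eventually (\<lambda>x. x \<noteq> 0) (at (0::complex))" by (simp add: eventually_at_filter)
  with c have "eventually (\<lambda>x. norm (g x / x ^ m) \<le> c) (at 0)"
    by eventually_elim (simp add: norm_divide divide_le_eq)
  moreover have "(\<lambda>x. g x / x ^ m) holomorphic_on ball 0 e - {0}"
    by (intro holomorphic_intros holomorphic_on_subset[OF g]) auto
  ultimately obtain k where k: "k holomorphic_on ball 0 e" "\<And>x. x \<in> ball 0 e - {0} \<Longrightarrow> k x = g x / x ^ m"
    using holomorphic_on_extend_bounded[of "\<lambda>x. g x / x ^ m" "ball 0 e" 0] e by (auto simp: interior_open)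
  have eq: "g x = x ^ m * k x" if "x \<in> ball 0 e" "x \<noteq> 0" for x using k(2)[of x] that by simp
  have ev: "eventually (\<lambda>x. x \<in> ball 0 e \<and> x \<noteq> 0) (at (0::complex))"
    unfolding eventually_at using e by (intro exI[of _ e]) (auto simp: dist_norm)
  have cg: "isCont g 0" and ck: "isCont k 0"
    using holomorphic_isCont g k(1) e by blast+
  have "isCont (\<lambda>x. x ^ m * k x) 0" by (intro continuous_intros ck)
  then have "((\<lambda>x. x ^ m * k x) \<longlongrightarrow> 0 ^ m * k 0) (at 0)" by (simp add: isCont_def)
  moreover have "eventually (\<lambda>x. x ^ m * k x = g x) (at 0)" using ev by eventually_elim (simp add: eq)
  ultimately have "(g \<longlongrightarrow> 0 ^ m * k 0) (at 0)" by (rule Lim_transform_eventually)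
  then have "g 0 = 0 ^ m * k 0" using cg LIM_unique unfolding isCont_def by blast
  then have "\<forall>x\<in>ball 0 e. g x = x ^ m * k x" using eq by metis
  then show ?thesis using k(1) by blast
qed

text \<open>Besides the germ, the exact jet \<open>n\<close> with holomorphic tail \<open>k\<close>
  is extracted: the petal estimates use the bounded form, while the normalization at
  \<open>a = 0\<close> needs all coefficients up to order \<open>2*q+1\<close>.\<close>

lemma parabolic_coordinate_germ:
  fixes p :: int and q :: nat
  defines "l \<equiv> multiplier p q"
  assumes q: "q \<ge> 1" and cop: "coprime p (int q)" and pc: "parabolic_coordinate l q V \<rho> \<phi>"
  shows "\<exists>\<epsilon> K n k. parabolic_germ l q V \<phi> (inv_into V \<phi>) \<rho> \<epsilon> K \<and> \<epsilon> \<le> 1 \<and>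
    k holomorphic_on ball 0 \<epsilon> \<and> n 1 = l \<and> n (q+1) = l \<and> (\<forall>i. i \<notin> {1, q+1, 2*q+1} \<longrightarrow> n i = 0) \<and>
    (\<forall>x. norm x < \<epsilon> \<longrightarrow> \<phi> (parabolic_poly l (inv_into V \<phi> x)) = (\<Sum>i<2*q+2. n i * x ^ i) + x ^ (2*q+2) * k x)"
proof -
  have l: "norm l = 1" "l ^ q = 1" using multiplier_root_of_unity[OF q cop] by (auto simp: l_def)
  have l0: "l \<noteq> 0" using l by auto
  obtain C where V: "open V" "l / 2 \<in> V" and \<rho>: "\<rho> > 0" and \<phi>: "\<phi> holomorphic_on V" and bij: "bij_betw \<phi> V (ball 0 \<rho>)"
    and \<phi>0: "\<phi> (l / 2) = 0"
    and O: "(\<lambda>x. \<phi> (parabolic_poly l (inv_into V \<phi> x)) - l * x * (1 + x^q + C * x^(2*q))) \<in> O[at 0](\<lambda>x. x^(2*q+2))"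
    using pc by (auto simp: parabolic_coordinate_def)
  define \<psi> where "\<psi> = inv_into V \<phi>"
  have inj: "inj_on \<phi> V" and im: "\<phi> ` V = ball 0 \<rho>" using bij by (auto simp: bij_betw_def)
  have \<phi>\<psi>: "\<psi> x \<in> V \<and> \<phi> (\<psi> x) = x" if "norm x < \<rho>" for x
    using that im by (auto simp: \<psi>_def inv_into_into f_inv_into_f)
  have \<psi>\<phi>: "norm (\<phi> x) < \<rho> \<and> \<psi> (\<phi> x) = x" if "x \<in> V" for x
    using that im inj by (auto simp: \<psi>_def)
  obtain g where g: "g holomorphic_on (\<phi> ` V)" "\<And>z. z \<in> V \<Longrightarrow> g (\<phi> z) = z"
    using holomorphic_has_inverse[OF \<phi> V(1) inj] by metis
  have \<psi>: "\<psi> holomorphic_on ball 0 \<rho>"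
  proof (rule holomorphic_transform)
    show "g holomorphic_on ball 0 \<rho>" using g im by simp
    show "g x = \<psi> x" if "x \<in> ball 0 \<rho>" for x using \<phi>\<psi>[of x] g(2)[of "\<psi> x"] that by simp
  qed
  have \<psi>0: "\<psi> 0 = l / 2" using \<psi>\<phi>[OF V(2)] \<phi>0 by simp
  have P_hol: "(\<lambda>x. parabolic_poly l (\<psi> x)) holomorphic_on ball 0 \<rho>"
    unfolding parabolic_poly_def by (intro holomorphic_intros \<psi>)
  have P0: "parabolic_poly l (\<psi> 0) = l / 2" unfolding \<psi>0 by (simp add: parabolic_poly_def power2_eq_square field_simps)
  have "open (ball 0 \<rho> \<inter> (\<lambda>x. parabolic_poly l (\<psi> x)) -` V)"
    by (rule continuous_open_preimage[OF holomorphic_on_imp_continuous_on[OF P_hol]]) (use V in auto)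
  then obtain e0 where e0: "e0 > 0" "ball 0 e0 \<subseteq> ball 0 \<rho> \<inter> (\<lambda>x. parabolic_poly l (\<psi> x)) -` V"
    using open_contains_ball P0 V(2) \<rho> by (metis IntI centre_in_ball vimageI2)
  have PV: "parabolic_poly l (\<psi> x) \<in> V" if "norm x < e0" for x using e0(2) that by auto
  have e0\<rho>: "e0 \<le> \<rho>"
  proof (rule ccontr)
    assume "\<not> e0 \<le> \<rho>"
    then have "complex_of_real \<rho> \<in> ball 0 e0" using \<rho> by simp
    then have "complex_of_real \<rho> \<in> ball 0 \<rho>" using e0(2) by blast
    then show False using \<rho> by simp
  qed
  define f where "f = (\<lambda>x. \<phi> (parabolic_poly l (\<psi> x)))"
  have f_hol: "f holomorphic_on ball 0 e0" unfolding f_def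
    by (rule holomorphic_on_compose_gen[OF _ \<phi>, unfolded o_def]) (use PV P_hol e0\<rho> in \<open>auto intro: holomorphic_on_subset\<close>)
  have "(\<lambda>x. f x - l * x * (1 + x^q + C * x^(2*q))) holomorphic_on ball 0 e0"
    by (intro holomorphic_intros f_hol)
  then obtain k where k: "k holomorphic_on ball 0 e0" "\<And>x. x \<in> ball 0 e0 \<Longrightarrow> f x - l * x * (1 + x^q + C * x^(2*q)) = x ^ (2*q+2) * k x"
    using bigo_power_factor[OF _ e0(1), of _ "2*q+2"] O unfolding f_def \<psi>_def by blast
  \<comment> \<open>Strictly inside the disc of holomorphy \<open>k\<close> is bounded, and
    \<open>|x| \<le> 1\<close> lets powers of \<open>x\<close> be dropped from the bound on
    \<open>s\<close>.\<close>
  define \<epsilon> where "\<epsilon> = min 1 (e0 / 2)"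
  have \<epsilon>: "\<epsilon> > 0" "\<epsilon> < e0" "\<epsilon> \<le> 1" using e0 by (auto simp: \<epsilon>_def)
  have "compact (k ` cball 0 \<epsilon>)"
    by (intro compact_continuous_image continuous_on_subset[OF holomorphic_on_imp_continuous_on[OF k(1)]]) (use \<epsilon> in auto)
  then obtain M where M: "\<And>x. norm x \<le> \<epsilon> \<Longrightarrow> norm (k x) \<le> M"
    using compact_imp_bounded bounded_iff by (metis imageI mem_cball_0)
  have M0: "M \<ge> 0" using M[of 0] \<epsilon> by (metis norm_ge_zero norm_zero order_trans less_imp_le)
  have germ: "parabolic_germ l q V \<phi> \<psi> \<rho> \<epsilon> (norm C + M)"
  proof
    fix x :: complex assume x: "norm x < \<epsilon>"
    define s where "s = C * x ^ (q - 1) + x ^ q * k x / l"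
    have "norm s \<le> norm C * 1 + 1 * M"
    proof -
      have "norm (C * x ^ (q - 1)) \<le> norm C * 1" unfolding norm_mult norm_power
        using x \<epsilon> by (intro mult_left_mono power_le_one) auto
      moreover have "norm (x ^ q * k x / l) \<le> 1 * M" unfolding norm_divide norm_mult norm_power l div_by_1
        using x \<epsilon> M by (intro mult_mono power_le_one) auto
      ultimately show ?thesis unfolding s_def by (rule norm_triangle_le[OF add_mono])
    qed
    moreover have "f x = l * x * (1 + x ^ q + x ^ (q+1) * s)"
    proof -
      have e1: "x * x ^ (q+1) * x ^ (q - 1) = x ^ (2*q+1)" using q by (simp flip: power_add power_Suc add: mult_2)
      have e2: "x * x ^ (q+1) * x ^ q = x ^ (2*q+2)" by (simp flip: power_add power_Suc add: mult_2)
      have "l * x * (1 + x ^ q + x ^ (q+1) * s) = l * x * (1 + x ^ q) + l * C * (x * x ^ (q+1) * x ^ (q - 1)) + (x * x ^ (q+1) * x ^ q) * k x"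
        using l0 by (simp add: s_def field_simps)
      also have "\<dots> = l * x * (1 + x^q + C * x^(2*q)) + x ^ (2*q+2) * k x" unfolding e1 e2 by (simp add: algebra_simps)
      also have "\<dots> = f x" using k(2)[of x] x \<epsilon> by (simp add: algebra_simps)
      finally show ?thesis by simp
    qed
    ultimately show "parabolic_poly l (\<psi> x) \<in> V \<and> (\<exists>s. norm s \<le> norm C + M \<and> \<phi> (parabolic_poly l (\<psi> x)) = l * x * (1 + x ^ q + x ^ (q + 1) * s))"
      using PV[of x] x \<epsilon> by (auto simp: f_def)
  qed (use q l V \<phi> \<psi> \<phi>\<psi> \<psi>\<phi> \<psi>0 \<epsilon> e0\<rho> M0 in auto)
  define n where "n = (\<lambda>i. if i = 1 \<or> i = q+1 then l else if i = 2*q+1 then l * C else 0)"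
  have nsum: "(\<Sum>i<2*q+2. n i * x ^ i) = l * x * (1 + x^q + C * x^(2*q))" for x
  proof -
    have "(\<Sum>i<2*q+2. n i * x ^ i) = (\<Sum>i\<in>{1, q+1, 2*q+1}. n i * x ^ i)"
      by (rule sum.mono_neutral_right) (auto simp: n_def)
    also have "\<dots> = n 1 * x ^ 1 + (n (q+1) * x ^ (q+1) + n (2*q+1) * x ^ (2*q+1))"
      using q by (subst sum.insert; simp)
    finally show ?thesis using q by (simp add: n_def algebra_simps)
  qed
  show ?thesis
  proof (intro exI conjI)
    show "parabolic_germ l q V \<phi> (inv_into V \<phi>) \<rho> \<epsilon> (norm C + M)" using germ by (simp add: \<psi>_def)
    show "k holomorphic_on ball 0 \<epsilon>" using k(1) \<epsilon> by (auto intro: holomorphic_on_subset)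
    show "\<forall>x. norm x < \<epsilon> \<longrightarrow> \<phi> (parabolic_poly l (inv_into V \<phi> x)) = (\<Sum>i<2*q+2. n i * x ^ i) + x ^ (2*q+2) * k x"
    proof (intro allI impI)
      fix x :: complex assume "norm x < \<epsilon>"
      then have "f x = l * x * (1 + x^q + C * x^(2*q)) + x ^ (2*q+2) * k x" using k(2)[of x] \<epsilon> by (simp add: algebra_simps)
      then show "\<phi> (parabolic_poly l (inv_into V \<phi> x)) = (\<Sum>i<2*q+2. n i * x ^ i) + x ^ (2*q+2) * k x"
        unfolding nsum by (simp add: f_def \<psi>_def)
    qed
  qed (use \<epsilon> in \<open>auto simp: n_def\<close>)
qed

section \<open>Power series with parameters, and a Harnack estimate\<close>

lemma hol3_open_preimage:
  assumes "hol3 f S" "open S" "open A" shows "open {(a, x, t). (a, x, t) \<in> S \<and> f a x t \<in> A}"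
proof -
  have "open (S \<inter> (\<lambda>(a, x, t). f a x t) -` A)"
    using assms by (intro continuous_open_preimage hol3_continuous_on)
  moreover have "S \<inter> (\<lambda>(a, x, t). f a x t) -` A = {(a, x, t). (a, x, t) \<in> S \<and> f a x t \<in> A}" by auto
  ultimately show ?thesis by simp
qed

text \<open>The coefficients arise by repeatedly subtracting the value at \<open>x = 0\<close> and
  dividing by \<open>x\<close>. This makes them jointly holomorphic in \<open>a\<close> and
  \<open>t\<close>; on each slice they are the Taylor coefficients, which gives convergence on the
  whole disc.\<close>

lemma hol3_power_series:
  assumes f: "hol3 f (D \<times> ball 0 e \<times> T)" and D: "open D" and T: "open T" and e: "e > 0"
  shows "\<exists>\<alpha>. (\<forall>n. hol3 (\<lambda>a x t. \<alpha> n a t) (D \<times> UNIV \<times> T)) \<and>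
     (\<forall>a\<in>D. \<forall>t\<in>T. \<forall>x\<in>ball 0 e. (\<lambda>n. \<alpha> n a t * x ^ n) sums f a x t)"
proof -
  let ?S = "D \<times> ball 0 e \<times> T"
  have S: "open ?S" by (intro open_Times D T) auto
  have at0: "hol3 (\<lambda>a x t. g a 0 t) (D \<times> UNIV \<times> T)" if "hol3 g ?S" for g
    by (rule hol3_comp[OF that]) (use e in \<open>auto intro: hol3_intros\<close>)
  have "\<exists>W. (W 0 = f \<and> hol3 (W 0) ?S) \<and>
     (\<forall>n. hol3 (W (Suc n)) ?S \<and> (\<forall>a x t. (a, x, t) \<in> ?S \<longrightarrow> W n a x t - W n a 0 t = x * W (Suc n) a x t))"
  proof -
    have "\<exists>W. \<forall>n. (hol3 (W n) ?S \<and> (n = 0 \<longrightarrow> W n = f)) \<and>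
       (\<forall>a x t. (a, x, t) \<in> ?S \<longrightarrow> W n a x t - W n a 0 t = x * W (Suc n) a x t)"
    proof (rule dependent_nat_choice)
      show "\<exists>x. hol3 x ?S \<and> (0 = (0::nat) \<longrightarrow> x = f)" using f by blast
      fix W and n :: nat assume W: "hol3 W ?S \<and> (n = 0 \<longrightarrow> W = f)"
      have "hol3 (\<lambda>a x t. W a x t - W a 0 t) ?S"
        using W at0[of W] by (intro hol3_diff) (auto intro: hol3_subset)
      from hol3_divide_x[OF this S] obtain g where
        "hol3 g ?S" "\<forall>a x t. (a, x, t) \<in> ?S \<longrightarrow> W a x t - W a 0 t = x * g a x t" by auto
      then show "\<exists>y. (hol3 y ?S \<and> (Suc n = 0 \<longrightarrow> y = f)) \<and> (\<forall>a x t. (a, x, t) \<in> ?S \<longrightarrow> W a x t - W a 0 t = x * y a x t)"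
        by auto
    qed
    then show ?thesis by metis
  qed
  then obtain W where W0: "W 0 = f" and hW: "\<And>n. hol3 (W n) ?S"
    and WS: "\<And>n a x t. (a, x, t) \<in> ?S \<Longrightarrow> W n a x t - W n a 0 t = x * W (Suc n) a x t"
    by (metis not0_implies_Suc)
  have series: "(\<lambda>n. W n a 0 t * x ^ n) sums f a x t" if at: "a \<in> D" "t \<in> T" and x: "x \<in> ball 0 e" for a t x
  proof -
    have slice: "(\<lambda>x. W n a x t) holomorphic_on ball 0 e" for n
      by (rule hol3_slice[OF hW]) (use at in \<open>auto intro!: holomorphic_intros\<close>)
    have "(\<lambda>x. f a x t) holomorphic_on ball 0 e" using slice[of 0] W0 by simp
    note ps = holomorphic_power_series[OF this]
    define c where "c = (\<lambda>k. (deriv ^^ k) (\<lambda>x. f a x t) 0 / fact k)"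
    have c: "(\<lambda>k. c k * x ^ k) sums f a x t" if "x \<in> ball 0 e" for x
      using ps[OF that] by (simp add: c_def)
    have all: "\<forall>x\<in>ball 0 e. (\<lambda>k. c (n + k) * x ^ k) sums W n a x t" for n
    proof (induction n)
      case 0 then show ?case using c W0 by simp
    next
      case (Suc n)
      have cn: "W n a 0 t = c n" using bspec[OF Suc, of 0] e by simp
      have off: "(\<lambda>k. c (Suc n + k) * x ^ k) sums W (Suc n) a x t" if x: "x \<in> ball 0 e" "x \<noteq> 0" for x
      proof -
        have "(\<lambda>k. c (n + k) * x ^ k) sums W n a x t" using Suc x by blast
        then have "(\<lambda>k. c (n + Suc k) * x ^ Suc k) sums (W n a x t - c n)" by (subst sums_Suc_iff) simp
        then have "(\<lambda>k. c (n + Suc k) * x ^ Suc k / x) sums ((W n a x t - c n) / x)" by (rule sums_divide)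
        moreover have "(W n a x t - c n) / x = W (Suc n) a x t" using WS[of a x t n] cn x at by simp
        ultimately show ?thesis using x by (simp add: mult.commute)
      qed
      define y where "y = complex_of_real (e / 2)"
      have y: "y \<in> ball 0 e" "y \<noteq> 0" "norm y = e / 2" using e by (auto simp: y_def)
      have "isCont (\<lambda>x. \<Sum>k. c (Suc n + k) * x ^ k) 0"
        by (rule isCont_powser[of _ y]) (use sums_summable[OF off[OF y(1,2)]] y e in auto)
      then have 1: "((\<lambda>x. \<Sum>k. c (Suc n + k) * x ^ k) \<longlongrightarrow> c (Suc n)) (at 0)"
        by (simp add: isCont_def powser_zero)
      have "isCont (\<lambda>x. W (Suc n) a x t) 0"
        using slice[of "Suc n"] e by (rule holomorphic_isCont)
      then have 2: "((\<lambda>x. W (Suc n) a x t) \<longlongrightarrow> W (Suc n) a 0 t) (at 0)" by (simp add: isCont_def)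
      have "eventually (\<lambda>x. (\<Sum>k. c (Suc n + k) * x ^ k) = W (Suc n) a x t) (at 0)"
        unfolding eventually_at using off e by (intro exI[of _ e]) (auto simp: dist_norm sums_iff)
      from Lim_transform_eventually[OF 1 this] have "W (Suc n) a 0 t = c (Suc n)" using 2 LIM_unique by blast
      then have "(\<lambda>k. c (Suc n + k) * 0 ^ k) sums W (Suc n) a 0 t"
        using powser_sums_zero[of "\<lambda>k. c (Suc n + k)"] by simp
      then show ?case using off by metis
    qed
    have "W n a 0 t = c n" for n using bspec[OF all[of n], of 0] e by simp
    then show ?thesis using c[OF x] by simp
  qed
  show ?thesis
    by (rule exI[of _ "\<lambda>n a t. W n a 0 t"]) (use series at0[OF hW] in auto)
qed

text \<open>A Harnack-type estimate from the Schwarz lemma, applied to \<open>(L - L 0) / (L + cnj (L 0))\<close>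
  for a logarithm \<open>L\<close> of \<open>d\<close>.\<close>

lemma harnack_nonvanishing:
  assumes d: "d holomorphic_on ball 0 r" and r: "r > 0"
    and nz: "\<And>y. norm y < r \<Longrightarrow> d y \<noteq> 0" and lt: "\<And>y. norm y < r \<Longrightarrow> norm (d y) < 1" and y: "norm y < r"
  shows "(1 - (norm y / r)\<^sup>2) / 4 * (- ln (norm (d y))) \<le> - ln (norm (d 0))"
proof -
  have "\<exists>L. L holomorphic_on ball 0 r \<and> (\<forall>z\<in>ball 0 r. d z = exp (L z))"
    by (rule contractible_imp_holomorphic_log[OF d convex_imp_contractible[OF convex_ball]]) (use nz in auto)
  then obtain L where L: "L holomorphic_on ball 0 r" "\<And>z. norm z < r \<Longrightarrow> d z = exp (L z)" by auto
  have reL: "ln (norm (d z)) = Re (L z)" if "norm z < r" for z using L(2)[OF that] by simp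
  have neg: "Re (L z) < 0" if "norm z < r" for z
    using lt[OF that] L(2)[OF that] by simp
  define m where "m = (\<lambda>z. (L z - L 0) / (L z + cnj (L 0)))"
  have den: "L z + cnj (L 0) \<noteq> 0" if "norm z < r" for z
  proof
    assume "L z + cnj (L 0) = 0"
    then have "Re (L z + cnj (L 0)) = 0" by simp
    then have "Re (L z) + Re (L 0) = 0" by simp
    then show False using neg[OF that] neg[of 0] r by simp
  qed
  \<comment> \<open>This identity turns negativity of both real parts into
    \<open>|m z| \<le> 1\<close>.\<close>
  have id: "(norm (u + cnj v))\<^sup>2 - (norm (u - v))\<^sup>2 = 4 * Re u * Re v" for u v
    unfolding cmod_power2 by (simp add: power2_eq_square algebra_simps)
  have m_le: "norm (m z) \<le> 1" if "norm z < r" for z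
  proof -
    have "4 * Re (L z) * Re (L 0) \<ge> 0" using neg[OF that] neg[of 0] r by (intro mult_nonpos_nonpos) auto
    then have "(norm (L z - L 0))\<^sup>2 \<le> (norm (L z + cnj (L 0)))\<^sup>2" using id[of "L z" "L 0"] by linarith
    then have "norm (L z - L 0) \<le> norm (L z + cnj (L 0))" by (rule power2_le_imp_le) simp
    then show ?thesis using den[OF that] by (simp add: m_def norm_divide)
  qed
  have "norm (m y) \<le> 1 * norm y / r"
  proof (rule schwarz_scaled)
    show "m holomorphic_on ball 0 r" unfolding m_def
      by (intro holomorphic_intros L) (use den in auto)
  qed (use r y m_le in \<open>auto simp: m_def\<close>)
  then have "norm (L y - L 0) \<le> (norm y / r) * norm (L y + cnj (L 0))"
    using den[OF y] by (simp add: m_def norm_divide divide_le_eq)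
  then have "(norm (L y - L 0))\<^sup>2 \<le> ((norm y / r) * norm (L y + cnj (L 0)))\<^sup>2" by (intro power_mono) auto
  then have h: "(1 - (norm y / r)\<^sup>2) * (norm (L y + cnj (L 0)))\<^sup>2 \<le> 4 * Re (L y) * Re (L 0)"
    using id[of "L y" "L 0"] unfolding power_mult_distrib left_diff_distrib by linarith
  \<comment> \<open>With \<open>A\<close> and \<open>A0\<close> positive,
    \<open>|L y + cnj (L 0)|\<close> is at least \<open>A + A0 \<ge> A\<close>, so one factor
    \<open>A\<close> cancels from the squared Schwarz estimate and a linear one is left.\<close>
  define A where "A = - Re (L y)"
  define A0 where "A0 = - Re (L 0)"
  have A: "A > 0" "A0 > 0" using neg[OF y] neg[of 0] r by (auto simp: A_def A0_def)
  have k: "0 \<le> 1 - (norm y / r)\<^sup>2" using y r by (simp add: power_le_one)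
  have "A\<^sup>2 \<le> (A + A0)\<^sup>2" using A by (intro power_mono) auto
  also have "\<dots> = (Re (L y + cnj (L 0)))\<^sup>2" by (simp add: A_def A0_def power2_eq_square algebra_simps)
  also have "\<dots> \<le> (norm (L y + cnj (L 0)))\<^sup>2" by (simp add: cmod_power2)
  finally have "(1 - (norm y / r)\<^sup>2) * A\<^sup>2 \<le> 4 * A * A0"
    using h mult_left_mono[OF _ k] by (fastforce simp: A_def A0_def)
  then have "A * ((1 - (norm y / r)\<^sup>2) * A) \<le> A * (4 * A0)" by (simp add: power2_eq_square mult_ac)
  then have "(1 - (norm y / r)\<^sup>2) * A \<le> 4 * A0" using A by simp
  then show ?thesis using reL[OF y] reL[of 0] r by (simp add: A_def A0_def)
qed

section \<open>The coordinate change\<close>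

text \<open>\<open>Y a\<close> is a small perturbation of the identity and has an inverse
  \<open>\<eta> a\<close>, so the curve is a graph over \<open>y\<close>. The radii descend because
  each tool costs room: the curve exists on \<open>r+6\<close>, \<open>Y a\<close> is
  \<open>1/4\<close>-close to the identity on \<open>r+5\<close>, by Cauchy the difference is
  \<open>1/2\<close>-Lipschitz on \<open>r+4\<close>, and inversion leaves more than
  \<open>r+3\<close>.\<close>

lemma stable_curve_chart:
  assumes l: "norm l = 1" and r: "r > 0" and e: "e > 0"
  shows "\<exists>\<delta>>0. \<delta> \<le> 1/4 \<and> (\<exists>X Y \<eta> :: complex \<Rightarrow> complex \<Rightarrow> complex.
     hol3 (\<lambda>a x t. X a t) (ball 0 \<delta> \<times> UNIV \<times> ball 0 (r+4)) \<and>
     hol3 (\<lambda>a x t. Y a t) (ball 0 \<delta> \<times> UNIV \<times> ball 0 (r+4)) \<and>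
     hol3 (\<lambda>a x t. \<eta> a t) (ball 0 \<delta> \<times> UNIV \<times> ball 0 (r+3)) \<and>
     (\<forall>a t. norm a < \<delta> \<longrightarrow> norm t < r+4 \<longrightarrow>
        X a (small_eigenvalue l a * t) = (X a t)^2 + curve_c l a + a * Y a t \<and>
        Y a (small_eigenvalue l a * t) = a * X a t \<and> norm (X a t - l / 2) \<le> e) \<and>
     (\<forall>a. X a 0 = fixed_x l a \<and> Y a 0 = a * fixed_x l a) \<and>
     (\<forall>t. X 0 t = l / 2 \<and> Y 0 t = t) \<and>
     (\<forall>a. norm a < \<delta> \<longrightarrow> (Y a has_field_derivative 1) (at 0) \<and> (X a has_field_derivative (- a / l)) (at 0)) \<and>
     (\<forall>a y. norm a < \<delta> \<longrightarrow> norm y < r+3 \<longrightarrow> Y a (\<eta> a y) = y \<and> norm (\<eta> a y - y) \<le> 1/4) \<and>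
     (\<forall>a t. norm a < \<delta> \<longrightarrow> norm t < r+2 \<longrightarrow> norm (Y a t) < r+3 \<and> \<eta> a (Y a t) = t))"
proof -
  have r6: "r + 6 > 0" using r by simp
  obtain \<delta>1 X Y where \<delta>1: "\<delta>1 > 0" "\<delta>1 \<le> 1/4"
    and X: "hol3 (\<lambda>a x t. X a t) (ball 0 \<delta>1 \<times> UNIV \<times> ball 0 (r+6))"
    and Y: "hol3 (\<lambda>a x t. Y a t) (ball 0 \<delta>1 \<times> UNIV \<times> ball 0 (r+6))"
    and eqs: "\<And>a t. norm a < \<delta>1 \<Longrightarrow> norm t < r+6 \<Longrightarrow>
        X a (small_eigenvalue l a * t) = (X a t)^2 + curve_c l a + a * Y a t \<and>
        Y a (small_eigenvalue l a * t) = a * X a t"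
    and at0: "\<And>a. X a 0 = fixed_x l a \<and> Y a 0 = a * fixed_x l a"
    and a0: "\<And>t. X 0 t = l / 2 \<and> Y 0 t = t"
    and der: "\<And>a. norm a < \<delta>1 \<Longrightarrow> (Y a has_field_derivative 1) (at 0) \<and> (X a has_field_derivative (- a / l)) (at 0)"
    using strong_stable_curve[OF l r6] by blast
  obtain \<delta>2 where \<delta>2: "\<delta>2 > 0" "\<delta>2 \<le> \<delta>1"
    and Xs: "\<And>a x t. norm a < \<delta>2 \<Longrightarrow> x \<in> {0} \<Longrightarrow> t \<in> cball 0 (r+5) \<Longrightarrow> X a t \<in> ball (l/2) e"
    by (rule hol3_small_parameter[OF X, of "{0}" "cball 0 (r+5)" "ball (l/2) e"]) (use \<delta>1 e in \<open>auto simp: a0\<close>)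
  have E: "hol3 (\<lambda>a x t. Y a x - x) (ball 0 \<delta>1 \<times> ball 0 (r+6) \<times> UNIV)"
    using hol3_swap[OF Y] by (intro hol3_diff hol3_x)
  obtain \<delta> where \<delta>: "\<delta> > 0" "\<delta> \<le> \<delta>2"
    and Es: "\<And>a x t. norm a < \<delta> \<Longrightarrow> x \<in> cball 0 (r+5) \<Longrightarrow> t \<in> {0} \<Longrightarrow> Y a x - x \<in> ball 0 (1/4)"
  proof (rule hol3_small_parameter[of "\<lambda>a x t. Y a x - x" \<delta>2 "ball 0 (r+6)" UNIV "cball 0 (r+5)" "{0}" "ball 0 (1/4)"])
    show "hol3 (\<lambda>a x t. Y a x - x) (ball 0 \<delta>2 \<times> ball 0 (r+6) \<times> UNIV)"
      by (rule hol3_subset[OF E]) (use \<delta>2 in auto)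
  qed (use a0 \<delta>2 in auto)
  have \<delta>': "\<delta> \<le> 1/4" "\<delta> \<le> \<delta>1" using \<delta> \<delta>2 \<delta>1 by auto
  have Ebd: "norm (Y a x - x) \<le> 1/4" if "norm a < \<delta>" "norm x \<le> r+5" for a x
    using Es[of a x 0] that by simp
  have Elip: "norm ((Y a x - x) - (Y a x' - x')) \<le> 1/2 * norm (x - x')"
    if a: "norm a < \<delta>" and x: "x \<in> ball 0 (r+4)" "x' \<in> ball 0 (r+4)" for a x x'
  proof -
    have "(\<lambda>x. Y a x - x) holomorphic_on ball 0 (r+5)"
      by (rule hol3_slice[OF E, of _ "\<lambda>_. a" "\<lambda>x. x" "\<lambda>_. 0"]) (use a \<delta>' in \<open>auto intro!: holomorphic_intros\<close>)
    then have "norm ((Y a x - x) - (Y a x' - x')) \<le> 2 * (1/4) / 1 * norm (x - x')"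
      by (rule holomorphic_lipschitz) (use Ebd a x in auto)
    then show ?thesis by simp
  qed
  obtain s where s: "hol3 s (ball 0 \<delta> \<times> ball 0 (r + 4 - 1/4) \<times> UNIV)"
    and s1: "\<And>a w t. a \<in> ball 0 \<delta> \<Longrightarrow> w \<in> ball 0 (r + 4 - 1/4) \<Longrightarrow> t \<in> UNIV \<Longrightarrow>
        norm (s a w t) < r + 4 \<and> norm (s a w t - w) \<le> 1/4 \<and> s a w t + (Y a (s a w t) - s a w t) = w"
    and s2: "\<And>a x w t. a \<in> ball 0 \<delta> \<Longrightarrow> x \<in> ball 0 (r + 4) \<Longrightarrow> t \<in> UNIV \<Longrightarrow> w \<in> ball 0 (r + 4 - 1/4) \<Longrightarrow>
        x + (Y a x - x) = w \<Longrightarrow> x = s a w t"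
  proof (rule hol3_fixpoint[of "\<lambda>a x t. Y a x - x" "ball 0 \<delta>" "r+4" UNIV "1/4"])
    show "hol3 (\<lambda>a x t. Y a x - x) (ball 0 \<delta> \<times> ball 0 (r+4) \<times> UNIV)"
      by (rule hol3_subset[OF E]) (use \<delta>' in auto)
  qed (use Ebd Elip in auto)
  define \<eta> where "\<eta> = (\<lambda>a y. s a y 0)"
  have "hol3 (\<lambda>a x t. \<eta> a t) (ball 0 \<delta> \<times> UNIV \<times> ball 0 (r+3))"
    unfolding \<eta>_def by (rule hol3_comp[OF s]) (auto intro: hol3_intros)
  moreover have "hol3 (\<lambda>a x t. X a t) (ball 0 \<delta> \<times> UNIV \<times> ball 0 (r+4))"
    by (rule hol3_subset[OF X]) (use \<delta>' in auto)
  moreover have "hol3 (\<lambda>a x t. Y a t) (ball 0 \<delta> \<times> UNIV \<times> ball 0 (r+4))"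
    by (rule hol3_subset[OF Y]) (use \<delta>' in auto)
  moreover have "norm (X a t - l / 2) \<le> e" if "norm a < \<delta>" "norm t < r+4" for a t
    using Xs[of a 0 t] that \<delta> by (simp add: dist_norm norm_minus_commute)
  moreover have "Y a (\<eta> a y) = y \<and> norm (\<eta> a y - y) \<le> 1/4" if "norm a < \<delta>" "norm y < r+3" for a y
    using s1[of a y 0] that by (simp add: \<eta>_def)
  moreover have "norm (Y a t) < r+3 \<and> \<eta> a (Y a t) = t" if "norm a < \<delta>" "norm t < r+2" for a t
  proof -
    have "norm (Y a t) \<le> norm t + norm (Y a t - t)" by (metis add_diff_cancel_left' diff_add_cancel norm_triangle_ineq)
    then have "norm (Y a t) < r+3" using Ebd[of a t] that by simp
    then show ?thesis using s2[of a t 0 "Y a t"] that by (simp add: \<eta>_def)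
  qed
  ultimately show ?thesis
    using \<delta> \<delta>' eqs at0 a0 der
    by (intro exI[of _ \<delta>] conjI, simp, simp) (rule exI[of _ X], rule exI[of _ Y], rule exI[of _ \<eta>], auto)
qed

section \<open>The Henon map in straightened coordinates\<close>

text \<open>In \<open>X_near\<close> the bound \<open>1\<close> controls the size of
  \<open>x\<close>, and \<open>\<rho>' / 4\<close> keeps the argument of \<open>\<phi>\<close> in
  the doubled disc after straightening. The radius \<open>\<epsilon>\<close> may be smaller than
  \<open>\<epsilon>\<^sub>0\<close>, so that \<open>|\<psi>| < 2\<close> can be required on
  it.\<close>

locale stable_chart = parabolic_germ l q V \<phi> \<psi> \<rho> \<epsilon>\<^sub>0 K
  for l :: complex and q :: nat and V :: "complex set" and \<phi> \<psi> :: "complex \<Rightarrow> complex" and \<rho> \<epsilon>\<^sub>0 K :: real +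
  fixes \<rho>' r \<delta> \<epsilon> :: real and X Y \<eta> :: "complex \<Rightarrow> complex \<Rightarrow> complex"
  assumes \<rho>': "\<rho>' > 0" "ball (l / 2) (2 * \<rho>') \<subseteq> V" and r: "r > 3"
    and \<delta>: "0 < \<delta>" "\<delta> \<le> 1/4" and \<epsilon>_pos: "0 < \<epsilon>" and \<epsilon>_le: "\<epsilon> \<le> \<epsilon>\<^sub>0"
    and X: "hol3 (\<lambda>a x t. X a t) (ball 0 \<delta> \<times> UNIV \<times> ball 0 (r+4))"
    and Y: "hol3 (\<lambda>a x t. Y a t) (ball 0 \<delta> \<times> UNIV \<times> ball 0 (r+4))"
    and \<eta>: "hol3 (\<lambda>a x t. \<eta> a t) (ball 0 \<delta> \<times> UNIV \<times> ball 0 (r+3))"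
    and curve: "\<And>a t. norm a < \<delta> \<Longrightarrow> norm t < r+4 \<Longrightarrow> X a (small_eigenvalue l a * t) = (X a t)^2 + curve_c l a + a * Y a t"
       "\<And>a t. norm a < \<delta> \<Longrightarrow> norm t < r+4 \<Longrightarrow> Y a (small_eigenvalue l a * t) = a * X a t"
    and X_near: "\<And>a t. norm a < \<delta> \<Longrightarrow> norm t < r+4 \<Longrightarrow> norm (X a t - l / 2) \<le> min 1 (\<rho>' / 4)"
    and XY_at_0: "\<And>a. X a 0 = fixed_x l a" "\<And>a. Y a 0 = a * fixed_x l a"
    and XY_0: "\<And>t. X 0 t = l / 2" "\<And>t. Y 0 t = t"
    and XY_deriv: "\<And>a. norm a < \<delta> \<Longrightarrow> (Y a has_field_derivative 1) (at 0)"
       "\<And>a. norm a < \<delta> \<Longrightarrow> (X a has_field_derivative (- a / l)) (at 0)"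
    and Y\<eta>: "\<And>a y. norm a < \<delta> \<Longrightarrow> norm y < r+3 \<Longrightarrow> Y a (\<eta> a y) = y"
    and \<eta>_near: "\<And>a y. norm a < \<delta> \<Longrightarrow> norm y < r+3 \<Longrightarrow> norm (\<eta> a y - y) \<le> 1/4"
    and \<eta>Y: "\<And>a t. norm a < \<delta> \<Longrightarrow> norm t < r+2 \<Longrightarrow> norm (Y a t) < r+3 \<and> \<eta> a (Y a t) = t"
    and \<psi>_bound: "\<And>x. norm x < \<epsilon> \<Longrightarrow> norm (\<psi> x) < 2"
begin

text \<open>In the coordinates \<open>(u, t)\<close> with \<open>u = \<phi> (x - X a t + l / 2)\<close> and \<open>t = \<eta> a y\<close> the Henon map is
  \<open>(u, t) \<mapsto> (F a u t, G a u t)\<close>; \<open>base\<close> recovers \<open>x\<close>, and \<open>shifted\<close> is the argument of \<open>\<phi>\<close> in \<open>F\<close>.\<close>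

definition base :: "complex \<Rightarrow> complex \<Rightarrow> complex \<Rightarrow> complex" where
  "base a u t = \<psi> u + X a t - l / 2"

definition G :: "complex \<Rightarrow> complex \<Rightarrow> complex \<Rightarrow> complex" where
  "G a u t = \<eta> a (a * base a u t)"

definition shifted :: "complex \<Rightarrow> complex \<Rightarrow> complex \<Rightarrow> complex" where
  "shifted a u t = (base a u t)^2 + curve_c l a + a * Y a t - X a (G a u t) + l / 2"

definition F :: "complex \<Rightarrow> complex \<Rightarrow> complex \<Rightarrow> complex" where
  "F a u t = \<phi> (shifted a u t)"

lemma l_nonzero: "l \<noteq> 0" using l by auto

lemma mu_bound: "norm a < \<delta> \<Longrightarrow> norm (small_eigenvalue l a) \<le> norm a / 4"
  "norm a < \<delta> \<Longrightarrow> norm (small_eigenvalue l a) \<le> 1/16"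
proof -
  assume a: "norm a < \<delta>"
  have "norm (small_eigenvalue l a) = norm a * norm a"
    using l by (simp add: small_eigenvalue_def norm_divide norm_mult power2_eq_square)
  also have "\<dots> \<le> norm a * (1/4)" using a \<delta> by (intro mult_left_mono) auto
  finally show 1: "norm (small_eigenvalue l a) \<le> norm a / 4" by simp
  then show "norm (small_eigenvalue l a) \<le> 1/16" using a \<delta> by simp
qed

lemma \<epsilon>_rho: "\<epsilon> \<le> \<rho>" using \<epsilon>_le \<epsilon> by simp

lemma half_l_in_V: "l / 2 \<in> V" using \<rho>' by auto

lemma phi_half_l: "\<phi> (l / 2) = 0" using \<phi>\<psi>[of 0] \<psi>0 \<epsilon> by auto

lemma \<eta>_0: "norm y < r+2 \<Longrightarrow> \<eta> 0 y = y" using \<eta>Y[of 0 y] XY_0 \<delta> by simp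

lemma base_bound:
  assumes "norm a < \<delta>" "norm u < \<epsilon>" "norm t < r+4" shows "norm (base a u t) \<le> 3"
proof -
  have "norm (\<psi> u + (X a t - l / 2)) \<le> 2 + 1"
    using \<psi>_bound[OF assms(2)] X_near[OF assms(1,3)] by (intro norm_triangle_le add_mono) auto
  then show ?thesis by (simp add: base_def add_diff_eq)
qed

lemma a_base_bound:
  assumes "norm a < \<delta>" "norm u < \<epsilon>" "norm t < r+4" shows "norm (a * base a u t) \<le> 3/4"
proof -
  have "norm a * norm (base a u t) \<le> 1/4 * 3" using base_bound[OF assms] assms \<delta> by (intro mult_mono) auto
  then show ?thesis by (simp add: norm_mult)
qed

lemma G_small:
  assumes "norm a < \<delta>" "norm u < \<epsilon>" "norm t < r+4" shows "norm (G a u t) \<le> 1"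
proof -
  have "norm (G a u t - a * base a u t) \<le> 1/4"
    unfolding G_def using a_base_bound[OF assms] r by (intro \<eta>_near assms) simp
  then show ?thesis using a_base_bound[OF assms] norm_triangle_sub[of "G a u t" "a * base a u t"] by simp
qed

lemma hol3_base: "hol3 base (ball 0 \<delta> \<times> ball 0 \<rho> \<times> ball 0 (r+4))"
  unfolding base_def by (intro hol3_intros hol3_subset[OF X] hol3_holomorphic[OF \<psi>]) auto

lemma hol3_G: "hol3 G (ball 0 \<delta> \<times> ball 0 \<epsilon> \<times> ball 0 (r+4))"
  unfolding G_def
  by (rule hol3_comp[OF \<eta>])
     (use \<epsilon>_rho le_less_trans[OF a_base_bound] r in \<open>auto intro!: hol3_intros hol3_subset[OF hol3_base]\<close>)

lemma hol3_curve_c: "hol3 (\<lambda>a x t. curve_c l a) S"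
  by (rule hol3_holomorphic[where g = "curve_c l" and A = UNIV])
     (use l_nonzero in \<open>auto simp: curve_c_def[abs_def] fixed_x_def intro!: holomorphic_intros hol3_intros\<close>)

lemma hol3_shifted: "hol3 shifted (ball 0 \<delta> \<times> ball 0 \<epsilon> \<times> ball 0 (r+4))"
proof -
  have "hol3 (\<lambda>a u t. X a (G a u t)) (ball 0 \<delta> \<times> ball 0 \<epsilon> \<times> ball 0 (r+4))"
    by (rule hol3_comp[OF X _ _ hol3_G]) (use le_less_trans[OF G_small] r in \<open>auto intro!: hol3_intros\<close>)
  moreover have "hol3 base (ball 0 \<delta> \<times> ball 0 \<epsilon> \<times> ball 0 (r+4))"
    by (rule hol3_subset[OF hol3_base]) (use \<epsilon>_rho in auto)
  ultimately show ?thesis unfolding shifted_def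
    by (intro hol3_add hol3_diff hol3_power hol3_mult hol3_curve_c hol3_a hol3_const hol3_subset[OF Y]) auto
qed

lemma shifted_0: "norm u < \<epsilon> \<Longrightarrow> norm t < r+4 \<Longrightarrow> shifted 0 u t = parabolic_poly l (\<psi> u)"
  by (simp add: shifted_def base_def XY_0 curve_c_def fixed_x_def parabolic_poly_def power2_eq_square)

lemma mu_t_bound: "norm a < \<delta> \<Longrightarrow> norm (small_eigenvalue l a * t) \<le> norm t"
proof -
  assume "norm a < \<delta>"
  then have "norm (small_eigenvalue l a) * norm t \<le> 1 * norm t" using mu_bound(2)[of a] by (intro mult_right_mono) auto
  then show ?thesis by (simp add: norm_mult)
qed

lemma G_at_0: assumes "norm a < \<delta>" "norm t < r+2" shows "G a 0 t = small_eigenvalue l a * t"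
proof -
  have "G a 0 t = \<eta> a (Y a (small_eigenvalue l a * t))"
    using assms r curve(2)[of a t] by (simp add: G_def base_def \<psi>0)
  also have "\<dots> = small_eigenvalue l a * t"
    using \<eta>Y[of a "small_eigenvalue l a * t"] mu_t_bound[OF assms(1), of t] assms by simp
  finally show ?thesis .
qed

lemma shifted_at_0: assumes "norm a < \<delta>" "norm t < r+2" shows "shifted a 0 t = l / 2"
  using curve(1)[of a t] assms by (simp add: shifted_def base_def G_at_0[OF assms] \<psi>0)

lemma F_at_0: assumes "norm a < \<delta>" "norm t < r+2" shows "F a 0 t = 0"
  by (simp add: F_def shifted_at_0[OF assms] phi_half_l)

lemma eta_deriv: assumes a: "norm a < \<delta>" shows "(\<eta> a has_field_derivative 1) (at (a * fixed_x l a))"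
proof -
  have Y0: "Y a 0 = a * fixed_x l a" by (rule XY_at_0)
  have "norm (Y a 0) < r+3" using \<eta>Y[of a 0] a r by simp
  then have "(\<lambda>t. \<eta> a t) field_differentiable at (Y a 0)"
    using hol3_slices(3)[OF \<eta>, of a 0 "Y a 0"] a by simp
  then obtain D where D: "(\<eta> a has_field_derivative D) (at (Y a 0))" by (auto simp: field_differentiable_def)
  have "((\<lambda>t. \<eta> a (Y a t)) has_field_derivative D * 1) (at 0)"
    by (rule DERIV_chain2[OF D XY_deriv(1)[OF a]])
  then have "((\<lambda>t. t) has_field_derivative D * 1) (at 0)"
    by (rule has_field_derivative_transform_within_open[where S = "ball 0 (r+2)"]) (use \<eta>Y a r in auto)
  then have "D * 1 = 1" by (rule DERIV_unique[OF _ DERIV_ident])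
  then have "D = 1" by simp
  then show ?thesis using D Y0 by simp
qed

text \<open>The multiplier transverse to the curve is the other eigenvalue:
  \<open>2 * fixed_x l a = l - a^2 / l\<close>, and subtracting \<open>X\<close> along the curve
  restores exactly \<open>a^2 / l\<close>. This supplies \<open>A a 0 0 = l\<close>, the solvability
  condition for the linear coefficient.\<close>

lemma F_deriv: assumes a: "norm a < \<delta>" shows "((\<lambda>u. F a u 0) has_field_derivative l) (at 0)"
proof -
  define p where "p = deriv \<psi> 0"
  define f where "f = deriv \<phi> (l / 2)"
  have p: "(\<psi> has_field_derivative p) (at 0)"
    unfolding p_def by (rule holomorphic_derivI[OF \<psi>]) (use \<epsilon> in auto)
  have f: "(\<phi> has_field_derivative f) (at (l / 2))"
    unfolding f_def by (rule holomorphic_derivI[OF \<phi> V half_l_in_V])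
  have "((\<lambda>x. \<phi> (\<psi> x)) has_field_derivative f * p) (at 0)"
    by (rule DERIV_chain2[OF _ p]) (simp add: f \<psi>0)
  then have "((\<lambda>x. x) has_field_derivative f * p) (at 0)"
    by (rule has_field_derivative_transform_within_open[where S = "ball 0 \<rho>"]) (use \<phi>\<psi> \<epsilon> in auto)
  then have fp: "f * p = 1" using DERIV_ident DERIV_unique by blast
  have b: "((\<lambda>u. base a u 0) has_field_derivative p) (at 0)"
    unfolding base_def by (auto intro!: derivative_eq_intros p)
  have b0: "base a 0 0 = fixed_x l a" by (simp add: base_def \<psi>0 XY_at_0)
  have "((\<lambda>u. a * base a u 0) has_field_derivative a * p) (at 0)" by (rule DERIV_cmult[OF b])
  then have g: "((\<lambda>u. G a u 0) has_field_derivative 1 * (a * p)) (at 0)"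
    unfolding G_def by (intro DERIV_chain2[where f = "\<eta> a"]) (use eta_deriv[OF a] b0 in auto)
  have g0: "G a 0 0 = 0" using G_at_0[OF a, of 0] r by simp
  have x: "((\<lambda>u. X a (G a u 0)) has_field_derivative (- a / l) * (1 * (a * p))) (at 0)"
    by (rule DERIV_chain2[where f = "X a", OF _ g]) (use XY_deriv(2)[OF a] g0 in simp)
  have s: "((\<lambda>u. shifted a u 0) has_field_derivative (2 * fixed_x l a * p - (- a / l) * (1 * (a * p)))) (at 0)"
    unfolding shifted_def by (rule derivative_eq_intros b x refl)+ (simp add: b0)
  have "2 * fixed_x l a * p - (- a / l) * (1 * (a * p)) = l * p"
    using l_nonzero by (simp add: fixed_x_def field_simps power2_eq_square)
  then have s': "((\<lambda>u. shifted a u 0) has_field_derivative l * p) (at 0)" using s by simp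
  have "((\<lambda>u. F a u 0) has_field_derivative f * (l * p)) (at 0)"
    unfolding F_def by (rule DERIV_chain2[OF _ s']) (use f r in \<open>simp add: shifted_at_0[OF a, of 0]\<close>)
  moreover have "f * (l * p) = l" using fp by (simp add: mult.left_commute)
  ultimately show ?thesis by simp
qed

end

lemma stable_chart_mono:
  assumes "stable_chart l q V \<phi> \<psi> \<rho> \<epsilon>0 K \<rho>' r \<delta> \<epsilon> X Y \<eta>" "0 < \<delta>'" "\<delta>' \<le> \<delta>" "0 < \<epsilon>'" "\<epsilon>' \<le> \<epsilon>"
  shows "stable_chart l q V \<phi> \<psi> \<rho> \<epsilon>0 K \<rho>' r \<delta>' \<epsilon>' X Y \<eta>"
proof -
  interpret stable_chart l q V \<phi> \<psi> \<rho> \<epsilon>0 K \<rho>' r \<delta> \<epsilon> X Y \<eta> by (rule assms)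
  have a: "norm a < \<delta>" if "norm a < \<delta>'" for a :: complex using that assms by simp
  show ?thesis
  proof
    show "norm (X a t - l / 2) \<le> min 1 (\<rho>' / 4)" if "norm a < \<delta>'" "norm t < r+4" for a t
      by (rule X_near[OF a that(2)]) (rule that(1))
    show "(Y a has_field_derivative 1) (at 0)" "(X a has_field_derivative (- a / l)) (at 0)" if "norm a < \<delta>'" for a
      by (rule XY_deriv[OF a[OF that]])+
    show "Y a (\<eta> a y) = y" if "norm a < \<delta>'" "norm y < r+3" for a y by (rule Y\<eta>[OF a that(2)]) (rule that(1))
    show "norm (\<eta> a y - y) \<le> 1/4" if "norm a < \<delta>'" "norm y < r+3" for a y by (rule \<eta>_near[OF a that(2)]) (rule that(1))
    show "X 0 t = l / 2" for t by (rule XY_0)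
  qed (use assms \<rho>' r \<delta> \<epsilon>_le XY_at_0 XY_0 a curve \<eta>Y \<psi>_bound in
        \<open>auto intro!: hol3_subset[OF X] hol3_subset[OF Y] hol3_subset[OF \<eta>]\<close>)
qed

section \<open>The normalized chart\<close>

text \<open>The bound in \<open>B_near\<close> gives \<open>|T a u t - u| \<le> 1/4\<close> for
  \<open>|u| \<le> \<rho> + 2\<close>, so \<open>T a\<close> is invertible beyond the disc of radius
  \<open>\<rho>\<close>. \<open>T_image\<close> is imposed on the radius
  \<open>3/2 * \<rho>'\<close> because straightening moves the argument. The last assumption
  restates the normal form with a bounded \<open>s\<close>, ready for the petal estimate.\<close>

locale henon_chart = stable_chart +
  fixes T B rem :: "complex \<Rightarrow> complex \<Rightarrow> complex \<Rightarrow> complex" and C :: "complex \<Rightarrow> complex" and K\<^sub>s :: real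
  assumes shifted_V: "\<And>a u t. norm a < \<delta> \<Longrightarrow> norm u < \<epsilon> \<Longrightarrow> norm t < r + 3/2 \<Longrightarrow> shifted a u t \<in> V"
    and B: "hol3 B (ball 0 \<delta> \<times> UNIV \<times> ball 0 (r + 3/2))"
    and rem: "hol3 rem (ball 0 \<delta> \<times> ball 0 \<epsilon> \<times> ball 0 (r + 3/2))"
    and T: "\<And>a u t. T a u t = u * B a u t"
    and B_0: "\<And>u t. norm t < r + 3/2 \<Longrightarrow> B 0 u t = 1"
    and B_near: "\<And>a u t. norm a < \<delta> \<Longrightarrow> norm u \<le> \<rho> + 2 \<Longrightarrow> norm t \<le> r+1 \<Longrightarrow> norm (B a u t - 1) \<le> 1 / (4 * (\<rho> + 2))"
    and T_image: "\<And>a x t. norm a < \<delta> \<Longrightarrow> dist (l / 2) x \<le> 3/2 * \<rho>' \<Longrightarrow> norm t \<le> r+1 \<Longrightarrow> norm (T a (\<phi> x) t) < \<rho>"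
    and normal: "\<And>a u t. norm a < \<delta> \<Longrightarrow> norm u < \<epsilon> \<Longrightarrow> norm t < r + 3/2 \<Longrightarrow>
       T a (F a u t) (G a u t) = l * (T a u t + T a u t ^ (q+1) + C a * T a u t ^ (2*q+1)) + u ^ (2*q+2) * rem a u t"
    and K\<^sub>s: "K\<^sub>s \<ge> 0" "\<And>a u t. norm a < \<delta> \<Longrightarrow> norm u < \<epsilon> \<Longrightarrow> norm t \<le> r+1 \<Longrightarrow>
       \<exists>s. norm s \<le> K\<^sub>s \<and> T a (F a u t) (G a u t) = l * T a u t * (1 + T a u t ^ q + T a u t ^ (q+1) * s)"

text \<open>At \<open>a = 0\<close> everything is explicit: \<open>shifted\<close> is the polynomial
  after \<open>\<psi>\<close>, the linear coefficient is \<open>l\<close> and \<open>B\<close> is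
  \<open>1\<close>. The successive parameter radii let the required conditions persist.\<close>

lemma henon_chart_exists:
  assumes germ: "parabolic_germ l q V \<phi> \<psi> \<rho> \<epsilon>0 K" and \<epsilon>0: "\<epsilon>0 \<le> 1"
    and root: "\<And>i. l ^ i = 1 \<longleftrightarrow> q dvd i"
    and k: "k holomorphic_on ball 0 \<epsilon>0" and n: "n 1 = l" "n (q+1) = l" "\<And>i. i \<notin> {1, q+1, 2*q+1} \<Longrightarrow> n i = 0"
    and nf: "\<And>x. norm x < \<epsilon>0 \<Longrightarrow> \<phi> (parabolic_poly l (\<psi> x)) = (\<Sum>i<2*q+2. n i * x ^ i) + x ^ (2*q+2) * k x"
    and \<rho>': "\<rho>' > 0" "ball (l / 2) (2 * \<rho>') \<subseteq> V" and r: "r > 3"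
  shows "\<exists>\<delta> \<epsilon> X Y \<eta> T B rem C K\<^sub>s. henon_chart l q V \<phi> \<psi> \<rho> \<epsilon>0 K \<rho>' r \<delta> \<epsilon> X Y \<eta> T B rem C K\<^sub>s"
proof -
  interpret g: parabolic_germ l q V \<phi> \<psi> \<rho> \<epsilon>0 K by (rule germ)
  have r0: "r > 0" and e: "min 1 (\<rho>' / 4) > 0" using r \<rho>' by auto
  have l0: "l \<noteq> 0" using g.l by auto
  obtain \<delta>1 X Y \<eta> where \<delta>1: "\<delta>1 > 0" "\<delta>1 \<le> 1/4"
     and h: "hol3 (\<lambda>a x t. X a t) (ball 0 \<delta>1 \<times> UNIV \<times> ball 0 (r+4))"
     "hol3 (\<lambda>a x t. Y a t) (ball 0 \<delta>1 \<times> UNIV \<times> ball 0 (r+4))"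
     "hol3 (\<lambda>a x t. \<eta> a t) (ball 0 \<delta>1 \<times> UNIV \<times> ball 0 (r+3))"
     "\<forall>a t. norm a < \<delta>1 \<longrightarrow> norm t < r+4 \<longrightarrow>
        X a (small_eigenvalue l a * t) = (X a t)^2 + curve_c l a + a * Y a t \<and>
        Y a (small_eigenvalue l a * t) = a * X a t \<and> norm (X a t - l / 2) \<le> min 1 (\<rho>' / 4)"
     "\<forall>a. X a 0 = fixed_x l a \<and> Y a 0 = a * fixed_x l a"
     "\<forall>t. X 0 t = l / 2 \<and> Y 0 t = t"
     "\<forall>a. norm a < \<delta>1 \<longrightarrow> (Y a has_field_derivative 1) (at 0) \<and> (X a has_field_derivative (- a / l)) (at 0)"
     "\<forall>a y. norm a < \<delta>1 \<longrightarrow> norm y < r+3 \<longrightarrow> Y a (\<eta> a y) = y \<and> norm (\<eta> a y - y) \<le> 1/4"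
     "\<forall>a t. norm a < \<delta>1 \<longrightarrow> norm t < r+2 \<longrightarrow> norm (Y a t) < r+3 \<and> \<eta> a (Y a t) = t"
    using stable_curve_chart[OF g.l(2) r0 e] by blast
  have "isCont \<psi> 0" using g.\<psi> g.\<epsilon> by (intro holomorphic_isCont) auto
  moreover have "norm (\<psi> 0) < 2" unfolding g.\<psi>0 using g.l by (simp add: norm_divide)
  ultimately have "\<forall>\<^sub>F x in at 0. norm (\<psi> x) < 2"
    using order_tendstoD(2)[OF tendsto_norm] unfolding isCont_def by blast
  then obtain d where d: "d > 0" "\<And>x. x \<noteq> 0 \<Longrightarrow> norm x < d \<Longrightarrow> norm (\<psi> x) < 2"
    unfolding eventually_at by (auto simp: dist_norm)
  define \<epsilon>1 where "\<epsilon>1 = min d \<epsilon>0"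
  have \<epsilon>1: "\<epsilon>1 > 0" "\<epsilon>1 \<le> \<epsilon>0" "\<epsilon>1 \<le> d" using d g.\<epsilon> by (auto simp: \<epsilon>1_def)
  have chart1: "stable_chart l q V \<phi> \<psi> \<rho> \<epsilon>0 K \<rho>' r \<delta>1 \<epsilon>1 X Y \<eta>"
  proof
    show "norm (\<psi> x) < 2" if "norm x < \<epsilon>1" for x
      using d(2)[of x] that \<epsilon>1 \<open>norm (\<psi> 0) < 2\<close> by (cases "x = 0") auto
  qed (use h \<delta>1 \<epsilon>1 \<rho>' r in auto)
  interpret s: stable_chart l q V \<phi> \<psi> \<rho> \<epsilon>0 K \<rho>' r \<delta>1 \<epsilon>1 X Y \<eta> by (rule chart1)
  define \<epsilon> where "\<epsilon> = \<epsilon>1 / 2"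
  have \<epsilon>: "\<epsilon> > 0" "\<epsilon> < \<epsilon>1" "\<epsilon> < \<epsilon>0" "\<epsilon> \<le> 1/2" using \<epsilon>1 \<epsilon>0 by (auto simp: \<epsilon>_def)
  obtain \<delta>2 where \<delta>2: "\<delta>2 > 0" "\<delta>2 \<le> \<delta>1"
    and sV: "\<And>a u t. norm a < \<delta>2 \<Longrightarrow> u \<in> cball 0 \<epsilon> \<Longrightarrow> t \<in> cball 0 (r+2) \<Longrightarrow> s.shifted a u t \<in> V"
  proof (rule hol3_small_parameter[OF s.hol3_shifted, of "cball 0 \<epsilon>" "cball 0 (r+2)" V])
    show "s.shifted 0 u t \<in> V" if "u \<in> cball 0 \<epsilon>" "t \<in> cball 0 (r+2)" for u t
      using s.shifted_0[of u t] g.step[of u] that \<epsilon> by auto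
  qed (use \<epsilon> \<delta>1 g.V in auto)
  let ?V2 = "ball 0 \<delta>2 \<times> ball 0 \<epsilon> \<times> ball 0 (r+2) :: (complex \<times> complex \<times> complex) set"
  have V2: "open ?V2" by (intro open_Times) auto
  have hsh: "hol3 s.shifted ?V2" by (rule hol3_subset[OF s.hol3_shifted]) (use \<delta>2 \<epsilon> in auto)
  have hF: "hol3 s.F ?V2"
    unfolding s.F_def by (rule hol3_holomorphic[OF g.\<phi> g.V hsh]) (use sV in auto)
  obtain A where A: "hol3 A ?V2" "\<And>a u t. (a, u, t) \<in> ?V2 \<Longrightarrow> s.F a u t = u * A a u t"
    using hol3_divide_x[OF hF V2] s.F_at_0 \<delta>2 by auto
  have slice: "(\<lambda>u. A a u t) holomorphic_on ball 0 \<epsilon>" if "norm a < \<delta>2" "norm t < r+2" for a t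
    by (rule hol3_slice[OF A(1)]) (use that in \<open>auto intro!: holomorphic_intros\<close>)
  have F_A_deriv: "((\<lambda>u. s.F a u t) has_field_derivative A a 0 t) (at 0)" if at: "norm a < \<delta>2" "norm t < r+2" for a t
  proof -
    have "((\<lambda>u. A a u t) has_field_derivative deriv (\<lambda>u. A a u t) 0) (at 0)"
      by (rule holomorphic_derivI[OF slice[OF at]]) (use \<epsilon> in auto)
    then have "((\<lambda>u. u * A a u t) has_field_derivative A a 0 t) (at 0)"
      by (auto intro!: derivative_eq_intros)
    then show ?thesis
      by (rule has_field_derivative_transform_within_open[where S = "ball 0 \<epsilon>"]) (use A(2) at \<epsilon> in auto)
  qed
  have A00: "A a 0 0 = l" if "norm a < \<delta>2" for a
    using DERIV_unique[OF F_A_deriv[of a 0] s.F_deriv[of a]] that \<delta>2 r by simp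
  have F00: "s.F 0 u t = \<phi> (parabolic_poly l (\<psi> u))" if "norm u < \<epsilon>" "norm t < r+2" for u t
    using s.shifted_0[of u t] that \<epsilon> by (simp add: s.F_def)
  \<comment> \<open>At \<open>a = 0\<close> the first component does not depend on \<open>t\<close>,
    so the linear coefficient agrees with the one at the fixed point.\<close>
  have A0t: "A 0 0 t = l" if t: "norm t < r+2" for t
  proof -
    have "((\<lambda>u. s.F 0 u 0) has_field_derivative A 0 0 t) (at 0)"
      by (rule has_field_derivative_transform_within_open[OF F_A_deriv[of 0 t], where S = "ball 0 \<epsilon>"])
         (use F00 t \<delta>2 \<epsilon> r in auto)
    then show ?thesis using DERIV_unique s.F_deriv[of 0] \<delta>1 by auto
  qed
  obtain \<delta>3 where \<delta>3: "\<delta>3 > 0" "\<delta>3 \<le> \<delta>2"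
    and A_re: "\<And>a u t. norm a < \<delta>3 \<Longrightarrow> u \<in> {0} \<Longrightarrow> t \<in> cball 0 (r + 3/2) \<Longrightarrow> A a u t \<in> {z. 0 < Re (z / l)}"
  proof (rule hol3_small_parameter[OF A(1), of "{0}" "cball 0 (r + 3/2)" "{z. 0 < Re (z / l)}"])
    show "open {z. 0 < Re (z / l)}" by (intro open_Collect_less continuous_intros) (use l0 in auto)
  qed (use \<delta>2 \<epsilon> A0t l0 in auto)
  interpret j: semi_parabolic_jet s.F s.G A "small_eigenvalue l" k l \<delta>3 \<epsilon> "r + 3/2" q n
  proof
    show "hol3 A (ball 0 \<delta>3 \<times> ball 0 \<epsilon> \<times> ball 0 (r + 3/2))" by (rule hol3_subset[OF A(1)]) (use \<delta>3 in auto)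
    show "hol3 s.G (ball 0 \<delta>3 \<times> ball 0 \<epsilon> \<times> ball 0 (r + 3/2))" by (rule hol3_subset[OF s.hol3_G]) (use \<delta>3 \<delta>2 \<epsilon> in auto)
    show "norm (s.G a x t) < r + 3/2" if "norm a < \<delta>3" "norm x < \<epsilon>" "norm t < r + 3/2" for a x t
      using s.G_small[of a x t] that \<delta>3 \<delta>2 \<epsilon> r by simp
    show "small_eigenvalue l holomorphic_on ball 0 \<delta>3"
      unfolding small_eigenvalue_def[abs_def] by (intro holomorphic_intros) (use l0 in auto)
    show "norm (small_eigenvalue l a) \<le> 1/2" if "norm a < \<delta>3" for a
      using s.mu_bound(2)[of a] that \<delta>3 \<delta>2 by simp
    show "s.F 0 x t = (\<Sum>i<2*q+2. n i * x ^ i) + x ^ (2*q+2) * k x" if "norm x < \<epsilon>" "norm t < r + 3/2" for x t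
      using F00[of x t] nf[of x] that \<epsilon> by simp
    show "isCont k 0" using k g.\<epsilon> by (intro holomorphic_isCont) auto
    show "s.F a x t = x * A a x t" if "norm a < \<delta>3" "norm x < \<epsilon>" "norm t < r + 3/2" for a x t
      using A(2)[of a x t] that \<delta>3 by simp
    show "0 < Re (A a 0 t / l)" if "norm a < \<delta>3" "norm t < r + 3/2" for a t using A_re[of a 0 t] that by simp
    show "s.G a 0 t = small_eigenvalue l a * t" if "norm a < \<delta>3" "norm t < r + 3/2" for a t
      using s.G_at_0[of a t] that \<delta>3 \<delta>2 by simp
  qed (use \<delta>3 \<epsilon> r g.q g.l root A00 n in auto)
  obtain \<delta>4 T B rem C where \<delta>4: "\<delta>4 > 0" "\<delta>4 \<le> \<delta>3"
    and B: "hol3 B (ball 0 \<delta>4 \<times> UNIV \<times> ball 0 (r + 3/2))"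
    and rem: "hol3 rem (ball 0 \<delta>4 \<times> ball 0 \<epsilon> \<times> ball 0 (r + 3/2))"
    and C: "C holomorphic_on ball 0 \<delta>4"
    and T: "\<And>a x t. T a x t = x * B a x t"
    and B0: "\<And>x t. norm t < r + 3/2 \<Longrightarrow> B 0 x t = 1"
    and rel: "\<And>a x t. norm a < \<delta>4 \<Longrightarrow> norm x < \<epsilon> \<Longrightarrow> norm t < r + 3/2 \<Longrightarrow>
        T a (s.F a x t) (s.G a x t) = l * (T a x t + T a x t ^ (q+1) + C a * T a x t ^ (2*q+1)) + x ^ (2*q+2) * rem a x t"
    using j.normal_form_exists by blast
  have \<rho>: "\<rho> > 0" using g.\<epsilon> by simp
  obtain \<delta>5 where \<delta>5: "\<delta>5 > 0" "\<delta>5 \<le> \<delta>4"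
    and Bn: "\<And>a u t. norm a < \<delta>5 \<Longrightarrow> u \<in> cball 0 (\<rho>+2) \<Longrightarrow> t \<in> cball 0 (r+1) \<Longrightarrow> B a u t \<in> ball 1 (1 / (4 * (\<rho>+2)))"
    by (rule hol3_small_parameter[OF B, of "cball 0 (\<rho>+2)" "cball 0 (r+1)" "ball 1 (1 / (4 * (\<rho>+2)))"])
       (use \<delta>4 \<rho> in \<open>auto simp: B0\<close>)
  \<comment> \<open>This closed disc is compact in \<open>V\<close>, so \<open>\<phi>\<close> maps
    it onto a compact part of the open disc of radius \<open>\<rho>\<close>. The identity
    \<open>T 0\<close> keeps it there, hence so does \<open>T a\<close> for small
    \<open>a\<close>.\<close>
  have sub: "cball (l/2) (3/2 * \<rho>') \<subseteq> V" using \<rho>' by (force simp: dist_norm)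
  have cK: "compact (\<phi> ` cball (l/2) (3/2 * \<rho>'))"
    by (intro compact_continuous_image continuous_on_subset[OF holomorphic_on_imp_continuous_on[OF g.\<phi>] sub]) auto
  have hT: "hol3 T (ball 0 \<delta>5 \<times> UNIV \<times> ball 0 (r + 3/2))"
  proof -
    have "T = (\<lambda>a x t. x * B a x t)" by (simp add: fun_eq_iff T)
    then show ?thesis using \<delta>5 by (auto intro!: hol3_mult hol3_x hol3_subset[OF B])
  qed
  obtain \<delta>6 where \<delta>6: "\<delta>6 > 0" "\<delta>6 \<le> \<delta>5"
    and Ti: "\<And>a u t. norm a < \<delta>6 \<Longrightarrow> u \<in> \<phi> ` cball (l/2) (3/2 * \<rho>') \<Longrightarrow> t \<in> cball 0 (r+1) \<Longrightarrow> T a u t \<in> ball 0 \<rho>"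
    by (rule hol3_small_parameter[OF hT, of "\<phi> ` cball (l/2) (3/2 * \<rho>')" "cball 0 (r+1)" "ball 0 \<rho>"])
       (use \<delta>5 cK sub g.\<psi>\<phi> in \<open>auto simp: B0 T\<close>)
  \<comment> \<open>Halving makes the closed discs compact subsets of the domains of
    \<open>rem\<close> and \<open>C\<close>, which yields the uniform bounds entering
    \<open>Ks\<close>.\<close>
  define \<delta> where "\<delta> = \<delta>6 / 2"
  define \<epsilon>' where "\<epsilon>' = \<epsilon> / 2"
  have \<delta>: "\<delta> > 0" "\<delta> < \<delta>6" "\<delta> \<le> \<delta>5" "\<delta> < \<delta>4" "\<delta> \<le> \<delta>2" "\<delta> \<le> \<delta>1" using \<delta>6 \<delta>5 \<delta>4 \<delta>3 \<delta>2 by (auto simp: \<delta>_def)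
  have \<epsilon>': "\<epsilon>' > 0" "\<epsilon>' < \<epsilon>" "\<epsilon>' \<le> \<epsilon>1" "\<epsilon>' \<le> 1/4" "\<epsilon>' \<le> \<rho>" using \<epsilon> s.\<epsilon>_rho by (auto simp: \<epsilon>'_def)
  have Bnear: "norm (B a u t - 1) \<le> 1 / (4 * (\<rho>+2))" if "norm a < \<delta>" "norm u \<le> \<rho> + 2" "norm t \<le> r+1" for a u t
    using Bn[of a u t] that \<delta> by (simp add: dist_norm norm_minus_commute)
  obtain M where M: "M > 0" "\<And>a u t. (a, u, t) \<in> cball 0 \<delta> \<times> cball 0 \<epsilon>' \<times> cball 0 (r+1) \<Longrightarrow> norm (rem a u t) \<le> M"
  proof (rule hol3_compact_bound[OF rem])
    show "compact (cball 0 \<delta> \<times> cball 0 \<epsilon>' \<times> cball 0 (r+1) :: (complex \<times> complex \<times> complex) set)"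
      by (intro compact_Times compact_cball)
    show "cball 0 \<delta> \<times> cball 0 \<epsilon>' \<times> cball 0 (r+1) \<subseteq> ball 0 \<delta>4 \<times> ball 0 \<epsilon> \<times> ball 0 (r + 3/2)"
      using \<delta> \<epsilon>' by auto
  qed blast
  have "compact (C ` cball 0 \<delta>)"
    by (intro compact_continuous_image continuous_on_subset[OF holomorphic_on_imp_continuous_on[OF C]]) (use \<delta> in auto)
  then obtain Mc where Mc: "\<And>a. norm a \<le> \<delta> \<Longrightarrow> norm (C a) \<le> Mc"
    using compact_imp_bounded bounded_iff by (metis imageI mem_cball_0)
  have Mc0: "Mc \<ge> 0" using Mc[of 0] \<delta> by (metis norm_ge_zero norm_zero order_trans less_imp_le)
  define Ks where "Ks = Mc + M * 2 ^ (2*q+2)"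
  have Kbound: "\<exists>s. norm s \<le> Ks \<and> T a (s.F a u t) (s.G a u t) = l * T a u t * (1 + T a u t ^ q + T a u t ^ (q+1) * s)"
    if aut: "norm a < \<delta>" "norm u < \<epsilon>'" "norm t \<le> r+1" for a u t
  proof -
    define y where "y = T a u t"
    define b where "b = B a u t"
    have "norm (b - 1) \<le> 1 / (4 * (\<rho>+2))" unfolding b_def using aut \<epsilon>' \<rho> by (intro Bnear) auto
    also have "\<dots> \<le> 1/2" using \<rho> by (simp add: field_simps)
    finally have b1: "norm (b - 1) \<le> 1/2" .
    have b2: "1/2 \<le> norm b" using b1 norm_triangle_ineq2[of 1 "1 - b"] by (simp add: norm_minus_commute)
    have b3: "norm b \<le> 2" using b1 norm_triangle_sub[of b 1] by simp
    have b0: "b \<noteq> 0" using b2 by auto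
    have yb: "y = u * b" by (simp add: y_def b_def T)
    have "norm y \<le> 1/4 * 2" unfolding yb norm_mult using aut \<epsilon>' b3 by (intro mult_mono) auto
    then have y1: "norm y \<le> 1" by simp
    \<comment> \<open>The tail in powers of \<open>u\<close> is rewritten with
      \<open>u = y / b\<close>; the bound \<open>|b| \<ge> 1/2\<close> accounts for the factor
      \<open>2 ^ (2*q+2)\<close> in \<open>Ks\<close>.\<close>
    define s where "s = C a * y ^ (q - 1) + rem a u t * y ^ q / (l * b ^ (2*q+2))"
    have "norm s \<le> Mc * 1 + M * 2 ^ (2*q+2)"
      unfolding s_def
    proof (rule norm_triangle_le, rule add_mono)
      show "norm (C a * y ^ (q - 1)) \<le> Mc * 1"
        unfolding norm_mult norm_power using Mc[of a] aut y1 Mc0 by (intro mult_mono power_le_one) auto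
      have "norm (rem a u t * y ^ q / (l * b ^ (2*q+2))) = norm (rem a u t) * norm y ^ q * (1 / norm b) ^ (2*q+2)"
        using g.l by (simp add: norm_divide norm_mult norm_power power_divide)
      also have "\<dots> \<le> M * 1 * 2 ^ (2*q+2)"
        using M(2)[of a u t] aut y1 b2 M(1) b0 by (intro mult_mono power_le_one power_mono) (auto simp: divide_le_eq)
      finally show "norm (rem a u t * y ^ q / (l * b ^ (2*q+2))) \<le> M * 2 ^ (2*q+2)" by simp
    qed
    then have sK: "norm s \<le> Ks" by (simp add: Ks_def)
    have e1: "y * y ^ (q+1) * y ^ (q - 1) = y ^ (2*q+1)" using g.q by (simp flip: power_add power_Suc add: mult_2)
    have e2: "y * y ^ (q+1) * y ^ q = y ^ (2*q+2)" by (simp flip: power_add power_Suc add: mult_2)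
    have "l * y * (1 + y ^ q + y ^ (q+1) * s) = l * y * (1 + y ^ q) + l * C a * (y * y ^ (q+1) * y ^ (q - 1))
        + (y * y ^ (q+1) * y ^ q) * rem a u t / b ^ (2*q+2)"
      using l0 b0 by (simp add: s_def field_simps)
    also have "(y * y ^ (q+1) * y ^ q) * rem a u t / b ^ (2*q+2) = u ^ (2*q+2) * rem a u t"
      unfolding e2 using b0 by (simp add: yb power_mult_distrib)
    finally have "l * y * (1 + y ^ q + y ^ (q+1) * s) = l * (y + y ^ (q+1) + C a * y ^ (2*q+1)) + u ^ (2*q+2) * rem a u t"
      unfolding e1 by (simp add: algebra_simps)
    also have "\<dots> = T a (s.F a u t) (s.G a u t)" using rel[of a u t] aut \<delta> \<epsilon>' by (simp add: y_def)
    finally show ?thesis using sK by (auto simp: y_def)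
  qed
  interpret s': stable_chart l q V \<phi> \<psi> \<rho> \<epsilon>0 K \<rho>' r \<delta> \<epsilon>' X Y \<eta>
    by (rule stable_chart_mono[OF chart1]) (use \<delta> \<epsilon>' in auto)
  have "henon_chart l q V \<phi> \<psi> \<rho> \<epsilon>0 K \<rho>' r \<delta> \<epsilon>' X Y \<eta> T B rem C Ks"
  proof
    show "hol3 B (ball 0 \<delta> \<times> UNIV \<times> ball 0 (r + 3/2))" by (rule hol3_subset[OF B]) (use \<delta> in auto)
    show "hol3 rem (ball 0 \<delta> \<times> ball 0 \<epsilon>' \<times> ball 0 (r + 3/2))" by (rule hol3_subset[OF rem]) (use \<delta> \<epsilon>' in auto)
    show "norm (T a (\<phi> x) t) < \<rho>" if "norm a < \<delta>" "dist (l/2) x \<le> 3/2 * \<rho>'" "norm t \<le> r+1" for a x t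
      using Ti[of a "\<phi> x" t] that \<delta> by auto
    show "0 \<le> Ks" using M Mc0 by (simp add: Ks_def)
  qed (use sV \<delta> \<epsilon>' T B0 Bnear rel Kbound in auto)
  then show ?thesis by blast
qed

section \<open>The coordinate change and its properties\<close>

context henon_chart
begin

definition u_of :: "complex \<Rightarrow> complex \<Rightarrow> complex \<Rightarrow> complex" where
  "u_of a x y = \<phi> (x - X a (\<eta> a y) + l / 2)"

definition \<Phi> :: "complex \<Rightarrow> complex \<times> complex \<Rightarrow> complex \<times> complex" where
  "\<Phi> a = (\<lambda>(x, y). (T a (u_of a x y) (\<eta> a y), \<eta> a y))"

abbreviation H :: "complex \<Rightarrow> complex \<times> complex \<Rightarrow> complex \<times> complex" where
  "H a \<equiv> henon (curve_c l a) a"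

abbreviation tube :: "(complex \<times> complex) set" where
  "tube \<equiv> ball (l / 2) \<rho>' \<times> ball 0 r"

lemma \<rho>_pos: "\<rho> > 0" using \<epsilon> by simp

lemma eta_bound: "norm a < \<delta> \<Longrightarrow> norm y < s \<Longrightarrow> s \<le> r+3 \<Longrightarrow> norm (\<eta> a y) < s + 1/4"
  using \<eta>_near[of a y] norm_triangle_sub[of "\<eta> a y" y] by simp

text \<open>Straightening displaces the argument of \<open>\<phi>\<close> by at most
  \<open>\<rho>' / 4\<close>; points within \<open>3/2 * \<rho>'\<close> of \<open>l / 2\<close>
  therefore stay in the doubled disc.\<close>

lemma arg_near:
  assumes "norm a < \<delta>" "norm y < r+3"
  shows "dist (l / 2) (x - X a (\<eta> a y) + l / 2) \<le> dist (l / 2) x + \<rho>' / 4"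
proof -
  have "norm (X a (\<eta> a y) - l / 2) \<le> \<rho>' / 4" using X_near[of a "\<eta> a y"] eta_bound[OF assms] assms by simp
  moreover have "norm (l / 2 - (x - X a (\<eta> a y) + l / 2)) \<le> norm (l / 2 - x) + norm (X a (\<eta> a y) - l / 2)"
    using norm_triangle_ineq[of "l / 2 - x" "X a (\<eta> a y) - l / 2"] by (simp add: algebra_simps)
  ultimately show ?thesis by (simp add: dist_norm)
qed

lemma arg_V:
  assumes "norm a < \<delta>" "norm y < r+3" "dist (l / 2) x < 3/2 * \<rho>'"
  shows "x - X a (\<eta> a y) + l / 2 \<in> V"
  using arg_near[OF assms(1,2), of x] assms(3) \<rho>' by (intro subsetD[OF \<rho>'(2)]) simp

lemma u_of_bound:
  assumes "norm a < \<delta>" "norm y < r+3" "dist (l / 2) x < 3/2 * \<rho>'" shows "norm (u_of a x y) < \<rho>"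
  using arg_V[OF assms] \<psi>\<phi> by (simp add: u_of_def)

lemma hol3_X_eta: "hol3 (\<lambda>a x y. X a (\<eta> a y)) (ball 0 \<delta> \<times> UNIV \<times> ball 0 (r+3))"
  by (rule hol3_comp[OF X _ _ \<eta>]) (use eta_bound[of _ _ "r+3"] in \<open>fastforce intro!: hol3_intros\<close>)+

lemma hol3_u_of: "hol3 u_of (ball 0 \<delta> \<times> ball (l / 2) (3/2 * \<rho>') \<times> ball 0 (r+3))"
  unfolding u_of_def
  by (rule hol3_holomorphic[OF \<phi> V]) (use arg_V in \<open>auto intro!: hol3_intros hol3_subset[OF hol3_X_eta]\<close>)

lemma hol3_T: "hol3 T (ball 0 \<delta> \<times> UNIV \<times> ball 0 (r + 3/2))"
proof -
  have "T = (\<lambda>a u t. u * B a u t)" by (simp add: fun_eq_iff T)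
  then show ?thesis by (auto intro!: hol3_mult hol3_x B)
qed

lemma hol3_Phi1: "hol3 (\<lambda>a x y. T a (u_of a x y) (\<eta> a y)) (ball 0 \<delta> \<times> ball (l / 2) (3/2 * \<rho>') \<times> ball 0 (r+1))"
proof (rule hol3_comp[OF hol3_T])
  show "hol3 u_of (ball 0 \<delta> \<times> ball (l / 2) (3/2 * \<rho>') \<times> ball 0 (r+1))" by (rule hol3_subset[OF hol3_u_of]) auto
  show "hol3 (\<lambda>a x. \<eta> a) (ball 0 \<delta> \<times> ball (l / 2) (3/2 * \<rho>') \<times> ball 0 (r+1))" by (rule hol3_subset[OF \<eta>]) auto
  show "(a, u_of a x t, \<eta> a t) \<in> ball 0 \<delta> \<times> UNIV \<times> ball 0 (r + 3/2)"
    if "(a, x, t) \<in> ball 0 \<delta> \<times> ball (l / 2) (3/2 * \<rho>') \<times> ball 0 (r+1)" for a x t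
    using that eta_bound[of a t "r+1"] by auto
qed (auto intro: hol3_intros)

lemma base_u_of:
  assumes "norm a < \<delta>" "norm y < r+3" "dist (l / 2) x < 3/2 * \<rho>'"
  shows "base a (u_of a x y) (\<eta> a y) = x"
  using arg_V[OF assms] \<psi>\<phi> by (simp add: u_of_def base_def)

lemma F_G_u_of:
  assumes "norm a < \<delta>" "norm y < r+3" "dist (l / 2) x < 3/2 * \<rho>'"
  shows "G a (u_of a x y) (\<eta> a y) = \<eta> a (a * x)"
    "F a (u_of a x y) (\<eta> a y) = u_of a (x\<^sup>2 + curve_c l a + a * y) (a * x)"
proof -
  show g: "G a (u_of a x y) (\<eta> a y) = \<eta> a (a * x)" by (simp add: G_def base_u_of[OF assms])
  have "shifted a (u_of a x y) (\<eta> a y) = (x\<^sup>2 + curve_c l a + a * y) - X a (\<eta> a (a * x)) + l / 2"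
    unfolding shifted_def g base_u_of[OF assms] Y\<eta>[OF assms(1,2)] ..
  then show "F a (u_of a x y) (\<eta> a y) = u_of a (x\<^sup>2 + curve_c l a + a * y) (a * x)"
    by (simp add: F_def u_of_def[of a "x\<^sup>2 + curve_c l a + a * y"])
qed

lemma Phi_H:
  assumes "norm a < \<delta>" "norm y < r+3" "dist (l / 2) x < 3/2 * \<rho>'"
  shows "\<Phi> a (H a (x, y)) = (T a (F a (u_of a x y) (\<eta> a y)) (G a (u_of a x y) (\<eta> a y)), \<eta> a (a * x))"
  by (simp add: \<Phi>_def henon_def F_G_u_of[OF assms])

lemma B_bounds:
  assumes "norm a < \<delta>" "norm u \<le> \<rho> + 2" "norm t \<le> r+1"
  shows "norm (B a u t - 1) \<le> 1/2" "1/2 \<le> norm (B a u t)" "norm (B a u t) \<le> 2" "B a u t \<noteq> 0"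
    "norm u \<le> 2 * norm (T a u t)" "norm (T a u t) \<le> 2 * norm u" "norm (T a u t - u) \<le> 1/4"
proof -
  let ?b = "B a u t"
  have "1 / (4 * (\<rho>+2)) \<le> 1/2" using \<rho>_pos by (simp add: field_simps)
  then show b1: "norm (?b - 1) \<le> 1/2" using B_near[OF assms] by linarith
  show b2: "1/2 \<le> norm ?b" using b1 norm_triangle_ineq2[of 1 "1 - ?b"] by (simp add: norm_minus_commute)
  show b3: "norm ?b \<le> 2" using b1 norm_triangle_sub[of ?b 1] by simp
  show "?b \<noteq> 0" using b2 by auto
  show "norm u \<le> 2 * norm (T a u t)" using mult_left_mono[OF b2, of "norm u"] by (simp add: T norm_mult)
  show "norm (T a u t) \<le> 2 * norm u" using mult_left_mono[OF b3, of "norm u"] by (simp add: T norm_mult)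
  have "norm (T a u t - u) = norm u * norm (?b - 1)" by (simp add: T algebra_simps flip: norm_mult)
  also have "\<dots> \<le> (\<rho>+2) * (1 / (4 * (\<rho>+2)))" using assms B_near[OF assms] \<rho>_pos by (intro mult_mono) auto
  also have "\<dots> = 1/4" using \<rho>_pos by (simp add: field_simps)
  finally show "norm (T a u t - u) \<le> 1/4" .
qed

lemma T_lipschitz:
  assumes a: "norm a < \<delta>" and t: "norm t \<le> r+1" and u: "norm u < \<rho>+1" "norm u' < \<rho>+1"
  shows "norm ((T a u t - u) - (T a u' t - u')) \<le> 1/2 * norm (u - u')"
proof -
  have "(\<lambda>u. T a u t) holomorphic_on ball 0 (\<rho>+2)"
    by (rule hol3_slice[OF hol3_T]) (use a t in \<open>auto intro!: holomorphic_intros\<close>)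
  then have "(\<lambda>u. T a u t - u) holomorphic_on ball 0 (\<rho>+2)" by (intro holomorphic_intros)
  then have "norm ((T a u t - u) - (T a u' t - u')) \<le> 2 * (1/4) / 1 * norm (u - u')"
    by (rule holomorphic_lipschitz) (use B_bounds(7)[OF a _ t] u in auto)
  then show ?thesis by simp
qed

text \<open>The expansion is wanted in powers of the new first coordinate, whereas the remainder is
  known in \<open>u\<close>; the inverse \<open>S\<close> passes from one to the other,
  holomorphically in all variables.\<close>

lemma T_inverse:
  "\<exists>S. hol3 S (ball 0 \<delta> \<times> ball 0 (\<rho> + 3/4) \<times> ball 0 (r+1)) \<and>
    (\<forall>a w t. norm a < \<delta> \<longrightarrow> norm w < \<rho> + 3/4 \<longrightarrow> norm t < r+1 \<longrightarrow> norm (S a w t) < \<rho> + 1 \<and> T a (S a w t) t = w) \<and>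
    (\<forall>a u t. norm a < \<delta> \<longrightarrow> norm u < \<rho> + 1 \<longrightarrow> norm t < r+1 \<longrightarrow> norm (T a u t) < \<rho> + 3/4 \<longrightarrow> S a (T a u t) t = u)"
proof -
  have hE: "hol3 (\<lambda>a u t. T a u t - u) (ball 0 \<delta> \<times> ball 0 (\<rho>+1) \<times> ball 0 (r+1))"
    by (intro hol3_diff hol3_x hol3_subset[OF hol3_T]) auto
  obtain S where S: "hol3 S (ball 0 \<delta> \<times> ball 0 (\<rho> + 1 - 1/4) \<times> ball 0 (r+1))"
    and S1: "\<And>a w t. a \<in> ball 0 \<delta> \<Longrightarrow> w \<in> ball 0 (\<rho> + 1 - 1/4) \<Longrightarrow> t \<in> ball 0 (r+1) \<Longrightarrow>
        norm (S a w t) < \<rho> + 1 \<and> norm (S a w t - w) \<le> 1/4 \<and> S a w t + (T a (S a w t) t - S a w t) = w"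
    and S2: "\<And>a x w t. a \<in> ball 0 \<delta> \<Longrightarrow> x \<in> ball 0 (\<rho> + 1) \<Longrightarrow> t \<in> ball 0 (r+1) \<Longrightarrow> w \<in> ball 0 (\<rho> + 1 - 1/4) \<Longrightarrow>
        x + (T a x t - x) = w \<Longrightarrow> x = S a w t"
    by (rule hol3_fixpoint[OF hE, of "1/4"]) (use B_bounds(7) T_lipschitz in auto)
  show ?thesis
  proof (intro exI[of _ S] conjI allI impI)
    show "hol3 S (ball 0 \<delta> \<times> ball 0 (\<rho> + 3/4) \<times> ball 0 (r+1))" by (rule hol3_subset[OF S]) auto
    show "norm (S a w t) < \<rho> + 1" "T a (S a w t) t = w" if "norm a < \<delta>" "norm w < \<rho> + 3/4" "norm t < r+1" for a w t
      using S1[of a w t] that by auto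
    show "S a (T a u t) t = u" if "norm a < \<delta>" "norm u < \<rho> + 1" "norm t < r+1" "norm (T a u t) < \<rho> + 3/4" for a u t
      using S2[of a u t "T a u t"] that by auto
  qed
qed

lemma Phi_image_1:
  assumes a: "norm a < \<delta>" and y: "norm y < r" and x: "dist (l / 2) x < \<rho>'"
  shows "norm (T a (u_of a x y) (\<eta> a y)) < \<rho>"
  unfolding u_of_def
  using arg_near[OF a, of y x] eta_bound[OF a y] y x \<rho>' by (intro T_image a) auto

text \<open>The second component determines \<open>y\<close> through \<open>Y\<close>, and for fixed
  \<open>y\<close> the map \<open>T a\<close> is the identity plus a \<open>1/2\<close>-Lipschitz
  map.\<close>

lemma Phi_inj:
  assumes a: "norm a < \<delta>" shows "inj_on (\<Phi> a) (ball (l / 2) (3/2 * \<rho>') \<times> ball 0 (r + 1/2))"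
proof (rule inj_onI, clarify)
  fix x y x' y'
  assume d: "x \<in> ball (l / 2) (3/2 * \<rho>')" "y \<in> ball 0 (r + 1/2)" "x' \<in> ball (l / 2) (3/2 * \<rho>')" "y' \<in> ball 0 (r + 1/2)"
    and eq: "\<Phi> a (x, y) = \<Phi> a (x', y')"
  have "\<eta> a y = \<eta> a y'" using eq by (simp add: \<Phi>_def)
  moreover have "Y a (\<eta> a y) = y" "Y a (\<eta> a y') = y'" using Y\<eta>[OF a] d by auto
  ultimately have yy: "y = y'" by metis
  have t: "norm (\<eta> a y) \<le> r+1" using eta_bound[OF a, of y "r + 1/2"] d by simp
  let ?u = "u_of a x y" and ?u' = "u_of a x' y"
  have u: "norm ?u < \<rho>" "norm ?u' < \<rho>" using u_of_bound[OF a] d by auto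
  have Teq: "T a ?u (\<eta> a y) = T a ?u' (\<eta> a y)" using eq yy by (simp add: \<Phi>_def)
  have "norm ((T a ?u (\<eta> a y) - ?u) - (T a ?u' (\<eta> a y) - ?u')) \<le> 1/2 * norm (?u - ?u')"
    by (rule T_lipschitz[OF a t]) (use u in auto)
  then have "norm (?u' - ?u) \<le> 1/2 * norm (?u - ?u')" using Teq by simp
  then have uu: "?u = ?u'" by (simp add: norm_minus_commute)
  have "x = base a ?u (\<eta> a y)" by (rule base_u_of[symmetric]) (use a d in auto)
  also have "\<dots> = x'" unfolding uu by (rule base_u_of) (use a d in auto)
  finally show "x = x' \<and> y = y'" using yy by simp
qed

lemma tube_sub: "tube \<subseteq> ball (l / 2) (3/2 * \<rho>') \<times> ball 0 (r + 1/2)"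
  using \<rho>' by auto

lemma Phi_coordinate_transformation:
  assumes a: "norm a < \<delta>" shows "coordinate_transformation (\<Phi> a) tube"
  unfolding coordinate_transformation_def
proof (intro conjI)
  show "inj_on (\<Phi> a) tube" by (rule inj_on_subset[OF Phi_inj[OF a] tube_sub])
  have "holomorphic2_on (\<lambda>(x, y). T a (u_of a x y) (\<eta> a y)) tube"
    by (rule hol3_imp_holomorphic2_on[OF hol3_Phi1]) (use a \<rho>' in auto)
  then show "holomorphic2_on (fst \<circ> \<Phi> a) tube" by (simp add: \<Phi>_def o_def case_prod_unfold)
  have "holomorphic2_on (\<lambda>(x, y). \<eta> a y) tube"
    by (rule hol3_imp_holomorphic2_on[OF \<eta>]) (use a in auto)
  then show "holomorphic2_on (snd \<circ> \<Phi> a) tube" by (simp add: \<Phi>_def o_def case_prod_unfold)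
qed

text \<open>The Schwarz lemma in the variable \<open>a\<close>: the difference vanishes at
  \<open>a = 0\<close> and is at most \<open>1/4\<close> on \<open>|a| < \<delta>\<close>. This is
  the origin of the constant \<open>1 / (4 * \<delta>)\<close> in the radius of the image.\<close>

lemma eta_near_a:
  assumes a: "norm a < \<delta>" and y: "norm y < r+2" shows "norm (\<eta> a y - y) \<le> norm a / (4 * \<delta>)"
proof -
  have "(\<lambda>a. \<eta> a y - y) holomorphic_on ball 0 \<delta>"
    by (intro holomorphic_intros hol3_slice[OF \<eta>, of _ "\<lambda>a. a" "\<lambda>_. 0" "\<lambda>_. y"]) (use y in \<open>auto intro!: holomorphic_intros\<close>)
  then have "norm (\<eta> a y - y) \<le> (1/4) * norm a / \<delta>"
    by (rule schwarz_scaled) (use a y \<delta> \<eta>_0 \<eta>_near in auto)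
  then show ?thesis by simp
qed

lemma Phi_image:
  assumes a: "norm a < \<delta>" shows "\<Phi> a ` tube \<subseteq> ball 0 \<rho> \<times> ball 0 (r + 1 / (4 * \<delta>) * norm a)"
proof (clarsimp simp: \<Phi>_def)
  fix x y :: complex assume x: "dist (l / 2) x < \<rho>'" and y: "norm y < r"
  have "norm (\<eta> a y) \<le> norm y + norm (\<eta> a y - y)" by (metis add_diff_cancel_left' diff_add_cancel norm_triangle_ineq)
  then show "norm (T a (u_of a x y) (\<eta> a y)) < \<rho> \<and> norm (\<eta> a y) < r + norm a / (4 * \<delta>)"
    using Phi_image_1[OF a y x] eta_near_a[OF a, of y] y by simp
qed

lemma fixed_pt_tube: assumes a: "norm a < \<delta>" shows "fixed_pt l a \<in> tube"
proof -
  have n: "norm (fixed_x l a - l / 2) \<le> \<rho>' / 4" "norm (fixed_x l a - l / 2) \<le> 1"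
    using X_near[OF a, of 0] r by (auto simp: XY_at_0)
  have "norm (fixed_x l a) \<le> norm (l / 2) + norm (fixed_x l a - l / 2)" by (metis add_diff_cancel_left' diff_add_cancel norm_triangle_ineq)
  then have "norm (fixed_x l a) \<le> 2" using n l by (simp add: norm_divide)
  then have "norm a * norm (fixed_x l a) \<le> 1 * 2" using a \<delta> by (intro mult_mono) auto
  then show ?thesis using n \<rho>' r by (simp add: fixed_pt_def dist_norm norm_minus_commute norm_mult)
qed

lemma eta_fixed: "norm a < \<delta> \<Longrightarrow> \<eta> a (a * fixed_x l a) = 0"
  using \<eta>Y[of a 0] r by (simp add: XY_at_0)

lemma Phi_fixed_pt: assumes a: "norm a < \<delta>" shows "\<Phi> a (fixed_pt l a) = (0, 0)"
  by (simp add: \<Phi>_def fixed_pt_def eta_fixed[OF a] u_of_def XY_at_0 phi_half_l T)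

lemma Phi_0: assumes "norm y < r" shows "\<Phi> 0 (x, y) = (\<phi> x, y)"
  using assms by (simp add: \<Phi>_def \<eta>_0 u_of_def XY_0 T B_0)

lemma Phi_holomorphic_a:
  assumes "z \<in> tube" shows "(\<lambda>a. fst (\<Phi> a z)) holomorphic_on ball 0 \<delta>" "(\<lambda>a. snd (\<Phi> a z)) holomorphic_on ball 0 \<delta>"
proof -
  obtain x y where z: "z = (x, y)" "dist (l / 2) x < \<rho>'" "norm y < r" using assms by (cases z) auto
  have "(\<lambda>a. T a (u_of a x y) (\<eta> a y)) holomorphic_on ball 0 \<delta>"
    by (rule hol3_slice[OF hol3_Phi1, of _ "\<lambda>a. a" "\<lambda>_. x" "\<lambda>_. y"]) (use z \<rho>' in \<open>auto intro!: holomorphic_intros\<close>)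
  then show "(\<lambda>a. fst (\<Phi> a z)) holomorphic_on ball 0 \<delta>" by (simp add: z \<Phi>_def)
  have "(\<lambda>a. \<eta> a y) holomorphic_on ball 0 \<delta>"
    by (rule hol3_slice[OF \<eta>, of _ "\<lambda>a. a" "\<lambda>_. 0" "\<lambda>_. y"]) (use z in \<open>auto intro!: holomorphic_intros\<close>)
  then show "(\<lambda>a. snd (\<Phi> a z)) holomorphic_on ball 0 \<delta>" by (simp add: z \<Phi>_def)
qed

lemma Phi_uniform_limit:
  assumes S: "compact S" "S \<subseteq> tube" shows "uniform_limit S \<Phi> (\<Phi> 0) (at 0)"
  unfolding uniform_limit_iff
proof (intro allI impI)
  fix e :: real assume e: "e > 0"
  have cK: "compact (fst ` S)" "compact (snd ` S)" using S(1) by (auto intro!: compact_continuous_image continuous_intros)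
  have K: "fst ` S \<subseteq> ball (l / 2) (3/2 * \<rho>')" "snd ` S \<subseteq> ball 0 (r+1)" "fst ` S \<subseteq> V" using S(2) \<rho>' by fastforce+
  have h1: "hol3 (\<lambda>a x y. T a (u_of a x y) (\<eta> a y) - \<phi> x) (ball 0 \<delta> \<times> ball (l / 2) (3/2 * \<rho>') \<times> ball 0 (r+1))"
    by (intro hol3_diff hol3_Phi1 hol3_holomorphic[OF \<phi> V] hol3_x) (use \<rho>' in auto)
  have h2: "hol3 (\<lambda>a x y. \<eta> a y - y) (ball 0 \<delta> \<times> ball (l / 2) (3/2 * \<rho>') \<times> ball 0 (r+1))"
    by (intro hol3_diff hol3_subset[OF \<eta>] hol3_t) auto
  have z: "u_of 0 x y = \<phi> x" "\<eta> 0 y = y" if "norm y < r+1" for x y using that by (simp_all add: u_of_def XY_0 \<eta>_0)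
  obtain d1 where d1: "d1 > 0" and D1: "\<And>a x y. norm a < d1 \<Longrightarrow> x \<in> fst ` S \<Longrightarrow> y \<in> snd ` S \<Longrightarrow> T a (u_of a x y) (\<eta> a y) - \<phi> x \<in> ball 0 (e/2)"
    by (rule hol3_small_parameter[OF h1 _ _ cK(1) K(1) cK(2) K(2), of "ball 0 (e/2)"]) (use K(2) \<delta> e in \<open>auto simp: z T B_0 subset_iff\<close>)
  obtain d2 where d2: "d2 > 0" and D2: "\<And>a x y. norm a < d2 \<Longrightarrow> x \<in> fst ` S \<Longrightarrow> y \<in> snd ` S \<Longrightarrow> \<eta> a y - y \<in> ball 0 (e/2)"
    by (rule hol3_small_parameter[OF h2 _ _ cK(1) K(1) cK(2) K(2), of "ball 0 (e/2)"]) (use K(2) \<delta> e in \<open>auto simp: z subset_iff\<close>)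
  have "\<forall>z\<in>S. dist (\<Phi> a z) (\<Phi> 0 z) < e" if "norm a < min d1 d2" for a
  proof
    fix z assume zS: "z \<in> S"
    obtain x y where xy: "z = (x, y)" by (cases z)
    have m: "x \<in> fst ` S" "y \<in> snd ` S" "norm y < r" using zS xy S(2) by force+
    have "norm (T a (u_of a x y) (\<eta> a y) - \<phi> x) < e/2" "norm (\<eta> a y - y) < e/2"
      using D1[of a x y] D2[of a x y] m that by auto
    moreover have "dist (\<Phi> a z) (\<Phi> 0 z) \<le> norm (T a (u_of a x y) (\<eta> a y) - \<phi> x) + norm (\<eta> a y - y)"
    proof -
      have "\<Phi> 0 z = (\<phi> x, y)" using Phi_0[OF m(3)] xy by simp
      moreover have "\<Phi> a z = (T a (u_of a x y) (\<eta> a y), \<eta> a y)" by (simp add: xy \<Phi>_def)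
      ultimately show ?thesis by (simp add: dist_norm norm_Pair_le)
    qed
    ultimately show "dist (\<Phi> a z) (\<Phi> 0 z) < e" by linarith
  qed
  then show "\<forall>\<^sub>F a in at 0. \<forall>z\<in>S. dist (\<Phi> a z) (\<Phi> 0 z) < e"
    unfolding eventually_at using d1 d2 by (intro exI[of _ "min d1 d2"]) (auto simp: dist_norm)
qed

lemma conj_at:
  assumes a: "norm a < \<delta>" and z: "z \<in> tube" shows "conj_map (\<Phi> a) tube (H a) (\<Phi> a z) = \<Phi> a (H a z)"
  using inv_into_f_f[OF inj_on_subset[OF Phi_inj[OF a] tube_sub] z] by (simp add: conj_map_def)

lemma conj_domE:
  assumes "w \<in> conj_dom (\<Phi> a) tube (H a)"
  obtains x y where "dist (l / 2) x < \<rho>'" "norm y < r" "norm (a * x) < r" "w = \<Phi> a (x, y)"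
  using assms by (auto simp: conj_dom_def henon_def)

text \<open>With \<open>v = T a u t = u * B\<close>, the remainder \<open>u ^ (2*q+2) * rem\<close>
  is \<open>v ^ (2*q+2)\<close> times a function of \<open>u\<close> and \<open>t\<close>, which is
  rewritten in \<open>v\<close> by the inverse of \<open>T\<close> and expanded. The condition
  \<open>|v| < \<epsilon> / 2\<close> ensures \<open>|u| < \<epsilon>\<close>, as
  \<open>|u| \<le> 2 * |v|\<close>.\<close>

lemma Phi_expansion:
  assumes a: "norm a < \<delta>" shows "semi_parabolic_expansion l q (\<Phi> a) tube (H a)"
proof -
  obtain S where S: "hol3 S (ball 0 \<delta> \<times> ball 0 (\<rho> + 3/4) \<times> ball 0 (r+1))"
    and S1: "\<And>a w t. norm a < \<delta> \<Longrightarrow> norm w < \<rho> + 3/4 \<Longrightarrow> norm t < r+1 \<Longrightarrow> norm (S a w t) < \<rho> + 1 \<and> T a (S a w t) t = w"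
    and S2: "\<And>a u t. norm a < \<delta> \<Longrightarrow> norm u < \<rho> + 1 \<Longrightarrow> norm t < r+1 \<Longrightarrow> norm (T a u t) < \<rho> + 3/4 \<Longrightarrow> S a (T a u t) t = u"
    using T_inverse by blast
  define W where "W = (\<lambda>a w t. (1 / B a (S a w t) t) ^ (2*q+2) * rem a (S a w t) t / l)"
  let ?U = "ball 0 \<delta> \<times> ball 0 (\<epsilon>/2) \<times> ball 0 (r+1) :: (complex \<times> complex \<times> complex) set"
  have SU: "hol3 S ?U" by (rule hol3_subset[OF S]) (use \<epsilon>_rho \<rho>_pos in auto)
  have S\<epsilon>: "norm (S a w t) < \<epsilon>" "B a (S a w t) t \<noteq> 0" if "(a, w, t) \<in> ?U" for a w t
  proof -
    have s: "norm (S a w t) < \<rho> + 1 \<and> T a (S a w t) t = w" using that \<epsilon>_rho \<rho>_pos by (intro S1) auto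
    then show "norm (S a w t) < \<epsilon>" using B_bounds(5)[of a "S a w t" t] that by simp
    show "B a (S a w t) t \<noteq> 0" using s that by (intro B_bounds(4)) auto
  qed
  have "hol3 (\<lambda>a w t. B a (S a w t) t) ?U"
    by (rule hol3_comp[OF B _ SU]) (auto intro: hol3_intros)
  moreover have "hol3 (\<lambda>a w t. rem a (S a w t) t) ?U"
    by (rule hol3_comp[OF rem _ SU]) (use S\<epsilon>(1) in \<open>auto intro: hol3_intros\<close>)
  ultimately have W: "hol3 W ?U" unfolding W_def
    using S\<epsilon>(2) l_nonzero by (intro hol3_divide hol3_mult hol3_power hol3_const) auto
  have "\<epsilon> / 2 > 0" using \<epsilon>_pos by simp
  from hol3_power_series[OF W open_ball open_ball this]
  obtain \<alpha> where \<alpha>: "\<And>n. hol3 (\<lambda>a x t. \<alpha> n a t) (ball 0 \<delta> \<times> UNIV \<times> ball 0 (r+1))"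
    and sums: "\<forall>a\<in>ball 0 \<delta>. \<forall>t\<in>ball 0 (r+1). \<forall>x\<in>ball 0 (\<epsilon>/2). (\<lambda>n. \<alpha> n a t * x ^ n) sums W a x t"
    by blast
  have W_sums: "(\<lambda>n. \<alpha> n a t * x ^ n) sums W a x t" if "norm a < \<delta>" "norm t < r+1" "norm x < \<epsilon>/2" for a t x
    using sums that by simp
  show ?thesis
    unfolding semi_parabolic_expansion_def
  proof (intro exI[of _ "C a"] exI[of _ "\<lambda>j t. \<alpha> (j - (2*q+2)) a t"] exI[of _ "\<epsilon>/2"] conjI allI impI ballI)
    show "\<epsilon>/2 > 0" by fact
    show "(\<lambda>t. \<alpha> (j - (2*q+2)) a t) holomorphic_on snd ` \<Phi> a ` tube" for j
    proof (rule holomorphic_on_subset)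
      show "(\<lambda>t. \<alpha> (j - (2*q+2)) a t) holomorphic_on ball 0 (r+1)"
        by (rule hol3_slice[OF \<alpha>, of _ "\<lambda>_. a" "\<lambda>_. 0" "\<lambda>t. t"]) (use a in \<open>auto intro!: holomorphic_intros\<close>)
      show "snd ` \<Phi> a ` tube \<subseteq> ball 0 (r+1)" using eta_bound[OF a, of _ r] by (fastforce simp: \<Phi>_def)
    qed
    fix w assume w: "w \<in> conj_dom (\<Phi> a) tube (H a)"
    then obtain x y where xy: "dist (l / 2) x < \<rho>'" "norm y < r" "norm (a * x) < r" "w = \<Phi> a (x, y)" by (rule conj_domE)
    define t where "t = \<eta> a y"
    define u where "u = u_of a x y"
    define v where "v = T a u t"
    have wv: "w = (v, t)" using xy by (simp add: \<Phi>_def t_def u_def v_def)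
    have t: "norm t < r+1" using eta_bound[OF a xy(2)] by (simp add: t_def)
    have d: "dist (l / 2) x < 3/2 * \<rho>'" using xy \<rho>' by simp
    have u\<rho>: "norm u < \<rho>" unfolding u_def by (rule u_of_bound) (use a xy d in auto)
    have "(\<lambda>(v, t). norm v < \<epsilon>/2 \<longrightarrow> summable (\<lambda>n. \<alpha> (2*q+2+n - (2*q+2)) a t * v ^ (2*q+2+n)) \<and>
        fst (conj_map (\<Phi> a) tube (H a) (v, t)) =
        l * (v + v ^ (q+1) + C a * v ^ (2*q+1) + (\<Sum>n. \<alpha> (2*q+2+n - (2*q+2)) a t * v ^ (2*q+2+n)))) (v, t)"
    proof (clarify, intro conjI)
      assume v: "norm v < \<epsilon>/2"
      have u\<epsilon>: "norm u < \<epsilon>" using B_bounds(5)[OF a, of u t] u\<rho> t v by (simp add: v_def)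
      have Su: "S a v t = u" unfolding v_def by (rule S2) (use a u\<rho> t v \<epsilon>_rho \<rho>_pos in \<open>auto simp: v_def\<close>)
      have sm: "(\<lambda>n. v ^ (2*q+2) * (\<alpha> n a t * v ^ n)) sums (v ^ (2*q+2) * W a v t)"
        by (rule sums_mult[OF W_sums[OF a t v]])
      have eq: "\<alpha> (2*q+2+n - (2*q+2)) a t * v ^ (2*q+2+n) = v ^ (2*q+2) * (\<alpha> n a t * v ^ n)" for n
        by (simp add: power_add)
      show "summable (\<lambda>n. \<alpha> (2*q+2+n - (2*q+2)) a t * v ^ (2*q+2+n))" unfolding eq using sm by (rule sums_summable)
      have b0: "B a u t \<noteq> 0" using a u\<rho> t by (intro B_bounds(4)) auto
      have "l * (v ^ (2*q+2) * W a v t) = u ^ (2*q+2) * rem a u t"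
      proof -
        have "W a v t = (1 / B a u t) ^ (2*q+2) * rem a u t / l" by (simp add: W_def Su)
        moreover have "v = u * B a u t" by (simp add: v_def T)
        ultimately have "l * (v ^ (2*q+2) * W a v t) = (u * B a u t) ^ (2*q+2) * (1 / B a u t) ^ (2*q+2) * rem a u t"
          using l_nonzero by simp
        also have "(u * B a u t) ^ (2*q+2) * (1 / B a u t) ^ (2*q+2) = u ^ (2*q+2)"
          using b0 by (simp flip: power_mult_distrib)
        finally show ?thesis .
      qed
      moreover have "fst (conj_map (\<Phi> a) tube (H a) (v, t)) = T a (F a u t) (G a u t)"
      proof -
        have z: "(x, y) \<in> tube" using xy by simp
        have y3: "norm y < r + 3" using xy by simp
        show ?thesis unfolding wv[symmetric] xy(4) conj_at[OF a z] using Phi_H[OF a y3 d] by (simp add: u_def t_def)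
      qed
      moreover have "T a (F a u t) (G a u t) = l * (v + v ^ (q+1) + C a * v ^ (2*q+1)) + u ^ (2*q+2) * rem a u t"
        unfolding v_def by (rule normal[OF a u\<epsilon>]) (use t in simp)
      ultimately show "fst (conj_map (\<Phi> a) tube (H a) (v, t)) =
        l * (v + v ^ (q+1) + C a * v ^ (2*q+1) + (\<Sum>n. \<alpha> (2*q+2+n - (2*q+2)) a t * v ^ (2*q+2+n)))"
        unfolding eq using sums_unique[OF sm] by (simp add: distrib_left)
    qed
    then show "case w of (v, t) \<Rightarrow> norm v < \<epsilon>/2 \<longrightarrow> summable (\<lambda>n. \<alpha> (2*q+2+n - (2*q+2)) a t * v ^ (2*q+2+n)) \<and>
        fst (conj_map (\<Phi> a) tube (H a) (v, t)) =
        l * (v + v ^ (q+1) + C a * v ^ (2*q+1) + (\<Sum>n. \<alpha> (2*q+2+n - (2*q+2)) a t * v ^ (2*q+2+n)))"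
      unfolding wv .
  qed
qed

text \<open>The curve is invariant, so the difference between the second component and
  \<open>\<mu> * t\<close> vanishes for \<open>v = 0\<close> and is divisible by \<open>v\<close>.
  Its bound collects the displacement by \<open>\<eta>\<close>, the size of \<open>a * x\<close> and
  that of \<open>\<mu> * t\<close>.\<close>

lemma Phi_second_component:
  assumes a: "norm a < \<delta>"
  shows "\<exists>h. holomorphic2_on h (conj_dom (\<Phi> a) tube (H a)) \<and>
     (\<forall>(v, t) \<in> conj_dom (\<Phi> a) tube (H a).
        snd (conj_map (\<Phi> a) tube (H a) (v, t)) = small_eigenvalue l a * t + v * h (v, t) \<and>
        norm (v * h (v, t)) \<le> (1 / (4 * \<delta>) + \<rho>' + r + 2) * norm a)"
proof -
  obtain S where S: "hol3 S (ball 0 \<delta> \<times> ball 0 (\<rho> + 3/4) \<times> ball 0 (r+1))"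
    and S1: "\<And>a w t. norm a < \<delta> \<Longrightarrow> norm w < \<rho> + 3/4 \<Longrightarrow> norm t < r+1 \<Longrightarrow> norm (S a w t) < \<rho> + 1 \<and> T a (S a w t) t = w"
    and S2: "\<And>a u t. norm a < \<delta> \<Longrightarrow> norm u < \<rho> + 1 \<Longrightarrow> norm t < r+1 \<Longrightarrow> norm (T a u t) < \<rho> + 3/4 \<Longrightarrow> S a (T a u t) t = u"
    using T_inverse by blast
  define U0 where "U0 = (ball 0 \<delta> \<times> ball 0 (\<rho> + 3/4) \<times> ball 0 (r+1) :: (complex \<times> complex \<times> complex) set)"
  \<comment> \<open>Division by \<open>v\<close> needs an open set in the new coordinates on which
    \<open>base\<close> and \<open>\<eta>\<close> can be composed; \<open>U1\<close> and
    \<open>U2\<close> cut out the required inequalities as preimages.\<close>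
  define U1 where "U1 = {(a, w, t). (a, w, t) \<in> U0 \<and> S a w t \<in> ball 0 \<rho>}"
  define X1 where "X1 = (\<lambda>a w t. a * base a (S a w t) t)"
  define U2 where "U2 = {(a, w, t). (a, w, t) \<in> U1 \<and> X1 a w t \<in> ball 0 (r+3)}"
  have U0: "open U0" unfolding U0_def by (intro open_Times) auto
  have U1: "open U1" unfolding U1_def by (rule hol3_open_preimage[OF S[folded U0_def] U0]) auto
  have SU1: "hol3 S U1" by (rule hol3_subset[OF S]) (auto simp: U1_def U0_def)
  have X1: "hol3 X1 U1" unfolding X1_def
    by (intro hol3_mult hol3_a hol3_comp[OF hol3_base] SU1) (auto simp: U1_def U0_def intro: hol3_intros)
  have U2: "open U2" unfolding U2_def by (rule hol3_open_preimage[OF X1 U1]) auto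
  have X1U2: "hol3 X1 U2" by (rule hol3_subset[OF X1]) (auto simp: U2_def)
  define D where "D = (\<lambda>a w t. \<eta> a (X1 a w t) - small_eigenvalue l a * t)"
  have mu: "small_eigenvalue l holomorphic_on UNIV"
    unfolding small_eigenvalue_def[abs_def] by (intro holomorphic_intros) (use l_nonzero in auto)
  have D: "hol3 D U2" unfolding D_def
    by (intro hol3_diff hol3_mult hol3_t hol3_holomorphic[OF mu] hol3_comp[OF \<eta> _ _ X1U2])
       (auto simp: U2_def U1_def U0_def intro: hol3_intros)
  have D0: "D a 0 t = 0" if "(a, 0, t) \<in> U2" for a t
  proof -
    have at: "norm a < \<delta>" "norm t < r+1" using that by (auto simp: U2_def U1_def U0_def)
    have "T a 0 t = 0" by (simp add: T)
    then have "S a 0 t = 0" using S2[OF at(1), of 0 t] at \<rho>_pos by simp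
    then show ?thesis using G_at_0[of a t] at by (simp add: D_def X1_def G_def)
  qed
  obtain Q where Q: "hol3 Q U2" "\<And>a w t. (a, w, t) \<in> U2 \<Longrightarrow> D a w t = w * Q a w t"
    using hol3_divide_x[OF D U2 D0] by blast
  have key: "(a, v, t) \<in> U2 \<and> snd (conj_map (\<Phi> a) tube (H a) (v, t)) = small_eigenvalue l a * t + v * Q a v t \<and>
        norm (v * Q a v t) \<le> (1 / (4 * \<delta>) + \<rho>' + r + 2) * norm a"
    if w: "(v, t) \<in> conj_dom (\<Phi> a) tube (H a)" for v t
  proof -
    obtain x y where xy: "dist (l / 2) x < \<rho>'" "norm y < r" "norm (a * x) < r" "(v, t) = \<Phi> a (x, y)"
      using w by (rule conj_domE)
    define u where "u = u_of a x y"
    have ty: "t = \<eta> a y" and vu: "v = T a u t" using xy(4) by (auto simp: \<Phi>_def u_def)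
    have t: "norm t < r+1" using eta_bound[OF a xy(2)] by (simp add: ty)
    have d: "dist (l / 2) x < 3/2 * \<rho>'" and y3: "norm y < r+3" using xy \<rho>' by simp_all
    have u\<rho>: "norm u < \<rho>" unfolding u_def by (rule u_of_bound[OF a y3 d])
    have v\<rho>: "norm v < \<rho>" using Phi_image_1[OF a xy(2,1)] by (simp add: vu u_def ty)
    have Su: "S a v t = u" unfolding vu by (rule S2) (use a u\<rho> t v\<rho> in \<open>auto simp: vu\<close>)
    have X1: "X1 a v t = a * x" unfolding X1_def Su using base_u_of[OF a y3 d] by (simp add: u_def ty)
    have mem: "(a, v, t) \<in> U2" using a v\<rho> t u\<rho> xy(3) by (simp add: U2_def U1_def U0_def Su X1)
    have D': "D a v t = \<eta> a (a * x) - small_eigenvalue l a * t" by (simp add: D_def X1)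
    have "snd (conj_map (\<Phi> a) tube (H a) (v, t)) = \<eta> a (a * x)"
    proof -
      have z: "(x, y) \<in> tube" using xy by simp
      show ?thesis unfolding xy(4) conj_at[OF a z] by (simp add: Phi_H[OF a y3 d])
    qed
    moreover have "norm (D a v t) \<le> (1 / (4 * \<delta>) + \<rho>' + r + 2) * norm a"
    proof -
      have "norm x \<le> norm (l / 2) + norm (l / 2 - x)" by (metis norm_minus_commute norm_triangle_sub)
      then have "norm x \<le> 1/2 + \<rho>'" using xy(1) l by (simp add: norm_divide dist_norm)
      then have "norm (a * x) \<le> norm a * (1/2 + \<rho>')" unfolding norm_mult by (intro mult_left_mono) auto
      moreover have "norm (\<eta> a (a * x) - a * x) \<le> norm a / (4 * \<delta>)" by (rule eta_near_a[OF a]) (use xy in simp)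
      moreover have "norm (small_eigenvalue l a * t) \<le> (norm a / 4) * (r + 1)"
        unfolding norm_mult using mu_bound(1)[OF a] t by (intro mult_mono) auto
      moreover have "norm (D a v t) \<le> norm (\<eta> a (a * x) - a * x) + norm (a * x) + norm (small_eigenvalue l a * t)"
      proof -
        have "D a v t = (\<eta> a (a * x) - a * x) + a * x - small_eigenvalue l a * t" by (simp add: D')
        then show ?thesis by (metis norm_triangle_ineq norm_triangle_ineq4 add_right_mono order_trans)
      qed
      ultimately have "norm (D a v t) \<le> norm a / (4 * \<delta>) + norm a * (1/2 + \<rho>') + (norm a / 4) * (r + 1)" by linarith
      also have "\<dots> = (1 / (4 * \<delta>) + \<rho>' + (r + 3) / 4) * norm a" by (simp add: field_simps)
      also have "\<dots> \<le> (1 / (4 * \<delta>) + \<rho>' + r + 2) * norm a" using r by (intro mult_right_mono) auto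
      finally show ?thesis .
    qed
    moreover have "\<eta> a (a * x) = small_eigenvalue l a * t + v * Q a v t"
      using Q(2)[OF mem] unfolding D' by (simp add: diff_eq_eq add.commute)
    ultimately show ?thesis using mem Q(2)[OF mem] by simp
  qed
  have "holomorphic2_on (\<lambda>(v, t). Q a v t) (conj_dom (\<Phi> a) tube (H a))"
    by (rule hol3_imp_holomorphic2_on[OF Q(1)]) (use key in blast)
  then show ?thesis using key by (intro exI[of _ "\<lambda>(v, t). Q a v t"]) auto
qed

end

section \<open>Iterated preimages of the stable curve\<close>

lemma Re_csqrt_near_1:
  assumes "norm (v - 1) < 1/2" shows "1/2 \<le> Re (csqrt v)" "v \<notin> \<real>\<^sub>\<le>\<^sub>0"
proof -
  have re: "Re v > 1/2" using abs_Re_le_cmod[of "v - 1"] assms by (simp add: abs_less_iff)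
  then show "v \<notin> \<real>\<^sub>\<le>\<^sub>0" by (auto simp: complex_nonpos_Reals_iff)
  define s where "s = csqrt v"
  have "s\<^sup>2 = v" by (simp add: s_def)
  then have "Re v = (Re s)\<^sup>2 - (Im s)\<^sup>2" by (metis Re_power2)
  moreover have "(1/2::real)\<^sup>2 = 1/4" by (simp add: power2_eq_square)
  ultimately have "(1/2)\<^sup>2 \<le> (Re s)\<^sup>2" using re zero_le_power2[of "Im s"] by linarith
  moreover have "0 \<le> Re s" unfolding s_def by (simp only: Re_csqrt)
  ultimately show "1/2 \<le> Re (csqrt v)" unfolding s_def by (rule power2_le_imp_le)
qed

text \<open>The constant \<open>6\<close> is \<open>2 * 3 / 1\<close>, from the bound
  \<open>3\<close> on \<open>f\<close> and a margin of \<open>1\<close> around the unit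
  disc.\<close>

lemma bounded_lipschitz:
  assumes f: "f holomorphic_on ball 0 r" and bd: "\<And>y. norm y < r \<Longrightarrow> norm (f y) < 3" and r: "r > 3"
    and u: "norm u \<le> 1" "norm v \<le> 1"
  shows "norm (f u - f v) \<le> 6 * norm (u - v)"
proof -
  have "norm (f u - f v) \<le> 2 * 3 / 1 * norm (u - v)"
    by (rule holomorphic_lipschitz[OF f]) (use bd u r less_imp_le in auto)
  then show ?thesis by simp
qed

text \<open>The preimage of a vertical graph \<open>x = f y\<close> under the Henon map consists of two vertical graphs,
  provided that the graph stays away from the critical value.\<close>

lemma graph_preimages:
  fixes f :: "complex \<Rightarrow> complex" and a c :: complex
  assumes f: "f holomorphic_on ball 0 r" and bd: "\<And>y. norm y < r \<Longrightarrow> norm (f y) < 3" and r: "r > 3"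
    and \<kappa>: "0 < \<kappa>" "\<kappa> \<le> norm (f 0 - c)" and c: "norm c \<le> 1"
    and a: "norm a \<le> 1/4" "norm a * r \<le> 1" "(18 + r) * norm a < \<kappa> / 2" "12 * norm a \<le> sqrt \<kappa>"
  shows "\<exists>g. (\<forall>\<sigma>::bool. g \<sigma> holomorphic_on ball 0 r \<and>
       (\<forall>y. norm y < r \<longrightarrow> norm (g \<sigma> y) < 3 \<and> (g \<sigma> y)\<^sup>2 = f (a * g \<sigma> y) - c - a * y)) \<and>
     (\<forall>x y. norm x < 3 \<longrightarrow> norm y < r \<longrightarrow> x\<^sup>2 = f (a * x) - c - a * y \<longrightarrow> (\<exists>\<sigma>. x = g \<sigma> y))"
proof -
  define w0 where "w0 = f 0 - c"
  have w0: "w0 \<noteq> 0" "\<kappa> \<le> norm w0" using \<kappa> by (auto simp: w0_def)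
  \<comment> \<open>A branch of the square root near \<open>w0\<close>; dividing by
    \<open>w0\<close> first keeps the argument near \<open>1\<close>, away from the cut.\<close>
  define sb where "sb = (\<lambda>w. csqrt w0 * csqrt (w / w0))"
  have near: "norm (w / w0 - 1) < 1/2" if "w \<in> ball w0 (\<kappa>/2)" for w
  proof -
    have "w / w0 - 1 = (w - w0) / w0" using w0 by (simp add: field_simps)
    moreover have "norm (w - w0) < norm w0 / 2" using that w0 by (simp add: dist_norm norm_minus_commute)
    ultimately show ?thesis using w0 by (simp add: norm_divide divide_less_eq)
  qed
  have sb_hol: "sb holomorphic_on ball w0 (\<kappa>/2)"
    unfolding sb_def using w0 Re_csqrt_near_1(2)[OF near]
    by (intro holomorphic_intros) auto
  have sb_sq: "(sb w)\<^sup>2 = w" for w using w0 by (simp add: sb_def power_mult_distrib)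
  \<comment> \<open>Both normalized roots have real part at least \<open>1/2\<close>, so the sum of
    the two roots has modulus at least \<open>sqrt \<kappa>\<close>; factoring the difference of
    squares gives the Lipschitz bound.\<close>
  have sb_lip: "sqrt \<kappa> * norm (sb w - sb w') \<le> norm (w - w')" if w: "w \<in> ball w0 (\<kappa>/2)" "w' \<in> ball w0 (\<kappa>/2)" for w w'
  proof -
    have "1 \<le> Re (csqrt (w / w0) + csqrt (w' / w0))"
      using Re_csqrt_near_1(1)[OF near[OF w(1)]] Re_csqrt_near_1(1)[OF near[OF w(2)]] by simp
    then have "1 \<le> norm (csqrt (w / w0) + csqrt (w' / w0))" using complex_Re_le_cmod order_trans by blast
    then have "norm (csqrt w0) * 1 \<le> norm (csqrt w0) * norm (csqrt (w / w0) + csqrt (w' / w0))" by (intro mult_left_mono) auto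
    also have "\<dots> = norm (csqrt w0 * (csqrt (w / w0) + csqrt (w' / w0)))" by (simp only: norm_mult)
    also have "\<dots> = norm (sb w + sb w')" by (simp only: sb_def distrib_left)
    finally have "sqrt (norm w0) \<le> norm (sb w + sb w')" by simp
    then have s: "sqrt \<kappa> \<le> norm (sb w + sb w')" using w0 real_sqrt_le_mono order_trans by blast
    have "w - w' = (sb w + sb w') * (sb w - sb w')" using sb_sq[of w] sb_sq[of w'] by (simp add: power2_eq_square algebra_simps)
    then have "norm (w - w') = norm (sb w + sb w') * norm (sb w - sb w')" by (simp add: norm_mult)
    then show ?thesis using s by (simp add: mult_right_mono)
  qed
  define arg where "arg = (\<lambda>x t. f (a * x) - c - a * t)"
  have ax: "norm (a * x) \<le> 1" if "norm x < 3" for x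
  proof -
    have "norm a * norm x \<le> 1/4 * 3" using a that by (intro mult_mono) auto
    then show ?thesis by (simp add: norm_mult)
  qed
  have arg: "arg x t \<in> ball w0 (\<kappa>/2)" if x: "norm x < 3" and t: "norm t < r" for x t
  proof -
    have "norm (f (a * x) - f 0) \<le> 6 * norm (a * x - 0)"
      by (rule bounded_lipschitz[OF f bd r]) (use ax[OF x] in auto)
    also have "\<dots> \<le> 6 * (norm a * 3)" unfolding diff_zero norm_mult using x by (intro mult_left_mono) auto
    finally have 1: "norm (f (a * x) - f 0) \<le> 18 * norm a" by simp
    have 2: "norm (a * t) \<le> norm a * r" unfolding norm_mult using t by (intro mult_left_mono) auto
    have "arg x t - w0 = (f (a * x) - f 0) - a * t" by (simp add: arg_def w0_def)
    then have "norm (arg x t - w0) \<le> 18 * norm a + norm a * r"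
      using norm_triangle_ineq4[of "f (a * x) - f 0" "a * t"] 1 2 by simp
    then show ?thesis using a(3) by (simp add: dist_norm norm_minus_commute algebra_simps)
  qed
  \<comment> \<open>The two signs of the root are posed as \<open>x + E = 0\<close>, the form of the
    fixed point lemma with target value \<open>0\<close>.\<close>
  define E where "E = (\<lambda>\<sigma> (b::complex) x t. if \<sigma> then sb (arg x t) else - sb (arg x t))"
  have arg_hol: "hol3 (\<lambda>b x t. arg x t) (UNIV \<times> ball 0 3 \<times> ball 0 r)"
  proof -
    have "hol3 (\<lambda>b x t. f (a * x)) (UNIV \<times> ball 0 3 \<times> ball 0 r)"
      by (rule hol3_holomorphic[OF f]) (use le_less_trans[OF ax] r in \<open>auto intro!: hol3_intros\<close>)
    then show ?thesis unfolding arg_def by (intro hol3_intros)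
  qed
  have sb3: "hol3 (\<lambda>b x t. sb (arg x t)) (UNIV \<times> ball 0 3 \<times> ball 0 r)"
    by (rule hol3_holomorphic[OF sb_hol open_ball arg_hol]) (use arg in auto)
  have E: "hol3 (E \<sigma>) (UNIV \<times> ball 0 3 \<times> ball 0 r)" for \<sigma>
    unfolding E_def by (cases \<sigma>) (auto intro!: sb3 hol3_uminus)
  \<comment> \<open>\<open>|arg| \<le> 3 + 1 + 1 \<le> (5/2)^2\<close>, and \<open>5/2 < 3\<close>
    leaves room for the target value \<open>0\<close>.\<close>
  have Ebd: "norm (E \<sigma> b x t) \<le> 5/2" if x: "norm x < 3" and t: "norm t < r" for \<sigma> b x t
  proof -
    have fx: "norm (f (a * x)) < 3" using ax[OF x] r by (intro bd) simp
    have "norm a * norm t \<le> norm a * r" using t by (intro mult_left_mono) auto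
    then have at: "norm (a * t) \<le> 1" using a(2) by (simp add: norm_mult)
    have "norm (arg x t) \<le> norm (f (a * x)) + norm c + norm (a * t)"
      unfolding arg_def by (metis norm_triangle_ineq4 add_right_mono order_trans)
    then have "norm (arg x t) \<le> 5" using fx at c by simp
    then have "(norm (sb (arg x t)))\<^sup>2 \<le> (5/2)\<^sup>2" using sb_sq[of "arg x t"] by (simp add: power2_eq_square flip: norm_mult)
    then have "norm (sb (arg x t)) \<le> 5/2" by (rule power2_le_imp_le) simp
    then show ?thesis by (simp add: E_def)
  qed
  have Elip: "norm (E \<sigma> b x t - E \<sigma> b x' t) \<le> 1/2 * norm (x - x')"
    if x: "norm x < 3" "norm x' < 3" and t: "norm t < r" for \<sigma> b x x' t
  proof -
    have "sqrt \<kappa> * norm (sb (arg x t) - sb (arg x' t)) \<le> norm (arg x t - arg x' t)"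
      by (rule sb_lip) (use arg x t in auto)
    also have "\<dots> = norm (f (a * x) - f (a * x'))" by (simp add: arg_def)
    also have "\<dots> \<le> 6 * norm (a * x - a * x')" by (rule bounded_lipschitz[OF f bd r]) (use ax x in auto)
    also have "\<dots> = 1/2 * (12 * norm a) * norm (x - x')" by (simp flip: right_diff_distrib add: norm_mult)
    also have "\<dots> \<le> 1/2 * sqrt \<kappa> * norm (x - x')" using a(4) by (intro mult_right_mono) auto
    finally have "sqrt \<kappa> * norm (sb (arg x t) - sb (arg x' t)) \<le> sqrt \<kappa> * (1/2 * norm (x - x'))" by simp
    then have "norm (sb (arg x t) - sb (arg x' t)) \<le> 1/2 * norm (x - x')"
      using \<kappa> by (simp only: mult_le_cancel_left_pos real_sqrt_gt_zero)
    then show ?thesis by (cases \<sigma>) (simp_all add: E_def norm_minus_commute)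
  qed
  have "\<exists>g. g holomorphic_on ball 0 r \<and>
       (\<forall>y. norm y < r \<longrightarrow> norm (g y) < 3 \<and> (g y)\<^sup>2 = f (a * g y) - c - a * y) \<and>
     (\<forall>x y. norm x < 3 \<longrightarrow> norm y < r \<longrightarrow> x + E \<sigma> 0 x y = 0 \<longrightarrow> x = g y)" for \<sigma>
  proof -
    obtain s where s: "hol3 s (UNIV \<times> ball 0 (3 - 5/2) \<times> ball 0 r)"
      and s1: "\<And>b w t. b \<in> UNIV \<Longrightarrow> w \<in> ball 0 (3 - 5/2) \<Longrightarrow> t \<in> ball 0 r \<Longrightarrow>
          norm (s b w t) < 3 \<and> norm (s b w t - w) \<le> 5/2 \<and> s b w t + E \<sigma> b (s b w t) t = w"
      and s2: "\<And>b x w t. b \<in> UNIV \<Longrightarrow> x \<in> ball 0 3 \<Longrightarrow> t \<in> ball 0 r \<Longrightarrow> w \<in> ball 0 (3 - 5/2) \<Longrightarrow>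
          x + E \<sigma> b x t = w \<Longrightarrow> x = s b w t"
      by (rule hol3_fixpoint[OF E[of \<sigma>], of "5/2"]) (use Ebd Elip in auto)
    have "s 0 0 holomorphic_on ball 0 r"
      by (rule hol3_slice[OF s, of _ "\<lambda>_. 0" "\<lambda>_. 0" "\<lambda>t. t"]) (auto intro!: holomorphic_intros)
    moreover have "norm (s 0 0 y) < 3 \<and> (s 0 0 y)\<^sup>2 = f (a * s 0 0 y) - c - a * y" if y: "norm y < r" for y
    proof -
      have p: "norm (s 0 0 y) < 3" "s 0 0 y + E \<sigma> 0 (s 0 0 y) y = 0" using s1[of 0 0 y] y by auto
      have "s 0 0 y = - E \<sigma> 0 (s 0 0 y) y" using p(2) by (simp add: eq_neg_iff_add_eq_0)
      then have "(s 0 0 y)\<^sup>2 = (E \<sigma> 0 (s 0 0 y) y)\<^sup>2" by (metis power2_minus)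
      also have "\<dots> = arg (s 0 0 y) y" by (simp add: E_def sb_sq)
      finally show ?thesis using p by (simp add: arg_def)
    qed
    moreover have "x = s 0 0 y" if "norm x < 3" "norm y < r" "x + E \<sigma> 0 x y = 0" for x y
      using s2[of 0 x y 0] that by simp
    ultimately show ?thesis by blast
  qed
  then obtain g where g: "\<And>\<sigma>. g \<sigma> holomorphic_on ball 0 r"
    "\<And>\<sigma> y. norm y < r \<Longrightarrow> norm (g \<sigma> y) < 3 \<and> (g \<sigma> y)\<^sup>2 = f (a * g \<sigma> y) - c - a * y"
    "\<And>\<sigma> x y. norm x < 3 \<Longrightarrow> norm y < r \<Longrightarrow> x + E \<sigma> 0 x y = 0 \<Longrightarrow> x = g \<sigma> y"
    by metis
  have "\<exists>\<sigma>. x = g \<sigma> y" if xy: "norm x < 3" "norm y < r" "x\<^sup>2 = f (a * x) - c - a * y" for x y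
  proof -
    have "x\<^sup>2 = (sb (arg x y))\<^sup>2" using xy(3) by (simp add: sb_sq arg_def)
    then have "x = sb (arg x y) \<or> x = - sb (arg x y)" by (simp add: power2_eq_iff)
    then have "x + E False 0 x y = 0 \<or> x + E True 0 x y = 0" 
      by (auto simp: E_def eq_neg_iff_add_eq_0)
    then show ?thesis using g(3) xy by metis
  qed
  then show ?thesis using g by blast
qed

text \<open>The difference of two solutions is nonzero only where their sum is at most \<open>6 * norm a\<close>, and
  zero only where it is larger; as the domain is connected, one alternative holds everywhere.\<close>

lemma graph_preimages_disjoint:
  fixes f g h :: "complex \<Rightarrow> complex" and a c :: complex
  assumes f: "f holomorphic_on ball 0 r" and bd: "\<And>y. norm y < r \<Longrightarrow> norm (f y) < 3" and r: "r > 3"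
    and \<kappa>: "0 < \<kappa>" "\<kappa> \<le> norm (f 0 - c)"
    and a: "norm a \<le> 1/4" "(18 + r) * norm a < \<kappa> / 2" "12 * norm a \<le> sqrt \<kappa>"
    and g: "g holomorphic_on ball 0 r" "\<And>y. norm y < r \<Longrightarrow> norm (g y) < 3 \<and> (g y)\<^sup>2 = f (a * g y) - c - a * y"
    and h: "h holomorphic_on ball 0 r" "\<And>y. norm y < r \<Longrightarrow> norm (h y) < 3 \<and> (h y)\<^sup>2 = f (a * h y) - c - a * y"
    and meet: "norm y0 < r" "g y0 = h y0" and y: "norm y < r"
  shows "g y = h y"
proof (rule ccontr)
  assume ne: "g y \<noteq> h y"
  have ax: "norm (a * x) \<le> 1" if "norm x < 3" for x
  proof -
    have "norm a * norm x \<le> 1/4 * 3" using a that by (intro mult_mono) auto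
    then show ?thesis by (simp add: norm_mult)
  qed
  define d where "d = (\<lambda>y. norm (g y + h y))"
  have low: "d z \<le> 6 * norm a" if z: "norm z < r" "g z \<noteq> h z" for z
  proof -
    have "(g z)\<^sup>2 - (h z)\<^sup>2 = f (a * g z) - f (a * h z)" using g(2)[OF z(1)] h(2)[OF z(1)] by simp
    then have "(g z + h z) * (g z - h z) = f (a * g z) - f (a * h z)" by (simp add: power2_eq_square algebra_simps)
    then have "d z * norm (g z - h z) = norm (f (a * g z) - f (a * h z))" by (simp add: d_def flip: norm_mult)
    also have "\<dots> \<le> 6 * norm (a * g z - a * h z)"
      by (rule bounded_lipschitz[OF f bd r]) (use ax g(2) h(2) z in auto)
    also have "\<dots> = 6 * norm a * norm (g z - h z)" by (simp flip: right_diff_distrib add: norm_mult)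
    finally show ?thesis using z(2) by simp
  qed
  have high: "sqrt \<kappa> \<le> d z" if z: "norm z < r" "g z = h z" for z
  proof -
    have gz: "norm (g z) < 3" "(g z)\<^sup>2 = f (a * g z) - c - a * z" using g(2)[OF z(1)] by auto
    have "norm (f (a * g z) - f 0) \<le> 6 * norm (a * g z - 0)"
      by (rule bounded_lipschitz[OF f bd r]) (use ax[OF gz(1)] in auto)
    also have "\<dots> \<le> 6 * (norm a * 3)" unfolding diff_zero norm_mult using gz by (intro mult_left_mono) auto
    finally have 1: "norm (f (a * g z) - f 0) \<le> 18 * norm a" by simp
    have 2: "norm (a * z) \<le> norm a * r" unfolding norm_mult using z by (intro mult_left_mono) auto
    have "f 0 - c = (g z)\<^sup>2 - ((f (a * g z) - f 0) - a * z)" using gz by simp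
    then have "norm (f 0 - c) \<le> norm ((g z)\<^sup>2) + norm ((f (a * g z) - f 0) - a * z)" by (metis norm_triangle_ineq4)
    also have "norm ((f (a * g z) - f 0) - a * z) \<le> 18 * norm a + norm a * r"
      using norm_triangle_ineq4[of "f (a * g z) - f 0" "a * z"] 1 2 by linarith
    finally have "\<kappa> \<le> norm ((g z)\<^sup>2) + (18 + r) * norm a" using \<kappa> by (simp add: algebra_simps)
    then have k2: "\<kappa> / 2 < (norm (g z))\<^sup>2" using a(2) by (simp add: norm_power)
    have "d z = 2 * norm (g z)" using z(2) by (simp add: d_def flip: mult_2 add: norm_mult)
    then have "(sqrt \<kappa>)\<^sup>2 \<le> (d z)\<^sup>2" using k2 \<kappa> by (simp add: power_mult_distrib)
    then show ?thesis by (rule power2_le_imp_le) (simp add: d_def)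
  qed
  have "continuous_on (ball 0 r) d" unfolding d_def
    by (intro continuous_intros holomorphic_on_imp_continuous_on g h)
  then have conn: "connected (d ` ball 0 r)" by (intro connected_continuous_image) auto
  \<comment> \<open>A value strictly between the two ranges, as
    \<open>6 * |a| \<le> sqrt \<kappa> / 2\<close>.\<close>
  define m where "m = 3/4 * sqrt \<kappa>"
  have m: "6 * norm a < m" "m < sqrt \<kappa>" using a(3) real_sqrt_gt_zero[OF \<kappa>(1)] unfolding m_def by linarith+
  have "m \<in> d ` ball 0 r"
  proof (rule connectedD_interval[OF conn])
    show "d y \<in> d ` ball 0 r" "d y0 \<in> d ` ball 0 r" using y meet by auto
    show "d y \<le> m" using low[OF y ne] m by simp
    show "m \<le> d y0" using high[OF meet] m by simp
  qed
  then obtain z where z: "norm z < r" "d z = m" by auto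
  then show False using low[OF z(1)] high[OF z(1)] m by (cases "g z = h z") auto
qed

section \<open>Dynamics near the invariant graph\<close>

context henon_chart
begin

definition coord :: "complex \<Rightarrow> complex \<times> complex \<Rightarrow> complex" where
  "coord a z = fst (\<Phi> a z)"

definition graph0 :: "complex \<Rightarrow> (complex \<times> complex) set" where
  "graph0 a = {(x, y). norm y < r \<and> x = X a (\<eta> a y)}"

text \<open>The attracting petals in the normalized coordinate, pulled back to the tube. On the
  invariant graph \<open>coord\<close> is \<open>0\<close>, so the two sets are disjoint.\<close>

definition basin :: "complex \<Rightarrow> real \<Rightarrow> (complex \<times> complex) set" where
  "basin a L = {z \<in> tube. coord a z \<noteq> 0 \<and> Re (- 1 / coord a z ^ q) > L}"

text \<open>The one-variable petal estimate applies to \<open>coord\<close> with constants uniform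
  in \<open>a\<close> and the height. In addition the image must remain in the tube: a small
  coordinate makes \<open>F\<close> small, so its \<open>\<psi>\<close>-image is within
  \<open>\<rho>' / 2\<close> of \<open>l / 2\<close>, and undoing the straightening costs at most
  \<open>\<rho>' / 4\<close>.\<close>

lemma coord_step:
  "\<exists>e>0. e \<le> 1 \<and> (\<forall>w. norm w < e \<longrightarrow> norm w < \<rho> \<and> dist (l / 2) (\<psi> w) < \<rho>' / 2) \<and>
    (\<forall>a z. norm a < \<delta> \<longrightarrow> z \<in> tube \<longrightarrow> coord a z \<noteq> 0 \<longrightarrow> norm (coord a z) < e \<longrightarrow>
       H a z \<in> tube \<and> norm (coord a (H a z)) \<ge> norm (coord a z) / 2 \<and>
       norm (- 1 / coord a (H a z) ^ q - (- 1 / coord a z ^ q) - of_nat q) \<le> real q / 2)"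
proof -
  obtain e1 K1 where e1: "0 < e1" "e1 \<le> 1" and K1: "K1 \<ge> 0" and st: "\<And>x s. x \<noteq> 0 \<Longrightarrow> norm x < e1 \<Longrightarrow> norm s \<le> K\<^sub>s \<Longrightarrow>
     norm (l * x * (1 + x ^ q + x ^ (q+1) * s)) \<ge> norm x / 2 \<and>
     norm (- 1 / (l * x * (1 + x ^ q + x ^ (q+1) * s)) ^ q - (- 1 / x ^ q) - of_nat q) \<le> K1 * norm x"
    using petal_coordinate_step[OF q l K\<^sub>s(1)] by blast
  have "isCont \<psi> 0" by (rule holomorphic_isCont[OF \<psi> \<rho>_pos])
  then obtain e2 where e2: "e2 > 0" "\<And>w. norm w < e2 \<Longrightarrow> dist (\<psi> w) (l / 2) < \<rho>' / 2"
    unfolding continuous_at_eps_delta using \<rho>'(1) \<psi>0 by (auto simp: dist_norm dest!: spec[of _ "\<rho>' / 2"])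
  define e3 where "e3 = min e2 \<rho>"
  \<comment> \<open>The entries serve in turn the petal estimate, the validity of the normal form
    through \<open>|u| \<le> 2 * |coord|\<close>, a deviation of at most \<open>q / 2\<close>, and
    smallness of \<open>F\<close>, where \<open>2 + K\<^sub>s\<close> bounds the growth in one
    step.\<close>
  define e where "e = min (min e1 (\<epsilon> / 2)) (min (1 / (2 * (K1 + 1))) (e3 / (2 * (2 + K\<^sub>s))))"
  have e3: "e3 > 0" using e2 \<rho>_pos by (simp add: e3_def)
  have Ks2: "2 + K\<^sub>s > 0" using K\<^sub>s(1) by simp
  have e: "e > 0" "e \<le> e1" "e \<le> \<epsilon> / 2" "e \<le> 1 / (2 * (K1 + 1))" "e \<le> e3 / (2 * (2 + K\<^sub>s))" "e \<le> 1"
  proof -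
    have m: "e \<le> min e1 (\<epsilon> / 2)" "e \<le> min (1 / (2 * (K1 + 1))) (e3 / (2 * (2 + K\<^sub>s)))"
      unfolding e_def by (rule min.cobounded1, rule min.cobounded2)
    have "0 < 1 / (2 * (K1 + 1))" "0 < e3 / (2 * (2 + K\<^sub>s))" using e3 K1 Ks2 by simp_all
    then show "e > 0" unfolding e_def min_less_iff_conj using e1 \<epsilon>_pos by simp
    show "e \<le> e1" "e \<le> \<epsilon> / 2" by (rule order_trans[OF m(1)], rule min.cobounded1 min.cobounded2)+
    show "e \<le> 1 / (2 * (K1 + 1))" "e \<le> e3 / (2 * (2 + K\<^sub>s))"
      by (rule order_trans[OF m(2)], rule min.cobounded1 min.cobounded2)+
    show "e \<le> 1" using \<open>e \<le> e1\<close> e1 by simp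
  qed
  have ee3: "e \<le> e3"
  proof -
    have "2 * (2 + K\<^sub>s) \<ge> 1" using K\<^sub>s(1) by simp
    then have "e3 / (2 * (2 + K\<^sub>s)) \<le> e3 / 1" using e3 by (intro divide_left_mono) auto
    then show ?thesis using e(5) by simp
  qed
  show ?thesis
  proof (intro exI[of _ e] conjI allI impI)
    show "e > 0" "e \<le> 1" by fact+
    show "norm w < \<rho>" "dist (l / 2) (\<psi> w) < \<rho>' / 2" if "norm w < e" for w
      using that ee3 e2(2)[of w] by (auto simp: e3_def dist_commute)
    fix a z assume a: "norm a < \<delta>" and z: "z \<in> tube" "coord a z \<noteq> 0" "norm (coord a z) < e"
    obtain x y where xy: "z = (x, y)" "dist (l / 2) x < \<rho>'" "norm y < r" using z(1) by (cases z) auto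
    define t where "t = \<eta> a y"
    define u where "u = u_of a x y"
    have d: "dist (l / 2) x < 3/2 * \<rho>'" and y3: "norm y < r+3" using xy \<rho>' by simp_all
    have v: "coord a z = T a u t" by (simp add: coord_def \<Phi>_def xy u_def t_def)
    have t: "norm t < r+1" using eta_bound[OF a xy(3)] by (simp add: t_def)
    have u\<rho>: "norm u < \<rho>" unfolding u_def by (rule u_of_bound[OF a y3 d])
    have u\<epsilon>: "norm u < \<epsilon>" using B_bounds(5)[OF a, of u t] u\<rho> t z(3) e v by simp
    have c1: "coord a (H a z) = T a (F a u t) (G a u t)"
      unfolding coord_def xy(1) by (simp add: Phi_H[OF a y3 d] u_def t_def)
    obtain s where s: "norm s \<le> K\<^sub>s" "coord a (H a z) = l * T a u t * (1 + T a u t ^ q + T a u t ^ (q+1) * s)"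
      using K\<^sub>s(2)[OF a u\<epsilon>, of t] t unfolding c1 by auto
    have v0: "T a u t \<noteq> 0" "norm (T a u t) < e1" using z e v by auto
    note st' = st[OF v0 s(1)]
    show "norm (coord a (H a z)) \<ge> norm (coord a z) / 2" using st' unfolding s(2) v by simp
    have "K1 * norm (T a u t) \<le> (K1 + 1) * (1 / (2 * (K1 + 1)))" using z(3) e K1 v by (intro mult_mono) auto
    also have "\<dots> = 1/2" using K1 by (simp add: field_simps)
    finally have "K1 * norm (T a u t) \<le> real q / 2" using q by simp
    then show "norm (- 1 / coord a (H a z) ^ q - (- 1 / coord a z ^ q) - of_nat q) \<le> real q / 2"
      using st' unfolding s(2) v by linarith
    have sV: "shifted a u t \<in> V" by (rule shifted_V[OF a u\<epsilon>]) (use t in simp)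
    have F\<rho>: "norm (F a u t) < \<rho>" using \<psi>\<phi>[OF sV] by (simp add: F_def)
    have Gs: "norm (G a u t) \<le> 1" by (rule G_small[OF a u\<epsilon>]) (use t in simp)
    have "norm (F a u t) \<le> 2 * norm (coord a (H a z))"
      unfolding c1 using F\<rho> Gs r by (intro B_bounds(5)[OF a]) auto
    also have "norm (coord a (H a z)) \<le> norm (T a u t) * (2 + K\<^sub>s)"
    proof -
      have n1: "norm (T a u t) \<le> 1" using v0 e1 by simp
      have "norm (T a u t ^ (q+1) * s) \<le> 1 * K\<^sub>s"
        unfolding norm_mult norm_power using n1 s(1) K\<^sub>s(1) by (intro mult_mono power_le_one) auto
      moreover have "norm (T a u t ^ q) \<le> 1" unfolding norm_power using n1 by (intro power_le_one) auto
      ultimately have "norm (1 + T a u t ^ q + T a u t ^ (q+1) * s) \<le> 2 + K\<^sub>s"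
        using norm_triangle_ineq[of "1 + T a u t ^ q" "T a u t ^ (q+1) * s"] norm_triangle_ineq[of 1 "T a u t ^ q"] by simp
      then show ?thesis unfolding s(2) norm_mult using l by (simp add: mult_left_mono)
    qed
    also have "2 * (norm (T a u t) * (2 + K\<^sub>s)) < 2 * (e3 / (2 * (2 + K\<^sub>s)) * (2 + K\<^sub>s))"
      using z(3) e(5) v Ks2 by (intro mult_strict_left_mono mult_strict_right_mono) auto
    also have "\<dots> = e3" using Ks2 by (simp add: field_simps)
    finally have Fe: "norm (F a u t) < e3" by simp
    have "\<psi> (F a u t) = x\<^sup>2 + curve_c l a + a * y - X a (\<eta> a (a * x)) + l / 2"
      using \<psi>\<phi>[OF sV] base_u_of[OF a y3 d] Y\<eta>[OF a y3] F_G_u_of(1)[OF a y3 d]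
      by (simp add: F_def shifted_def u_def t_def)
    then have eq: "x\<^sup>2 + curve_c l a + a * y - l / 2 = (\<psi> (F a u t) - l / 2) + (X a (\<eta> a (a * x)) - l / 2)" by (simp add: algebra_simps)
    have "norm (\<psi> (F a u t) - l / 2) < \<rho>' / 2" using e2(2)[of "F a u t"] Fe by (simp add: e3_def dist_norm)
    moreover have "norm (X a (\<eta> a (a * x)) - l / 2) \<le> \<rho>' / 4"
      using X_near[OF a, of "G a u t"] Gs r F_G_u_of(1)[OF a y3 d] by (simp add: u_def t_def)
    ultimately have "norm (x\<^sup>2 + curve_c l a + a * y - l / 2) < \<rho>'"
      unfolding eq using norm_triangle_ineq[of "\<psi> (F a u t) - l / 2" "X a (\<eta> a (a * x)) - l / 2"] \<rho>'(1) by simp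
    moreover have "norm (a * x) < r"
      using a_base_bound[OF a u\<epsilon>, of t] t base_u_of[OF a y3 d] r by (simp add: u_def t_def)
    ultimately show "H a z \<in> tube" by (simp add: xy henon_def dist_norm norm_minus_commute)
  qed
qed

text \<open>In the petal the real part of \<open>- 1 / coord ^ q\<close> gains at least
  \<open>q / 2\<close> per step. The second conclusion later places a point of the critical orbit
  inside the tube.\<close>

lemma basin_invariant:
  "\<exists>L0>0. \<forall>L\<ge>L0. (\<forall>a z. norm a < \<delta> \<longrightarrow> z \<in> basin a L \<longrightarrow> H a z \<in> basin a L) \<and>
     (\<forall>w. w \<noteq> 0 \<longrightarrow> Re (- 1 / w ^ q) > L \<longrightarrow> norm w < \<rho> \<and> dist (l / 2) (\<psi> w) < \<rho>' / 2)"
proof -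
  obtain e where e: "e > 0" "e \<le> 1" "\<And>w. norm w < e \<Longrightarrow> norm w < \<rho> \<and> dist (l / 2) (\<psi> w) < \<rho>' / 2"
    and st: "\<And>a z. norm a < \<delta> \<Longrightarrow> z \<in> tube \<Longrightarrow> coord a z \<noteq> 0 \<Longrightarrow> norm (coord a z) < e \<Longrightarrow>
       H a z \<in> tube \<and> norm (coord a (H a z)) \<ge> norm (coord a z) / 2 \<and>
       norm (- 1 / coord a (H a z) ^ q - (- 1 / coord a z ^ q) - of_nat q) \<le> real q / 2"
    using coord_step by blast
  show ?thesis
  proof (intro exI[of _ "1 / e ^ q"] conjI allI impI)
    show L0: "1 / e ^ q > 0" using e by simp
    fix L assume L: "L \<ge> 1 / e ^ q"
    have Lpos: "L > 0" using L L0 by linarith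
    show "norm w < \<rho>" "dist (l / 2) (\<psi> w) < \<rho>' / 2" if "w \<noteq> 0" "Re (- 1 / w ^ q) > L" for w
      using e(3)[OF petal_small(2)[OF that(2) Lpos e(1) L q]] by auto
    fix a z assume a: "norm a < \<delta>" and z: "z \<in> basin a L"
    have z': "z \<in> tube" "coord a z \<noteq> 0" "Re (- 1 / coord a z ^ q) > L" using z by (auto simp: basin_def)
    note s = st[OF a z'(1,2) petal_small(2)[OF z'(3) Lpos e(1) L q]]
    have "coord a (H a z) \<noteq> 0" using s z'(2) by auto
    moreover have "\<bar>Re (- 1 / coord a (H a z) ^ q - (- 1 / coord a z ^ q) - of_nat q)\<bar> \<le> real q / 2"
      using s abs_Re_le_cmod order_trans by blast
    then have "- (real q / 2) \<le> Re (- 1 / coord a (H a z) ^ q - (- 1 / coord a z ^ q) - of_nat q)" by linarith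
    then have "Re (- 1 / coord a (H a z) ^ q) \<ge> Re (- 1 / coord a z ^ q) + real q / 2"
      unfolding minus_complex.simps by simp
    then have "Re (- 1 / coord a (H a z) ^ q) > L" using z'(3) by (smt (verit) of_nat_0_le_iff divide_nonneg_nonneg)
    ultimately show "H a z \<in> basin a L" using s by (simp add: basin_def)
  qed
qed

lemma graph0_tube: assumes a: "norm a < \<delta>" and z: "z \<in> graph0 a" shows "z \<in> tube" "coord a z = 0" "H a z \<in> graph0 a"
proof -
  obtain x y where xy: "z = (x, y)" "norm y < r" "x = X a (\<eta> a y)" using z by (auto simp: graph0_def)
  have t: "norm (\<eta> a y) < r + 1/4" using eta_bound[OF a xy(2)] by simp
  have n: "norm (x - l / 2) \<le> \<rho>' / 4" "norm (x - l / 2) \<le> 1" using X_near[OF a, of "\<eta> a y"] t xy(3) by auto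
  show "z \<in> tube" using n(1) xy \<rho>'(1) by (simp add: dist_norm norm_minus_commute)
  have "u_of a x y = 0" by (simp add: u_of_def xy(3) phi_half_l)
  then show "coord a z = 0" by (simp add: coord_def \<Phi>_def xy(1) T)
  have Yy: "Y a (\<eta> a y) = y" using Y\<eta>[OF a] xy by simp
  have c: "X a (small_eigenvalue l a * \<eta> a y) = x\<^sup>2 + curve_c l a + a * y"
    "Y a (small_eigenvalue l a * \<eta> a y) = a * x"
    using curve[OF a, of "\<eta> a y"] t Yy xy(3) by auto
  have "\<eta> a (a * x) = small_eigenvalue l a * \<eta> a y"
    using \<eta>Y[OF a, of "small_eigenvalue l a * \<eta> a y"] mu_t_bound[OF a, of "\<eta> a y"] t c(2) by simp
  moreover have "norm x \<le> 2" using n(2) norm_triangle_sub[of x "l / 2"] l by (simp add: norm_divide)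
  then have "norm a * norm x \<le> 1 * 2" using a \<delta> by (intro mult_mono) auto
  ultimately show "H a z \<in> graph0 a" using r c(1) by (simp add: xy(1) henon_def graph0_def norm_mult)
qed

lemma graph0_iterate: "norm a < \<delta> \<Longrightarrow> z \<in> graph0 a \<Longrightarrow> (H a ^^ m) z \<in> graph0 a"
  by (induction m) (auto intro: graph0_tube)

lemma coord_0_graph0: assumes a: "norm a < \<delta>" and z: "z \<in> tube" "coord a z = 0" shows "z \<in> graph0 a"
proof -
  obtain x y where xy: "z = (x, y)" "dist (l / 2) x < \<rho>'" "norm y < r" using z(1) by (cases z) auto
  have d: "dist (l / 2) x < 3/2 * \<rho>'" and y3: "norm y < r+3" using xy \<rho>' by simp_all
  have t: "norm (\<eta> a y) < r+1" using eta_bound[OF a xy(3)] by simp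
  have "norm (u_of a x y) < \<rho>" by (rule u_of_bound[OF a y3 d])
  then have "norm (u_of a x y) \<le> 2 * norm (coord a z)"
    using B_bounds(5)[OF a, of "u_of a x y" "\<eta> a y"] t by (simp add: coord_def \<Phi>_def xy)
  then have "u_of a x y = 0" using z(2) by simp
  then have "\<psi> 0 = x - X a (\<eta> a y) + l / 2" using \<psi>\<phi>[OF arg_V[OF a y3 d]] by (simp add: u_of_def)
  then have "x = X a (\<eta> a y)" unfolding \<psi>0 by simp
  then show ?thesis using xy by (simp add: graph0_def)
qed

lemma fixed_pt_graph0: "norm a < \<delta> \<Longrightarrow> fixed_pt l a \<in> graph0 a"
  using fixed_pt_tube Phi_fixed_pt by (intro coord_0_graph0) (auto simp: coord_def)

text \<open>Differentiability at the fixed point, where \<open>coord\<close> vanishes, converts the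
  convergence rate of an orbit into a rate for its coordinate.\<close>

lemma coord_lipschitz:
  assumes a: "norm a < \<delta>"
  shows "\<exists>K d. d > 0 \<and> (\<forall>z. dist z (fixed_pt l a) < d \<longrightarrow> z \<in> tube \<and> norm (coord a z) \<le> K * dist z (fixed_pt l a))"
proof -
  let ?p = "fixed_pt l a"
  have p: "?p \<in> tube" by (rule fixed_pt_tube[OF a])
  have ot: "open tube" by (intro open_Times) auto
  have "holomorphic2_on (fst \<circ> \<Phi> a) tube"
    using Phi_coordinate_transformation[OF a] by (simp add: coordinate_transformation_def)
  from bspec[OF this[unfolded holomorphic2_on_def] p]
  obtain A A' where D: "((fst \<circ> \<Phi> a) has_derivative (\<lambda>(u, v). A * u + A' * v)) (at ?p within tube)" by (elim exE)
  have "fst \<circ> \<Phi> a = coord a" by (simp add: fun_eq_iff coord_def)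
  then have D': "(coord a has_derivative (\<lambda>(u, v). A * u + A' * v)) (at ?p)"
    using D at_within_open[OF p ot] by simp
  from conjunct2[OF this[unfolded has_derivative_at_alt], rule_format, OF zero_less_one]
  obtain d where d: "d > 0" "\<And>z. norm (z - ?p) < d \<Longrightarrow> norm (coord a z - coord a ?p - (\<lambda>(u, v). A * u + A' * v) (z - ?p)) \<le> 1 * norm (z - ?p)"
    by auto
  from bounded_linear.bounded[OF has_derivative_bounded_linear[OF D']]
  obtain K where K: "\<forall>h. norm ((\<lambda>(u, v). A * u + A' * v) h) \<le> norm h * K" by (elim exE)
  obtain d' where d': "d' > 0" "ball ?p d' \<subseteq> tube" using openE[OF ot p] .
  have cp: "coord a ?p = 0" using Phi_fixed_pt[OF a] by (simp add: coord_def)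
  have "z \<in> tube \<and> norm (coord a z) \<le> (1 + K) * dist z ?p" if z: "dist z ?p < min d d'" for z
  proof
    show "z \<in> tube" using z d' by (auto simp: dist_commute)
    let ?L = "(\<lambda>(u, v). A * u + A' * v) (z - ?p)"
    have "norm (coord a z - ?L) \<le> norm (z - ?p)" using d(2)[of z] z cp by (simp add: dist_norm)
    moreover have "norm ?L \<le> norm (z - ?p) * K" by (rule spec[OF K])
    ultimately have "norm (coord a z) \<le> norm (z - ?p) + norm (z - ?p) * K"
      using norm_triangle_sub[of "coord a z" ?L] by linarith
    then show "norm (coord a z) \<le> (1 + K) * dist z ?p" by (simp add: dist_norm algebra_simps)
  qed
  then show ?thesis using d d' by (intro exI[of _ "1 + K"] exI[of _ "min d d'"]) auto
qed

text \<open>A point converging at the rate \<open>\<mu> ^ m\<close> must eventually satisfy \<open>coord = 0\<close>, because a nonzero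
  coordinate shrinks at most by the factor \<open>1/2\<close> in each step.\<close>

lemma stable_manifold_reaches_graph0:
  assumes a: "norm a < \<delta>" "a \<noteq> 0" and z: "z \<in> stable_manifold l (curve_c l a) a"
  shows "\<exists>m. (H a ^^ m) z \<in> graph0 a"
proof -
  let ?p = "fixed_pt l a" and ?\<mu> = "small_eigenvalue l a"
  define o' where "o' = (\<lambda>m. (H a ^^ m) z)"
  have lim: "o' \<longlonglongrightarrow> ?p" and O: "(\<lambda>m. dist (o' m) ?p) \<in> O(\<lambda>m. norm ?\<mu> ^ m)"
    using z a(2) by (auto simp: stable_manifold_def o'_def)
  obtain e where e: "e > 0" 
    and st: "\<And>a z. norm a < \<delta> \<Longrightarrow> z \<in> tube \<Longrightarrow> coord a z \<noteq> 0 \<Longrightarrow> norm (coord a z) < e \<Longrightarrow>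
       H a z \<in> tube \<and> norm (coord a (H a z)) \<ge> norm (coord a z) / 2"
    using coord_step by blast
  obtain K d where d: "d > 0" and K: "\<And>z. dist z ?p < d \<Longrightarrow> z \<in> tube \<and> norm (coord a z) \<le> K * dist z ?p"
    using coord_lipschitz[OF a(1)] by blast
  define K0 where "K0 = max K 1"
  have K0: "K0 > 0" "\<And>z. dist z ?p < d \<Longrightarrow> norm (coord a z) \<le> K0 * dist z ?p"
  proof -
    show "K0 > 0" by (simp add: K0_def)
    show "norm (coord a z) \<le> K0 * dist z ?p" if "dist z ?p < d" for z
      using K[OF that] mult_right_mono[of K K0 "dist z ?p"] by (simp add: K0_def)
  qed
  obtain C where C: "C > 0" "eventually (\<lambda>m. norm (dist (o' m) ?p) \<le> C * norm (norm ?\<mu> ^ m)) sequentially"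
    using O by (elim landau_o.bigE)
  have "eventually (\<lambda>m. dist (o' m) ?p < min d (e / K0)) sequentially"
    using lim d e K0 by (intro tendstoD) auto
  with C(2) have "eventually (\<lambda>m. dist (o' m) ?p \<le> C * norm ?\<mu> ^ m \<and> dist (o' m) ?p < min d (e / K0)) sequentially"
    by eventually_elim simp
  then obtain m0 where m0: "\<And>m. m \<ge> m0 \<Longrightarrow> dist (o' m) ?p \<le> C * norm ?\<mu> ^ m \<and> dist (o' m) ?p < min d (e / K0)"
    unfolding eventually_sequentially by blast
  \<comment> \<open>As \<open>|\<mu>| \<le> 1/16\<close>, the coordinate decays at least like
    \<open>16 ^ -m\<close>, to be set against the lower bound of order
    \<open>2 ^ -m\<close>.\<close>
  have near: "o' m \<in> tube" "norm (coord a (o' m)) < e" "norm (coord a (o' m)) \<le> K0 * C * (1/16) ^ m" if m: "m \<ge> m0" for m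
  proof -
    have dm: "dist (o' m) ?p \<le> C * norm ?\<mu> ^ m" "dist (o' m) ?p < d" "dist (o' m) ?p < e / K0" using m0[OF m] by auto
    show "o' m \<in> tube" using K[OF dm(2)] by simp
    have "K0 * dist (o' m) ?p < e" using dm(3) K0(1) by (simp add: less_divide_eq mult.commute)
    then show "norm (coord a (o' m)) < e" using K0(2)[OF dm(2)] by linarith
    have "norm ?\<mu> ^ m \<le> (1/16) ^ m" using mu_bound(2)[OF a(1)] by (intro power_mono) auto
    then have "C * norm ?\<mu> ^ m \<le> C * (1/16) ^ m" using C by (intro mult_left_mono) auto
    then have "K0 * dist (o' m) ?p \<le> K0 * (C * (1/16) ^ m)" using dm(1) K0(1) by (intro mult_left_mono) auto
    then show "norm (coord a (o' m)) \<le> K0 * C * (1/16) ^ m" using K0(2)[OF dm(2)] by simp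
  qed
  have oS: "o' (Suc m) = H a (o' m)" for m by (simp add: o'_def)
  have "coord a (o' m0) = 0"
  proof (rule ccontr)
    assume nz: "coord a (o' m0) \<noteq> 0"
    define v where "v = norm (coord a (o' m0))"
    have v: "v > 0" using nz by (simp add: v_def)
    have low: "v / 2 ^ k \<le> norm (coord a (o' (m0 + k)))" for k
    proof (induction k)
      case (Suc k)
      have "0 < v / 2 ^ k" using v by simp
      then have nz: "coord a (o' (m0 + k)) \<noteq> 0" using Suc by auto
      have "norm (coord a (o' (m0 + k))) / 2 \<le> norm (coord a (o' (m0 + Suc k)))"
        using st[OF a(1) near(1) nz near(2)] oS[of "m0 + k"] by simp
      then show ?case using Suc by simp
    qed (simp add: v_def)
    have "v * 8 ^ k \<le> K0 * C" for k
    proof -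
      have "v / 2 ^ k \<le> K0 * C * (1/16) ^ (m0 + k)" using low[of k] near(3)[of "m0 + k"] by simp
      also have "\<dots> \<le> K0 * C * (1/16) ^ k" using K0 C by (intro mult_left_mono power_decreasing) auto
      finally have "v \<le> K0 * C * (1/16) ^ k * 2 ^ k" by (simp only: divide_le_eq zero_less_power zero_less_numeral if_True)
      then have "v \<le> K0 * C * (1/8) ^ k" by (simp add: mult.assoc flip: power_mult_distrib)
      then have "v * 8 ^ k \<le> K0 * C * (1/8) ^ k * 8 ^ k" by (intro mult_right_mono) auto
      then show ?thesis by (simp add: power_one_over)
    qed
    moreover obtain k where "K0 * C / v < 8 ^ k" using real_arch_pow[of 8 "K0 * C / v"] by auto
    then have "K0 * C < v * 8 ^ k" using v by (simp add: divide_less_eq mult.commute)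
    ultimately show False by (meson not_le)
  qed
  then have "o' m0 \<in> graph0 a" using near(1) by (intro coord_0_graph0[OF a(1)]) auto
  then show ?thesis unfolding o'_def by blast
qed

lemma hol3_iterate:
  "hol3 (\<lambda>a x y. fst ((H a ^^ n) (x, y))) UNIV \<and> hol3 (\<lambda>a x y. snd ((H a ^^ n) (x, y))) UNIV"
proof (induction n)
  case 0 then show ?case by (simp add: hol3_x hol3_t)
next
  case (Suc n)
  have eq: "H a ((H a ^^ n) (x, y)) = ((fst ((H a ^^ n) (x, y)))\<^sup>2 + curve_c l a + a * snd ((H a ^^ n) (x, y)), a * fst ((H a ^^ n) (x, y)))" for a x y
    by (cases "(H a ^^ n) (x, y)") (simp add: henon_def)
  show ?case unfolding funpow.simps o_apply eq fst_conv snd_conv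
    by (intro conjI hol3_add hol3_power hol3_mult hol3_a hol3_curve_c conjunct1[OF Suc] conjunct2[OF Suc])
qed

text \<open>At \<open>a = 0\<close> some iterate \<open>n\<close> of the critical value lies in the
  basin, an open condition in \<open>(a, x, y)\<close>. Nearby points enter the basin after
  \<open>n\<close> steps and stay there, whereas an orbit meeting the graph stays in the graph; the
  iterate \<open>n + m\<close> would lie in both.\<close>

lemma critical_value_avoids_stable_manifold:
  "\<exists>\<kappa>>0. \<exists>\<delta>'>0. \<delta>' \<le> \<delta> \<and> (\<forall>a x y m. norm a < \<delta>' \<longrightarrow> norm (x - parabolic_poly l 0) < \<kappa> \<longrightarrow> norm y < \<kappa> \<longrightarrow>
      (H a ^^ m) (x, y) \<notin> graph0 a)"
proof -
  obtain L1 where L1: "L1 > 0" "\<And>L. L \<ge> L1 \<Longrightarrow> \<exists>n. (P ^^ Suc n) 0 \<in> V \<and> \<phi> ((P ^^ Suc n) 0) \<noteq> 0 \<and> Re (- 1 / \<phi> ((P ^^ Suc n) 0) ^ q) > L"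
    using critical_orbit_enters_petal by blast
  obtain L2 where L2: "L2 > 0" "\<And>L a z. L \<ge> L2 \<Longrightarrow> norm a < \<delta> \<Longrightarrow> z \<in> basin a L \<Longrightarrow> H a z \<in> basin a L"
     "\<And>L w. L \<ge> L2 \<Longrightarrow> w \<noteq> 0 \<Longrightarrow> Re (- 1 / w ^ q) > L \<Longrightarrow> norm w < \<rho> \<and> dist (l / 2) (\<psi> w) < \<rho>' / 2"
    using basin_invariant by blast
  define L where "L = max L1 L2"
  have L: "L \<ge> L1" "L \<ge> L2" by (auto simp: L_def)
  obtain n where n: "(P ^^ Suc n) 0 \<in> V" "\<phi> ((P ^^ Suc n) 0) \<noteq> 0" "Re (- 1 / \<phi> ((P ^^ Suc n) 0) ^ q) > L"
    using L1(2)[OF L(1)] by blast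
  define c0 where "c0 = P 0"
  define x0 where "x0 = (P ^^ n) c0"
  have x0: "x0 \<in> V" "\<phi> x0 \<noteq> 0" "Re (- 1 / \<phi> x0 ^ q) > L" using n by (simp_all add: x0_def c0_def funpow_swap1)
  have "dist (l / 2) (\<psi> (\<phi> x0)) < \<rho>' / 2" using L2(3)[OF L(2) x0(2,3)] by simp
  then have x0d: "dist (l / 2) x0 < \<rho>'" using \<psi>\<phi>[OF x0(1)] \<rho>'(1) by simp
  have it0: "(H 0 ^^ k) (x, 0) = ((P ^^ k) x, 0)" for k x
    by (induction k) (simp_all add: henon_def curve_c_def fixed_x_def parabolic_poly_def power2_eq_square)
  let ?\<Omega> = "ball 0 \<delta> \<times> ball (l / 2) \<rho>' \<times> ball 0 r :: (complex \<times> complex \<times> complex) set"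
  have h\<Omega>: "hol3 (\<lambda>a x y. T a (u_of a x y) (\<eta> a y)) ?\<Omega>" by (rule hol3_subset[OF hol3_Phi1]) (use \<rho>' in auto)
  define O' where "O' = {(a, x, y). (a, x, y) \<in> ?\<Omega> \<and> T a (u_of a x y) (\<eta> a y) \<in> {w. w \<noteq> 0 \<and> Re (- 1 / w ^ q) > L}}"
  have O_open: "open O'" unfolding O'_def
  proof (rule hol3_open_preimage[OF h\<Omega>])
    show "open ?\<Omega>" by (intro open_Times open_ball)
    show "open {w::complex. w \<noteq> 0 \<and> Re (- 1 / w ^ q) > L}" by (rule open_petal)
  qed
  have O_basin: "(x, y) \<in> basin a L \<and> norm a < \<delta>" if "(a, x, y) \<in> O'" for a x y
    using that by (auto simp: O'_def basin_def coord_def \<Phi>_def)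
  define it where "it = (\<lambda>(a, x, y). (a, (H a ^^ n) (x, y)))"
  have "continuous_on UNIV it"
  proof -
    have "continuous_on UNIV (\<lambda>(a, x, y). fst ((H a ^^ n) (x, y)))" "continuous_on UNIV (\<lambda>(a, x, y). snd ((H a ^^ n) (x, y)))"
      using hol3_iterate hol3_continuous_on by blast+
    then have "continuous_on UNIV (\<lambda>z. (fst z, fst ((H (fst z) ^^ n) (snd z)), snd ((H (fst z) ^^ n) (snd z))))"
      by (intro continuous_on_Pair) (simp_all add: case_prod_unfold continuous_on_fst)
    then show ?thesis by (simp add: it_def case_prod_unfold)
  qed
  then have iO: "open (it -` O')" using O_open by (intro open_vimage)
  have "(0, x0, 0) \<in> O'"
    using x0 x0d \<delta> r by (simp add: O'_def u_of_def XY_0 \<eta>_0 T B_0)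
  then have "(0, c0, 0) \<in> it -` O'" by (simp add: it_def it0 x0_def)
  then obtain e where e: "e > 0" "ball (0, c0, 0) e \<subseteq> it -` O'" using iO open_contains_ball by blast
  define \<kappa> where "\<kappa> = min (e / 3) \<delta>"
  have \<kappa>: "\<kappa> > 0" "\<kappa> \<le> e / 3" "\<kappa> \<le> \<delta>" using e \<delta> by (auto simp: \<kappa>_def)
  have "(H a ^^ m) (x, y) \<notin> graph0 a" if a: "norm a < \<kappa>" and x: "norm (x - c0) < \<kappa>" and y: "norm y < \<kappa>" for a x y m
  proof
    assume g: "(H a ^^ m) (x, y) \<in> graph0 a"
    have a\<delta>: "norm a < \<delta>" using a \<kappa> by simp
    have "dist (0, c0, 0) (a, x, y) \<le> norm a + (norm (x - c0) + norm y)"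
      using norm_Pair_le[of a "(c0 - x, y)"] norm_Pair_le[of "c0 - x" y]
      by (simp add: dist_norm norm_minus_commute norm_Pair)
    then have "(a, x, y) \<in> ball (0, c0, 0) e" using a x y \<kappa> by simp
    then have b: "(H a ^^ n) (x, y) \<in> basin a L" using e(2) O_basin by (cases "(H a ^^ n) (x, y)") (auto simp: it_def)
    have "(H a ^^ (k + n)) (x, y) \<in> basin a L" for k
      using b by (induction k) (auto intro: L2(2)[OF L(2) a\<delta>])
    then have "(H a ^^ (m + n)) (x, y) \<in> basin a L" .
    moreover have "(H a ^^ (n + m)) (x, y) \<in> graph0 a" unfolding funpow_add using graph0_iterate[OF a\<delta> g] by simp
    ultimately show False using graph0_tube(2)[OF a\<delta>] by (simp add: basin_def add.commute)
  qed
  then show ?thesis using \<kappa> unfolding c0_def by blast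
qed

end

section \<open>Sheets over the whole disc\<close>

text \<open>\<open>G\<^sub>0\<close> is an invariant graph over the disc, and \<open>avoid\<close>
  keeps its iterated preimages away from the critical value at height \<open>0\<close>. The bound
  \<open>3/10\<close> on \<open>|a| * r\<close> is made for the escape estimate, those involving
  \<open>\<kappa>\<close> for the construction and separation of preimages.\<close>

locale preimage_sheets =
  fixes a c :: complex and r \<kappa> :: real and g\<^sub>0 :: "complex \<Rightarrow> complex" and G\<^sub>0 :: "(complex \<times> complex) set"
  assumes r: "r > 3" and \<kappa>: "\<kappa> > 0" and c: "norm c \<le> 1"
    and a: "norm a \<le> 1/4" "norm a * r \<le> 3/10" "(18 + r) * norm a < \<kappa> / 2" "12 * norm a \<le> sqrt \<kappa>"
    and g\<^sub>0: "g\<^sub>0 holomorphic_on ball 0 r"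
      "\<And>y. norm y < r \<Longrightarrow> norm (g\<^sub>0 y) < 3 \<and> (g\<^sub>0 y)\<^sup>2 = g\<^sub>0 (a * g\<^sub>0 y) - c - a * y"
    and G\<^sub>0: "G\<^sub>0 = {(x, y). norm y < r \<and> x = g\<^sub>0 y}"
    and avoid: "\<And>m x. norm (x - c) < \<kappa> \<Longrightarrow> (henon c a ^^ m) (x, 0) \<notin> G\<^sub>0"
begin

text \<open>The equation for \<open>g\<close> says that the map carries the graph of
  \<open>g\<close> into that of \<open>f\<close>. So a sheet of level \<open>n\<close> is a graph
  over the whole disc that reaches \<open>G\<^sub>0\<close> in \<open>n\<close> steps.\<close>

inductive sheet :: "nat \<Rightarrow> (complex \<Rightarrow> complex) \<Rightarrow> bool" where
  sheet_0: "sheet 0 g\<^sub>0"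
| sheet_Suc: "sheet n f \<Longrightarrow> g holomorphic_on ball 0 r \<Longrightarrow>
    (\<And>y. norm y < r \<Longrightarrow> norm (g y) < 3 \<and> (g y)\<^sup>2 = f (a * g y) - c - a * y) \<Longrightarrow> sheet (Suc n) g"

lemma small: "norm x < 3 \<Longrightarrow> norm (a * x) < r"
proof -
  assume "norm x < 3"
  then have "norm a * norm x \<le> 1/4 * 3" using a by (intro mult_mono) auto
  then show ?thesis using r by (simp add: norm_mult)
qed

lemma sheet_properties:
  assumes "sheet n g"
  shows "g holomorphic_on ball 0 r \<and> (\<forall>y. norm y < r \<longrightarrow> norm (g y) < 3 \<and> (henon c a ^^ n) (g y, y) \<in> G\<^sub>0)"
  using assms
proof induction
  case sheet_0
  then show ?case using g\<^sub>0 by (auto simp: G\<^sub>0)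
next
  case (sheet_Suc n f g)
  have "(henon c a ^^ Suc n) (g y, y) \<in> G\<^sub>0" if y: "norm y < r" for y
  proof -
    have g: "norm (g y) < 3" "(g y)\<^sup>2 = f (a * g y) - c - a * y" using sheet_Suc.hyps(3)[OF y] by auto
    have "henon c a (g y, y) = (f (a * g y), a * g y)" by (simp add: henon_def g(2))
    then show ?thesis using sheet_Suc.IH small[OF g(1)] by (simp add: funpow_Suc_right del: funpow.simps)
  qed
  then show ?case using sheet_Suc.hyps by blast
qed

lemma sheet_holomorphic: "sheet n g \<Longrightarrow> g holomorphic_on ball 0 r"
  and sheet_bound: "sheet n g \<Longrightarrow> norm y < r \<Longrightarrow> norm (g y) < 3"
  and sheet_iterate: "sheet n g \<Longrightarrow> norm y < r \<Longrightarrow> (henon c a ^^ n) (g y, y) \<in> G\<^sub>0"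
  using sheet_properties by blast+

lemma sheet_critical: assumes "sheet n g" shows "\<kappa> \<le> norm (g 0 - c)"
  using sheet_iterate[OF assms, of 0] avoid[of "g 0" n] r by force

text \<open>Invariance makes the base graph a preimage of itself, so levels are cumulative and
  sheets of different levels can be compared at a common one.\<close>

lemma sheet_lift: "sheet n g \<Longrightarrow> sheet (Suc n) g"
proof (induction rule: sheet.induct)
  case sheet_0
  show ?case by (rule sheet.sheet_Suc[OF sheet.sheet_0 g\<^sub>0])
next
  case (sheet_Suc n f g)
  show ?case by (rule sheet.sheet_Suc[OF sheet_Suc.IH]) (use sheet_Suc.hyps in auto)
qed

lemma sheet_mono: "sheet n g \<Longrightarrow> n \<le> m \<Longrightarrow> sheet m g"
  by (induction m) (auto simp: le_Suc_eq intro: sheet_lift)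

lemma same_preimage:
  assumes "sheet n f" "g holomorphic_on ball 0 r" "h holomorphic_on ball 0 r"
    and "\<And>y. norm y < r \<Longrightarrow> norm (g y) < 3 \<and> (g y)\<^sup>2 = f (a * g y) - c - a * y"
    and "\<And>y. norm y < r \<Longrightarrow> norm (h y) < 3 \<and> (h y)\<^sup>2 = f (a * h y) - c - a * y"
    and "norm y0 < r" "g y0 = h y0" "norm y < r"
  shows "g y = h y"
  by (rule graph_preimages_disjoint[OF sheet_holomorphic[OF assms(1)] sheet_bound[OF assms(1)] r \<kappa> sheet_critical[OF assms(1)]
        a(1,3,4) assms(2,4,3,5,6,7,8)])

text \<open>If two sheets meet at \<open>y0\<close>, the sheets they map to meet at
  \<open>a * g y0\<close> and coincide by induction; both are then preimages of one sheet, to which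
  the separation lemma applies.\<close>

lemma sheet_unique_level:
  assumes "sheet n g" "sheet n h" "norm y0 < r" "g y0 = h y0" "norm y < r"
  shows "g y = h y"
  using assms
proof (induction n arbitrary: g h y0 y)
  case 0
  then show ?case by (auto elim: sheet.cases)
next
  case (Suc n)
  from Suc.prems(1) obtain f where f: "sheet n f" "g holomorphic_on ball 0 r"
    "\<And>y. norm y < r \<Longrightarrow> norm (g y) < 3 \<and> (g y)\<^sup>2 = f (a * g y) - c - a * y"
    by cases blast
  from Suc.prems(2) obtain f' where f': "sheet n f'" "h holomorphic_on ball 0 r"
    "\<And>y. norm y < r \<Longrightarrow> norm (h y) < 3 \<and> (h y)\<^sup>2 = f' (a * h y) - c - a * y"
    by cases blast
  have g0: "norm (g y0) < 3" "(g y0)\<^sup>2 = f (a * g y0) - c - a * y0" using f(3)[OF Suc.prems(3)] by auto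
  have h0: "(g y0)\<^sup>2 = f' (a * g y0) - c - a * y0" using f'(3)[OF Suc.prems(3)] Suc.prems(4) by simp
  have "f (a * g y0) = f' (a * g y0)" using g0(2) h0 by simp
  then have ff: "f z = f' z" if "norm z < r" for z
    using Suc.IH[OF f(1) f'(1) small[OF g0(1)]] that by blast
  have "norm (h y) < 3 \<and> (h y)\<^sup>2 = f (a * h y) - c - a * y" if y: "norm y < r" for y
    using f'(3)[OF y] ff[OF small[of "h y"]] by simp
  from same_preimage[OF f(1,2) f'(2) f(3) this Suc.prems(3-5)] show ?case .
qed

lemma sheet_unique:
  assumes "sheet n g" "sheet m h" "norm y0 < r" "g y0 = h y0" "norm y < r"
  shows "g y = h y"
  by (rule sheet_unique_level[of "max n m"]) (use assms in \<open>auto intro: sheet_mono\<close>)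

lemma preimages:
  assumes "sheet n f"
  shows "\<exists>g. (\<forall>\<sigma>::bool. g \<sigma> holomorphic_on ball 0 r \<and>
       (\<forall>y. norm y < r \<longrightarrow> norm (g \<sigma> y) < 3 \<and> (g \<sigma> y)\<^sup>2 = f (a * g \<sigma> y) - c - a * y)) \<and>
     (\<forall>x y. norm x < 3 \<longrightarrow> norm y < r \<longrightarrow> x\<^sup>2 = f (a * x) - c - a * y \<longrightarrow> (\<exists>\<sigma>. x = g \<sigma> y))"
  by (rule graph_preimages[OF sheet_holomorphic[OF assms] sheet_bound[OF assms] r \<kappa> sheet_critical[OF assms] c a(1) _ a(3,4)])
     (use a in auto)

text \<open>Each sheet has at most two preimages, so a level contains finitely many sheets up to
  agreement on the disc. Sheets are functions on the whole plane, unconstrained outside the disc;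
  hence the representatives \<open>S\<close> and the evaluation at \<open>0\<close>.\<close>

lemma sheets_at_0_finite: "finite {g 0 |g. sheet n g}"
proof -
  have "\<exists>S. finite S \<and> (\<forall>g. sheet n g \<longrightarrow> (\<exists>g'\<in>S. \<forall>y. norm y < r \<longrightarrow> g y = g' y)) \<and> (\<forall>g\<in>S. sheet n g)"
  proof (induction n)
    case 0
    show ?case by (rule exI[of _ "{g\<^sub>0}"]) (auto elim: sheet.cases intro: sheet_0)
  next
    case (Suc n)
    then obtain S where S: "finite S" "\<And>g. sheet n g \<Longrightarrow> \<exists>g'\<in>S. \<forall>y. norm y < r \<longrightarrow> g y = g' y" "\<And>g. g \<in> S \<Longrightarrow> sheet n g" by blast
    define good where "good = (\<lambda>f b. (\<forall>\<sigma>::bool. b \<sigma> holomorphic_on ball 0 r \<and>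
       (\<forall>y. norm y < r \<longrightarrow> norm (b \<sigma> y) < 3 \<and> (b \<sigma> y)\<^sup>2 = f (a * b \<sigma> y) - c - a * y)) \<and>
     (\<forall>x y. norm x < 3 \<longrightarrow> norm y < r \<longrightarrow> x\<^sup>2 = f (a * x) - c - a * y \<longrightarrow> (\<exists>\<sigma>. x = b \<sigma> y)))"
    have "\<forall>f\<in>S. \<exists>b. good f b" using preimages S(3) unfolding good_def by blast
    then obtain b where b: "\<And>f. f \<in> S \<Longrightarrow> good f (b f)" by metis
    have b1: "b f \<sigma> holomorphic_on ball 0 r" "\<And>y. norm y < r \<Longrightarrow> norm (b f \<sigma> y) < 3 \<and> (b f \<sigma> y)\<^sup>2 = f (a * b f \<sigma> y) - c - a * y"
      if "f \<in> S" for f \<sigma> using b[OF that] unfolding good_def by blast+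
    have b2: "\<exists>\<sigma>. x = b f \<sigma> y" if "f \<in> S" "norm x < 3" "norm y < r" "x\<^sup>2 = f (a * x) - c - a * y" for f x y
      using b[OF that(1)] that unfolding good_def by blast
    let ?S = "(\<lambda>(f, \<sigma>). b f \<sigma>) ` (S \<times> UNIV)"
    have fin: "finite ?S" using S(1) by simp
    have sh: "sheet (Suc n) g" if g: "g \<in> ?S" for g
    proof -
      obtain f \<sigma> where f: "f \<in> S" "g = b f \<sigma>" using g by auto
      show ?thesis unfolding f(2) by (rule sheet_Suc[OF S(3)[OF f(1)] b1[OF f(1)]])
    qed
    have ex: "\<exists>g'\<in>?S. \<forall>y. norm y < r \<longrightarrow> g y = g' y" if g: "sheet (Suc n) g" for g
    proof -
      from g obtain f where f: "sheet n f" "g holomorphic_on ball 0 r"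
        "\<And>y. norm y < r \<Longrightarrow> norm (g y) < 3 \<and> (g y)\<^sup>2 = f (a * g y) - c - a * y"
        by cases blast
      obtain f' where f': "f' \<in> S" "\<And>y. norm y < r \<Longrightarrow> f y = f' y" using S(2)[OF f(1)] by blast
      have "norm (0::complex) < r" using r by simp
      note g0 = f(3)[OF this]
      have "(g 0)\<^sup>2 = f' (a * g 0) - c - a * 0" using g0 f'(2)[OF small[of "g 0"]] by simp
      with b2[OF f'(1)] g0 r obtain \<sigma> where \<sigma>: "g 0 = b f' \<sigma> 0" by (metis norm_zero \<open>norm 0 < r\<close>)
      have "sheet (Suc n) (b f' \<sigma>)" by (rule sh) (use f' in auto)
      from sheet_unique[where g = g and h = "b f' \<sigma>", OF g this \<open>norm 0 < r\<close> \<sigma>]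
      have "\<forall>y. norm y < r \<longrightarrow> g y = b f' \<sigma> y" by blast
      then show ?thesis using f'(1) by auto
    qed
    show ?case by (rule exI[of _ ?S]) (use fin sh ex in blast)
  qed
  then obtain S where S: "finite S" "\<And>g. sheet n g \<Longrightarrow> \<exists>g'\<in>S. \<forall>y. norm y < r \<longrightarrow> g y = g' y" by blast
  have "{g 0 |g. sheet n g} \<subseteq> (\<lambda>g. g 0) ` S"
  proof clarify
    fix g assume "sheet n g"
    then obtain g' where "g' \<in> S" "g 0 = g' 0" using S(2) r by fastforce
    then show "g 0 \<in> (\<lambda>g. g 0) ` S" by auto
  qed
  then show ?thesis using S(1) finite_surj by blast
qed

text \<open>The region \<open>|x| \<ge> 3\<close>, \<open>|a * y| \<le> |x| / 10\<close> is forward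
  invariant: there the first coordinate at least doubles, since
  \<open>3 * |x| - 1 - |x| / 10 \<ge> 2 * |x|\<close>.\<close>

lemma escape:
  assumes "norm x \<ge> 3" "norm (a * y) \<le> norm x / 10"
  shows "norm (fst ((henon c a ^^ n) (x, y))) \<ge> 3 \<and>
    norm (a * snd ((henon c a ^^ n) (x, y))) \<le> norm (fst ((henon c a ^^ n) (x, y))) / 10"
proof (induction n)
  case 0
  then show ?case using assms by simp
next
  case (Suc n)
  obtain u v where uv: "(henon c a ^^ n) (x, y) = (u, v)" by (cases "(henon c a ^^ n) (x, y)")
  have u: "norm u \<ge> 3" "norm (a * v) \<le> norm u / 10" using Suc by (auto simp: uv)
  have "u\<^sup>2 = (u\<^sup>2 + c + a * v) - c - a * v" by simp
  then have "norm (u\<^sup>2) \<le> norm (u\<^sup>2 + c + a * v) + norm c + norm (a * v)" by (smt (verit) norm_triangle_ineq4)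
  moreover have "norm (u\<^sup>2) \<ge> 3 * norm u" using u(1) unfolding power2_eq_square norm_mult by (intro mult_right_mono) auto
  ultimately have big: "norm (u\<^sup>2 + c + a * v) \<ge> 2 * norm u" using c u by linarith
  have "norm (a * (a * u)) \<le> 1/4 * (1/4 * norm u)"
    unfolding norm_mult using a by (intro mult_mono) auto
  then have "norm (a * (a * u)) \<le> norm (u\<^sup>2 + c + a * v) / 10" using big u(1) by linarith
  moreover have "(henon c a ^^ Suc n) (x, y) = henon c a (u, v)" by (simp add: uv)
  moreover have "henon c a (u, v) = (u\<^sup>2 + c + a * v, a * u)" by (simp add: henon_def)
  ultimately show ?case using big u by simp
qed

lemma preimage_bound:
  assumes "(henon c a ^^ n) (x, y) \<in> G\<^sub>0" "norm y < r" shows "norm x < 3"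
proof (rule ccontr)
  assume "\<not> norm x < 3"
  then have x: "norm x \<ge> 3" by simp
  have "norm (a * y) \<le> norm a * r" unfolding norm_mult using assms(2) by (intro mult_left_mono) auto
  then have "norm (a * y) \<le> norm x / 10" using a(2) x by linarith
  from escape[OF x this, of n] show False using assms(1) g\<^sub>0(2) by (force simp: G\<^sub>0)
qed

lemma sheet_through:
  "(henon c a ^^ n) (x, y) \<in> G\<^sub>0 \<Longrightarrow> norm y < r \<Longrightarrow> \<exists>g. sheet n g \<and> g y = x"
proof (induction n arbitrary: x y)
  case 0
  then show ?case using sheet_0 by (auto simp: G\<^sub>0)
next
  case (Suc n)
  have x: "norm x < 3" by (rule preimage_bound[OF Suc.prems])
  have "(henon c a ^^ n) (x\<^sup>2 + c + a * y, a * x) \<in> G\<^sub>0"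
    using Suc.prems(1) by (simp add: funpow_Suc_right henon_def del: funpow.simps)
  from Suc.IH[OF this small[OF x]] obtain f where f: "sheet n f" "f (a * x) = x\<^sup>2 + c + a * y" by blast
  from preimages[OF f(1)] obtain g :: "bool \<Rightarrow> complex \<Rightarrow> complex" where g: "\<And>\<sigma>. g \<sigma> holomorphic_on ball 0 r"
    "\<And>\<sigma> y. norm y < r \<Longrightarrow> norm (g \<sigma> y) < 3 \<and> (g \<sigma> y)\<^sup>2 = f (a * g \<sigma> y) - c - a * y"
    "\<And>x y. norm x < 3 \<Longrightarrow> norm y < r \<Longrightarrow> x\<^sup>2 = f (a * x) - c - a * y \<Longrightarrow> \<exists>\<sigma>. x = g \<sigma> y" by blast
  have "x\<^sup>2 = f (a * x) - c - a * y" using f(2) by simp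
  then obtain \<sigma> where \<sigma>: "x = g \<sigma> y" using g(3)[OF x Suc.prems(2)] by blast
  have "sheet (Suc n) (g \<sigma>)" by (rule sheet_Suc[OF f(1) g(1,2)])
  then show ?case using \<sigma> by blast
qed

text \<open>Two sheets either coincide or never meet. In the second case Harnack's inequality for
  their difference shows that sheets through nearby points are close at height \<open>0\<close>, where only countably
  many values occur; so the sheet cannot change along a connected set.\<close>

lemma connected_preimage_subset:
  assumes C: "connected C" "C \<subseteq> {(x, y). norm y < r \<and> (\<exists>n. (henon c a ^^ n) (x, y) \<in> G\<^sub>0)}" and p: "p \<in> C" "p \<in> G\<^sub>0"
  shows "C \<subseteq> G\<^sub>0"
proof -
  have r0: "r > 0" "norm (0::complex) < r" using r by auto
  have "\<exists>g n. sheet n g \<and> g (snd z) = fst z" if "z \<in> C" for z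
    using sheet_through C(2) that by (cases z) fastforce
  then obtain s n where s: "\<And>z. z \<in> C \<Longrightarrow> sheet (n z) (s z)" "\<And>z. z \<in> C \<Longrightarrow> s z (snd z) = fst z" by metis
  have Cr: "norm (snd z) < r" if "z \<in> C" for z using C(2) that by auto
  define f where "f = (\<lambda>z. s z 0)"
  \<comment> \<open>The threshold in the last hypothesis is Harnack's inequality solved for the
    difference at height \<open>snd z'\<close>; the factor \<open>6\<close> normalizes the
    difference of two sheets, each bounded by \<open>3\<close>.\<close>
  have near: "norm (f z' - f z) < e"
    if z: "z \<in> C" and z': "z' \<in> C" and t: "norm (snd z') < t" "t < r" and e: "0 < e" "e < 6"
      and d: "norm (fst z' - s z (snd z')) < 6 * exp (ln (e / 6) / ((1 - (t / r)\<^sup>2) / 4))" for z z' t e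
  proof (cases "\<exists>y. norm y < r \<and> s z' y = s z y")
    case True
    then have "f z' = f z" unfolding f_def using sheet_unique[OF s(1)[OF z'] s(1)[OF z]] r0(2) by blast
    then show ?thesis using e by simp
  next
    case False
    define D where "D = (\<lambda>y. (s z' y - s z y) / 6)"
    have D0: "D y \<noteq> 0" if "norm y < r" for y using False that by (auto simp: D_def)
    have D1: "norm (D y) < 1" if "norm y < r" for y
      using sheet_bound[OF s(1)[OF z'] that] sheet_bound[OF s(1)[OF z] that] norm_triangle_ineq4[of "s z' y" "s z y"]
      by (simp add: D_def norm_divide)
    have "D holomorphic_on ball 0 r" unfolding D_def
      by (intro holomorphic_intros sheet_holomorphic[OF s(1)] z z') auto
    from harnack_nonvanishing[OF this r0(1) D0 D1 Cr[OF z']]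
    have h: "(1 - (norm (snd z') / r)\<^sup>2) / 4 * (- ln (norm (D (snd z')))) \<le> - ln (norm (D 0))" .
    define \<beta> where "\<beta> = (1 - (t / r)\<^sup>2) / 4"
    have t0: "0 < t" using t(1) norm_ge_zero le_less_trans by blast
    then have "t / r < 1" "0 < t / r" using t r0 by auto
    then have \<beta>: "\<beta> > 0" by (simp add: \<beta>_def power_less_one_iff)
    have "norm (D (snd z')) < exp (ln (e / 6) / \<beta>)"
      using d s(2)[OF z'] by (simp add: D_def norm_divide \<beta>_def)
    then have "ln (norm (D (snd z'))) < ln (e / 6) / \<beta>"
      using D0[OF Cr[OF z']] by (metis exp_less_cancel_iff exp_ln zero_less_norm_iff)
    then have 1: "\<beta> * (- ln (norm (D (snd z')))) > - ln (e / 6)" using \<beta> by (simp add: less_divide_eq mult.commute)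
    have "(norm (snd z') / r)\<^sup>2 \<le> (t / r)\<^sup>2" using t r0 by (intro power_mono divide_right_mono) auto
    then have "\<beta> \<le> (1 - (norm (snd z') / r)\<^sup>2) / 4" by (simp add: \<beta>_def)
    moreover have "0 \<le> - ln (norm (D (snd z')))" using D1[OF Cr[OF z']] D0[OF Cr[OF z']] by simp
    ultimately have "\<beta> * (- ln (norm (D (snd z')))) \<le> (1 - (norm (snd z') / r)\<^sup>2) / 4 * (- ln (norm (D (snd z'))))"
      by (rule mult_right_mono)
    then have "ln (norm (D 0)) < ln (e / 6)" using 1 h by linarith
    then have "norm (D 0) < e / 6" using D0[OF r0(2)] e by simp
    then show ?thesis by (simp add: D_def f_def norm_divide)
  qed
  have "continuous_on C f"
    unfolding continuous_on_def
  proof (intro ballI tendstoI)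
    fix z and e :: real assume z: "z \<in> C" and e: "e > 0"
    define e' where "e' = min e 5"
    have e': "0 < e'" "e' < 6" "e' \<le> e" using e by (auto simp: e'_def)
    define t where "t = (norm (snd z) + r) / 2"
    have t: "norm (snd z) < t" "t < r" using Cr[OF z] by (auto simp: t_def)
    have "continuous_on (ball 0 r) (s z)" by (intro holomorphic_on_imp_continuous_on sheet_holomorphic[OF s(1)[OF z]])
    then have "isCont (s z) (snd z)" using Cr[OF z] by (simp add: continuous_on_eq_continuous_at)
    moreover have "(snd \<longlongrightarrow> snd z) (at z within C)" by (intro tendsto_intros)
    ultimately have "((\<lambda>z'. s z (snd z')) \<longlongrightarrow> s z (snd z)) (at z within C)" by (rule isCont_tendsto_compose)
    then have "((\<lambda>z'. fst z' - s z (snd z')) \<longlongrightarrow> fst z - s z (snd z)) (at z within C)" by (intro tendsto_intros)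
    then have "((\<lambda>z'. norm (fst z' - s z (snd z'))) \<longlongrightarrow> 0) (at z within C)"
      using s(2)[OF z] by (simp add: tendsto_norm_zero_iff)
    then have "eventually (\<lambda>z'. norm (fst z' - s z (snd z')) < 6 * exp (ln (e' / 6) / ((1 - (t / r)\<^sup>2) / 4))) (at z within C)"
      by (rule order_tendstoD) simp
    moreover have "((\<lambda>z'. norm (snd z')) \<longlongrightarrow> norm (snd z)) (at z within C)" by (intro tendsto_intros)
    then have "eventually (\<lambda>z'. norm (snd z') < t) (at z within C)" using t(1) by (rule order_tendstoD)
    moreover have "eventually (\<lambda>z'. z' \<in> C) (at z within C)" by (simp add: eventually_at_filter)
    ultimately show "eventually (\<lambda>z'. dist (f z') (f z) < e) (at z within C)"
      by eventually_elim (use near[OF z _ _ t(2) e'(1,2)] e'(3) in \<open>force simp: dist_norm\<close>)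
  qed
  then have conn: "connected (f ` C)" by (rule connected_continuous_image[OF _ C(1)])
  have "f ` C \<subseteq> (\<Union>n. {g 0 |g. sheet n g})" using s(1) by (auto simp: f_def)
  moreover have "countable (\<Union>n. {g 0 |g. sheet n g})"
    by (intro countable_UN) (auto intro: countable_finite sheets_at_0_finite)
  ultimately have "countable (f ` C)" by (rule countable_subset)
  \<comment> \<open>A connected set with two distinct points is uncountable, so the value at height
    \<open>0\<close> is constant along \<open>C\<close>.\<close>
  then have const: "f z = f p" if "z \<in> C" for z
    using connected_uncountable[OF conn, of "f z" "f p"] that p(1) by blast
  have pg: "norm (snd p) < r" "fst p = g\<^sub>0 (snd p)" using p(2) by (auto simp: G\<^sub>0)
  have fp: "f p = g\<^sub>0 0" unfolding f_def
    by (rule sheet_unique[OF s(1)[OF p(1)] sheet_0 pg(1) _ r0(2)]) (simp add: s(2)[OF p(1)] pg(2))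
  show "C \<subseteq> G\<^sub>0"
  proof
    fix z assume z: "z \<in> C"
    have "s z (snd z) = g\<^sub>0 (snd z)"
      by (rule sheet_unique[OF s(1)[OF z] sheet_0 r0(2) _ Cr[OF z]]) (use const[OF z] fp in \<open>simp add: f_def\<close>)
    then show "z \<in> G\<^sub>0" using s(2)[OF z] Cr[OF z] by (auto simp: G\<^sub>0 case_prod_unfold)
  qed
qed

end

section \<open>The local stable manifold lies in the tube\<close>

context henon_chart
begin

text \<open>For \<open>a = 0\<close> the stable manifold is a vertical line by convention. Otherwise
  every point of the component eventually reaches the invariant graph, and the component, being
  connected and containing the fixed point, lies in that graph.\<close>

lemma local_stable_manifold_tube:
  "\<exists>\<delta>'>0. \<delta>' \<le> \<delta> \<and> (\<forall>a. norm a < \<delta>' \<longrightarrow> local_stable_manifold l r (curve_c l a) a \<subseteq> tube)"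
proof -
  define c0 where "c0 = P 0"
  obtain \<kappa> \<delta>1 where \<kappa>: "\<kappa> > 0" and \<delta>1: "\<delta>1 > 0" "\<delta>1 \<le> \<delta>"
    and avoid: "\<And>a x y m. norm a < \<delta>1 \<Longrightarrow> norm (x - c0) < \<kappa> \<Longrightarrow> norm y < \<kappa> \<Longrightarrow> (H a ^^ m) (x, y) \<notin> graph0 a"
    using critical_value_avoids_stable_manifold unfolding c0_def by blast
  have cc: "curve_c l 0 = c0" by (simp add: curve_c_def fixed_x_def c0_def parabolic_poly_def power2_eq_square)
  have c0: "norm c0 \<le> 3/4" using const_bound by (simp add: c0_def parabolic_poly_def)
  \<comment> \<open>Half of \<open>\<kappa>\<close> is reserved for the distance between the
    critical values for \<open>a\<close> and for \<open>0\<close>; the cap \<open>1/4\<close> gives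
    \<open>|c| \<le> 1\<close>, as \<open>|c0| \<le> 3/4\<close>.\<close>
  define \<kappa>1 where "\<kappa>1 = min (\<kappa> / 2) (1/4)"
  have \<kappa>1: "\<kappa>1 > 0" "\<kappa>1 \<le> \<kappa> / 2" "\<kappa>1 \<le> 1/4" using \<kappa> by (auto simp: \<kappa>1_def)
  have "isCont (curve_c l) 0" unfolding curve_c_def[abs_def] fixed_x_def using l_nonzero by (intro continuous_intros) auto
  then obtain \<delta>2 where \<delta>2: "\<delta>2 > 0" "\<And>a. norm a < \<delta>2 \<Longrightarrow> norm (curve_c l a - c0) < \<kappa>1"
    unfolding continuous_at_eps_delta using \<kappa>1(1) cc by (metis dist_norm diff_zero)
  define \<delta>' where "\<delta>' = Min {\<delta>1, \<delta>2, 3 / (10 * r), \<kappa>1 / (2 * (18 + r)), sqrt \<kappa>1 / 12}"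
  have \<delta>': "\<delta>' > 0" "\<delta>' \<le> \<delta>1" "\<delta>' \<le> \<delta>2" "\<delta>' \<le> 3 / (10 * r)" "\<delta>' \<le> \<kappa>1 / (2 * (18 + r))" "\<delta>' \<le> sqrt \<kappa>1 / 12"
  proof -
    have "0 < 3 / (10 * r)" "0 < \<kappa>1 / (2 * (18 + r))" "0 < sqrt \<kappa>1 / 12" using r \<kappa>1(1) by simp_all
    with \<delta>1 \<delta>2 show "\<delta>' > 0" unfolding \<delta>'_def by (subst Min_gr_iff) auto
    show "\<delta>' \<le> \<delta>1" "\<delta>' \<le> \<delta>2" "\<delta>' \<le> 3 / (10 * r)" "\<delta>' \<le> \<kappa>1 / (2 * (18 + r))" "\<delta>' \<le> sqrt \<kappa>1 / 12"
      unfolding \<delta>'_def by (rule Min_le; simp)+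
  qed
  have "local_stable_manifold l r (curve_c l a) a \<subseteq> tube" if a: "norm a < \<delta>'" for a
  proof (cases "a = 0")
    case True
    have "local_stable_manifold l r (curve_c l a) a \<subseteq> stable_manifold l (curve_c l a) a \<inter> {(x, y). norm y < r}"
      unfolding local_stable_manifold_def by (rule connected_component_subset)
    then show ?thesis using True \<rho>'(1) by (auto simp: stable_manifold_def fixed_x_def)
  next
    case False
    have a\<delta>: "norm a < \<delta>" "norm a < \<delta>1" using a \<delta>' \<delta>1 by auto
    have nc: "norm (curve_c l a - c0) < \<kappa>1" using \<delta>2(2) a \<delta>' by simp
    interpret s: preimage_sheets a "curve_c l a" r \<kappa>1 "\<lambda>y. X a (\<eta> a y)" "graph0 a"
    proof
      show "norm (curve_c l a) \<le> 1" using nc c0 \<kappa>1(3) norm_triangle_sub[of "curve_c l a" c0] by linarith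
      show "norm a \<le> 1/4" using a\<delta> \<delta> by simp
      show "norm a * r \<le> 3/10"
      proof -
        have "norm a * r \<le> 3 / (10 * r) * r" using a \<delta>' r by (intro mult_right_mono) auto
        then show ?thesis using r by simp
      qed
      show "(18 + r) * norm a < \<kappa>1 / 2"
      proof -
        have "(18 + r) * norm a < (18 + r) * (\<kappa>1 / (2 * (18 + r)))" using a \<delta>' r by (intro mult_strict_left_mono) auto
        also have "\<dots> = \<kappa>1 / 2" using r by (simp add: field_simps)
        finally show ?thesis .
      qed
      show "12 * norm a \<le> sqrt \<kappa>1" using a \<delta>' by simp
      show "(\<lambda>y. X a (\<eta> a y)) holomorphic_on ball 0 r"
        by (rule hol3_slice[OF hol3_X_eta, of _ "\<lambda>_. a" "\<lambda>_. 0" "\<lambda>y. y"]) (use a\<delta> in \<open>auto intro!: holomorphic_intros\<close>)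
      show "norm (X a (\<eta> a y)) < 3 \<and> (X a (\<eta> a y))\<^sup>2 = X a (\<eta> a (a * X a (\<eta> a y))) - curve_c l a - a * y" if y: "norm y < r" for y
      proof -
        have t: "norm (\<eta> a y) < r + 1/4" using eta_bound[OF a\<delta>(1) y] by simp
        have "norm (X a (\<eta> a y) - l / 2) \<le> 1" using X_near[OF a\<delta>(1), of "\<eta> a y"] t by simp
        then have "norm (X a (\<eta> a y)) < 3" using norm_triangle_sub[of "X a (\<eta> a y)" "l / 2"] l by (simp add: norm_divide)
        moreover have "H a (X a (\<eta> a y), y) \<in> graph0 a" by (rule graph0_tube(3)[OF a\<delta>(1)]) (use y in \<open>simp add: graph0_def\<close>)
        then have "(X a (\<eta> a y))\<^sup>2 + curve_c l a + a * y = X a (\<eta> a (a * X a (\<eta> a y)))" by (simp add: graph0_def henon_def)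
        ultimately show ?thesis by (simp add: algebra_simps)
      qed
      show "(H a ^^ m) (x, 0) \<notin> graph0 a" if "norm (x - curve_c l a) < \<kappa>1" for m x
      proof (rule avoid[OF a\<delta>(2)])
        show "norm (x - c0) < \<kappa>" using norm_triangle_ineq[of "x - curve_c l a" "curve_c l a - c0"] that nc \<kappa>1 by simp
      qed (use \<kappa> in simp)
    qed (use r \<kappa>1 in \<open>auto simp: graph0_def\<close>)
    let ?C = "local_stable_manifold l r (curve_c l a) a"
    let ?W = "stable_manifold l (curve_c l a) a \<inter> {(x, y). norm y < r}"
    have C: "?C \<subseteq> ?W" unfolding local_stable_manifold_def by (rule connected_component_subset)
    show ?thesis
    \<comment> \<open>The component of a point outside the set is empty, so the inclusion is trivial
      in that case.\<close>
    proof (cases "fixed_pt l a \<in> ?W")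
      case True
      have "?C \<subseteq> graph0 a"
      proof (rule s.connected_preimage_subset)
        show "connected ?C" unfolding local_stable_manifold_def by (rule connected_connected_component)
        show "?C \<subseteq> {(x, y). norm y < r \<and> (\<exists>n. (H a ^^ n) (x, y) \<in> graph0 a)}"
          using C stable_manifold_reaches_graph0[OF a\<delta>(1) False] by blast
        show "fixed_pt l a \<in> ?C" using True unfolding local_stable_manifold_def by (simp add: connected_component_refl)
        show "fixed_pt l a \<in> graph0 a" by (rule fixed_pt_graph0[OF a\<delta>(1)])
      qed
      then show ?thesis using graph0_tube(1)[OF a\<delta>(1)] by blast
    next
      case False
      then have "?C = {}" unfolding local_stable_manifold_def connected_component_eq_empty .
      then show ?thesis by simp
    qed
  qed
  then show ?thesis using \<delta>' \<delta>1 by (intro exI[of _ \<delta>']) auto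
qed

end

theorem theorem6p2:
  fixes p :: int and q :: nat and V\<^sub>0 :: "complex set" and \<phi> :: "complex \<Rightarrow> complex"
    and \<rho> \<rho>' r :: real
  defines "l \<equiv> multiplier p q"
  defines "B \<equiv> ball (l / 2) \<rho>' \<times> ball 0 r"
  assumes "q \<ge> 1" and "coprime p (int q)"
    and "parabolic_coordinate l q V\<^sub>0 \<rho> \<phi>"
    and "\<rho>' > 0" and "ball (l / 2) (2 * \<rho>') \<subseteq> V\<^sub>0"
    and "r > 3"
  shows "\<exists>\<delta>>0. \<exists>\<Phi> :: complex \<Rightarrow> complex \<times> complex \<Rightarrow> complex \<times> complex. \<exists>K M :: real.
    (\<forall>(c, a) \<in> semi_parabolic_curve l. norm a < \<delta> \<longrightarrow>
       fixed_pt l a \<in> B \<and> local_stable_manifold l r c a \<subseteq> B \<and>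
       coordinate_transformation (\<Phi> a) B \<and>
       \<Phi> a ` B \<subseteq> ball 0 \<rho> \<times> ball 0 (r + K * norm a) \<and>
       \<Phi> a (fixed_pt l a) = (0, 0) \<and>
       semi_parabolic_expansion l q (\<Phi> a) B (henon c a) \<and>
       (\<exists>h. holomorphic2_on h (conj_dom (\<Phi> a) B (henon c a)) \<and>
          (\<forall>(x, y) \<in> conj_dom (\<Phi> a) B (henon c a).
             snd (conj_map (\<Phi> a) B (henon c a) (x, y)) = small_eigenvalue l a * y + x * h (x, y) \<and>
             norm (x * h (x, y)) \<le> M * norm a))) \<and>
    (\<forall>z\<in>B. (\<lambda>a. fst (\<Phi> a z)) holomorphic_on ball 0 \<delta> \<and>
            (\<lambda>a. snd (\<Phi> a z)) holomorphic_on ball 0 \<delta>) \<and>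
    (\<forall>x y. (x, y) \<in> B \<longrightarrow> \<Phi> 0 (x, y) = (\<phi> x, y)) \<and>
    (\<forall>S. compact S \<and> S \<subseteq> B \<longrightarrow> uniform_limit S \<Phi> (\<Phi> 0) (at 0))"
proof -
  obtain \<epsilon> K n k where germ: "parabolic_germ l q V\<^sub>0 \<phi> (inv_into V\<^sub>0 \<phi>) \<rho> \<epsilon> K" "\<epsilon> \<le> 1" "k holomorphic_on ball 0 \<epsilon>"
    "n 1 = l" "n (q+1) = l" "\<And>i. i \<notin> {1, q+1, 2*q+1} \<Longrightarrow> n i = 0"
    "\<And>x. norm x < \<epsilon> \<Longrightarrow> \<phi> (parabolic_poly l (inv_into V\<^sub>0 \<phi> x)) = (\<Sum>i<2*q+2. n i * x ^ i) + x ^ (2*q+2) * k x"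
    using parabolic_coordinate_germ[OF assms(3,4)] assms(5) unfolding l_def by blast
  have root: "l ^ i = 1 \<longleftrightarrow> q dvd i" for i using multiplier_root_of_unity[OF assms(3,4)] by (simp add: l_def)
  have "\<exists>\<delta> \<epsilon>' X Y \<eta> T b rem C K'. henon_chart l q V\<^sub>0 \<phi> (inv_into V\<^sub>0 \<phi>) \<rho> \<epsilon> K \<rho>' r \<delta> \<epsilon>' X Y \<eta> T b rem C K'"
    by (rule henon_chart_exists[OF germ(1,2) root germ(3-5)]) (use germ(6,7) assms(6-8) in auto)
  then obtain \<delta> \<epsilon>' X Y \<eta> T b rem C K' where
    chart: "henon_chart l q V\<^sub>0 \<phi> (inv_into V\<^sub>0 \<phi>) \<rho> \<epsilon> K \<rho>' r \<delta> \<epsilon>' X Y \<eta> T b rem C K'"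
    by (elim exE)
  interpret henon_chart l q V\<^sub>0 \<phi> "inv_into V\<^sub>0 \<phi>" \<rho> \<epsilon> K \<rho>' r \<delta> \<epsilon>' X Y \<eta> T b rem C K' by (rule chart)
  obtain \<delta>' where \<delta>': "\<delta>' > 0" "\<delta>' \<le> \<delta>"
    and W: "\<And>a. norm a < \<delta>' \<Longrightarrow> local_stable_manifold l r (curve_c l a) a \<subseteq> tube"
    using local_stable_manifold_tube by blast
  show ?thesis
  \<comment> \<open>The constant \<open>1 / (4 * \<delta>)\<close> refers to the parameter radius of
    the chart, where the Schwarz lemma was applied; \<open>\<delta>'\<close> is the possibly smaller
    radius for which the local stable manifold is controlled.\<close>
  proof (rule exI[of _ \<delta>'], rule conjI[OF \<delta>'(1)], rule exI[of _ \<Phi>], rule exI[of _ "1 / (4 * \<delta>)"],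
      rule exI[of _ "1 / (4 * \<delta>) + \<rho>' + r + 2"], intro conjI)
    show "\<forall>(c, a) \<in> semi_parabolic_curve l. norm a < \<delta>' \<longrightarrow>
       fixed_pt l a \<in> B \<and> local_stable_manifold l r c a \<subseteq> B \<and>
       coordinate_transformation (\<Phi> a) B \<and>
       \<Phi> a ` B \<subseteq> ball 0 \<rho> \<times> ball 0 (r + 1 / (4 * \<delta>) * norm a) \<and>
       \<Phi> a (fixed_pt l a) = (0, 0) \<and>
       semi_parabolic_expansion l q (\<Phi> a) B (henon c a) \<and>
       (\<exists>h. holomorphic2_on h (conj_dom (\<Phi> a) B (henon c a)) \<and>
          (\<forall>(x, y) \<in> conj_dom (\<Phi> a) B (henon c a).
             snd (conj_map (\<Phi> a) B (henon c a) (x, y)) = small_eigenvalue l a * y + x * h (x, y) \<and>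
             norm (x * h (x, y)) \<le> (1 / (4 * \<delta>) + \<rho>' + r + 2) * norm a))"
    proof (clarify del: conjI)
      fix c a assume c: "(c, a) \<in> semi_parabolic_curve l" and a': "norm a < \<delta>'"
      have cc: "c = curve_c l a" using c by (simp add: semi_parabolic_curve_def curve_c_def)
      have a: "norm a < \<delta>" using a' \<delta>' by simp
      show "fixed_pt l a \<in> B \<and> local_stable_manifold l r c a \<subseteq> B \<and>
        coordinate_transformation (\<Phi> a) B \<and>
        \<Phi> a ` B \<subseteq> ball 0 \<rho> \<times> ball 0 (r + 1 / (4 * \<delta>) * norm a) \<and>
        \<Phi> a (fixed_pt l a) = (0, 0) \<and>
        semi_parabolic_expansion l q (\<Phi> a) B (henon c a) \<and>
        (\<exists>h. holomorphic2_on h (conj_dom (\<Phi> a) B (henon c a)) \<and>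
           (\<forall>(x, y) \<in> conj_dom (\<Phi> a) B (henon c a).
              snd (conj_map (\<Phi> a) B (henon c a) (x, y)) = small_eigenvalue l a * y + x * h (x, y) \<and>
              norm (x * h (x, y)) \<le> (1 / (4 * \<delta>) + \<rho>' + r + 2) * norm a))"
        unfolding cc B_def
        by (intro conjI fixed_pt_tube[OF a] W[OF a'] Phi_coordinate_transformation[OF a] Phi_image[OF a] Phi_fixed_pt[OF a]
            Phi_expansion[OF a] Phi_second_component[OF a])
    qed
    show "\<forall>z\<in>B. (\<lambda>a. fst (\<Phi> a z)) holomorphic_on ball 0 \<delta>' \<and> (\<lambda>a. snd (\<Phi> a z)) holomorphic_on ball 0 \<delta>'"
    proof (intro ballI conjI)
      fix z assume z: "z \<in> B"
      have sub: "ball 0 \<delta>' \<subseteq> ball (0::complex) \<delta>" using \<delta>'(2) by auto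
      show "(\<lambda>a. fst (\<Phi> a z)) holomorphic_on ball 0 \<delta>'" "(\<lambda>a. snd (\<Phi> a z)) holomorphic_on ball 0 \<delta>'"
        by (rule holomorphic_on_subset[OF Phi_holomorphic_a(1)[OF z[unfolded B_def]] sub],
            rule holomorphic_on_subset[OF Phi_holomorphic_a(2)[OF z[unfolded B_def]] sub])
    qed
    show "\<forall>x y. (x, y) \<in> B \<longrightarrow> \<Phi> 0 (x, y) = (\<phi> x, y)" unfolding B_def using Phi_0 by simp
    show "\<forall>S. compact S \<and> S \<subseteq> B \<longrightarrow> uniform_limit S \<Phi> (\<Phi> 0) (at 0)"
      unfolding B_def using Phi_uniform_limit by blast
  qed
qed

end
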